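(* Let $(M,\Psi)$ be a $Spin(7)$ manifold with torsion connection $\nabla$, torsion 3-form $T$ and curvature $R$. Then $R$ is a $Spin(7)$-instanton, $d^{\nabla}T=0$ (equivalently, $dT=2\sigma^T$) and $\delta T=0$ if and only if the torsion 3-form is parallel with respect to the torsion connection, $\nabla T=0$.
   Context: Manifolds are smooth. A $Spin(7)$ manifold $(M,\Psi)$ is an 8-manifold with a 4-form $\Psi$ that near each point can be written, in a local coframe $e_0,\dots,e_7$, as $\Psi=-e_{0127}+e_{0236}-e_{0347}-e_{0567}+e_{0146}+e_{0245}-e_{0135}-e_{3456}-e_{1457}-e_{1256}-e_{1234}-e_{2357}-e_{1367}+e_{2467}$, where $e_{ijkl}=e_i\wedge e_j\wedge e_k\wedge e_l$. It induces the metric $g$ and orientation for which such coframes are oriented orthonormal; $*$ is the Hodge star and $\delta=-*d*$ the codifferential. Indices refer to a local orthonormal frame, and repeated indices are summed. There is a unique linear connection $\nabla$ (the torsion connection) with $\nabla g=0$, $\nabla\Psi=0$ and totally skew-symmetric torsion, i.e. $T(X,Y,Z)=g(\nabla_XY-\nabla_YX-[X,Y],Z)$ is a 3-form. Curvature: $R(X,Y)Z=[\nabla_X,\nabla_Y]Z-\nabla_{[X,Y]}Z$, $R(X,Y,Z,V)=g(R(X,Y)Z,V)$. $R$ is a $Spin(7)$-instanton if $R_{abij}\Psi_{abkl}=2R_{klij}$ for all $i,j,k,l$, i.e. the curvature 2-form lies in $\mathfrak{spin}(7)\cong\{\alpha\in\Lambda^2:\alpha_{ij}\Psi_{ijkl}=2\alpha_{kl}\}$;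 equivalently (since $\nabla\Psi=0$) $R\in\mathfrak{spin}(7)\otimes\mathfrak{spin}(7)$. The 4-form $d^\nabla T$ is $d^{\nabla}T(X,Y,Z,V)=(\nabla_XT)(Y,Z,V)+(\nabla_YT)(Z,X,V)+(\nabla_ZT)(X,Y,V)-(\nabla_VT)(X,Y,Z)$, and $\sigma^T=\frac12\sum_j(e_j\lrcorner T)\wedge(e_j\lrcorner T)$ for an orthonormal frame, where $(e_j\lrcorner T)(X,Y)=T(e_j,X,Y)$. One always has $dT=d^{\nabla}T+2\sigma^T$. *)

theory Defs
  imports "HOL-Analysis.Analysis" "HOL-Combinatorics.Permutations"
begin

section \<open>Smooth manifolds of dimension 8\<close>

text \<open>C\<open>\<^sup>k\<close> and C\<open>\<^sup>\<infinity>\<close> functions on an open set \<open>S\<close>, through iterated directional derivatives; on a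
  finite-dimensional domain this is the usual notion.\<close>

fun Ck_on :: "nat \<Rightarrow> 'a::real_normed_vector set \<Rightarrow> ('a \<Rightarrow> 'b::real_normed_vector) \<Rightarrow> bool" where
  "Ck_on 0 S f \<longleftrightarrow> continuous_on S f"
| "Ck_on (Suc n) S f \<longleftrightarrow>
     (\<forall>x\<in>S. f differentiable (at x)) \<and> (\<forall>v. Ck_on n S (\<lambda>x. frechet_derivative f (at x) v))"

definition smooth_on :: "'a::real_normed_vector set \<Rightarrow> ('a \<Rightarrow> 'b::real_normed_vector) \<Rightarrow> bool" where
  "smooth_on S f \<longleftrightarrow> (\<forall>n. Ck_on n S f)"

type_synonym 'm chart = "'m set \<times> ('m \<Rightarrow> real ^ 8)"

definition is_chart :: "'m topology \<Rightarrow> 'm chart \<Rightarrow> bool" where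
  "is_chart M c \<longleftrightarrow> openin M (fst c) \<and> open (snd c ` fst c) \<and>
     homeomorphic_map (subtopology M (fst c)) (top_of_set (snd c ` fst c)) (snd c)"

definition smooth_manifold8 :: "'m topology \<Rightarrow> 'm chart set \<Rightarrow> bool" where
  "smooth_manifold8 M A \<longleftrightarrow>
     Hausdorff_space M \<and> second_countable M \<and>
     (\<forall>c\<in>A. is_chart M c) \<and> \<Union>(fst ` A) = topspace M \<and>
     (\<forall>c\<in>A. \<forall>c'\<in>A. smooth_on (snd c ` (fst c \<inter> fst c')) (snd c' \<circ> inv_into (fst c) (snd c)))"

text \<open>The sheaf of smooth real functions. Functions are total; only the values on \<open>W\<close> matter.\<close>

definition smooth_fun :: "'m topology \<Rightarrow> 'm chart set \<Rightarrow> 'm set \<Rightarrow> ('m \<Rightarrow> real) \<Rightarrow> bool" where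
  "smooth_fun M A W f \<longleftrightarrow> openin M W \<and>
     (\<forall>c\<in>A. smooth_on (snd c ` (fst c \<inter> W)) (f \<circ> inv_into (fst c) (snd c)))"


section \<open>Vector fields\<close>

text \<open>A smooth vector field on an open set \<open>W\<close> is a derivation of the sheaf of smooth functions on \<open>W\<close>:
  for every open \<open>V \<subseteq> W\<close> it maps smooth functions on \<open>V\<close> to smooth functions on \<open>V\<close>, is linear,
  satisfies the Leibniz rule, and only depends on the values of its argument on \<open>V\<close>. (Since one
  operator serves all \<open>V\<close>, compatibility with restrictions is built in.)\<close>

type_synonym 'm vfield = "('m \<Rightarrow> real) \<Rightarrow> 'm \<Rightarrow> real"

definition vector_field :: "'m topology \<Rightarrow> 'm chart set \<Rightarrow> 'm set \<Rightarrow> 'm vfield \<Rightarrow> bool" where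
  "vector_field M A W X \<longleftrightarrow> openin M W \<and>
     (\<forall>V f h. V \<subseteq> W \<longrightarrow> smooth_fun M A V f \<longrightarrow> smooth_fun M A V h \<longrightarrow>
        smooth_fun M A V (X f) \<and>
        ((\<forall>p\<in>V. f p = h p) \<longrightarrow> (\<forall>p\<in>V. X f p = X h p)) \<and>
        (\<forall>p\<in>V. X (\<lambda>q. f q + h q) p = X f p + X h p) \<and>
        (\<forall>a. \<forall>p\<in>V. X (\<lambda>q. a * f q) p = a * X f p) \<and>
        (\<forall>p\<in>V. X (\<lambda>q. f q * h q) p = f p * X h p + X f p * h p))"

definition vf_eq :: "'m topology \<Rightarrow> 'm chart set \<Rightarrow> 'm set \<Rightarrow> 'm vfield \<Rightarrow> 'm vfield \<Rightarrow> bool" where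
  "vf_eq M A W X Y \<longleftrightarrow> (\<forall>V f. V \<subseteq> W \<longrightarrow> smooth_fun M A V f \<longrightarrow> (\<forall>p\<in>V. X f p = Y f p))"

definition vf_add :: "'m vfield \<Rightarrow> 'm vfield \<Rightarrow> 'm vfield" where
  "vf_add X Y = (\<lambda>f p. X f p + Y f p)"

definition vf_diff :: "'m vfield \<Rightarrow> 'm vfield \<Rightarrow> 'm vfield" where
  "vf_diff X Y = (\<lambda>f p. X f p - Y f p)"

definition vf_scale :: "('m \<Rightarrow> real) \<Rightarrow> 'm vfield \<Rightarrow> 'm vfield" where
  "vf_scale h X = (\<lambda>f p. h p * X f p)"

definition bracket :: "'m vfield \<Rightarrow> 'm vfield \<Rightarrow> 'm vfield" where
  "bracket X Y = (\<lambda>f p. X (Y f) p - Y (X f) p)"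


section \<open>Tensor fields and differential forms\<close>

text \<open>A covariant \<open>k\<close>-tensor field on an open set \<open>W\<close> is a map which, over every open \<open>V \<subseteq> W\<close>, is
  multilinear over the smooth functions on \<open>V\<close>; it takes the list of its \<open>k\<close> arguments.\<close>

type_synonym 'm tensor = "'m vfield list \<Rightarrow> 'm \<Rightarrow> real"

definition vfields :: "'m topology \<Rightarrow> 'm chart set \<Rightarrow> 'm set \<Rightarrow> nat \<Rightarrow> 'm vfield list set" where
  "vfields M A V k = {Xs. length Xs = k \<and> (\<forall>X\<in>set Xs. vector_field M A V X)}"

definition tensor_field :: "'m topology \<Rightarrow> 'm chart set \<Rightarrow> 'm set \<Rightarrow> nat \<Rightarrow> 'm tensor \<Rightarrow> bool" where
  "tensor_field M A W k \<omega> \<longleftrightarrow> openin M W \<and>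
     (\<forall>V Xs. openin M V \<longrightarrow> V \<subseteq> W \<longrightarrow> Xs \<in> vfields M A V k \<longrightarrow>
        smooth_fun M A V (\<omega> Xs) \<and>
        (\<forall>Ys\<in>vfields M A V k. list_all2 (vf_eq M A V) Xs Ys \<longrightarrow> (\<forall>p\<in>V. \<omega> Xs p = \<omega> Ys p)) \<and>
        (\<forall>i<k. \<forall>Y Z f. vector_field M A V Y \<longrightarrow> vector_field M A V Z \<longrightarrow> smooth_fun M A V f \<longrightarrow>
           (\<forall>p\<in>V. \<omega> (Xs[i := vf_add Y Z]) p = \<omega> (Xs[i := Y]) p + \<omega> (Xs[i := Z]) p) \<and>
           (\<forall>p\<in>V. \<omega> (Xs[i := vf_scale f Y]) p = f p * \<omega> (Xs[i := Y]) p)))"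

definition tensor_eq ::
  "'m topology \<Rightarrow> 'm chart set \<Rightarrow> 'm set \<Rightarrow> nat \<Rightarrow> 'm tensor \<Rightarrow> 'm tensor \<Rightarrow> bool" where
  "tensor_eq M A W k \<alpha> \<beta> \<longleftrightarrow>
     (\<forall>V Xs. openin M V \<longrightarrow> V \<subseteq> W \<longrightarrow> Xs \<in> vfields M A V k \<longrightarrow> (\<forall>p\<in>V. \<alpha> Xs p = \<beta> Xs p))"

definition k_form :: "'m topology \<Rightarrow> 'm chart set \<Rightarrow> 'm set \<Rightarrow> nat \<Rightarrow> 'm tensor \<Rightarrow> bool" where
  "k_form M A W k \<omega> \<longleftrightarrow> tensor_field M A W k \<omega> \<and>
     (\<forall>V Xs i j. openin M V \<longrightarrow> V \<subseteq> W \<longrightarrow> Xs \<in> vfields M A V k \<longrightarrow>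
        i < j \<longrightarrow> j < k \<longrightarrow> Xs ! i = Xs ! j \<longrightarrow> (\<forall>p\<in>V. \<omega> Xs p = 0))"

text \<open>Normalised so that for 1-forms \<open>(\<alpha> \<and> \<beta>)(X,Y) = \<alpha>(X) \<beta>(Y) - \<alpha>(Y) \<beta>(X)\<close>.\<close>

definition wedge :: "nat \<Rightarrow> nat \<Rightarrow> 'm tensor \<Rightarrow> 'm tensor \<Rightarrow> 'm tensor" where
  "wedge k l \<alpha> \<beta> = (\<lambda>Xs p. 1 / (fact k * fact l) *
     (\<Sum>\<pi> | \<pi> permutes {..<k + l}. of_int (sign \<pi>) *
        \<alpha> (map (\<lambda>i. Xs ! \<pi> i) [0..<k]) p * \<beta> (map (\<lambda>i. Xs ! \<pi> i) [k..<k + l]) p))"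

definition interior :: "'m vfield \<Rightarrow> 'm tensor \<Rightarrow> 'm tensor" where
  "interior X \<omega> = (\<lambda>Xs. \<omega> (X # Xs))"

definition omit :: "nat \<Rightarrow> 'a list \<Rightarrow> 'a list" where
  "omit i xs = take i xs @ drop (Suc i) xs"

definition ext_d :: "'m tensor \<Rightarrow> 'm tensor" where
  "ext_d \<omega> = (\<lambda>Xs p.
     (\<Sum>i<length Xs. (-1) ^ i * (Xs ! i) (\<omega> (omit i Xs)) p) +
     (\<Sum>j<length Xs. \<Sum>i<j. (-1) ^ (i + j) *
        \<omega> (bracket (Xs ! i) (Xs ! j) # omit i (omit j Xs)) p))"


section \<open>Frames, metrics, Hodge star\<close>

text \<open>A local coframe \<open>\<theta>\<^sub>0, \<dots>, \<theta>\<^sub>7\<close> on \<open>W\<close> together with its dual frame \<open>e\<^sub>0, \<dots>, e\<^sub>7\<close>.\<close>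

definition coframe ::
  "'m topology \<Rightarrow> 'm chart set \<Rightarrow> 'm set \<Rightarrow> (nat \<Rightarrow> 'm tensor) \<Rightarrow> (nat \<Rightarrow> 'm vfield) \<Rightarrow> bool" where
  "coframe M A W \<theta> e \<longleftrightarrow> openin M W \<and>
     (\<forall>i<8. k_form M A W 1 (\<theta> i)) \<and> (\<forall>i<8. vector_field M A W (e i)) \<and>
     (\<forall>i<8. \<forall>j<8. \<forall>p\<in>W. \<theta> i [e j] p = (if i = j then 1 else 0)) \<and>
     (\<forall>V X. V \<subseteq> W \<longrightarrow> vector_field M A V X \<longrightarrow>
        vf_eq M A V X (\<lambda>f p. \<Sum>i<8. \<theta> i [X] p * e i f p))"

definition local_frame ::
  "'m topology \<Rightarrow> 'm chart set \<Rightarrow> 'm set \<Rightarrow> (nat \<Rightarrow> 'm vfield) \<Rightarrow> bool" where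
  "local_frame M A W e \<longleftrightarrow> (\<exists>\<theta>. coframe M A W \<theta> e)"

text \<open>In the definiteness condition, \<open>X\<close> is nonzero at \<open>p\<close> iff it does not kill all germs at \<open>p\<close>.\<close>

definition riemannian_metric :: "'m topology \<Rightarrow> 'm chart set \<Rightarrow> 'm tensor \<Rightarrow> bool" where
  "riemannian_metric M A g \<longleftrightarrow> tensor_field M A (topspace M) 2 g \<and>
     (\<forall>V X Y. vector_field M A V X \<longrightarrow> vector_field M A V Y \<longrightarrow> (\<forall>p\<in>V. g [X, Y] p = g [Y, X] p)) \<and>
     (\<forall>V X U f. vector_field M A V X \<longrightarrow> U \<subseteq> V \<longrightarrow> smooth_fun M A U f \<longrightarrow>
        (\<forall>p\<in>U. X f p \<noteq> 0 \<longrightarrow> g [X, X] p > 0))"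

definition orthonormal_frame ::
  "'m topology \<Rightarrow> 'm chart set \<Rightarrow> 'm tensor \<Rightarrow> 'm set \<Rightarrow> (nat \<Rightarrow> 'm vfield) \<Rightarrow> bool" where
  "orthonormal_frame M A g W e \<longleftrightarrow> local_frame M A W e \<and>
     (\<forall>i<8. \<forall>j<8. \<forall>p\<in>W. g [e i, e j] p = (if i = j then 1 else 0))"

text \<open>An orientation is represented by the Riemannian volume form \<open>vol\<close>.\<close>

definition oriented_orthonormal_frame ::
  "'m topology \<Rightarrow> 'm chart set \<Rightarrow> 'm tensor \<Rightarrow> 'm tensor \<Rightarrow> 'm set \<Rightarrow> (nat \<Rightarrow> 'm vfield) \<Rightarrow> bool" where
  "oriented_orthonormal_frame M A g vol W e \<longleftrightarrow> orthonormal_frame M A g W e \<and>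
     (\<forall>p\<in>W. vol (map e [0..<8]) p = 1)"

text \<open>The Hodge star of a \<open>k\<close>-form,
  \<open>(*\<omega>)(Y\<^sub>1, \<dots>) = 1/k! \<Sum> \<omega>(e\<^bsub>i\<^sub>1\<^esub>, \<dots>, e\<^bsub>i\<^sub>k\<^esub>) vol(e\<^bsub>i\<^sub>1\<^esub>, \<dots>, e\<^bsub>i\<^sub>k\<^esub>, Y\<^sub>1, \<dots>)\<close>, for an oriented orthonormal frame \<open>e\<close>
  near the point; the value does not depend on the choice of \<open>e\<close>. This is the convention
  \<open>\<alpha> \<and> *\<beta> = \<langle>\<alpha>, \<beta>\<rangle> vol\<close>.\<close>

definition hodge_star ::
  "'m topology \<Rightarrow> 'm chart set \<Rightarrow> 'm tensor \<Rightarrow> 'm tensor \<Rightarrow> nat \<Rightarrow> 'm tensor \<Rightarrow> 'm tensor" where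
  "hodge_star M A g vol k \<omega> = (\<lambda>Ys p.
     let e = (SOME e. \<exists>W. p \<in> W \<and> oriented_orthonormal_frame M A g vol W e)
     in 1 / fact k * (\<Sum>I | length I = k \<and> set I \<subseteq> {..<8}. \<omega> (map e I) p * vol (map e I @ Ys) p))"

definition codiff ::
  "'m topology \<Rightarrow> 'm chart set \<Rightarrow> 'm tensor \<Rightarrow> 'm tensor \<Rightarrow> nat \<Rightarrow> 'm tensor \<Rightarrow> 'm tensor" where
  "codiff M A g vol k \<omega> =
     (\<lambda>Ys p. - hodge_star M A g vol (9 - k) (ext_d (hodge_star M A g vol k \<omega>)) Ys p)"


section \<open>Connections\<close>

definition linear_connection ::
  "'m topology \<Rightarrow> 'm chart set \<Rightarrow> ('m vfield \<Rightarrow> 'm vfield \<Rightarrow> 'm vfield) \<Rightarrow> bool" where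
  "linear_connection M A D \<longleftrightarrow>
     (\<forall>V X X' Y Y' f. vector_field M A V X \<longrightarrow> vector_field M A V X' \<longrightarrow>
        vector_field M A V Y \<longrightarrow> vector_field M A V Y' \<longrightarrow> smooth_fun M A V f \<longrightarrow>
        vector_field M A V (D X Y) \<and>
        (vf_eq M A V X X' \<longrightarrow> vf_eq M A V Y Y' \<longrightarrow> vf_eq M A V (D X Y) (D X' Y')) \<and>
        vf_eq M A V (D (vf_add X X') Y) (vf_add (D X Y) (D X' Y)) \<and>
        vf_eq M A V (D (vf_scale f X) Y) (vf_scale f (D X Y)) \<and>
        vf_eq M A V (D X (vf_add Y Y')) (vf_add (D X Y) (D X Y')) \<and>
        vf_eq M A V (D X (vf_scale f Y)) (vf_add (vf_scale (X f) Y) (vf_scale f (D X Y))))"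

definition cov_deriv ::
  "('m vfield \<Rightarrow> 'm vfield \<Rightarrow> 'm vfield) \<Rightarrow> 'm vfield \<Rightarrow> 'm tensor \<Rightarrow> 'm tensor" where
  "cov_deriv D X \<omega> = (\<lambda>Ys p. X (\<omega> Ys) p - (\<Sum>i<length Ys. \<omega> (Ys[i := D X (Ys ! i)]) p))"

definition parallel :: "'m topology \<Rightarrow> 'm chart set \<Rightarrow> ('m vfield \<Rightarrow> 'm vfield \<Rightarrow> 'm vfield) \<Rightarrow>
    nat \<Rightarrow> 'm tensor \<Rightarrow> bool" where
  "parallel M A D k \<omega> \<longleftrightarrow>
     (\<forall>V X. vector_field M A V X \<longrightarrow> tensor_eq M A V k (cov_deriv D X \<omega>) (\<lambda>_ _. 0))"

definition torsion :: "'m tensor \<Rightarrow> ('m vfield \<Rightarrow> 'm vfield \<Rightarrow> 'm vfield) \<Rightarrow> 'm tensor" where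
  "torsion g D = (\<lambda>Xs.
     g [vf_diff (vf_diff (D (Xs ! 0) (Xs ! 1)) (D (Xs ! 1) (Xs ! 0))) (bracket (Xs ! 0) (Xs ! 1)),
        Xs ! 2])"

definition curvature :: "('m vfield \<Rightarrow> 'm vfield \<Rightarrow> 'm vfield) \<Rightarrow>
    'm vfield \<Rightarrow> 'm vfield \<Rightarrow> 'm vfield \<Rightarrow> 'm vfield" where
  "curvature D X Y Z = vf_diff (vf_diff (D X (D Y Z)) (D Y (D X Z))) (D (bracket X Y) Z)"

definition curvature_tensor :: "'m tensor \<Rightarrow> ('m vfield \<Rightarrow> 'm vfield \<Rightarrow> 'm vfield) \<Rightarrow> 'm tensor" where
  "curvature_tensor g D = (\<lambda>Xs. g [curvature D (Xs ! 0) (Xs ! 1) (Xs ! 2), Xs ! 3])"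

definition d_nabla :: "('m vfield \<Rightarrow> 'm vfield \<Rightarrow> 'm vfield) \<Rightarrow> 'm tensor \<Rightarrow> 'm tensor" where
  "d_nabla D T = (\<lambda>Xs p.
       cov_deriv D (Xs ! 0) T [Xs ! 1, Xs ! 2, Xs ! 3] p
     + cov_deriv D (Xs ! 1) T [Xs ! 2, Xs ! 0, Xs ! 3] p
     + cov_deriv D (Xs ! 2) T [Xs ! 0, Xs ! 1, Xs ! 3] p
     - cov_deriv D (Xs ! 3) T [Xs ! 0, Xs ! 1, Xs ! 2] p)"

text \<open>As for the Hodge star, the value does not depend on the orthonormal frame chosen near the point.\<close>

definition sigma_form :: "'m topology \<Rightarrow> 'm chart set \<Rightarrow> 'm tensor \<Rightarrow> 'm tensor \<Rightarrow> 'm tensor" where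
  "sigma_form M A g T = (\<lambda>Xs p.
     let e = (SOME e. \<exists>W. p \<in> W \<and> orthonormal_frame M A g W e)
     in 1 / 2 * (\<Sum>j<8. wedge 2 2 (interior (e j) T) (interior (e j) T) Xs p))"


section \<open>\<open>Spin(7)\<close> geometry\<close>

definition wedge4 :: "(nat \<Rightarrow> 'm tensor) \<Rightarrow> nat \<Rightarrow> nat \<Rightarrow> nat \<Rightarrow> nat \<Rightarrow> 'm tensor" where
  "wedge4 \<theta> i j k l = wedge 1 3 (\<theta> i) (wedge 1 2 (\<theta> j) (wedge 1 1 (\<theta> k) (\<theta> l)))"

definition Psi_of_coframe :: "(nat \<Rightarrow> 'm tensor) \<Rightarrow> 'm tensor" where
  "Psi_of_coframe \<theta> = (\<lambda>Xs p. let E = (\<lambda>i j k l. wedge4 \<theta> i j k l Xs p) in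
     - E 0 1 2 7 + E 0 2 3 6 - E 0 3 4 7 - E 0 5 6 7 + E 0 1 4 6 + E 0 2 4 5 - E 0 1 3 5
     - E 3 4 5 6 - E 1 4 5 7 - E 1 2 5 6 - E 1 2 3 4 - E 2 3 5 7 - E 1 3 6 7 + E 2 4 6 7)"

definition adapted_coframe :: "'m topology \<Rightarrow> 'm chart set \<Rightarrow> 'm tensor \<Rightarrow>
    'm set \<Rightarrow> (nat \<Rightarrow> 'm tensor) \<Rightarrow> (nat \<Rightarrow> 'm vfield) \<Rightarrow> bool" where
  "adapted_coframe M A \<Psi> W \<theta> e \<longleftrightarrow>
     coframe M A W \<theta> e \<and> tensor_eq M A W 4 \<Psi> (Psi_of_coframe \<theta>)"

definition Spin7_manifold :: "'m topology \<Rightarrow> 'm chart set \<Rightarrow> 'm tensor \<Rightarrow> bool" where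
  "Spin7_manifold M A \<Psi> \<longleftrightarrow> smooth_manifold8 M A \<and> k_form M A (topspace M) 4 \<Psi> \<and>
     (\<forall>p\<in>topspace M. \<exists>W \<theta> e. p \<in> W \<and> adapted_coframe M A \<Psi> W \<theta> e)"

text \<open>\<open>g\<close> and the orientation given by \<open>vol\<close> are those induced by \<open>\<Psi>\<close>, i.e. those for which
  the adapted coframes are oriented orthonormal.\<close>

definition induced_metric_orientation ::
  "'m topology \<Rightarrow> 'm chart set \<Rightarrow> 'm tensor \<Rightarrow> 'm tensor \<Rightarrow> 'm tensor \<Rightarrow> bool" where
  "induced_metric_orientation M A \<Psi> g vol \<longleftrightarrow>
     riemannian_metric M A g \<and> k_form M A (topspace M) 8 vol \<and>
     (\<forall>W \<theta> e. adapted_coframe M A \<Psi> W \<theta> e \<longrightarrow> oriented_orthonormal_frame M A g vol W e)"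

definition torsion_connection :: "'m topology \<Rightarrow> 'm chart set \<Rightarrow> 'm tensor \<Rightarrow> 'm tensor \<Rightarrow>
    ('m vfield \<Rightarrow> 'm vfield \<Rightarrow> 'm vfield) \<Rightarrow> bool" where
  "torsion_connection M A \<Psi> g D \<longleftrightarrow> linear_connection M A D \<and>
     parallel M A D 2 g \<and> parallel M A D 4 \<Psi> \<and> k_form M A (topspace M) 3 (torsion g D)"

definition Spin7_instanton :: "'m topology \<Rightarrow> 'm chart set \<Rightarrow> 'm tensor \<Rightarrow> 'm tensor \<Rightarrow> 'm tensor \<Rightarrow> bool" where
  "Spin7_instanton M A \<Psi> g R \<longleftrightarrow>
     (\<forall>W e. orthonormal_frame M A g W e \<longrightarrow>
        (\<forall>i<8. \<forall>j<8. \<forall>k<8. \<forall>l<8. \<forall>p\<in>W.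
           (\<Sum>a<8. \<Sum>b<8. R [e a, e b, e i, e j] p * \<Psi> [e a, e b, e k, e l] p)
             = 2 * R [e k, e l, e i, e j] p))"

end

theory Submission
  imports Defs "HOL-Combinatorics.Multiset_Permutations"
begin

text \<open>Write \<open>N = \<nabla>T\<close>. If \<open>d\<^sup>\<nabla>T = 0\<close>, the first Bianchi identity says that the cyclic sum of
  \<open>R(X,Y,Z,U)\<close> over \<open>X, Y, Z\<close> is \<open>(\<nabla>\<^sub>UT)(X,Y,Z) + \<sigma>\<^sup>T(X,Y,Z,U)\<close>, and \<open>R(X,Y,Z,U) - R(Z,U,X,Y)\<close> is the
  part of \<open>N\<close> that is skew in the first two arguments. If moreover \<open>R\<close> is an instanton and \<open>\<delta>T = 0\<close>, i.e. \<open>N\<close> is trace free,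
  contracting the two Bianchi identities with \<open>\<Psi>\<close> gives \<open>\<langle>\<nabla>\<^sub>XT, T\<rangle> = 0\<close> for all \<open>X\<close>. Since \<open>\<nabla>\<Psi> = 0\<close>, every
  linear identity satisfied by \<open>R\<close> and \<open>N\<close> also holds for \<open>\<nabla>\<^sub>XR\<close> and \<open>\<nabla>\<^sub>XN\<close>; with these the divergence of \<open>R\<close>
  paired with \<open>T\<close> vanishes, and this forces \<open>\<langle>tr \<nabla>\<^sup>2T, T\<rangle> = 0\<close>. Tracing the derivative of
  \<open>\<langle>\<nabla>\<^sub>XT, T\<rangle> = 0\<close> now gives \<open>|\<nabla>T|\<^sup>2 = 0\<close>.

  Conversely, if \<open>\<nabla>T = 0\<close> then \<open>R\<close> is symmetric under exchange of its two pairs of arguments, and it takes values in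
  spin(7) in the second pair because \<open>\<nabla>\<Psi> = 0\<close>.\<close>

section \<open>Smooth functions\<close>

text \<open>The manifold need not be compact, so no divergence can be integrated away: the argument
  is pointwise algebra. In an adapted frame Psi has constant components, and the covariant
  derivative differs from the directional one by the action of a connection matrix that stabilises
  Psi; hence an invariant linear identity known on an open set can be differentiated. The
  coefficients decide the outcome. In the doubly contracted second Bianchi identity the derivative
  of the scalar curvature and two Ricci divergences contribute -2/3, 1/3 and 1/3 times <N_u, T> and
  cancel as in the torsion-free case; torsion times curvature leaves 1/3. Psi enters through its
  action on 3-forms, with eigenvalues 2 and -12 in dimensions 48 and 8. The 8-dimensional part of T,
  its Lee form, need not vanish; that part of N does, and the Lee form met in the divergence of R
  only multiplies numbers <N_u, T>. A second difficulty is that the Hodge star selects a frame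
  separately at each point, so the star of T must be rewritten in one fixed frame before d can
  act.\<close>

lemma Ck_on_subset: "Ck_on n S f \<Longrightarrow> S' \<subseteq> S \<Longrightarrow> Ck_on n S' f"
  by (induction n arbitrary: f) (auto intro: continuous_on_subset)

lemma Ck_on_const: "Ck_on n S (\<lambda>x. c)"
proof (induction n arbitrary: c)
  case (Suc n)
  have "frechet_derivative (\<lambda>x::'a. c) (at x) v = 0" for x v
    using frechet_derivative_at[OF has_derivative_const[of c "at x"]] by metis
  then show ?case using Suc by simp
qed simp

text \<open>Openness of \<open>S\<close> makes the two functions agree near each point, so they have
  the same Frechet derivatives and the recursion on the order can continue.\<close>

lemma Ck_on_cong:
  assumes "open S" "\<And>x. x \<in> S \<Longrightarrow> f x = h x"
  shows "Ck_on n S f \<longleftrightarrow> Ck_on n S h"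
  using assms(2)
proof (induction n arbitrary: f h)
  case 0 then show ?case by (simp cong: continuous_on_cong)
next
  case (Suc n)
  have D: "(f has_derivative D) (at x) \<longleftrightarrow> (h has_derivative D) (at x)" if "x \<in> S" for x D
    using has_derivative_transform_within_open[of f D x UNIV S h]
      has_derivative_transform_within_open[of h D x UNIV S f] assms(1) that Suc.prems by auto
  then have "frechet_derivative f (at x) v = frechet_derivative h (at x) v" if "x \<in> S" for x v
    using that by (simp add: frechet_derivative_def)
  then have "Ck_on n S (\<lambda>x. frechet_derivative f (at x) v)
           = Ck_on n S (\<lambda>x. frechet_derivative h (at x) v)" for v
    by (intro Suc.IH) auto
  then show ?case using D by (auto simp: differentiable_def)
qed

text \<open>Serves the product rule: the derivative of a product contains the undifferentiated
  factors, which must be known to have the lower order.\<close>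

lemma Ck_on_SucD: "Ck_on (Suc n) S f \<Longrightarrow> Ck_on n S f"
proof (induction n arbitrary: f)
  case 0
  then show ?case
    by (auto intro!: continuous_at_imp_continuous_on differentiable_imp_continuous_within)
next
  case (Suc n)
  then have "Ck_on n S (\<lambda>x. frechet_derivative f (at x) v)" for v by (simp only: Ck_on.simps) blast
  then show ?case using Suc.prems by simp
qed

lemma Ck_on_add:
  fixes f h :: "'a::real_normed_vector \<Rightarrow> 'b::real_normed_vector"
  assumes "open S" "Ck_on n S f" "Ck_on n S h"
  shows "Ck_on n S (\<lambda>x. f x + h x)"
  using assms(2-)
proof (induction n arbitrary: f h)
  case 0 then show ?case by (auto intro!: continuous_intros)
next
  case (Suc n)
  have "frechet_derivative (\<lambda>x. f x + h x) (at x) v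
      = frechet_derivative f (at x) v + frechet_derivative h (at x) v" if "x \<in> S" for x v
  proof -
    have "f differentiable (at x)" "h differentiable (at x)" using Suc.prems that by auto
    then show ?thesis
      unfolding frechet_derivative_works
      by (rule fun_cong[OF frechet_derivative_at[OF has_derivative_add, symmetric], of f _ x h])
  qed
  moreover have "Ck_on n S (\<lambda>x. frechet_derivative f (at x) v + frechet_derivative h (at x) v)" for v
    using Suc.prems by (intro Suc.IH) simp_all
  ultimately have "Ck_on n S (\<lambda>x. frechet_derivative (\<lambda>x. f x + h x) (at x) v)" for v
    by (subst Ck_on_cong[OF assms(1)]) auto
  then show ?case using Suc.prems by auto
qed

lemma Ck_on_mult:
  fixes f h :: "'a::real_normed_vector \<Rightarrow> real"
  assumes "open S" "Ck_on n S f" "Ck_on n S h"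
  shows "Ck_on n S (\<lambda>x. f x * h x)"
  using assms(2-)
proof (induction n arbitrary: f h)
  case 0 then show ?case by (auto intro!: continuous_intros)
next
  case (Suc n)
  have "frechet_derivative (\<lambda>x. f x * h x) (at x) v
      = f x * frechet_derivative h (at x) v + frechet_derivative f (at x) v * h x" if "x \<in> S" for x v
  proof -
    have "f differentiable (at x)" "h differentiable (at x)" using Suc.prems that by auto
    then show ?thesis
      unfolding frechet_derivative_works
      by (rule fun_cong[OF frechet_derivative_at[OF has_derivative_mult, symmetric], of f _ x h])
  qed
  moreover have "Ck_on n S (\<lambda>x. f x * frechet_derivative h (at x) v + frechet_derivative f (at x) v * h x)" for v
    using Suc.prems Suc.prems[THEN Ck_on_SucD] by (intro Ck_on_add Suc.IH assms(1)) simp_all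
  ultimately have "Ck_on n S (\<lambda>x. frechet_derivative (\<lambda>x. f x * h x) (at x) v)" for v
    by (subst Ck_on_cong[OF assms(1)]) auto
  then show ?case using Suc.prems by auto
qed

section \<open>Charts and the sheaf of smooth functions\<close>

locale manifold8 =
  fixes M :: "'m topology" and A :: "'m chart set"
  assumes manifold: "smooth_manifold8 M A"
begin

lemma open_chart_image:
  assumes "c \<in> A" "openin M V"
  shows "open (snd c ` (fst c \<inter> V))"
proof -
  have c: "openin M (fst c)" "open (snd c ` fst c)"
    "homeomorphic_map (subtopology M (fst c)) (top_of_set (snd c ` fst c)) (snd c)"
    using manifold assms(1) by (auto simp: smooth_manifold8_def is_chart_def)
  have "openin (subtopology M (fst c)) (fst c \<inter> V)"
    using assms(2) by (simp add: openin_subtopology_Int2)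
  then have "openin (top_of_set (snd c ` fst c)) (snd c ` (fst c \<inter> V))"
    using homeomorphic_imp_open_map[OF c(3)] by (auto simp: open_map_def)
  then show ?thesis using c(2) openin_open_trans by blast
qed

lemma inj_on_chart:
  assumes "c \<in> A" shows "inj_on (snd c) (fst c)"
proof -
  have c: "openin M (fst c)"
    "homeomorphic_map (subtopology M (fst c)) (top_of_set (snd c ` fst c)) (snd c)"
    using manifold assms by (auto simp: smooth_manifold8_def is_chart_def)
  show ?thesis
    using homeomorphic_imp_injective_map[OF c(2)] openin_subset[OF c(1)]
    by (simp add: Int_absorb1)
qed

abbreviation "sm \<equiv> smooth_fun M A"
abbreviation "vf \<equiv> vector_field M A"
abbreviation "vfs \<equiv> vfields M A"

lemma sm_openin: "sm V f \<Longrightarrow> openin M V"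
  by (simp add: smooth_fun_def)

text \<open>Functions are total and only their values on \<open>V\<close> count. Since charts are
  injective and the chart image of \<open>V\<close> is open, equality on \<open>V\<close> passes
  through \<open>Ck_on_cong\<close>.\<close>

lemma sm_cong:
  assumes "\<And>p. p \<in> V \<Longrightarrow> f p = h p"
  shows "sm V f \<longleftrightarrow> sm V h"
proof -
  have "smooth_on (snd c ` (fst c \<inter> V)) (f \<circ> inv_into (fst c) (snd c))
      \<longleftrightarrow> smooth_on (snd c ` (fst c \<inter> V)) (h \<circ> inv_into (fst c) (snd c))"
    if c: "c \<in> A" "openin M V" for c
  proof -
    have e: "(f \<circ> inv_into (fst c) (snd c)) x = (h \<circ> inv_into (fst c) (snd c)) x"
      if "x \<in> snd c ` (fst c \<inter> V)" for x
    proof -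
      obtain q where "q \<in> fst c" "q \<in> V" "x = snd c q" using \<open>x \<in> _\<close> by (elim imageE IntE)
      then show ?thesis using assms inv_into_f_f[OF inj_on_chart[OF c(1)]] by simp
    qed
    have "Ck_on n (snd c ` (fst c \<inter> V)) (f \<circ> inv_into (fst c) (snd c))
      = Ck_on n (snd c ` (fst c \<inter> V)) (h \<circ> inv_into (fst c) (snd c))" for n
      by (rule Ck_on_cong[OF open_chart_image[OF c] e])
    then show ?thesis unfolding smooth_on_def by simp
  qed
  then show ?thesis by (auto simp: smooth_fun_def)
qed

lemma sm_def':
  "sm V f \<longleftrightarrow> openin M V \<and>
    (\<forall>c\<in>A. \<forall>n. Ck_on n (snd c ` (fst c \<inter> V)) (\<lambda>x. f (inv_into (fst c) (snd c) x)))"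
  by (simp add: smooth_fun_def smooth_on_def comp_def)

lemma sm_restrict:
  assumes "sm V f" "openin M U" "U \<subseteq> V" shows "sm U f"
proof -
  have s: "snd c ` (fst c \<inter> U) \<subseteq> snd c ` (fst c \<inter> V)" for c :: "'m chart"
    using assms(3) by auto
  show ?thesis unfolding sm_def'
    using assms(1)[unfolded sm_def'] by (intro conjI ballI allI assms(2) Ck_on_subset[OF _ s]) simp
qed

lemma sm_const: "openin M V \<Longrightarrow> sm V (\<lambda>_. c)"
  by (simp add: sm_def' Ck_on_const)

lemma sm_add: "sm V f \<Longrightarrow> sm V h \<Longrightarrow> sm V (\<lambda>p. f p + h p)"
  by (simp add: sm_def' Ck_on_add[OF open_chart_image])

lemma sm_mult: "sm V f \<Longrightarrow> sm V h \<Longrightarrow> sm V (\<lambda>p. f p * h p)"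
  by (simp add: sm_def' Ck_on_mult[OF open_chart_image])

lemma sm_cmult: "sm V f \<Longrightarrow> sm V (\<lambda>p. c * f p)"
  using sm_mult[OF sm_const[OF sm_openin]] by blast

lemma sm_minus: "sm V f \<Longrightarrow> sm V (\<lambda>p. - f p)"
  using sm_cmult[of V f "-1"] by simp

lemma sm_diff: "sm V f \<Longrightarrow> sm V h \<Longrightarrow> sm V (\<lambda>p. f p - h p)"
  using sm_add[OF _ sm_minus, of V f h] by simp

lemma sm_sum: "openin M V \<Longrightarrow> (\<And>i. i \<in> I \<Longrightarrow> sm V (f i)) \<Longrightarrow> sm V (\<lambda>p. \<Sum>i\<in>I. f i p)"
  by (induction I rule: infinite_finite_induct) (auto intro: sm_const sm_add)

section \<open>Vector fields and tensor fields\<close>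

lemma vf_openin: "vf V X \<Longrightarrow> openin M V"
  by (simp add: vector_field_def)

lemma vf_restrict: "vf V X \<Longrightarrow> openin M U \<Longrightarrow> U \<subseteq> V \<Longrightarrow> vf U X"
  unfolding vector_field_def by (meson order_trans)

lemma vf_sm: "vf V X \<Longrightarrow> sm V f \<Longrightarrow> sm V (X f)"
  unfolding vector_field_def by blast

lemma vf_local: "vf V X \<Longrightarrow> sm V f \<Longrightarrow> (\<And>q. q \<in> V \<Longrightarrow> f q = h q) \<Longrightarrow> p \<in> V \<Longrightarrow> X f p = X h p"
  using sm_cong[of V f h] unfolding vector_field_def by blast

lemma vf_plus: "vf V X \<Longrightarrow> sm V f \<Longrightarrow> sm V h \<Longrightarrow> p \<in> V \<Longrightarrow> X (\<lambda>q. f q + h q) p = X f p + X h p"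
  unfolding vector_field_def by blast

lemma vf_cmult: "vf V X \<Longrightarrow> sm V f \<Longrightarrow> p \<in> V \<Longrightarrow> X (\<lambda>q. c * f q) p = c * X f p"
  unfolding vector_field_def by blast

lemma vf_times: "vf V X \<Longrightarrow> sm V f \<Longrightarrow> sm V h \<Longrightarrow> p \<in> V \<Longrightarrow> X (\<lambda>q. f q * h q) p = f p * X h p + X f p * h p"
  unfolding vector_field_def by blast

text \<open>The Leibniz rule for 1 = 1 * 1 gives X 1 = 2 X 1, so a derivation kills 1 and, by
  linearity, all constants.\<close>

lemma vf_const: 
  assumes "vf V X" "p \<in> V" shows "X (\<lambda>_. c) p = 0"
proof -
  have 1: "sm V (\<lambda>_. 1)" using assms by (simp add: sm_const vf_openin)
  have "X (\<lambda>_. 1 * 1) p = 1 * X (\<lambda>_. 1) p + X (\<lambda>_. 1) p * 1"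
    using vf_times[OF assms(1) 1 1 assms(2)] .
  then show ?thesis using vf_cmult[OF assms(1) 1 assms(2), of c] by simp
qed

lemma vf_minus: "vf V X \<Longrightarrow> sm V f \<Longrightarrow> p \<in> V \<Longrightarrow> X (\<lambda>q. - f q) p = - X f p"
  using vf_cmult[of V X f p "-1"] by simp

lemma vf_sub: "vf V X \<Longrightarrow> sm V f \<Longrightarrow> sm V h \<Longrightarrow> p \<in> V \<Longrightarrow> X (\<lambda>q. f q - h q) p = X f p - X h p"
  using vf_plus[of V X f "\<lambda>q. - h q" p] sm_minus[of V h] vf_minus[of V X h p] by simp

lemma vf_sum:
  "vf V X \<Longrightarrow> p \<in> V \<Longrightarrow> (\<And>i. i \<in> I \<Longrightarrow> sm V (f i)) \<Longrightarrow> X (\<lambda>q. \<Sum>i\<in>I. f i q) p = (\<Sum>i\<in>I. X (f i) p)"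
proof (induction I rule: infinite_finite_induct)
  case (insert j J)
  then show ?case using vf_plus[of V X "f j" "\<lambda>q. \<Sum>i\<in>J. f i q" p] sm_sum[OF vf_openin, of V X J f]
    by simp
qed (simp_all add: vf_const)

lemma vf_vf_add:
  assumes "vf V X" "vf V Y" shows "vf V (vf_add X Y)"
  unfolding vector_field_def vf_add_def
proof (intro conjI allI impI ballI)
  show "openin M V" using assms(1) by (simp add: vf_openin)
next
  fix U f h assume U: "U \<subseteq> V" "sm U f" "sm U h"
  note X = vf_restrict[OF assms(1) sm_openin[OF U(2)] U(1)]
  note Y = vf_restrict[OF assms(2) sm_openin[OF U(2)] U(1)]
  show "sm U (\<lambda>p. X f p + Y f p)"
    by (rule sm_add[OF vf_sm[OF X U(2)] vf_sm[OF Y U(2)]])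
  { fix p assume "\<forall>p\<in>U. f p = h p" "p \<in> U"
    then show "X f p + Y f p = X h p + Y h p"
      using vf_local[OF X U(2), of h p] vf_local[OF Y U(2), of h p] by simp }
  fix p assume p: "p \<in> U"
  show "X (\<lambda>q. f q + h q) p + Y (\<lambda>q. f q + h q) p = X f p + Y f p + (X h p + Y h p)"
    by (simp add: vf_plus[OF X] vf_plus[OF Y] U p)
  show "X (\<lambda>q. f q * h q) p + Y (\<lambda>q. f q * h q) p = f p * (X h p + Y h p) + (X f p + Y f p) * h p"
    by (simp add: vf_times[OF X] vf_times[OF Y] U p algebra_simps)
  show "X (\<lambda>q. a * f q) p + Y (\<lambda>q. a * f q) p = a * (X f p + Y f p)" for a
    by (simp add: vf_cmult[OF X] vf_cmult[OF Y] U p algebra_simps)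
qed

lemma vf_vf_scale:
  assumes "sm V u" "vf V X" shows "vf V (vf_scale u X)"
  unfolding vector_field_def vf_scale_def
proof (intro conjI allI impI ballI)
  show "openin M V" using assms(1) by (rule sm_openin)
next
  fix U f h assume U: "U \<subseteq> V" "sm U f" "sm U h"
  note X = vf_restrict[OF assms(2) sm_openin[OF U(2)] U(1)]
  show "sm U (\<lambda>p. u p * X f p)"
    by (rule sm_mult[OF sm_restrict[OF assms(1) sm_openin[OF U(2)] U(1)] vf_sm[OF X U(2)]])
  { fix p assume "\<forall>p\<in>U. f p = h p" "p \<in> U"
    then show "u p * X f p = u p * X h p"
      using vf_local[OF X U(2), of h p] by simp }
  fix p assume p: "p \<in> U"
  show "u p * X (\<lambda>q. f q + h q) p = u p * X f p + u p * X h p"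
    by (simp add: vf_plus[OF X] U p algebra_simps)
  show "u p * X (\<lambda>q. f q * h q) p = f p * (u p * X h p) + u p * X f p * h p"
    by (simp add: vf_times[OF X] U p algebra_simps)
  show "u p * X (\<lambda>q. a * f q) p = a * (u p * X f p)" for a
    by (simp add: vf_cmult[OF X] U p algebra_simps)
qed

lemma vf_diff_eq: "vf_diff X Y = vf_add X (vf_scale (\<lambda>_. -1) Y)"
  by (simp add: vf_diff_def vf_add_def vf_scale_def)

lemma vf_vf_diff: "vf V X \<Longrightarrow> vf V Y \<Longrightarrow> vf V (vf_diff X Y)"
  by (simp add: vf_diff_eq vf_vf_add vf_vf_scale sm_const vf_openin)

lemma vf_bracket:
  assumes "vf V X" "vf V Y" shows "vf V (bracket X Y)"
  unfolding vector_field_def bracket_def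
proof (intro conjI allI impI ballI)
  show "openin M V" using assms(1) by (simp add: vf_openin)
next
  fix U f h assume U: "U \<subseteq> V" "sm U f" "sm U h"
  note X = vf_restrict[OF assms(1) sm_openin[OF U(2)] U(1)]
  note Y = vf_restrict[OF assms(2) sm_openin[OF U(2)] U(1)]
  show "sm U (\<lambda>p. X (Y f) p - Y (X f) p)"
    by (rule sm_diff[OF vf_sm[OF X vf_sm[OF Y U(2)]] vf_sm[OF Y vf_sm[OF X U(2)]]])
  { fix p assume "\<forall>p\<in>U. f p = h p" "p \<in> U"
    then show "X (Y f) p - Y (X f) p = X (Y h) p - Y (X h) p"
      using vf_local[OF X vf_sm[OF Y U(2)], of "Y h" p] vf_local[OF Y vf_sm[OF X U(2)], of "X h" p]
        vf_local[OF X U(2), of h] vf_local[OF Y U(2), of h] by simp }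
  fix p assume p: "p \<in> U"
  have "X (Y (\<lambda>q. f q + h q)) p = X (\<lambda>q. Y f q + Y h q) p"
    "Y (X (\<lambda>q. f q + h q)) p = Y (\<lambda>q. X f q + X h q) p"
    by (rule vf_local[OF X vf_sm[OF Y sm_add[OF U(2,3)]] vf_plus[OF Y U(2,3)] p], assumption, rule vf_local[OF Y vf_sm[OF X sm_add[OF U(2,3)]] vf_plus[OF X U(2,3)] p], assumption)
  then show "X (Y (\<lambda>q. f q + h q)) p - Y (X (\<lambda>q. f q + h q)) p
    = X (Y f) p - Y (X f) p + (X (Y h) p - Y (X h) p)"
    using vf_plus[OF X vf_sm[OF Y U(2)] vf_sm[OF Y U(3)] p] 
      vf_plus[OF Y vf_sm[OF X U(2)] vf_sm[OF X U(3)] p] by simp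
  have "X (Y (\<lambda>q. f q * h q)) p = X (\<lambda>q. f q * Y h q + Y f q * h q) p"
    "Y (X (\<lambda>q. f q * h q)) p = Y (\<lambda>q. f q * X h q + X f q * h q) p"
    by (rule vf_local[OF X vf_sm[OF Y sm_mult[OF U(2,3)]] vf_times[OF Y U(2,3)] p], assumption, rule vf_local[OF Y vf_sm[OF X sm_mult[OF U(2,3)]] vf_times[OF X U(2,3)] p], assumption)
  then show "X (Y (\<lambda>q. f q * h q)) p - Y (X (\<lambda>q. f q * h q)) p 
     = f p * (X (Y h) p - Y (X h) p) + (X (Y f) p - Y (X f) p) * h p"
    by (simp add: vf_plus[OF X] vf_plus[OF Y] vf_times[OF X] vf_times[OF Y] sm_mult vf_sm[OF X] vf_sm[OF Y] U p algebra_simps)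
  fix a
  have "X (Y (\<lambda>q. a * f q)) p = X (\<lambda>q. a * Y f q) p"
    "Y (X (\<lambda>q. a * f q)) p = Y (\<lambda>q. a * X f q) p"
    by (rule vf_local[OF X vf_sm[OF Y sm_cmult[OF U(2)]] vf_cmult[OF Y U(2)] p], assumption, rule vf_local[OF Y vf_sm[OF X sm_cmult[OF U(2)]] vf_cmult[OF X U(2)] p], assumption)
  then show "X (Y (\<lambda>q. a * f q)) p - Y (X (\<lambda>q. a * f q)) p = a * (X (Y f) p - Y (X f) p)"
    by (simp add: vf_cmult[OF X] vf_cmult[OF Y] vf_sm[OF X] vf_sm[OF Y] U p algebra_simps)
qed

lemma vf_eq_refl: "vf_eq M A V X X"
  by (simp add: vf_eq_def)

lemma vf_eq_restrict: "vf_eq M A V X Y \<Longrightarrow> U \<subseteq> V \<Longrightarrow> vf_eq M A U X Y"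
  unfolding vf_eq_def by (meson order_trans)

lemma vf_eqI: "(\<And>U f p. U \<subseteq> V \<Longrightarrow> sm U f \<Longrightarrow> p \<in> U \<Longrightarrow> X f p = Y f p) \<Longrightarrow> vf_eq M A V X Y"
  by (simp add: vf_eq_def)

lemma vf_eqD: "vf_eq M A V X Y \<Longrightarrow> sm V f \<Longrightarrow> p \<in> V \<Longrightarrow> X f p = Y f p"
  by (auto simp: vf_eq_def)

lemma vfsD: "Xs \<in> vfs V k \<Longrightarrow> length Xs = k" "Xs \<in> vfs V k \<Longrightarrow> i < k \<Longrightarrow> vf V (Xs ! i)"
  by (auto simp: vfields_def)

lemma vfs_update: "Xs \<in> vfs V k \<Longrightarrow> vf V Y \<Longrightarrow> Xs[i := Y] \<in> vfs V k"
  using set_update_subset_insert[of Xs i Y] by (auto simp: vfields_def)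

lemma vfs_restrict: "Xs \<in> vfs V k \<Longrightarrow> openin M U \<Longrightarrow> U \<subseteq> V \<Longrightarrow> Xs \<in> vfs U k"
  by (auto simp: vfields_def intro: vf_restrict)

lemma vfs_simps: "[] \<in> vfs V 0" "x # Xs \<in> vfs V (Suc k) \<longleftrightarrow> vf V x \<and> Xs \<in> vfs V k"
  by (auto simp: vfields_def)

abbreviation "tens \<equiv> tensor_field M A (topspace M)"

lemma tens_sm: "tens k \<omega> \<Longrightarrow> openin M V \<Longrightarrow> Xs \<in> vfs V k \<Longrightarrow> sm V (\<omega> Xs)"
  unfolding tensor_field_def using openin_subset by blast

lemma tens_cong: 
  assumes "tens k \<omega>" "openin M V" "Xs \<in> vfs V k" "Ys \<in> vfs V k" 
    "\<And>i. i < k \<Longrightarrow> vf_eq M A V (Xs ! i) (Ys ! i)" "p \<in> V"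
  shows "\<omega> Xs p = \<omega> Ys p"
proof -
  have "list_all2 (vf_eq M A V) Xs Ys"
    using assms(3-5) by (auto simp: list_all2_conv_all_nth vfields_def)
  then show ?thesis using assms openin_subset[OF assms(2)] unfolding tensor_field_def by blast
qed

lemma tens_cong1: 
  assumes "tens k \<omega>" "Xs \<in> vfs V k" "vf V Y" "vf V Z" "vf_eq M A V Y Z" "p \<in> V" 
  shows "\<omega> (Xs[i := Y]) p = \<omega> (Xs[i := Z]) p"
proof (rule tens_cong[OF assms(1) vf_openin[OF assms(3)]])
  show "vf_eq M A V (Xs[i := Y] ! j) (Xs[i := Z] ! j)" if "j < k" for j
    using that assms by (cases "i = j") (auto simp: vfsD(1) vf_eq_refl)
qed (use assms in \<open>auto intro: vfs_update\<close>)

lemma tens_linear: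
  assumes "tens k \<omega>" "Xs \<in> vfs V k" "i < k" "vf V Y" "vf V Z" "sm V f" "p \<in> V"
  shows "\<omega> (Xs[i := vf_add Y Z]) p = \<omega> (Xs[i := Y]) p + \<omega> (Xs[i := Z]) p \<and>
    \<omega> (Xs[i := vf_scale f Y]) p = f p * \<omega> (Xs[i := Y]) p"
  using assms(1)[unfolded tensor_field_def, THEN conjunct2, rule_format,
      OF vf_openin[OF assms(4)] openin_subset[OF vf_openin[OF assms(4)]] assms(2),
      THEN conjunct2, THEN conjunct2, rule_format, OF assms(3-6)] assms(7) by simp

lemma tens_add: 
  "tens k \<omega> \<Longrightarrow> Xs \<in> vfs V k \<Longrightarrow> i < k \<Longrightarrow> vf V Y \<Longrightarrow> vf V Z \<Longrightarrow> p \<in> V \<Longrightarrow>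
    \<omega> (Xs[i := vf_add Y Z]) p = \<omega> (Xs[i := Y]) p + \<omega> (Xs[i := Z]) p"
  using tens_linear[OF _ _ _ _ _ sm_const[OF vf_openin]] by simp

lemma tens_scale: 
  "tens k \<omega> \<Longrightarrow> Xs \<in> vfs V k \<Longrightarrow> i < k \<Longrightarrow> vf V Y \<Longrightarrow> sm V f \<Longrightarrow> p \<in> V \<Longrightarrow>
    \<omega> (Xs[i := vf_scale f Y]) p = f p * \<omega> (Xs[i := Y]) p"
  using tens_linear by simp

lemma tens_diff: 
  assumes "tens k \<omega>" "Xs \<in> vfs V k" "i < k" "vf V Y" "vf V Z" "p \<in> V"
  shows "\<omega> (Xs[i := vf_diff Y Z]) p = \<omega> (Xs[i := Y]) p - \<omega> (Xs[i := Z]) p"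
  using assms vf_vf_scale[OF sm_const[OF vf_openin] assms(5)]
  by (simp add: vf_diff_eq tens_add tens_scale sm_const vf_openin vf_vf_scale)

definition vf_sum :: "nat set \<Rightarrow> (nat \<Rightarrow> 'm \<Rightarrow> real) \<Rightarrow> (nat \<Rightarrow> 'm vfield) \<Rightarrow> 'm vfield" where
  "vf_sum I u e = (\<lambda>f p. \<Sum>i\<in>I. u i p * e i f p)"

text \<open>Both claims share one induction: additivity of \<omega> in a further summand requires
  that the partial sum is already known to be a vector field.\<close>

lemma tens_vf_sum:
  assumes "tens k \<omega>" "Xs \<in> vfs V k" "i < k" "p \<in> V" "finite I"
    "\<And>s. s \<in> I \<Longrightarrow> sm V (u s)" "\<And>s. s \<in> I \<Longrightarrow> vf V (e s)"
  shows "vf V (vf_sum I u e) \<and> \<omega> (Xs[i := vf_sum I u e]) p = (\<Sum>s\<in>I. u s p * \<omega> (Xs[i := e s]) p)"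
  using assms(5-)
proof (induction I rule: finite_induct)
  case empty
  have X: "vf V (Xs ! i)" using assms vfsD by blast
  \<comment> \<open>The empty sum is the zero field, obtained as 0 times an existing argument so
    that tensoriality gives the value 0.\<close>
  have "vf_sum {} u e = vf_scale (\<lambda>_. 0) (Xs ! i)"
    by (simp add: vf_sum_def vf_scale_def)
  then show ?case using tens_scale[OF assms(1-3) X, of "\<lambda>_. 0" p] X vf_vf_scale[OF _ X, of "\<lambda>_. 0"] assms(4)
      sm_const vf_openin by auto
next
  case (insert j J)
  have "vf_sum (insert j J) u e = vf_add (vf_scale (u j) (e j)) (vf_sum J u e)"
    using insert by (simp add: vf_sum_def vf_add_def vf_scale_def)
  moreover have "vf V (vf_scale (u j) (e j))" using insert by (auto intro: vf_vf_scale)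
  ultimately show ?case using insert assms(1-4)
    by (auto simp: tens_add tens_scale intro: vf_vf_add)
qed

end

section \<open>Alternating forms and the Lie bracket\<close>

context manifold8 begin

text \<open>Polarisation: vanishing on equal arguments, applied to Y + Z in both slots, leaves the
  two mixed terms with sum 0.\<close>

lemma alternating_swap:
  assumes "k_form M A (topspace M) k \<omega>" "Xs \<in> vfs V k" "i < k" "j < k" "i \<noteq> j" "vf V Y" "vf V Z" "p \<in> V"
  shows "\<omega> (Xs[i := Y, j := Z]) p = - \<omega> (Xs[i := Z, j := Y]) p"
proof -
  have t: "tens k \<omega>" using assms(1) by (simp add: k_form_def)
  have V: "openin M V" "V \<subseteq> topspace M" using vf_openin[OF assms(6)] openin_subset by auto
  have z: "\<omega> (Xs[i := U, j := U]) p = 0" if U: "vf V U" for U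
  proof -
    let ?Ys = "Xs[i := U, j := U]"
    have "?Ys \<in> vfs V k" "?Ys ! i = ?Ys ! j"
      using assms U vfsD(1) by (auto intro!: vfs_update)
    then show ?thesis using assms(1,3,4,5,8) V unfolding k_form_def by (metis linorder_neqE_nat)
  qed
  note ad = vf_vf_add[OF assms(6,7)]
  have "\<omega> (Xs[i := vf_add Y Z, j := vf_add Y Z]) p = \<omega> (Xs[i := vf_add Y Z, j := Y]) p + \<omega> (Xs[i := vf_add Y Z, j := Z]) p"
    using tens_add[OF t vfs_update[OF assms(2) ad] assms(4,6,7,8)] .
  moreover have "\<omega> (Xs[i := vf_add Y Z, j := U]) p = \<omega> (Xs[i := Y, j := U]) p + \<omega> (Xs[i := Z, j := U]) p"
    if U: "vf V U" for U
    using tens_add[OF t vfs_update[OF assms(2) U] assms(3,6,7,8), of j] assms(5)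
    by (simp add: list_update_swap)
  ultimately show ?thesis using z[OF ad] z[OF assms(6)] z[OF assms(7)] assms(6,7) by simp
qed

lemma vf_eq_diff: "vf_eq M A V X X' \<Longrightarrow> vf_eq M A V Y Y' \<Longrightarrow> vf_eq M A V (vf_diff X Y) (vf_diff X' Y')"
  by (simp add: vf_eq_def vf_diff_def)

lemma bracket_cong:
  assumes "vf V X" "vf V Y" "vf V X'" "vf V Y'" "vf_eq M A V X X'" "vf_eq M A V Y Y'"
  shows "vf_eq M A V (bracket X Y) (bracket X' Y')"
proof (rule vf_eqI)
  fix U f p assume U: "U \<subseteq> V" "sm U f" "p \<in> U"
  note r = vf_restrict[OF _ sm_openin[OF U(2)] U(1)]
  note e = assms(5,6)[THEN vf_eq_restrict[OF _ U(1)]]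
  have "X (Y f) p = X' (Y' f) p"
    using vf_eqD[OF e(1) vf_sm[OF r[OF assms(2)] U(2)] U(3)]
      vf_local[OF r[OF assms(3)] vf_sm[OF r[OF assms(2)] U(2)] vf_eqD[OF e(2) U(2)] U(3)] by simp
  moreover have "Y (X f) p = Y' (X' f) p"
    using vf_eqD[OF e(2) vf_sm[OF r[OF assms(1)] U(2)] U(3)]
      vf_local[OF r[OF assms(4)] vf_sm[OF r[OF assms(1)] U(2)] vf_eqD[OF e(1) U(2)] U(3)] by simp
  ultimately show "bracket X Y f p = bracket X' Y' f p"
    by (simp add: bracket_def)
qed

lemma bracket_add:
  assumes "vf V X" "vf V Y" "vf V Z"
  shows "vf_eq M A V (bracket (vf_add X Y) Z) (vf_add (bracket X Z) (bracket Y Z))"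
proof (rule vf_eqI)
  fix U f p assume U: "U \<subseteq> V" "sm U f" "p \<in> U"
  note r = assms[THEN vf_restrict[OF _ sm_openin[OF U(2)] U(1)]]
  show "bracket (vf_add X Y) Z f p = vf_add (bracket X Z) (bracket Y Z) f p"
    using vf_plus[OF r(3) vf_sm[OF r(1) U(2)] vf_sm[OF r(2) U(2)] U(3)]
    by (simp add: bracket_def vf_add_def)
qed

lemma bracket_scale:
  assumes "vf V X" "vf V Z" "sm V u"
  shows "vf_eq M A V (bracket (vf_scale u X) Z) (vf_diff (vf_scale u (bracket X Z)) (vf_scale (Z u) X))"
proof (rule vf_eqI)
  fix U f p assume U: "U \<subseteq> V" "sm U f" "p \<in> U"
  note r = assms(1,2)[THEN vf_restrict[OF _ sm_openin[OF U(2)] U(1)]]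
  show "bracket (vf_scale u X) Z f p = vf_diff (vf_scale u (bracket X Z)) (vf_scale (Z u) X) f p"
    using vf_times[OF r(2) sm_restrict[OF assms(3) sm_openin[OF U(2)] U(1)] vf_sm[OF r(1) U(2)] U(3)]
    by (simp add: bracket_def vf_scale_def vf_diff_def algebra_simps)
qed

text \<open>The twelve threefold derivatives cancel in pairs. The right-hand side is the zero field,
  written as a multiple of a field that is at hand.\<close>

lemma jacobi:
  assumes "vf V X" "vf V Y" "vf V Z"
  shows "vf_eq M A V (vf_add (vf_add (bracket (bracket X Y) Z) (bracket (bracket Y Z) X)) (bracket (bracket Z X) Y))
      (vf_scale (\<lambda>_. 0) X)"
proof (rule vf_eqI)
  fix U f p assume U: "U \<subseteq> V" "sm U f" "p \<in> U"
  note r = assms[THEN vf_restrict[OF _ sm_openin[OF U(2)] U(1)]]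
  have s: "B (C f) \<in> {f. sm U f}" if "B \<in> {X,Y,Z}" "C \<in> {X,Y,Z}" for B C
    using that U r vf_sm by auto
  show "vf_add (vf_add (bracket (bracket X Y) Z) (bracket (bracket Y Z) X)) (bracket (bracket Z X) Y) f p
      = vf_scale (\<lambda>_. 0) X f p"
    using s by (simp add: bracket_def vf_add_def vf_scale_def vf_sub[OF r(1) _ _ U(3)]
      vf_sub[OF r(2) _ _ U(3)] vf_sub[OF r(3) _ _ U(3)])
qed

lemma vf_zero: "vf V X \<Longrightarrow> vf V (vf_scale (\<lambda>_. 0) X)"
  by (simp add: vf_vf_scale sm_const vf_openin)

end

section \<open>Connections, curvature and the Bianchi identities\<close>

locale connection8 = manifold8 M A
  for M :: "'m topology" and A :: "'m chart set" +
  fixes D :: "'m vfield \<Rightarrow> 'm vfield \<Rightarrow> 'm vfield"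
  assumes connection: "linear_connection M A D"
begin

lemma D_vf: "vf V X \<Longrightarrow> vf V Y \<Longrightarrow> vf V (D X Y)"
  using connection sm_const[OF vf_openin] unfolding linear_connection_def by meson

lemma D_cong: "vf V X \<Longrightarrow> vf V X' \<Longrightarrow> vf V Y \<Longrightarrow> vf V Y' \<Longrightarrow>
    vf_eq M A V X X' \<Longrightarrow> vf_eq M A V Y Y' \<Longrightarrow> vf_eq M A V (D X Y) (D X' Y')"
  using connection sm_const[OF vf_openin] unfolding linear_connection_def by meson

lemma D_add1: "vf V X \<Longrightarrow> vf V X' \<Longrightarrow> vf V Y \<Longrightarrow> vf_eq M A V (D (vf_add X X') Y) (vf_add (D X Y) (D X' Y))"
  using connection sm_const[OF vf_openin] unfolding linear_connection_def by meson

lemma D_add2: "vf V X \<Longrightarrow> vf V Y \<Longrightarrow> vf V Y' \<Longrightarrow> vf_eq M A V (D X (vf_add Y Y')) (vf_add (D X Y) (D X Y'))"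
  using connection sm_const[OF vf_openin] unfolding linear_connection_def by meson

lemma D_scale1: "vf V X \<Longrightarrow> vf V Y \<Longrightarrow> sm V f \<Longrightarrow> vf_eq M A V (D (vf_scale f X) Y) (vf_scale f (D X Y))"
  using connection unfolding linear_connection_def by meson

lemma D_scale2: "vf V X \<Longrightarrow> vf V Y \<Longrightarrow> sm V f \<Longrightarrow>
    vf_eq M A V (D X (vf_scale f Y)) (vf_add (vf_scale (X f) Y) (vf_scale f (D X Y)))"
  using connection unfolding linear_connection_def by meson

lemma D_diff1:
  assumes "vf V X" "vf V X'" "vf V Y"
  shows "vf_eq M A V (D (vf_diff X X') Y) (vf_diff (D X Y) (D X' Y))"
proof (rule vf_eqI)
  fix U f p assume U: "U \<subseteq> V" "sm U f" "p \<in> U"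
  have c: "sm V (\<lambda>_. -1)" using assms vf_openin sm_const by blast
  show "D (vf_diff X X') Y f p = vf_diff (D X Y) (D X' Y) f p"
    unfolding vf_diff_eq
    using D_add1[OF assms(1) vf_vf_scale[OF c assms(2)] assms(3)] D_scale1[OF assms(2,3) c] U
    by (simp add: vf_eq_def vf_add_def vf_scale_def)
qed

lemma D_diff2:
  assumes "vf V X" "vf V Y" "vf V Y'"
  shows "vf_eq M A V (D X (vf_diff Y Y')) (vf_diff (D X Y) (D X Y'))"
proof (rule vf_eqI)
  fix U f p assume U: "U \<subseteq> V" "sm U f" "p \<in> U"
  have c: "sm V (\<lambda>_. -1)" using assms vf_openin sm_const by blast
  have "X (\<lambda>_. -1) p = 0" using vf_const[OF assms(1)] U by blast
  then show "D X (vf_diff Y Y') f p = vf_diff (D X Y) (D X Y') f p"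
    unfolding vf_diff_eq
    using D_add2[OF assms(1,2) vf_vf_scale[OF c assms(3)]] D_scale2[OF assms(1,3) c] U
    by (simp add: vf_eq_def vf_add_def vf_scale_def)
qed

text \<open>The direction of differentiation becomes the first argument, so that the derivative of a
  k-tensor is a (k+1)-tensor and can be differentiated again.\<close>

definition nab :: "'m tensor \<Rightarrow> 'm tensor" where
  "nab \<omega> = (\<lambda>Xs. cov_deriv D (hd Xs) \<omega> (tl Xs))"

lemma nab_Cons: "nab \<omega> (X # Xs) p = X (\<omega> Xs) p - (\<Sum>i<length Xs. \<omega> (Xs[i := D X (Xs ! i)]) p)"
  by (simp add: nab_def cov_deriv_def)

lemma nab_arg0:
  assumes "tens k \<omega>" "Xs \<in> vfs V k" "vf V X" "vf V Y" "p \<in> V"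
  shows "nab \<omega> (vf_add X Y # Xs) p = nab \<omega> (X # Xs) p + nab \<omega> (Y # Xs) p"
    and "sm V f \<Longrightarrow> nab \<omega> (vf_scale f X # Xs) p = f p * nab \<omega> (X # Xs) p"
proof -
  have l: "length Xs = k" using assms vfsD by blast
  have "\<omega> (Xs[i := D (vf_add X Y) (Xs ! i)]) p = \<omega> (Xs[i := D X (Xs ! i)]) p + \<omega> (Xs[i := D Y (Xs ! i)]) p"
    if "i < k" for i
    using tens_cong1[OF assms(1,2) _ _ D_add1[OF assms(3,4) vfsD(2)[OF assms(2) that]] assms(5)]
      tens_add[OF assms(1,2) that _ _ assms(5)] vfsD(2)[OF assms(2) that] assms
    by (simp add: D_vf vf_vf_add)
  then show "nab \<omega> (vf_add X Y # Xs) p = nab \<omega> (X # Xs) p + nab \<omega> (Y # Xs) p"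
    using l by (simp add: nab_Cons vf_add_def sum.distrib)
  assume f: "sm V f"
  have "\<omega> (Xs[i := D (vf_scale f X) (Xs ! i)]) p = f p * \<omega> (Xs[i := D X (Xs ! i)]) p"
    if "i < k" for i
    using tens_cong1[OF assms(1,2) _ _ D_scale1[OF assms(3) vfsD(2)[OF assms(2) that] f] assms(5)]
      tens_scale[OF assms(1,2) that _ f assms(5)] vfsD(2)[OF assms(2) that] assms f
    by (simp add: D_vf vf_vf_scale)
  then show "nab \<omega> (vf_scale f X # Xs) p = f p * nab \<omega> (X # Xs) p"
    using l by (simp add: nab_Cons vf_scale_def sum_distrib_left right_diff_distrib)
qed

text \<open>The derivative of \<open>f\<close> arises twice with opposite signs: from
  differentiating the scaled value of \<omega>, and from \<open>D X\<close> acting on the scaled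
  argument.\<close>

lemma nab_args:
  assumes "tens k \<omega>" "Xs \<in> vfs V k" "vf V X" "i < k" "vf V Y" "vf V Z" "p \<in> V"
  shows "nab \<omega> (X # Xs[i := vf_add Y Z]) p = nab \<omega> (X # Xs[i := Y]) p + nab \<omega> (X # Xs[i := Z]) p"
    and "sm V f \<Longrightarrow> nab \<omega> (X # Xs[i := vf_scale f Y]) p = f p * nab \<omega> (X # Xs[i := Y]) p"
proof -
  have l: "length Xs = k" using assms vfsD by blast
  have ov: "openin M V" using assms vf_openin by blast
  note s = tens_sm[OF assms(1) ov vfs_update[OF assms(2)]]
  \<comment> \<open>For j distinct from i the two updates commute, so linearity in slot i can be
    applied to the list already differentiated in slot j.\<close>
  have up: "\<omega> (Xs[i := U, j := D X (Xs[i := U] ! j)]) = 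
     \<omega> (if j = i then Xs[i := D X U] else (Xs[j := D X (Xs ! j)])[i := U])" if "j < k" for j U
    using that l assms(4) by (auto simp: list_update_swap)
  have xj: "Xs[j := D X (Xs ! j)] \<in> vfs V k" if "j < k" for j
    using that assms D_vf vfs_update vfsD by metis
  have "X (\<omega> (Xs[i := vf_add Y Z])) p = X (\<lambda>q. \<omega> (Xs[i := Y]) q + \<omega> (Xs[i := Z]) q) p"
    using assms by (intro vf_local[OF assms(3)] s vf_vf_add tens_add[OF assms(1,2,4-6)])
  moreover have "\<dots> = X (\<omega> (Xs[i := Y])) p + X (\<omega> (Xs[i := Z])) p"
    using assms by (intro vf_plus[OF assms(3)] s)
  moreover have "\<omega> (Xs[i := vf_add Y Z, j := D X (Xs[i := vf_add Y Z] ! j)]) p =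
     \<omega> (Xs[i := Y, j := D X (Xs[i := Y] ! j)]) p + \<omega> (Xs[i := Z, j := D X (Xs[i := Z] ! j)]) p" if "j < k" for j
    unfolding up[OF that]
    using tens_cong1[OF assms(1,2) _ _ D_add2[OF assms(3,5,6)] assms(7), of i]
      tens_add[OF assms(1,2,4) _ _ assms(7)] tens_add[OF assms(1) xj[OF that] assms(4-7)] assms
    by (simp add: D_vf vf_vf_add)
  ultimately show "nab \<omega> (X # Xs[i := vf_add Y Z]) p = nab \<omega> (X # Xs[i := Y]) p + nab \<omega> (X # Xs[i := Z]) p"
    using l by (simp add: nab_Cons sum.distrib)
  assume f: "sm V f"
  note ff = vf_vf_scale[OF f assms(5)]
  have 1: "X (\<omega> (Xs[i := vf_scale f Y])) p = X (\<lambda>q. f q * \<omega> (Xs[i := Y]) q) p"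
    using assms ff by (intro vf_local[OF assms(3)] s tens_scale[OF assms(1,2,4,5) f])
  have 2: "\<dots> = f p * X (\<omega> (Xs[i := Y])) p + X f p * \<omega> (Xs[i := Y]) p"
    using assms f by (intro vf_times[OF assms(3)] s)
  have 3: "\<omega> (Xs[i := vf_scale f Y, j := D X (Xs[i := vf_scale f Y] ! j)]) p =
     (if j = i then X f p * \<omega> (Xs[i := Y]) p else 0) + f p * \<omega> (Xs[i := Y, j := D X (Xs[i := Y] ! j)]) p" if "j < k" for j
    unfolding up[OF that]
    using tens_cong1[OF assms(1,2) _ _ D_scale2[OF assms(3,5) f] assms(7), of i]
      tens_add[OF assms(1,2,4) vf_vf_scale[OF vf_sm[OF assms(3) f] assms(5)] vf_vf_scale[OF f D_vf[OF assms(3,5)]] assms(7)] 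
      tens_scale[OF assms(1,2,4) _ _ assms(7)] tens_scale[OF assms(1) xj[OF that] assms(4,5) f assms(7)] assms f ff
      vf_sm[OF assms(3) f] D_vf[OF assms(3,5)]
    by (simp add: D_vf vf_vf_add vf_vf_scale)
  show "nab \<omega> (X # Xs[i := vf_scale f Y]) p = f p * nab \<omega> (X # Xs[i := Y]) p"
    using l 1 2 3 assms(4) by (simp add: nab_Cons sum.distrib right_diff_distrib flip: sum_distrib_left)
qed

lemma tens_nab: 
  assumes "tens k \<omega>" shows "tens (Suc k) (nab \<omega>)"
  unfolding tensor_field_def
proof (intro conjI allI impI ballI)
  fix V XXs assume V: "openin M V" and "XXs \<in> vfs V (Suc k)"
  then obtain X Xs where X: "XXs = X # Xs" "vf V X" "Xs \<in> vfs V k" "length Xs = k"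
    by (cases XXs) (auto simp: vfs_simps vfields_def)
  have xj: "Xs[j := D X (Xs ! j)] \<in> vfs V k" if "j < k" for j
    using that X D_vf vfs_update vfsD by metis
  show "sm V (nab \<omega> XXs)"
  proof -
    have "nab \<omega> XXs = (\<lambda>p. X (\<omega> Xs) p - (\<Sum>i<length Xs. \<omega> (Xs[i := D X (Xs ! i)]) p))"
      by (simp add: X(1) nab_Cons fun_eq_iff)
    then show ?thesis
      using X xj by (auto intro!: sm_diff vf_sm[OF X(2)] sm_sum V tens_sm[OF assms V])
  qed
  { fix YYs p assume YY: "YYs \<in> vfs V (Suc k)" "list_all2 (vf_eq M A V) XXs YYs" and p: "p \<in> V"
    then obtain Y Ys where Y: "YYs = Y # Ys" "vf V Y" "Ys \<in> vfs V k" "length Ys = k"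
      by (cases YYs) (auto simp: vfs_simps vfields_def)
    have e: "vf_eq M A V X Y" "\<And>i. i < k \<Longrightarrow> vf_eq M A V (Xs ! i) (Ys ! i)"
      using YY X(1,4) Y(1,4) by (auto simp: list_all2_conv_all_nth)
    have "X (\<omega> Xs) p = Y (\<omega> Ys) p"
      using vf_eqD[OF e(1) tens_sm[OF assms V X(3)] p] 
       vf_local[OF Y(2) tens_sm[OF assms V X(3)] tens_cong[OF assms V X(3) Y(3) e(2)] p] by auto
    moreover have "\<omega> (Xs[i := D X (Xs ! i)]) p = \<omega> (Ys[i := D Y (Ys ! i)]) p" if i: "i < k" for i
    proof (rule tens_cong[OF assms V xj[OF i] _ _ p])
      show "Ys[i := D Y (Ys ! i)] \<in> vfs V k" using vfs_update D_vf vfsD(2)[OF _ i] Y by metis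
      show "vf_eq M A V (Xs[i := D X (Xs ! i)] ! j) (Ys[i := D Y (Ys ! i)] ! j)" if "j < k" for j
        using that e X Y by (cases "i = j") (auto intro!: D_cong vfsD(2))
    qed
    ultimately show "nab \<omega> XXs p = nab \<omega> YYs p"
      using X(1,4) Y(1,4) by (simp add: nab_Cons) }
  fix i Y Z f p assume i: "i < Suc k" and YZ: "vf V Y" "vf V Z" "sm V f" and p: "p \<in> V"
  show "nab \<omega> (XXs[i := vf_add Y Z]) p = nab \<omega> (XXs[i := Y]) p + nab \<omega> (XXs[i := Z]) p"
    using nab_arg0(1)[OF assms X(3) YZ(1,2) p] nab_args(1)[OF assms X(3,2) _ YZ(1,2) p] i X(1)
    by (cases i) auto
  show "nab \<omega> (XXs[i := vf_scale f Y]) p = f p * nab \<omega> (XXs[i := Y]) p"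
    using nab_arg0(2)[OF assms X(3) YZ(1,2) p YZ(3)] nab_args(2)[OF assms X(3,2) _ YZ(1,2) p YZ(3)] i X(1)
    by (cases i) auto
qed auto

lemma vf_curvature: "vf V X \<Longrightarrow> vf V Y \<Longrightarrow> vf V Z \<Longrightarrow> vf V (curvature D X Y Z)"
  by (simp add: curvature_def vf_vf_diff D_vf vf_bracket)

text \<open>The terms in which two different arguments are differentiated are symmetric in the two directions.\<close>

lemma parallel_curvature:
  assumes "tens k \<omega>" "parallel M A D k \<omega>" "Zs \<in> vfs V k" "vf V X" "vf V Y" "p \<in> V"
  shows "(\<Sum>i<k. \<omega> (Zs[i := curvature D X Y (Zs ! i)]) p) = 0"
proof -
  have ov: "openin M V" using assms vf_openin by blast
  have l: "length Zs = k" using assms vfsD by blast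
  have Z: "vf V (Zs ! i)" if "i < k" for i using that assms vfsD by blast
  have par: "U (\<omega> Ws) q = (\<Sum>i<k. \<omega> (Ws[i := D U (Ws ! i)]) q)" if "vf V U" "Ws \<in> vfs V k" "q \<in> V" for U Ws q
    using assms(2) ov that vfsD(1)[OF that(2)]
    unfolding parallel_def tensor_eq_def cov_deriv_def by fastforce
  define off where "off X Y i j = (if i = j then 0 else \<omega> (Zs[i := D Y (Zs ! i), j := D X (Zs ! j)]) p)" for X Y i j
  have two: "X (Y (\<omega> Zs)) p = (\<Sum>i<k. \<omega> (Zs[i := D X (D Y (Zs ! i))]) p) + (\<Sum>i<k. \<Sum>j<k. off X Y i j)"
    if XY: "vf V X" "vf V Y" for X Y
  proof -
    have up: "Zs[i := D Y (Zs ! i)] \<in> vfs V k" if "i < k" for i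
      using that XY assms(3) Z D_vf vfs_update by metis
    have "X (Y (\<omega> Zs)) p = X (\<lambda>q. \<Sum>i<k. \<omega> (Zs[i := D Y (Zs ! i)]) q) p"
      by (intro vf_local[OF XY(1)] vf_sm[OF XY(2)] tens_sm[OF assms(1) ov] par assms XY)
    also have "\<dots> = (\<Sum>i<k. X (\<omega> (Zs[i := D Y (Zs ! i)])) p)"
      using up by (intro vf_sum[OF XY(1) assms(6)] tens_sm[OF assms(1) ov]) simp
    also have "\<dots> = (\<Sum>i<k. \<Sum>j<k. \<omega> (Zs[i := D Y (Zs ! i), j := D X (Zs[i := D Y (Zs ! i)] ! j)]) p)"
      using up by (intro sum.cong refl par XY assms) simp
    also have "\<dots> = (\<Sum>i<k. \<Sum>j<k. (if i = j then \<omega> (Zs[i := D X (D Y (Zs ! i))]) p else 0) + off X Y i j)"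
      using l by (intro sum.cong refl) (auto simp: off_def)
    finally show ?thesis by (simp add: sum.distrib)
  qed
  have sw: "(\<Sum>i<k. \<Sum>j<k. off X Y i j) = (\<Sum>i<k. \<Sum>j<k. off Y X i j)"
    by (subst sum.swap) (auto simp: off_def list_update_swap intro!: sum.cong)
  have "\<omega> (Zs[i := curvature D X Y (Zs ! i)]) p = \<omega> (Zs[i := D X (D Y (Zs ! i))]) p
      - \<omega> (Zs[i := D Y (D X (Zs ! i))]) p - \<omega> (Zs[i := D (bracket X Y) (Zs ! i)]) p" if "i < k" for i
    using that assms(4,5) Z[OF that]
    by (simp add: curvature_def tens_diff[OF assms(1,3) that _ _ assms(6)] vf_vf_diff D_vf vf_bracket)
  then have "(\<Sum>i<k. \<omega> (Zs[i := curvature D X Y (Zs ! i)]) p)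
    = X (Y (\<omega> Zs)) p - Y (X (\<omega> Zs)) p - bracket X Y (\<omega> Zs) p"
    using two[OF assms(4,5)] two[OF assms(5,4)] sw par[OF vf_bracket[OF assms(4,5)] assms(3,6)]
    by (simp add: sum_subtractf)
  then show ?thesis by (simp add: bracket_def)
qed

end

section \<open>Metric connections with skew torsion\<close>

locale metric_connection8 = connection8 M A D
  for M :: "'m topology" and A :: "'m chart set" and D :: "'m vfield \<Rightarrow> 'm vfield \<Rightarrow> 'm vfield" +
  fixes g :: "'m tensor"
  assumes metric: "riemannian_metric M A g" and parallel_g: "parallel M A D 2 g"
    and torsion_form: "k_form M A (topspace M) 3 (torsion g D)"
begin

lemma tens_g: "tens 2 g"
  using metric by (simp add: riemannian_metric_def)

lemma vfs2: "[X, Y] \<in> vfs V 2 \<longleftrightarrow> vf V X \<and> vf V Y"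
  by (auto simp: vfields_def)
lemma vfs3: "[X, Y, Z] \<in> vfs V 3 \<longleftrightarrow> vf V X \<and> vf V Y \<and> vf V Z"
  by (auto simp: vfields_def)
lemma vfs4: "[X, Y, Z, U] \<in> vfs V 4 \<longleftrightarrow> vf V X \<and> vf V Y \<and> vf V Z \<and> vf V U"
  by (auto simp: vfields_def)

lemma g_sym: "vf V X \<Longrightarrow> vf V Y \<Longrightarrow> p \<in> V \<Longrightarrow> g [X, Y] p = g [Y, X] p"
  using metric unfolding riemannian_metric_def by blast

lemma g_cong: "vf V X \<Longrightarrow> vf V X' \<Longrightarrow> vf V U \<Longrightarrow> vf_eq M A V X X' \<Longrightarrow> p \<in> V \<Longrightarrow> g [X, U] p = g [X', U] p"
  using tens_cong1[OF tens_g, of "[X, U]" V X X' p 0] by (simp add: vfs2)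

lemma g_add: "p \<in> V \<Longrightarrow> vf V X \<Longrightarrow> vf V Y \<Longrightarrow> vf V U \<Longrightarrow>  g [vf_add X Y, U] p = g [X, U] p + g [Y, U] p"
  using tens_add[OF tens_g, of "[X, U]" V 0 X Y p] by (simp add: vfs2)

lemma g_diff: "p \<in> V \<Longrightarrow> vf V X \<Longrightarrow> vf V Y \<Longrightarrow> vf V U \<Longrightarrow>  g [vf_diff X Y, U] p = g [X, U] p - g [Y, U] p"
  using tens_diff[OF tens_g, of "[X, U]" V 0 X Y p] by (simp add: vfs2)

lemma g_scale: "p \<in> V \<Longrightarrow> vf V X \<Longrightarrow> vf V U \<Longrightarrow> sm V f \<Longrightarrow>  g [vf_scale f X, U] p = f p * g [X, U] p"
  using tens_scale[OF tens_g, of "[X, U]" V 0 X f p] by (simp add: vfs2)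

lemma g_sm: "vf V X \<Longrightarrow> vf V U \<Longrightarrow> sm V (g [X, U])"
  using tens_sm[OF tens_g vf_openin] by (simp add: vfs2)

lemma g_deriv: "vf V X \<Longrightarrow> vf V Y \<Longrightarrow> vf V Z \<Longrightarrow> p \<in> V \<Longrightarrow>
    X (g [Y, Z]) p = g [D X Y, Z] p + g [Y, D X Z] p"
  using parallel_g vf_openin[of V X] vfs2[of Y Z V]
  unfolding parallel_def tensor_eq_def cov_deriv_def by (force simp: numeral_2_eq_2)

abbreviation "R \<equiv> curvature_tensor g D"
abbreviation "T \<equiv> torsion g D"
definition "tor X Y = vf_diff (vf_diff (D X Y) (D Y X)) (bracket X Y)"

lemma R_eq: "R [X, Y, Z, U] = g [curvature D X Y Z, U]"
  by (simp add: curvature_tensor_def)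

lemma T_eq: "T [X, Y, Z] = g [tor X Y, Z]"
  by (simp add: torsion_def tor_def)

lemma vf_tor: "vf V X \<Longrightarrow> vf V Y \<Longrightarrow> vf V (tor X Y)"
  by (simp add: tor_def vf_vf_diff D_vf vf_bracket)

lemma tens_T: "tens 3 T"
  using torsion_form by (simp add: k_form_def)

lemmas vf_closed = D_vf vf_vf_add vf_vf_diff vf_bracket vf_curvature vf_tor

lemma g_D_cong1: "vf V X \<Longrightarrow> vf V X' \<Longrightarrow> vf V Y \<Longrightarrow> vf V U \<Longrightarrow> vf_eq M A V X X' \<Longrightarrow> p \<in> V \<Longrightarrow>
    g [D X Y, U] p = g [D X' Y, U] p"
  by (rule g_cong) (auto intro: D_cong D_vf vf_eq_refl)

lemma g_D_cong2: "vf V X \<Longrightarrow> vf V Y \<Longrightarrow> vf V Y' \<Longrightarrow> vf V U \<Longrightarrow> vf_eq M A V Y Y' \<Longrightarrow> p \<in> V \<Longrightarrow>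
    g [D X Y, U] p = g [D X Y', U] p"
  by (rule g_cong) (auto intro: D_cong D_vf vf_eq_refl)

lemma g_D_add1: "p \<in> V \<Longrightarrow> vf V X \<Longrightarrow> vf V X' \<Longrightarrow> vf V Y \<Longrightarrow> vf V U \<Longrightarrow> 
    g [D (vf_add X X') Y, U] p = g [D X Y, U] p + g [D X' Y, U] p"
  using g_cong[OF _ _ _ D_add1] by (simp add: D_vf vf_vf_add g_add)

lemma g_D_diff1: "p \<in> V \<Longrightarrow> vf V X \<Longrightarrow> vf V X' \<Longrightarrow> vf V Y \<Longrightarrow> vf V U \<Longrightarrow> 
    g [D (vf_diff X X') Y, U] p = g [D X Y, U] p - g [D X' Y, U] p"
  using g_cong[OF _ _ _ D_diff1] by (simp add: D_vf vf_vf_diff g_diff)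

lemma g_D_scale1: "p \<in> V \<Longrightarrow> vf V X \<Longrightarrow> vf V Y \<Longrightarrow> vf V U \<Longrightarrow> sm V f \<Longrightarrow> 
    g [D (vf_scale f X) Y, U] p = f p * g [D X Y, U] p"
  using g_cong[OF _ _ _ D_scale1] by (simp add: D_vf vf_vf_scale g_scale)

lemma g_D_add2: "p \<in> V \<Longrightarrow> vf V X \<Longrightarrow> vf V Y \<Longrightarrow> vf V Y' \<Longrightarrow> vf V U \<Longrightarrow> 
    g [D X (vf_add Y Y'), U] p = g [D X Y, U] p + g [D X Y', U] p"
  using g_cong[OF _ _ _ D_add2] by (simp add: D_vf vf_vf_add g_add)

lemma g_D_diff2: "p \<in> V \<Longrightarrow> vf V X \<Longrightarrow> vf V Y \<Longrightarrow> vf V Y' \<Longrightarrow> vf V U \<Longrightarrow> 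
    g [D X (vf_diff Y Y'), U] p = g [D X Y, U] p - g [D X Y', U] p"
  using g_cong[OF _ _ _ D_diff2] by (simp add: D_vf vf_vf_diff g_diff)

lemma g_D_scale2: "p \<in> V \<Longrightarrow> vf V X \<Longrightarrow> vf V Y \<Longrightarrow> vf V U \<Longrightarrow> sm V f \<Longrightarrow> 
    g [D X (vf_scale f Y), U] p = X f p * g [Y, U] p + f p * g [D X Y, U] p"
  using g_cong[OF _ _ _ D_scale2] by (simp add: D_vf vf_vf_add vf_vf_scale g_add g_scale vf_sm)

lemmas g_D = g_D_add1 g_D_diff1 g_D_scale1 g_D_add2 g_D_diff2 g_D_scale2

lemma R_expand: "p \<in> V \<Longrightarrow> vf V X \<Longrightarrow> vf V Y \<Longrightarrow> vf V Z \<Longrightarrow> vf V U \<Longrightarrow>  R [X, Y, Z, U] p =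
    g [D X (D Y Z), U] p - g [D Y (D X Z), U] p - g [D (bracket X Y) Z, U] p"
  by (simp add: R_eq curvature_def g_diff vf_closed)

lemma bracket_skew: "vf_eq M A V (bracket Y X) (vf_scale (\<lambda>_. -1) (bracket X Y))"
  by (simp add: vf_eq_def bracket_def vf_scale_def)

lemma R_skew12:
  assumes "vf V X" "vf V Y" "vf V Z" "vf V U" "p \<in> V"
  shows "R [Y, X, Z, U] p = - R [X, Y, Z, U] p"
proof -
  have c: "sm V (\<lambda>_. -1)" using assms sm_const vf_openin by blast
  show ?thesis
    using g_D_cong1[OF _ _ assms(3,4) bracket_skew assms(5), of X Y] assms c
    by (simp add: R_expand vf_closed vf_vf_scale g_D_scale1)
qed

text \<open>Tensoriality in the first slot: the term - (Y f) X in the bracket of f X with Y cancels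
  the derivative of f produced by differentiating f D_X Z along Y.\<close>

lemma R_arg1:
  assumes "vf V X" "vf V X'" "vf V Y" "vf V Z" "vf V U" "sm V f" "p \<in> V"
  shows "R [vf_add X X', Y, Z, U] p = R [X, Y, Z, U] p + R [X', Y, Z, U] p"
    and "R [vf_scale f X, Y, Z, U] p = f p * R [X, Y, Z, U] p"
proof -
  note c = vf_closed vf_vf_scale vf_sm
  show "R [vf_add X X', Y, Z, U] p = R [X, Y, Z, U] p + R [X', Y, Z, U] p"
    using g_D_cong1[OF _ _ assms(4,5) bracket_add[OF assms(1-3)] assms(7)]
      g_D_cong2[OF assms(3) _ _ assms(5) D_add1[OF assms(1,2,4)] assms(7)] assms
    by (simp add: R_expand c g_D)
  show "R [vf_scale f X, Y, Z, U] p = f p * R [X, Y, Z, U] p"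
    using g_D_cong1[OF _ _ assms(4,5) bracket_scale[OF assms(1,3,6)] assms(7)]
      g_D_cong2[OF assms(3) _ _ assms(5) D_scale1[OF assms(1,4,6)] assms(7)] assms
    by (simp add: R_expand c g_D algebra_simps)
qed

lemma R_arg2:
  assumes "vf V X" "vf V X'" "vf V Y" "vf V Z" "vf V U" "sm V f" "p \<in> V"
  shows "R [Y, vf_add X X', Z, U] p = R [Y, X, Z, U] p + R [Y, X', Z, U] p"
    and "R [Y, vf_scale f X, Z, U] p = f p * R [Y, X, Z, U] p"
  using R_arg1[OF assms] R_skew12[OF _ _ assms(4,5,7), of _ Y] assms
  by (simp_all add: vf_closed vf_vf_scale)

text \<open>First derivatives of \<open>f\<close> cancel between the two orders of differentiation
  and the bracket term; its second derivatives form a commutator, which the bracket term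
  cancels.\<close>

lemma R_arg3:
  assumes "vf V X" "vf V X'" "vf V Y" "vf V Z" "vf V U" "sm V f" "p \<in> V"
  shows "R [Y, Z, vf_add X X', U] p = R [Y, Z, X, U] p + R [Y, Z, X', U] p"
    and "R [Y, Z, vf_scale f X, U] p = f p * R [Y, Z, X, U] p"
proof -
  note c = vf_closed vf_vf_scale vf_sm
  have a: "g [D Y (D Z (vf_add X X')), U] p = g [D Y (D Z X), U] p + g [D Y (D Z X'), U] p"
    if "vf V Y" "vf V Z" for Y Z
    using g_D_cong2[OF that(1) _ _ assms(5) D_add2[OF that(2) assms(1,2)] assms(7)] assms that
    by (simp add: c g_D)
  show "R [Y, Z, vf_add X X', U] p = R [Y, Z, X, U] p + R [Y, Z, X', U] p"
    using assms by (simp add: R_expand c g_D a)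
  have b: "g [D Y (D Z (vf_scale f X)), U] p = Y (Z f) p * g [X, U] p + Z f p * g [D Y X, U] p
      + Y f p * g [D Z X, U] p + f p * g [D Y (D Z X), U] p"
    if "vf V Y" "vf V Z" for Y Z
    using g_D_cong2[OF that(1) _ _ assms(5) D_scale2[OF that(2) assms(1,6)] assms(7)] assms that
    by (simp add: c g_D)
  show "R [Y, Z, vf_scale f X, U] p = f p * R [Y, Z, X, U] p"
    using assms by (simp add: R_expand c g_D b) (simp add: bracket_def algebra_simps)
qed

lemma list4: "length Xs = 4 \<Longrightarrow> \<exists>a b c d. Xs = [a, b, c, d]"
  by (auto simp: length_Suc_conv numeral_eq_Suc)

lemma vf_eq_curvature:
  assumes "vf V X" "vf V X'" "vf V Y" "vf V Y'" "vf V Z" "vf V Z'"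
    "vf_eq M A V X X'" "vf_eq M A V Y Y'" "vf_eq M A V Z Z'"
  shows "vf_eq M A V (curvature D X Y Z) (curvature D X' Y' Z')"
  unfolding curvature_def using assms
  by (intro vf_eq_diff D_cong bracket_cong vf_closed)

lemma tens_R: "tens 4 R"
  unfolding tensor_field_def
proof (intro conjI allI impI ballI)
  fix V Xs assume V: "openin M V" and Xs: "Xs \<in> vfs V 4"
  then obtain X Y Z U where X: "Xs = [X, Y, Z, U]" using list4 vfsD(1) by blast
  then have v: "vf V X" "vf V Y" "vf V Z" "vf V U" using Xs by (simp_all add: vfs4)
  show "sm V (R Xs)" using v by (simp add: X R_eq g_sm vf_curvature)
  { fix Ys p assume Ys: "Ys \<in> vfs V 4" "list_all2 (vf_eq M A V) Xs Ys" and p: "p \<in> V"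
    obtain X' Y' Z' U' where X': "Ys = [X', Y', Z', U']" using list4 vfsD(1) Ys by blast
    then have w: "vf V X'" "vf V Y'" "vf V Z'" "vf V U'" using Ys by (simp_all add: vfs4)
    have e: "vf_eq M A V X X'" "vf_eq M A V Y Y'" "vf_eq M A V Z Z'" "vf_eq M A V U U'"
      using Ys(2) X X' by auto
    have "g [curvature D X Y Z, U] p = g [curvature D X' Y' Z', U] p"
      using v w e p by (intro g_cong[of V] vf_curvature vf_eq_curvature)
    moreover have "g [U, curvature D X' Y' Z'] p = g [U', curvature D X' Y' Z'] p"
      using v w e p by (intro g_cong[of V] vf_curvature)
    ultimately show "R Xs p = R Ys p" using v w p by (simp add: X X' R_eq g_sym[of V _ "curvature D X' Y' Z'"] vf_curvature)
  }
  fix i B C f p assume i: "i < (4::nat)" and B: "vf V B" "vf V C" "sm V f" and p: "p \<in> V"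
  have i': "i = 0 \<or> i = 1 \<or> i = 2 \<or> i = 3" using i by auto
  \<comment> \<open>The fourth slot enters only through g; symmetry of g moves it to the front,
    where linearity of g is available.\<close>
  have 3: "R [X, Y, Z, vf_add B C] p = R [X, Y, Z, B] p + R [X, Y, Z, C] p"
    "R [X, Y, Z, vf_scale f B] p = f p * R [X, Y, Z, B] p"
    using v B p by (simp_all add: R_eq g_sym[of V "curvature D X Y Z"] vf_curvature vf_vf_add vf_vf_scale g_add g_scale)
  show "R (Xs[i := vf_add B C]) p = R (Xs[i := B]) p + R (Xs[i := C]) p"
    "R (Xs[i := vf_scale f B]) p = f p * R (Xs[i := B]) p"
    using i' 3 R_arg1[OF B(1,2) v(2-4) B(3) p] R_arg2[OF B(1,2) v(1,3,4) B(3) p] R_arg3[OF B(1,2) v(1,2,4) B(3) p]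
    unfolding X by (auto simp: numeral_eq_Suc)
qed auto

lemma R_diff1:
  "p \<in> V \<Longrightarrow> vf V X \<Longrightarrow> vf V X' \<Longrightarrow> vf V Y \<Longrightarrow> vf V Z \<Longrightarrow> vf V U \<Longrightarrow> 
    R [vf_diff X X', Y, Z, U] p = R [X, Y, Z, U] p - R [X', Y, Z, U] p"
  using tens_diff[OF tens_R, of "[X, Y, Z, U]" V 0 X X' p] by (simp add: vfs4)

lemma T_diff1:
  "p \<in> V \<Longrightarrow> vf V X \<Longrightarrow> vf V X' \<Longrightarrow> vf V Y \<Longrightarrow> vf V Z \<Longrightarrow> 
    T [vf_diff X X', Y, Z] p = T [X, Y, Z] p - T [X', Y, Z] p"
  using tens_diff[OF tens_T, of "[X, Y, Z]" V 0 X X' p] by (simp add: vfs3)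

lemma T_skew12: "vf V X \<Longrightarrow> vf V Y \<Longrightarrow> vf V Z \<Longrightarrow> p \<in> V \<Longrightarrow> T [Y, X, Z] p = - T [X, Y, Z] p"
  using alternating_swap[OF torsion_form, of "[X, Y, Z]" V 0 1 Y X p] by (simp add: vfs3)

lemma T_skew23: "vf V X \<Longrightarrow> vf V Y \<Longrightarrow> vf V Z \<Longrightarrow> p \<in> V \<Longrightarrow> T [X, Z, Y] p = - T [X, Y, Z] p"
  using alternating_swap[OF torsion_form, of "[X, Y, Z]" V 1 2 Z Y p] by (simp add: vfs3)

text \<open>The curvature acts as a derivation on the parallel tensor g and gives 0, which is
  skewness with respect to g.\<close>

lemma R_skew34:
  assumes "vf V X" "vf V Y" "vf V Z" "vf V U" "p \<in> V"
  shows "R [X, Y, U, Z] p = - R [X, Y, Z, U] p"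
  using parallel_curvature[OF tens_g parallel_g _ assms(1,2,5), of "[Z, U]"] assms
    g_sym[of V Z "curvature D X Y U" p]
  by (simp add: vfs2[unfolded numeral_2_eq_2] numeral_2_eq_2 R_eq vf_curvature)

text \<open>Carries the Jacobi identity to the functionals \<open>g [_, U]\<close> and
  \<open>g [D _ W, U]\<close> at a point. The Jacobi identity holds only up to equality of fields
  over \<open>V\<close>, hence the hypothesis \<open>cong\<close>.\<close>

lemma jacobi_linear:
  assumes "vf V X" "vf V Y" "vf V Z" "p \<in> V"
    and lin: "\<And>B C. vf V B \<Longrightarrow> vf V C \<Longrightarrow> L (vf_add B C) = L B + (L C :: real)"
    and hom: "\<And>B. vf V B \<Longrightarrow> L (vf_scale (\<lambda>_. 0) B) = 0"
    and cong: "\<And>B C. vf V B \<Longrightarrow> vf V C \<Longrightarrow> vf_eq M A V B C \<Longrightarrow> L B = L C"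
  shows "L (bracket (bracket X Y) Z) + L (bracket (bracket Y Z) X) + L (bracket (bracket Z X) Y) = 0"
  using cong[OF _ _ jacobi[OF assms(1-3)]] assms(1-3) lin hom by (simp add: vf_closed vf_zero)

lemma nabT:
  assumes "vf V X" "vf V Y" "vf V Z" "vf V U" "p \<in> V"
  shows "nab T [X, Y, Z, U] p = g [D X (D Y Z), U] p - g [D X (D Z Y), U] p - g [D X (bracket Y Z), U] p
    - T [D X Y, Z, U] p - T [Y, D X Z, U] p"
proof -
  have "X (T [Y, Z, U]) p = g [D X (tor Y Z), U] p + g [tor Y Z, D X U] p"
    unfolding T_eq using assms by (simp add: g_deriv vf_tor)
  moreover have "g [D X (tor Y Z), U] p = g [D X (D Y Z), U] p - g [D X (D Z Y), U] p - g [D X (bracket Y Z), U] p"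
    using assms by (simp add: tor_def g_D vf_closed)
  ultimately show ?thesis by (simp add: nab_Cons numeral_eq_Suc T_eq)
qed

text \<open>Once both sides are written in iterated covariant derivatives, everything cancels
  cyclically except the double brackets, which the Jacobi identity removes.\<close>

lemma first_bianchi:
  assumes v: "vf V X" "vf V Y" "vf V Z" "vf V U" and p: "p \<in> V"
  shows "R [X, Y, Z, U] p + R [Y, Z, X, U] p + R [Z, X, Y, U] p
    = nab T [X, Y, Z, U] p + nab T [Y, Z, X, U] p + nab T [Z, X, Y, U] p
      + T [tor X Y, Z, U] p + T [tor Y Z, X, U] p + T [tor Z X, Y, U] p"
proof -
  have t: "T [tor X Y, Z, U] p = T [D X Y, Z, U] p - T [D Y X, Z, U] p
      - (g [D (bracket X Y) Z, U] p - g [D Z (bracket X Y), U] p - g [bracket (bracket X Y) Z, U] p)"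
    if "vf V X" "vf V Y" "vf V Z" for X Y Z
  proof -
    have "T [bracket X Y, Z, U] p = g [D (bracket X Y) Z, U] p - g [D Z (bracket X Y), U] p - g [bracket (bracket X Y) Z, U] p"
      using that v(4) p by (simp add: T_eq tor_def[of "bracket X Y"] g_diff vf_closed)
    then show ?thesis using that v(4) p unfolding tor_def by (simp add: T_diff1 vf_closed)
  qed
  have "g [bracket (bracket X Y) Z, U] p + g [bracket (bracket Y Z) X, U] p + g [bracket (bracket Z X) Y, U] p = 0"
    using v p by (intro jacobi_linear[of V X Y Z p "\<lambda>B. g [B, U] p"]) (auto simp: g_add g_scale sm_const[OF vf_openin] intro: g_cong)
  then show ?thesis
    using v p by (simp add: t nabT R_expand T_skew12[OF D_vf v(1) v(4)] vf_closed
      T_skew12[of V _ X U] T_skew12[of V _ Y U] T_skew12[of V _ Z U])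
qed

lemma nabR:
  assumes "vf V X" "vf V Y" "vf V Z" "vf V W" "vf V U" "p \<in> V"
  shows "nab R [X, Y, Z, W, U] p = g [D X (D Y (D Z W)), U] p - g [D X (D Z (D Y W)), U] p
    - g [D X (D (bracket Y Z) W), U] p - R [D X Y, Z, W, U] p - R [Y, D X Z, W, U] p - R [Y, Z, D X W, U] p"
proof -
  have "X (R [Y, Z, W, U]) p = g [D X (curvature D Y Z W), U] p + g [curvature D Y Z W, D X U] p"
    unfolding R_eq using assms by (simp add: g_deriv vf_curvature)
  moreover have "g [D X (curvature D Y Z W), U] p = g [D X (D Y (D Z W)), U] p - g [D X (D Z (D Y W)), U] p
      - g [D X (D (bracket Y Z) W), U] p"
    using assms by (simp add: curvature_def g_D vf_closed)
  ultimately show ?thesis by (simp add: nab_Cons numeral_eq_Suc R_eq)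
qed

text \<open>The threefold derivatives cancel cyclically; what remains is D along double brackets,
  again zero by Jacobi.\<close>

lemma second_bianchi:
  assumes v: "vf V X" "vf V Y" "vf V Z" "vf V W" "vf V U" and p: "p \<in> V"
  shows "nab R [X, Y, Z, W, U] p + nab R [Y, Z, X, W, U] p + nab R [Z, X, Y, W, U] p
      + R [tor X Y, Z, W, U] p + R [tor Y Z, X, W, U] p + R [tor Z X, Y, W, U] p = 0"
proof -
  have t: "R [tor X Y, Z, W, U] p = R [D X Y, Z, W, U] p - R [D Y X, Z, W, U] p - R [bracket X Y, Z, W, U] p"
    if "vf V X" "vf V Y" "vf V Z" for X Y Z
    using that v(4,5) p unfolding tor_def by (simp add: R_diff1 vf_closed)
  have "g [D (bracket (bracket X Y) Z) W, U] p + g [D (bracket (bracket Y Z) X) W, U] p + g [D (bracket (bracket Z X) Y) W, U] p = 0"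
    using v p by (intro jacobi_linear[of V X Y Z p "\<lambda>B. g [D B W, U] p"])
      (auto simp: g_D sm_const[OF vf_openin] intro: g_D_cong1)
  \<comment> \<open>The derivative and the torsion term are combined because only their sum has this
    shape: each term but the double bracket reappears with the opposite sign under a cyclic shift of
    X, Y, Z.\<close>
  moreover have c: "nab R [X, Y, Z, W, U] p + R [tor X Y, Z, W, U] p =
      g [D X (D Y (D Z W)), U] p - g [D X (D Z (D Y W)), U] p - g [D X (D (bracket Y Z) W), U] p
      - R [D Y X, Z, W, U] p + R [D X Z, Y, W, U] p
      - (g [D Y (D Z (D X W)), U] p - g [D Z (D Y (D X W)), U] p - g [D (bracket Y Z) (D X W), U] p)
      - (g [D (bracket X Y) (D Z W), U] p - g [D Z (D (bracket X Y) W), U] p - g [D (bracket (bracket X Y) Z) W, U] p)"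
    if "vf V X" "vf V Y" "vf V Z" for X Y Z
    using R_expand[OF p that(2,3) D_vf[OF that(1) v(4)] v(5)] R_expand[OF p vf_bracket[OF that(1,2)] that(3) v(4,5)]
      R_skew12[OF D_vf[OF that(1,3)] that(2) v(4,5) p] t[OF that] nabR[OF that v(4,5) p] by linarith
  ultimately show ?thesis using c[OF v(1-3)] c[OF v(2,3,1)] c[OF v(3,1,2)] by linarith
qed

end

section \<open>The algebra of curvature tensors with values in spin(7)\<close>

lemma sum3_231:
  fixes F :: "'i::finite \<Rightarrow> 'i::finite \<Rightarrow> 'i::finite \<Rightarrow> 'b::comm_monoid_add"
  shows "(\<Sum>a\<in>UNIV. \<Sum>b\<in>UNIV. \<Sum>c\<in>UNIV. F a b c) = (\<Sum>a\<in>UNIV. \<Sum>b\<in>UNIV. \<Sum>c\<in>UNIV. F b c a)"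
  unfolding sum.cartesian_product
  by (rule sum.reindex_bij_witness[of _ "(\<lambda>(a, b, c). (b, c, a))" "(\<lambda>(a, b, c). (c, a, b))"]) auto

lemma sum3_312:
  fixes F :: "'i::finite \<Rightarrow> 'i::finite \<Rightarrow> 'i::finite \<Rightarrow> 'b::comm_monoid_add"
  shows "(\<Sum>a\<in>UNIV. \<Sum>b\<in>UNIV. \<Sum>c\<in>UNIV. F a b c) = (\<Sum>a\<in>UNIV. \<Sum>b\<in>UNIV. \<Sum>c\<in>UNIV. F c a b)"
  unfolding sum.cartesian_product
  by (rule sum.reindex_bij_witness[of _ "(\<lambda>(a, b, c). (c, a, b))" "(\<lambda>(a, b, c). (b, c, a))"]) auto

lemma sum3_213:
  fixes F :: "'i::finite \<Rightarrow> 'i::finite \<Rightarrow> 'i::finite \<Rightarrow> 'b::comm_monoid_add"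
  shows "(\<Sum>a\<in>UNIV. \<Sum>b\<in>UNIV. \<Sum>c\<in>UNIV. F a b c) = (\<Sum>a\<in>UNIV. \<Sum>b\<in>UNIV. \<Sum>c\<in>UNIV. F b a c)"
  unfolding sum.cartesian_product
  by (rule sum.reindex_bij_witness[of _ "(\<lambda>(a, b, c). (b, a, c))" "(\<lambda>(a, b, c). (b, a, c))"]) auto

lemma sum3_132:
  fixes F :: "'i::finite \<Rightarrow> 'i::finite \<Rightarrow> 'i::finite \<Rightarrow> 'b::comm_monoid_add"
  shows "(\<Sum>a\<in>UNIV. \<Sum>b\<in>UNIV. \<Sum>c\<in>UNIV. F a b c) = (\<Sum>a\<in>UNIV. \<Sum>b\<in>UNIV. \<Sum>c\<in>UNIV. F a c b)"
  unfolding sum.cartesian_product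
  by (rule sum.reindex_bij_witness[of _ "(\<lambda>(a, b, c). (a, c, b))" "(\<lambda>(a, b, c). (a, c, b))"]) auto

lemma sum3_321:
  fixes F :: "'i::finite \<Rightarrow> 'i::finite \<Rightarrow> 'i::finite \<Rightarrow> 'b::comm_monoid_add"
  shows "(\<Sum>a\<in>UNIV. \<Sum>b\<in>UNIV. \<Sum>c\<in>UNIV. F a b c) = (\<Sum>a\<in>UNIV. \<Sum>b\<in>UNIV. \<Sum>c\<in>UNIV. F c b a)"
  unfolding sum.cartesian_product
  by (rule sum.reindex_bij_witness[of _ "(\<lambda>(a, b, c). (c, b, a))" "(\<lambda>(a, b, c). (c, b, a))"]) auto

lemma sum4_2314:
  fixes F :: "'i::finite \<Rightarrow> 'i::finite \<Rightarrow> 'i::finite \<Rightarrow> 'i::finite \<Rightarrow> 'b::comm_monoid_add"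
  shows "(\<Sum>a\<in>UNIV. \<Sum>b\<in>UNIV. \<Sum>c\<in>UNIV. \<Sum>d\<in>UNIV. F a b c d) = (\<Sum>a\<in>UNIV. \<Sum>b\<in>UNIV. \<Sum>c\<in>UNIV. \<Sum>d\<in>UNIV. F b c a d)"
  unfolding sum.cartesian_product
  by (rule sum.reindex_bij_witness[of _ "(\<lambda>(a, b, c, d). (b, c, a, d))" "(\<lambda>(a, b, c, d). (c, a, b, d))"]) auto

lemma sum4_3124:
  fixes F :: "'i::finite \<Rightarrow> 'i::finite \<Rightarrow> 'i::finite \<Rightarrow> 'i::finite \<Rightarrow> 'b::comm_monoid_add"
  shows "(\<Sum>a\<in>UNIV. \<Sum>b\<in>UNIV. \<Sum>c\<in>UNIV. \<Sum>d\<in>UNIV. F a b c d) = (\<Sum>a\<in>UNIV. \<Sum>b\<in>UNIV. \<Sum>c\<in>UNIV. \<Sum>d\<in>UNIV. F c a b d)"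
  unfolding sum.cartesian_product
  by (rule sum.reindex_bij_witness[of _ "(\<lambda>(a, b, c, d). (c, a, b, d))" "(\<lambda>(a, b, c, d). (b, c, a, d))"]) auto

lemma sum4_3412:
  fixes F :: "'i::finite \<Rightarrow> 'i::finite \<Rightarrow> 'i::finite \<Rightarrow> 'i::finite \<Rightarrow> 'b::comm_monoid_add"
  shows "(\<Sum>a\<in>UNIV. \<Sum>b\<in>UNIV. \<Sum>c\<in>UNIV. \<Sum>d\<in>UNIV. F a b c d) = (\<Sum>a\<in>UNIV. \<Sum>b\<in>UNIV. \<Sum>c\<in>UNIV. \<Sum>d\<in>UNIV. F c d a b)"
  unfolding sum.cartesian_product
  by (rule sum.reindex_bij_witness[of _ "(\<lambda>(a, b, c, d). (c, d, a, b))" "(\<lambda>(a, b, c, d). (c, d, a, b))"]) auto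

lemma sum4_1423:
  fixes F :: "'i::finite \<Rightarrow> 'i::finite \<Rightarrow> 'i::finite \<Rightarrow> 'i::finite \<Rightarrow> 'b::comm_monoid_add"
  shows "(\<Sum>a\<in>UNIV. \<Sum>b\<in>UNIV. \<Sum>c\<in>UNIV. \<Sum>d\<in>UNIV. F a b c d) = (\<Sum>a\<in>UNIV. \<Sum>b\<in>UNIV. \<Sum>c\<in>UNIV. \<Sum>d\<in>UNIV. F a d b c)"
  unfolding sum.cartesian_product
  by (rule sum.reindex_bij_witness[of _ "(\<lambda>(a, b, c, d). (a, d, b, c))" "(\<lambda>(a, b, c, d). (a, c, d, b))"]) auto

lemma sum4_2431:
  fixes F :: "'i::finite \<Rightarrow> 'i::finite \<Rightarrow> 'i::finite \<Rightarrow> 'i::finite \<Rightarrow> 'b::comm_monoid_add"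
  shows "(\<Sum>a\<in>UNIV. \<Sum>b\<in>UNIV. \<Sum>c\<in>UNIV. \<Sum>d\<in>UNIV. F a b c d) = (\<Sum>a\<in>UNIV. \<Sum>b\<in>UNIV. \<Sum>c\<in>UNIV. \<Sum>d\<in>UNIV. F b d c a)"
  unfolding sum.cartesian_product
  by (rule sum.reindex_bij_witness[of _ "(\<lambda>(a, b, c, d). (b, d, c, a))" "(\<lambda>(a, b, c, d). (d, a, c, b))"]) auto

lemma sum4_4123:
  fixes F :: "'i::finite \<Rightarrow> 'i::finite \<Rightarrow> 'i::finite \<Rightarrow> 'i::finite \<Rightarrow> 'b::comm_monoid_add"
  shows "(\<Sum>a\<in>UNIV. \<Sum>b\<in>UNIV. \<Sum>c\<in>UNIV. \<Sum>d\<in>UNIV. F a b c d) = (\<Sum>a\<in>UNIV. \<Sum>b\<in>UNIV. \<Sum>c\<in>UNIV. \<Sum>d\<in>UNIV. F d a b c)"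
  unfolding sum.cartesian_product
  by (rule sum.reindex_bij_witness[of _ "(\<lambda>(a, b, c, d). (d, a, b, c))" "(\<lambda>(a, b, c, d). (b, c, d, a))"]) auto

lemma sum4_2134:
  fixes F :: "'i::finite \<Rightarrow> 'i::finite \<Rightarrow> 'i::finite \<Rightarrow> 'i::finite \<Rightarrow> 'b::comm_monoid_add"
  shows "(\<Sum>a\<in>UNIV. \<Sum>b\<in>UNIV. \<Sum>c\<in>UNIV. \<Sum>d\<in>UNIV. F a b c d) = (\<Sum>a\<in>UNIV. \<Sum>b\<in>UNIV. \<Sum>c\<in>UNIV. \<Sum>d\<in>UNIV. F b a c d)"
  unfolding sum.cartesian_product
  by (rule sum.reindex_bij_witness[of _ "(\<lambda>(a, b, c, d). (b, a, c, d))" "(\<lambda>(a, b, c, d). (b, a, c, d))"]) auto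

lemma sum4_2341:
  fixes F :: "'i::finite \<Rightarrow> 'i::finite \<Rightarrow> 'i::finite \<Rightarrow> 'i::finite \<Rightarrow> 'b::comm_monoid_add"
  shows "(\<Sum>a\<in>UNIV. \<Sum>b\<in>UNIV. \<Sum>c\<in>UNIV. \<Sum>d\<in>UNIV. F a b c d) = (\<Sum>a\<in>UNIV. \<Sum>b\<in>UNIV. \<Sum>c\<in>UNIV. \<Sum>d\<in>UNIV. F b c d a)"
  unfolding sum.cartesian_product
  by (rule sum.reindex_bij_witness[of _ "(\<lambda>(a, b, c, d). (b, c, d, a))" "(\<lambda>(a, b, c, d). (d, a, b, c))"]) auto


lemma sum_scaled: "(\<Sum>x\<in>B. c * f x) = c * (\<Sum>x\<in>B. f x :: real)"
  by (simp add: sum_distrib_left)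

section \<open>Skew arrays, the quadratic torsion term and exchange of pairs\<close>

definition skew3 :: "('i \<Rightarrow> 'i \<Rightarrow> 'i \<Rightarrow> real) \<Rightarrow> bool" where
  "skew3 P \<longleftrightarrow> (\<forall>a b c. P b a c = - P a b c) \<and> (\<forall>a b c. P a c b = - P a b c)"

lemma skew3D:
  assumes "skew3 P"
  shows "P b a c = - P a b c" "P a c b = - P a b c" "P c b a = - P a b c" "P b c a = P a b c" "P c a b = P a b c"
  using assms unfolding skew3_def by (metis minus_minus)+

definition skew4 :: "('i \<Rightarrow> 'i \<Rightarrow> 'i \<Rightarrow> 'i \<Rightarrow> real) \<Rightarrow> bool" where
  "skew4 S \<longleftrightarrow> (\<forall>a b c d. S b a c d = - S a b c d) \<and> (\<forall>a b c d. S a c b d = - S a b c d)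
     \<and> (\<forall>a b c d. S a b d c = - S a b c d)"

lemma skew4D:
  assumes "skew4 S"
  shows "S b a c d = - S a b c d" "S a c b d = - S a b c d" "S a b d c = - S a b c d"
    "S b c a d = S a b c d" "S c a b d = S a b c d" "S c d a b = S a b c d" "S b c d a = - S a b c d"
    "S d a b c = - S a b c d" "S a c d b = S a b c d" "S a d b c = S a b c d" "S b d c a = S a b c d"
  using assms unfolding skew4_def by (metis minus_minus)+

text \<open>The symmetric bilinear expression whose value at P = Q = T is twice sigma^T. Thus
  sigma^T is half of \<open>skewmix T T\<close>, and its derivative is
  \<open>skewmix (N u) T\<close> without the half.\<close>

definition skewmix :: "('i::finite \<Rightarrow> 'i \<Rightarrow> 'i \<Rightarrow> real) \<Rightarrow> ('i \<Rightarrow> 'i \<Rightarrow> 'i \<Rightarrow> real) \<Rightarrow> 'i \<Rightarrow> 'i \<Rightarrow> 'i \<Rightarrow> 'i \<Rightarrow> real" where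
  "skewmix P Q a b c d = (\<Sum>s\<in>UNIV. P a b s * Q c d s + P b c s * Q a d s + P c a s * Q b d s
      + P c d s * Q a b s + P a d s * Q b c s + P b d s * Q c a s)"

lemma skewmix_skew4:
  assumes "skew3 P" "skew3 Q" shows "skew4 (skewmix P Q)"
  unfolding skew4_def
proof (intro conjI allI)
  fix a b c d
  note s = skew3D(1)[OF assms(1)] skew3D(1)[OF assms(2)]
  show "skewmix P Q b a c d = - skewmix P Q a b c d"
    unfolding skewmix_def sum_negf[symmetric]
    by (rule sum.cong[OF refl]) (simp add: s(1)[of b a] s(2)[of b a] s(1)[of a c] s(1)[of c b] s(2)[of c b] s(2)[of a c])
  show "skewmix P Q a c b d = - skewmix P Q a b c d"
    unfolding skewmix_def sum_negf[symmetric]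
    by (rule sum.cong[OF refl]) (simp add: s(1)[of b a] s(2)[of b a] s(1)[of a c] s(1)[of c b] s(2)[of c b] s(2)[of a c])
  show "skewmix P Q a b d c = - skewmix P Q a b c d"
    unfolding skewmix_def sum_negf[symmetric]
    by (rule sum.cong[OF refl]) (simp add: s(1)[of d c] s(2)[of d c] s(1)[of d a] s(1)[of d b] s(2)[of d b] s(2)[of d a]
      s(1)[of a c] s(2)[of a c])
qed

text \<open>The octahedron argument of Riemannian geometry: four cyclic identities, one for each
  choice of the last index, are combined with signs. Total skewness cancels the terms
  \<open>S\<close>, and \<open>N_closed\<close> condenses the terms \<open>N\<close> to the stated
  difference.\<close>

lemma pair_exchange_skew:
  fixes R N S :: "'i \<Rightarrow> 'i \<Rightarrow> 'i \<Rightarrow> 'i \<Rightarrow> real"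
  assumes R12: "\<And>a b c d. R b a c d = - R a b c d" and R34: "\<And>a b c d. R a b d c = - R a b c d"
    and N_skew: "\<And>d. skew3 (N d)" and S_skew: "skew4 S"
    and N_closed: "\<And>a b c d. N a b c d + N b c a d + N c a b d = N d a b c"
    and bianchi: "\<And>a b c d. R a b c d + R b c a d + R c a b d = N d a b c + S a b c d"
  shows "R a b c d - R c d a b = N a b c d - N b a c d"
proof -
  note nd = skew3D[OF N_skew] and sd = skew4D[OF S_skew]
  have "R a c d b = R c a b d" using R12[of c a d b] R34[of c a b d] by simp
  then show ?thesis
    using bianchi[of a b c d] bianchi[of b c d a] bianchi[of c d a b] bianchi[of d a b c] N_closed[of a b c d]
      R34[of a b d c] R34[of b c d a] R34[of c d b a] R12[of d b c a] R34[of d a c b] R34[of b d a c]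
      nd(4)[of b c d a] nd(5)[of c d a b] nd(2)[of b a c d] nd(1)[of b c a d]
      sd(7)[of b c d a] sd(6)[of c d a b] sd(8)[of d a b c]
    by linarith
qed

section \<open>The Lie algebra spin(7) and the cubic identity for 3-forms\<close>

text \<open>For the Spin(7) form the operator on the left of \<open>psi_cubic\<close> has eigenvalue
  2 on the 48-dimensional 3-forms, where the last term vanishes. On the 8-dimensional ones it is 2 -
  42/3 = -12, because psi_auvw psi_buvw = 42 delta_ab.\<close>

locale spin7_form =
  fixes psi :: "'i::finite \<Rightarrow> 'i \<Rightarrow> 'i \<Rightarrow> 'i \<Rightarrow> real"
  assumes psi_skew: "skew4 psi"
    and psi_cubic: "\<And>P x y z. skew3 P \<Longrightarrow>
      (\<Sum>u\<in>UNIV. \<Sum>v\<in>UNIV. P u v z * psi u v x y) + (\<Sum>u\<in>UNIV. \<Sum>v\<in>UNIV. P u v x * psi u v y z)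
      + (\<Sum>u\<in>UNIV. \<Sum>v\<in>UNIV. P u v y * psi u v z x)
      = 2 * P x y z - 1/3 * (\<Sum>a\<in>UNIV. (\<Sum>u\<in>UNIV. \<Sum>v\<in>UNIV. \<Sum>w\<in>UNIV. P u v w * psi a u v w) * psi a x y z)"
begin

text \<open>On 2-forms contraction with Psi has eigenvalue 2 on spin(7), of dimension 21, and -6 on
  the complement of dimension 7.\<close>

definition spin7 :: "('i \<Rightarrow> 'i \<Rightarrow> real) \<Rightarrow> bool" where
  "spin7 F \<longleftrightarrow> (\<forall>k l. (\<Sum>a\<in>UNIV. \<Sum>b\<in>UNIV. F a b * psi a b k l) = 2 * F k l)"

lemma spin7D: "spin7 F \<Longrightarrow> (\<Sum>a\<in>UNIV. \<Sum>b\<in>UNIV. F a b * psi a b k l) = 2 * F k l"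
  by (simp add: spin7_def)

lemma spin7_diff: "spin7 F \<Longrightarrow> spin7 G \<Longrightarrow> spin7 (\<lambda>a b. F a b - G a b)"
  by (simp add: spin7_def left_diff_distrib sum_subtractf)

text \<open>For the torsion of a Spin(7) structure this is, up to a constant factor, its Lee
  form.\<close>

definition lee :: "('i \<Rightarrow> 'i \<Rightarrow> 'i \<Rightarrow> real) \<Rightarrow> 'i \<Rightarrow> real" where
  "lee P a = (\<Sum>u\<in>UNIV. \<Sum>v\<in>UNIV. \<Sum>w\<in>UNIV. P u v w * psi a u v w)"

text \<open>The cubic identity is paired with \<open>F\<close>. Since \<open>F\<close> is an
  eigenform for 2, one of the three contractions cancels the term 2 P; the other two agree by
  skewness, and the Lee term is evaluated by the eigenvalue of \<open>F\<close> once more.\<close>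

lemma spin7_lee:
  assumes P: "skew3 P" and F: "spin7 F" and Fs: "\<And>a b. F b a = - F a b"
  shows "(\<Sum>s\<in>UNIV. \<Sum>y\<in>UNIV. F s y * (\<Sum>u\<in>UNIV. \<Sum>v\<in>UNIV. P u v s * psi u v y w)) = - 1/3 * (\<Sum>a\<in>UNIV. lee P a * F a w)"
    (is "?X = _")
proof -
  define Q where "Q s y w = (\<Sum>u\<in>UNIV. \<Sum>v\<in>UNIV. P u v s * psi u v y w)" for s y w
  note pd = skew4D[OF psi_skew]
  have Qs: "Q s w y = - Q s y w" for s y w
    unfolding Q_def sum_negf[symmetric] by (intro sum.cong refl) (simp add: pd(3)[of _ _ w y])
  have 1: "F s y * Q w s y + F s y * Q s y w + F s y * Q y w s
    = 2 * (F s y * P s y w) - 1/3 * (\<Sum>a\<in>UNIV. lee P a * (F s y * psi a s y w))" for s y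
  proof -
    have "Q w s y + Q s y w + Q y w s = 2 * P s y w - 1/3 * (\<Sum>a\<in>UNIV. lee P a * psi a s y w)"
      using psi_cubic[OF P, where x = s and y = y and z = w] unfolding Q_def lee_def by simp
    then have "F s y * (Q w s y + Q s y w + Q y w s)
        = F s y * (2 * P s y w - 1/3 * (\<Sum>a\<in>UNIV. lee P a * psi a s y w))" by (rule arg_cong)
    moreover have "(\<Sum>a\<in>UNIV. lee P a * (F s y * psi a s y w)) = F s y * (\<Sum>a\<in>UNIV. lee P a * psi a s y w)"
      by (simp add: sum_distrib_left mult.left_commute)
    ultimately show ?thesis by (simp add: distrib_left right_diff_distrib)
  qed
  have "(\<Sum>s\<in>UNIV. \<Sum>y\<in>UNIV. F s y * Q w s y) = (\<Sum>s\<in>UNIV. \<Sum>y\<in>UNIV. \<Sum>u\<in>UNIV. \<Sum>v\<in>UNIV. F s y * (P u v w * psi u v s y))"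
    by (simp add: Q_def sum_distrib_left)
  also have "\<dots> = (\<Sum>s\<in>UNIV. \<Sum>y\<in>UNIV. \<Sum>u\<in>UNIV. \<Sum>v\<in>UNIV. F u v * (P s y w * psi s y u v))"
    by (rule sum4_3412)
  also have "\<dots> = (\<Sum>s\<in>UNIV. \<Sum>y\<in>UNIV. P s y w * (\<Sum>u\<in>UNIV. \<Sum>v\<in>UNIV. F u v * psi u v s y))"
    by (simp add: sum_distrib_left mult_ac pd(6))
  finally have A: "(\<Sum>s\<in>UNIV. \<Sum>y\<in>UNIV. F s y * Q w s y) = (\<Sum>s\<in>UNIV. \<Sum>y\<in>UNIV. 2 * (F s y * P s y w))"
    by (simp add: spin7D[OF F] mult_ac)
  have B: "(\<Sum>s\<in>UNIV. \<Sum>y\<in>UNIV. F s y * Q y w s) = (\<Sum>s\<in>UNIV. \<Sum>y\<in>UNIV. F s y * Q s y w)"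
  proof -
    have e: "F y s * Q s w y = F s y * Q s y w" for s y
      using Fs[of y s] Qs[of s w y] by simp
    show ?thesis using sum.swap[of "\<lambda>s y. F s y * Q y w s" UNIV UNIV] by (simp add: e)
  qed
  have "(\<Sum>s\<in>UNIV. \<Sum>y\<in>UNIV. \<Sum>a\<in>UNIV. lee P a * (F s y * psi a s y w)) = (\<Sum>a\<in>UNIV. \<Sum>s\<in>UNIV. \<Sum>y\<in>UNIV. lee P a * (F s y * psi a s y w))"
    by (rule sum3_231)
  also have "\<dots> = (\<Sum>a\<in>UNIV. lee P a * (\<Sum>s\<in>UNIV. \<Sum>y\<in>UNIV. F s y * psi s y a w))"
    by (simp add: sum_distrib_left pd(4))
  finally have C: "(\<Sum>s\<in>UNIV. \<Sum>y\<in>UNIV. \<Sum>a\<in>UNIV. lee P a * (F s y * psi a s y w)) = 2 * (\<Sum>a\<in>UNIV. lee P a * F a w)"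
    by (simp add: spin7D[OF F] sum_distrib_left mult_ac)
  have "(\<Sum>s\<in>UNIV. \<Sum>y\<in>UNIV. F s y * Q w s y) + (\<Sum>s\<in>UNIV. \<Sum>y\<in>UNIV. F s y * Q s y w) + (\<Sum>s\<in>UNIV. \<Sum>y\<in>UNIV. F s y * Q y w s)
    = (\<Sum>s\<in>UNIV. \<Sum>y\<in>UNIV. 2 * (F s y * P s y w)) - 1/3 * (\<Sum>s\<in>UNIV. \<Sum>y\<in>UNIV. \<Sum>a\<in>UNIV. lee P a * (F s y * psi a s y w))"
    unfolding sum.distrib[symmetric] sum_distrib_left[of "1/3"] sum_subtractf[symmetric]
    by (intro sum.cong refl) (simp add: 1[unfolded sum_distrib_left[of "1/3"]])
  then show ?thesis using A B C by (simp add: Q_def)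
qed

end

text \<open>Covers both the curvature tensor and its covariant derivative, with \<open>S\<close> the respective quadratic torsion
  term.\<close>

locale spin7_bianchi = spin7_form psi for psi :: "'i::finite \<Rightarrow> 'i \<Rightarrow> 'i \<Rightarrow> 'i \<Rightarrow> real" +
  fixes R N S :: "'i \<Rightarrow> 'i \<Rightarrow> 'i \<Rightarrow> 'i \<Rightarrow> real"
  assumes R12: "\<And>a b c d. R b a c d = - R a b c d" and R34: "\<And>a b c d. R a b d c = - R a b c d"
    and R_first: "\<And>c d. spin7 (\<lambda>a b. R a b c d)" and R_last: "\<And>a b. spin7 (R a b)"
    and N_skew: "\<And>d. skew3 (N d)" and S_skew: "skew4 S"
    and N_closed: "\<And>a b c d. N a b c d + N b c a d + N c a b d = N d a b c"
    and N_trace: "\<And>a b. (\<Sum>x\<in>UNIV. N x x a b) = 0"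
    and bianchi: "\<And>a b c d. R a b c d + R b c a d + R c a b d = N d a b c + S a b c d"
begin

lemma pair_exchange: "R a b c d - R c d a b = N a b c d - N b a c d"
  by (rule pair_exchange_skew[OF R12 R34 N_skew S_skew N_closed bianchi])

text \<open>The part of R that changes sign under exchange of pairs. As a difference of two arrays
  that lie in spin(7) in their last pair it does so too, and through \<open>pair_exchange\<close>
  this is a condition on N.\<close>

definition A where "A a b c d = R a b c d - R c d a b"

lemma A_eq: "A a b c d = N a b c d - N b a c d"
  by (simp add: A_def pair_exchange)

lemma A_spin7: "(\<Sum>c\<in>UNIV. \<Sum>d\<in>UNIV. A a b c d * psi c d k l) = 2 * A a b k l"
  using spin7D[OF spin7_diff[OF R_last R_first]] unfolding A_def .

text \<open>\<open>A\<close> sees only the part of N skew in the first two indices;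
  \<open>N_closed\<close> supplies what that loses.\<close>

lemma N_from_A: "2 * N w s x y = A w s x y + A w x y s + A w y s x"
  using N_closed[of s x y w] skew3D[OF N_skew] unfolding A_eq by (smt (verit))

text \<open>Each of the three \<open>A\<close> in \<open>N_from_A\<close> contributes the same
  amount. The spin(7) property of the last pair replaces the contraction with Psi by a factor 2,
  leaving traces of N that vanish.\<close>

lemma N_lee: "(\<Sum>x\<in>UNIV. \<Sum>y\<in>UNIV. \<Sum>z\<in>UNIV. N v x y z * psi x y z w) = 0"
proof -
  note pd = skew4D[OF psi_skew]
  define f where "f x y z = A v x y z * psi x y z w" for x y z
  have e: "2 * (N v x y z * psi x y z w) = f x y z + f y z x + f z x y" for x y z
    using N_from_A[of v x y z] pd(4)[of y z x w] pd(5)[of z x y w] by (simp add: f_def flip: distrib_right)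
  have "2 * (\<Sum>x\<in>UNIV. \<Sum>y\<in>UNIV. \<Sum>z\<in>UNIV. N v x y z * psi x y z w)
    = (\<Sum>x\<in>UNIV. \<Sum>y\<in>UNIV. \<Sum>z\<in>UNIV. f x y z) + (\<Sum>x\<in>UNIV. \<Sum>y\<in>UNIV. \<Sum>z\<in>UNIV. f y z x) + (\<Sum>x\<in>UNIV. \<Sum>y\<in>UNIV. \<Sum>z\<in>UNIV. f z x y)"
    by (simp only: sum_distrib_left e sum.distrib)
  also have "\<dots> = 3 * (\<Sum>x\<in>UNIV. \<Sum>y\<in>UNIV. \<Sum>z\<in>UNIV. A v x y z * psi y z x w)"
    using sum3_231[of f] sum3_312[of f] by (simp add: f_def pd(4))
  also have "\<dots> = 6 * (\<Sum>x\<in>UNIV. A v x x w)"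
    by (simp add: A_spin7 sum_distrib_left)
  also have "(\<Sum>x\<in>UNIV. A v x x w) = (\<Sum>x\<in>UNIV. N v x x w) + (\<Sum>x\<in>UNIV. N x x v w)"
    unfolding A_eq sum.distrib[symmetric]
    by (intro sum.cong refl) (simp add: skew3D(1)[OF N_skew, of _ x v for x])
  also have "\<dots> = 0" using N_trace skew3D(1)[OF N_skew, of v x x w for x] by simp
  finally show ?thesis by simp
qed

text \<open>The first Bianchi identity contracted with Psi: the three curvature terms coincide and
  the instanton condition turns each into twice a trace, whence 6; the term in N drops by
  \<open>N_lee\<close>.\<close>

lemma ricci: "6 * (\<Sum>z\<in>UNIV. R z w z v) = (\<Sum>x\<in>UNIV. \<Sum>y\<in>UNIV. \<Sum>z\<in>UNIV. S x y z v * psi x y z w)"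
proof -
  note pd = skew4D[OF psi_skew]
  define f where "f x y z = R x y z v * psi x y z w" for x y z
  have e: "f x y z + f y z x + f z x y = N v x y z * psi x y z w + S x y z v * psi x y z w" for x y z
    using bianchi[of x y z v] pd(4)[of y z x w] pd(5)[of z x y w] by (simp add: f_def flip: distrib_right)
  have "3 * (\<Sum>x\<in>UNIV. \<Sum>y\<in>UNIV. \<Sum>z\<in>UNIV. f x y z)
    = (\<Sum>x\<in>UNIV. \<Sum>y\<in>UNIV. \<Sum>z\<in>UNIV. f x y z + f y z x + f z x y)"
    using sum3_231[of f] sum3_312[of f] by (simp add: sum.distrib)
  also have "\<dots> = (\<Sum>x\<in>UNIV. \<Sum>y\<in>UNIV. \<Sum>z\<in>UNIV. S x y z v * psi x y z w)"
    using N_lee by (simp add: e sum.distrib)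
  finally have "3 * (\<Sum>x\<in>UNIV. \<Sum>y\<in>UNIV. \<Sum>z\<in>UNIV. f x y z) = (\<Sum>x\<in>UNIV. \<Sum>y\<in>UNIV. \<Sum>z\<in>UNIV. S x y z v * psi x y z w)" .
  moreover have "(\<Sum>x\<in>UNIV. \<Sum>y\<in>UNIV. \<Sum>z\<in>UNIV. f x y z) = (\<Sum>z\<in>UNIV. \<Sum>x\<in>UNIV. \<Sum>y\<in>UNIV. f x y z)"
    using sum3_312[of "\<lambda>z x y. f x y z"] by simp
  moreover have "\<dots> = (\<Sum>z\<in>UNIV. 2 * R z w z v)"
    by (simp add: f_def spin7D[OF R_first])
  ultimately show ?thesis by (simp flip: sum_distrib_left)
qed

text \<open>By exchange of pairs the skew part of the Ricci tensor is a trace of N, in general the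
  codifferential of T up to sign; here it is zero.\<close>

lemma ricci_sym: "(\<Sum>z\<in>UNIV. R z w z v) = (\<Sum>z\<in>UNIV. R z v z w)"
proof -
  have "R z w z v - R z v z w = N z w z v - N w z z v" for z
    by (rule pair_exchange)
  then have "(\<Sum>z\<in>UNIV. R z w z v) - (\<Sum>z\<in>UNIV. R z v z w) = (\<Sum>z\<in>UNIV. N z w z v) - (\<Sum>z\<in>UNIV. N w z z v)"
    by (simp flip: sum_subtractf)
  also have "(\<Sum>z\<in>UNIV. N z w z v) = 0"
    using N_trace[of w v] by (simp add: skew3D(1)[OF N_skew, of _ w] sum_negf)
  also have "(\<Sum>z\<in>UNIV. N w z z v) = 0"
    using skew3D(1)[OF N_skew, of w z z v for z] by simp
  finally show ?thesis by simp
qed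

end

lemma sum4_4321:
  fixes F :: "'i::finite \<Rightarrow> 'i::finite \<Rightarrow> 'i::finite \<Rightarrow> 'i::finite \<Rightarrow> 'b::comm_monoid_add"
  shows "(\<Sum>a\<in>UNIV. \<Sum>b\<in>UNIV. \<Sum>c\<in>UNIV. \<Sum>d\<in>UNIV. F a b c d) = (\<Sum>a\<in>UNIV. \<Sum>b\<in>UNIV. \<Sum>c\<in>UNIV. \<Sum>d\<in>UNIV. F d c b a)"
  unfolding sum.cartesian_product
  by (rule sum.reindex_bij_witness[of _ "(\<lambda>(a, b, c, d). (d, c, b, a))" "(\<lambda>(a, b, c, d). (d, c, b, a))"]) auto

lemma sum4_3421:
  fixes F :: "'i::finite \<Rightarrow> 'i::finite \<Rightarrow> 'i::finite \<Rightarrow> 'i::finite \<Rightarrow> 'b::comm_monoid_add"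
  shows "(\<Sum>a\<in>UNIV. \<Sum>b\<in>UNIV. \<Sum>c\<in>UNIV. \<Sum>d\<in>UNIV. F a b c d) = (\<Sum>a\<in>UNIV. \<Sum>b\<in>UNIV. \<Sum>c\<in>UNIV. \<Sum>d\<in>UNIV. F c d b a)"
  unfolding sum.cartesian_product
  by (rule sum.reindex_bij_witness[of _ "(\<lambda>(a, b, c, d). (c, d, b, a))" "(\<lambda>(a, b, c, d). (d, c, a, b))"]) auto


context spin7_bianchi begin

lemma N_trace2: "(\<Sum>x\<in>UNIV. N x a b x) = 0" "(\<Sum>x\<in>UNIV. N x a x b) = 0"
proof -
  show "(\<Sum>x\<in>UNIV. N x a b x) = 0"
    using N_trace[of a b] by (simp add: skew3D(4)[OF N_skew, of x a b x for x])
  then show "(\<Sum>x\<in>UNIV. N x a x b) = 0"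
    by (simp add: skew3D(2)[OF N_skew, of x a x b for x] sum_negf)
qed

text \<open>\<open>N_closed\<close> writes \<open>N w x y z\<close> as a cyclic sum over x, y, z. A
  skew \<open>P\<close> is invariant under cyclic shifts, so the three summands contribute
  equally.\<close>

lemma N_contract:
  assumes "skew3 P"
  shows "(\<Sum>x\<in>UNIV. \<Sum>y\<in>UNIV. \<Sum>z\<in>UNIV. N w x y z * P x y z) = 3 * (\<Sum>x\<in>UNIV. \<Sum>y\<in>UNIV. \<Sum>z\<in>UNIV. N x y z w * P x y z)"
proof -
  define f where "f x y z = N x y z w * P x y z" for x y z
  have "N w x y z * P x y z = f x y z + f y z x + f z x y" for x y z
    using N_closed[of x y z w] skew3D(4,5)[OF assms] unfolding f_def by (metis distrib_right)
  then show ?thesis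
    using sum3_231[of f] sum3_312[of f] by (simp add: sum.distrib) (simp add: f_def)
qed

end

section \<open>Vanishing of the covariant derivative of T from the second Bianchi identity\<close>

text \<open>The data at a single point: the torsion with its first two covariant derivatives and the
  curvature with its first one. \<open>deriv\<close> is the covariant derivative of
  \<open>base\<close>; u is the direction.\<close>

locale spin7_jet = spin7_form psi for psi :: "'i::finite \<Rightarrow> 'i \<Rightarrow> 'i \<Rightarrow> 'i \<Rightarrow> real" +
  fixes T :: "'i \<Rightarrow> 'i \<Rightarrow> 'i \<Rightarrow> real" and N R :: "'i \<Rightarrow> 'i \<Rightarrow> 'i \<Rightarrow> 'i \<Rightarrow> real"
    and DN DR :: "'i \<Rightarrow> 'i \<Rightarrow> 'i \<Rightarrow> 'i \<Rightarrow> 'i \<Rightarrow> real"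
  assumes T_skew: "skew3 T"
    and base: "spin7_bianchi psi R N (\<lambda>a b c d. 1/2 * skewmix T T a b c d)"
    and deriv: "\<And>u. spin7_bianchi psi (DR u) (DN u) (skewmix (N u) T)"
    and bianchi2: "\<And>u x y z v. DR u x y z v + DR x y u z v + DR y u x z v
      + (\<Sum>s\<in>UNIV. T u x s * R s y z v + T x y s * R s u z v + T y u s * R s x z v) = 0"

sublocale spin7_jet \<subseteq> spin7_bianchi psi R N "\<lambda>a b c d. 1/2 * skewmix T T a b c d"
  by (rule base)

context spin7_jet begin

text \<open>The number <N_w, T>, half the derivative of |T|^2 in the direction w.\<close>

definition uu where "uu w = (\<Sum>x\<in>UNIV. \<Sum>y\<in>UNIV. \<Sum>z\<in>UNIV. N w x y z * T x y z)"
definition K where "K u a b c d = (\<Sum>s\<in>UNIV. N u a b s * T c d s)"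
definition Dric where "Dric u w v = (\<Sum>z\<in>UNIV. DR u z w z v)"

lemmas td = skew3D[OF T_skew] and nd = skew3D[OF N_skew] and pd = skew4D[OF psi_skew]

lemma skewmix_K: "skewmix (N u) T a b c d = K u a b c d + K u b c a d + K u c a b d + K u c d a b + K u a d b c + K u b d c a"
  by (simp add: skewmix_def K_def sum.distrib)

lemma uu_alt: "(\<Sum>x\<in>UNIV. \<Sum>y\<in>UNIV. \<Sum>z\<in>UNIV. N x y z w * T x y z) = 1/3 * uu w"
  using N_contract[OF T_skew] by (simp add: uu_def)

text \<open>Up to sign, the derivative of the scalar curvature. The six terms of
  \<open>skewmix (N u) T\<close> contribute equally to the contraction with Psi, and the cubic
  identity for T evaluates them; its Lee part is killed by \<open>N_lee\<close>.\<close>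

lemma trace_Dric: "(\<Sum>y\<in>UNIV. Dric u y y) = 2/3 * uu u"
proof -
  define f where "f a b c d = K u a b c d * psi a b c d" for a b c d
  define S4 where "S4 F = (\<Sum>a\<in>UNIV. \<Sum>b\<in>UNIV. \<Sum>c\<in>UNIV. \<Sum>d\<in>UNIV. F a b c d :: real)" for F :: "'i \<Rightarrow> 'i \<Rightarrow> 'i \<Rightarrow> 'i \<Rightarrow> real"
  define Q where "Q s x y = (\<Sum>z\<in>UNIV. \<Sum>w\<in>UNIV. T z w s * psi z w x y)" for s x y
  have e: "skewmix (N u) T a b c d * psi a b c d = f a b c d + f b c a d + f c a b d + f c d a b + f a d b c + f b d c a" for a b c d
    using pd(4)[of b c a d] pd(5)[of c a b d] pd(6)[of c d a b] pd(10)[of a d b c] pd(11)[of b d c a]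
    by (simp add: skewmix_K f_def distrib_right)
  have "6 * (\<Sum>y\<in>UNIV. Dric u y y) = (\<Sum>w\<in>UNIV. \<Sum>x\<in>UNIV. \<Sum>y\<in>UNIV. \<Sum>z\<in>UNIV. skewmix (N u) T x y z w * psi x y z w)"
    using spin7_bianchi.ricci[OF deriv] by (simp add: Dric_def sum_distrib_left)
  also have "\<dots> = S4 (\<lambda>x y z w. skewmix (N u) T x y z w * psi x y z w)"
    unfolding S4_def by (rule sum4_4123)
  also have "\<dots> = S4 (\<lambda>a b c d. f a b c d) + S4 (\<lambda>a b c d. f b c a d) + S4 (\<lambda>a b c d. f c a b d) + S4 (\<lambda>a b c d. f c d a b)
      + S4 (\<lambda>a b c d. f a d b c) + S4 (\<lambda>a b c d. f b d c a)"
    unfolding S4_def e by (simp add: sum.distrib)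
  also have "\<dots> = 6 * S4 f"
    using sum4_2314[of f] sum4_3124[of f] sum4_3412[of f] sum4_1423[of f] sum4_2431[of f] by (simp add: S4_def)
  also have "S4 f = (\<Sum>a\<in>UNIV. \<Sum>b\<in>UNIV. \<Sum>s\<in>UNIV. N u a b s * Q s a b)"
  proof -
    have "(\<Sum>c\<in>UNIV. \<Sum>d\<in>UNIV. f a b c d) = (\<Sum>s\<in>UNIV. N u a b s * Q s a b)" for a b
    proof -
      have "(\<Sum>c\<in>UNIV. \<Sum>d\<in>UNIV. f a b c d) = (\<Sum>c\<in>UNIV. \<Sum>d\<in>UNIV. \<Sum>s\<in>UNIV. N u a b s * (T c d s * psi c d a b))"
        by (simp add: f_def K_def sum_distrib_right mult.assoc pd(6))
      also have "\<dots> = (\<Sum>s\<in>UNIV. \<Sum>c\<in>UNIV. \<Sum>d\<in>UNIV. N u a b s * (T c d s * psi c d a b))"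
        by (rule sum3_231)
      finally show ?thesis by (simp add: Q_def sum_distrib_left)
    qed
    then show ?thesis by (simp add: S4_def)
  qed
  finally have 1: "(\<Sum>y\<in>UNIV. Dric u y y) = (\<Sum>a\<in>UNIV. \<Sum>b\<in>UNIV. \<Sum>s\<in>UNIV. N u a b s * Q s a b)" by simp
  \<comment> \<open>Averaging over the cyclic rotations of the indices of N produces the left-hand
    side of the cubic identity.\<close>
  have "3 * (\<Sum>a\<in>UNIV. \<Sum>b\<in>UNIV. \<Sum>s\<in>UNIV. N u a b s * Q s a b) = (\<Sum>a\<in>UNIV. \<Sum>b\<in>UNIV. \<Sum>c\<in>UNIV. N u a b c * (Q c a b + Q a b c + Q b c a))"
  proof -
    define h where "h a b c = N u a b c * Q c a b" for a b c
    have "N u a b c * (Q c a b + Q a b c + Q b c a) = h a b c + h b c a + h c a b" for a b c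
      using nd(4)[of u b c a] nd(5)[of u c a b] by (simp add: h_def distrib_left)
    then show ?thesis using sum3_231[of h] sum3_312[of h] by (simp add: sum.distrib) (simp add: h_def)
  qed
  also have "\<dots> = (\<Sum>a\<in>UNIV. \<Sum>b\<in>UNIV. \<Sum>c\<in>UNIV. 2 * (N u a b c * T a b c) - 1/3 * (\<Sum>e\<in>UNIV. lee T e * (N u a b c * psi e a b c)))"
  proof (intro sum.cong refl)
    fix a b c
    have "Q c a b + Q a b c + Q b c a = 2 * T a b c - 1/3 * (\<Sum>e\<in>UNIV. lee T e * psi e a b c)"
      using psi_cubic[OF T_skew, where x = a and y = b and z = c] unfolding Q_def lee_def by simp
    then show "N u a b c * (Q c a b + Q a b c + Q b c a) = 2 * (N u a b c * T a b c) - 1/3 * (\<Sum>e\<in>UNIV. lee T e * (N u a b c * psi e a b c))"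
      by (simp add: right_diff_distrib sum_distrib_left mult.left_commute)
  qed
  also have "\<dots> = 2 * uu u - 1/3 * (\<Sum>a\<in>UNIV. \<Sum>b\<in>UNIV. \<Sum>c\<in>UNIV. \<Sum>e\<in>UNIV. lee T e * (N u a b c * psi e a b c))"
    by (simp add: sum_subtractf uu_def flip: sum_distrib_left sum_divide_distrib)
  also have "(\<Sum>a\<in>UNIV. \<Sum>b\<in>UNIV. \<Sum>c\<in>UNIV. \<Sum>e\<in>UNIV. lee T e * (N u a b c * psi e a b c))
     = (\<Sum>e\<in>UNIV. \<Sum>a\<in>UNIV. \<Sum>b\<in>UNIV. \<Sum>c\<in>UNIV. lee T e * (N u a b c * psi e a b c))"
    by (rule sum4_2341)
  also have "\<dots> = 0"
  proof -
    have "(\<Sum>a\<in>UNIV. \<Sum>b\<in>UNIV. \<Sum>c\<in>UNIV. N u a b c * psi e a b c) = 0" for e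
      using N_lee[of u e] by (simp add: pd(8)[of e] sum_negf)
    then show ?thesis by (simp flip: sum_distrib_left)
  qed
  finally show ?thesis using 1 by simp
qed

text \<open>Three of the six terms of \<open>skewmix\<close> contain a trace of N and vanish. In the
  other three, skew-symmetrisation in v and s turns N into half of \<open>A\<close>, on which
  contraction with Psi is multiplication by 2.\<close>

lemma div_Dric: "(\<Sum>v\<in>UNIV. Dric v w v) = 1/3 * uu w"
proof -
  define f where "f v x y z = K v x y z v * psi x y z w" for v x y z
  define S4 where "S4 F = (\<Sum>a\<in>UNIV. \<Sum>b\<in>UNIV. \<Sum>c\<in>UNIV. \<Sum>d\<in>UNIV. F a b c d :: real)" for F :: "'i \<Rightarrow> 'i \<Rightarrow> 'i \<Rightarrow> 'i \<Rightarrow> real"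
  have e: "skewmix (N v) T x y z v * psi x y z w = f v x y z + f v y z x + f v z x y
     + (K v z v x y + K v x v y z + K v y v z x) * psi x y z w" for v x y z
    using pd(4)[of y z x w] pd(5)[of z x y w]
    by (simp add: skewmix_K f_def distrib_right)
  have K0: "(\<Sum>v\<in>UNIV. K v a v b c) = 0" for a b c
  proof -
    have "(\<Sum>v\<in>UNIV. K v a v b c) = (\<Sum>s\<in>UNIV. \<Sum>v\<in>UNIV. N v a v s * T b c s)"
      unfolding K_def by (rule sum.swap)
    then show ?thesis by (simp add: N_trace2 flip: sum_distrib_right)
  qed
  have z: "S4 (\<lambda>v x y z. (K v z v x y + K v x v y z + K v y v z x) * psi x y z w) = 0"
  proof -
    have "S4 (\<lambda>v x y z. (K v z v x y + K v x v y z + K v y v z x) * psi x y z w)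
      = (\<Sum>x\<in>UNIV. \<Sum>y\<in>UNIV. \<Sum>z\<in>UNIV. \<Sum>v\<in>UNIV. (K v z v x y + K v x v y z + K v y v z x) * psi x y z w)"
      unfolding S4_def by (rule sum4_4123)
    then show ?thesis by (simp add: K0 sum.distrib flip: sum_distrib_right)
  qed
  have "6 * (\<Sum>v\<in>UNIV. Dric v w v) = S4 (\<lambda>v x y z. skewmix (N v) T x y z v * psi x y z w)"
    using spin7_bianchi.ricci[OF deriv] by (simp add: Dric_def sum_distrib_left S4_def)
  also have "\<dots> = S4 (\<lambda>v x y z. f v x y z) + S4 (\<lambda>v x y z. f v y z x) + S4 (\<lambda>v x y z. f v z x y)"
    using z unfolding S4_def e by (simp add: sum.distrib)
  also have "\<dots> = 3 * S4 f"
    using sum3_231[of "f v" for v] sum3_312[of "f v" for v] by (simp add: S4_def)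
  also have "S4 f = (\<Sum>x\<in>UNIV. \<Sum>y\<in>UNIV. \<Sum>z\<in>UNIV. \<Sum>v\<in>UNIV. f v x y z)"
    unfolding S4_def by (rule sum4_4123)
  \<comment> \<open>T is skew in v and s, so only the part of \<open>N v s x y\<close> skew in v and
    s contributes, and that is half of \<open>A v s x y\<close>.\<close>
  also have "\<dots> = (\<Sum>x\<in>UNIV. \<Sum>y\<in>UNIV. \<Sum>z\<in>UNIV. (\<Sum>v\<in>UNIV. \<Sum>s\<in>UNIV. 1/2 * (T z v s * (A v s x y * psi x y z w))))"
  proof (rule sum.cong[OF refl], rule sum.cong[OF refl], rule sum.cong[OF refl])
    fix x y z
    have "(\<Sum>v\<in>UNIV. f v x y z) = (\<Sum>v\<in>UNIV. \<Sum>s\<in>UNIV. N v s x y * T z v s * psi x y z w)"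
      unfolding f_def K_def sum_distrib_right by (simp add: nd(4)[of _ x y])
    moreover have "(\<Sum>v\<in>UNIV. \<Sum>s\<in>UNIV. N v s x y * T z v s * psi x y z w) = (\<Sum>v\<in>UNIV. \<Sum>s\<in>UNIV. - N s v x y * T z v s * psi x y z w)"
    proof -
      have "N s v x y * T z s v * psi x y z w = - N s v x y * T z v s * psi x y z w" for v s
        using td(2)[of z s v] by simp
      then show ?thesis by (subst sum.swap) simp
    qed
    moreover have "1/2 * (T z v s * (A v s x y * psi x y z w)) = 1/2 * (N v s x y * T z v s * psi x y z w) + 1/2 * (- N s v x y * T z v s * psi x y z w)" for v s
      by (simp add: A_eq algebra_simps)
    ultimately show "(\<Sum>v\<in>UNIV. f v x y z) = (\<Sum>v\<in>UNIV. \<Sum>s\<in>UNIV. 1/2 * (T z v s * (A v s x y * psi x y z w)))"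
      by (simp only: sum.distrib sum_scaled)
  qed
  also have "\<dots> = (\<Sum>z\<in>UNIV. \<Sum>x\<in>UNIV. \<Sum>y\<in>UNIV. (\<Sum>v\<in>UNIV. \<Sum>s\<in>UNIV. 1/2 * (T z v s * (A v s x y * psi x y z w))))"
    by (rule sum3_231)
  also have "\<dots> = (\<Sum>z\<in>UNIV. \<Sum>v\<in>UNIV. \<Sum>s\<in>UNIV. \<Sum>x\<in>UNIV. \<Sum>y\<in>UNIV. 1/2 * (T z v s * (A v s x y * psi x y z w)))"
    by (intro sum.cong refl sum4_3412)
  also have "\<dots> = (\<Sum>z\<in>UNIV. \<Sum>v\<in>UNIV. \<Sum>s\<in>UNIV. T z v s * A v s z w)"
  proof -
    have "(\<Sum>x\<in>UNIV. \<Sum>y\<in>UNIV. 1/2 * (T z v s * (A v s x y * psi x y z w))) = T z v s * A v s z w" for z v s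
      by (simp only: sum_scaled A_spin7)
    then show ?thesis by (simp only:)
  qed
  also have "\<dots> = (\<Sum>z\<in>UNIV. \<Sum>v\<in>UNIV. \<Sum>s\<in>UNIV. N v s z w * T v s z) + (\<Sum>z\<in>UNIV. \<Sum>v\<in>UNIV. \<Sum>s\<in>UNIV. N s v z w * T s v z)"
    unfolding sum.distrib[symmetric]
  proof (intro sum.cong refl)
    fix z v s
    show "T z v s * A v s z w = N v s z w * T v s z + N s v z w * T s v z"
      using td(5)[of z v s] td(1)[of s v z] by (simp add: A_eq algebra_simps)
  qed
  also have "(\<Sum>z\<in>UNIV. \<Sum>v\<in>UNIV. \<Sum>s\<in>UNIV. N v s z w * T v s z) = 1/3 * uu w"
    using sum3_231[of "\<lambda>v s z. N v s z w * T v s z"] sum3_312[of "\<lambda>v s z. N v s z w * T v s z"] uu_alt[of w] by simp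
  also have "(\<Sum>z\<in>UNIV. \<Sum>v\<in>UNIV. \<Sum>s\<in>UNIV. N s v z w * T s v z) = 1/3 * uu w"
    using sum3_321[of "\<lambda>s v z. N s v z w * T s v z"] uu_alt[of w] by simp
  finally show ?thesis by simp
qed

text \<open>The first Bianchi identity evaluates T against the first pair of R as uu/3. Exchange of
  pairs moves T to the second pair and adds two contractions of N with T: 1/3 + 1/3 - 1 =
  -1/3.\<close>

lemma T_R: "(\<Sum>s\<in>UNIV. \<Sum>x\<in>UNIV. \<Sum>y\<in>UNIV. T s x y * R s u x y) = - 1/3 * uu u"
proof -
  define f where "f x y s = T x y s * R x y s u" for x y s
  define q where "q x y s = T x y s * skewmix T T x y s u" for x y s
  have "3 * (\<Sum>x\<in>UNIV. \<Sum>y\<in>UNIV. \<Sum>s\<in>UNIV. f x y s) = (\<Sum>x\<in>UNIV. \<Sum>y\<in>UNIV. \<Sum>s\<in>UNIV. f x y s + f y s x + f s x y)"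
    using sum3_231[of f] sum3_312[of f] by (simp add: sum.distrib)
  also have "\<dots> = (\<Sum>x\<in>UNIV. \<Sum>y\<in>UNIV. \<Sum>s\<in>UNIV. N u x y s * T x y s + 1/2 * q x y s)"
  proof (intro sum.cong refl)
    fix x y s
    show "f x y s + f y s x + f s x y = N u x y s * T x y s + 1/2 * q x y s"
      using bianchi[of x y s u, THEN arg_cong[where f = "\<lambda>r. r * T x y s"]] td(4)[of y s x] td(5)[of s x y]
      by (simp add: f_def q_def algebra_simps)
  qed
  also have "\<dots> = uu u + 1/2 * (\<Sum>x\<in>UNIV. \<Sum>y\<in>UNIV. \<Sum>s\<in>UNIV. q x y s)"
    by (simp add: uu_def sum.distrib sum_divide_distrib)
  \<comment> \<open>T is orthogonal to its own quadratic term: \<open>T x y s * T x y t\<close> is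
    symmetric in s and t, while \<open>T s u t\<close> is skew in them.\<close>
  also have "(\<Sum>x\<in>UNIV. \<Sum>y\<in>UNIV. \<Sum>s\<in>UNIV. q x y s) = 0"
  proof -
    define h where "h x y s = (\<Sum>t\<in>UNIV. T x y s * T x y t * T s u t)" for x y s
    have "skewmix T T x y s u = 2 * (\<Sum>t\<in>UNIV. T x y t * T s u t + T y s t * T x u t + T s x t * T y u t)" for x y s
      unfolding skewmix_def sum_distrib_left by (intro sum.cong refl) (simp add: mult.commute)
    then have "q x y s = 2 * (h x y s + h y s x + h s x y)" for x y s
      using td(4)[of y s x] td(5)[of s x y] by (simp add: q_def h_def sum.distrib sum_distrib_left algebra_simps)
    then have "(\<Sum>x\<in>UNIV. \<Sum>y\<in>UNIV. \<Sum>s\<in>UNIV. q x y s) = 6 * (\<Sum>x\<in>UNIV. \<Sum>y\<in>UNIV. \<Sum>s\<in>UNIV. h x y s)"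
      using sum3_231[of h] sum3_312[of h] by (simp add: sum.distrib flip: sum_distrib_left)
    moreover have "(\<Sum>s\<in>UNIV. h x y s) = 0" for x y
    proof -
      have "(\<Sum>s\<in>UNIV. h x y s) = (\<Sum>t\<in>UNIV. \<Sum>s\<in>UNIV. T x y s * T x y t * T s u t)"
        unfolding h_def by (rule sum.swap)
      also have "\<dots> = - (\<Sum>s\<in>UNIV. h x y s)"
        unfolding h_def sum_negf[symmetric] 
      proof (intro sum.cong refl)
        fix s t
        show "T x y s * T x y t * T s u t = - (T x y t * T x y s * T t u s)" using td(3)[of t u s] by simp
      qed
      finally show ?thesis by simp
    qed
    ultimately show ?thesis by simp
  qed
  finally have 1: "(\<Sum>x\<in>UNIV. \<Sum>y\<in>UNIV. \<Sum>s\<in>UNIV. f x y s) = 1/3 * uu u" by simp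
  have "T s x y * R s u x y = f x y s + N s x y u * T s x y - N u s x y * T s x y" for s x y
  proof -
    have "R s u x y = R x y s u + N s x y u - N u s x y"
      using pair_exchange[of s u x y] nd(4)[of s x y u] by simp
    then have "T s x y * R s u x y = T s x y * (R x y s u + N s x y u - N u s x y)" by (simp only:)
    then show ?thesis unfolding f_def td(5)[of s x y] by (simp only: right_diff_distrib distrib_left mult.commute)
  qed
  then have "(\<Sum>s\<in>UNIV. \<Sum>x\<in>UNIV. \<Sum>y\<in>UNIV. T s x y * R s u x y) =
    (\<Sum>s\<in>UNIV. \<Sum>x\<in>UNIV. \<Sum>y\<in>UNIV. f x y s) + 1/3 * uu u - uu u"
    using uu_alt[of u] by (simp add: sum.distrib sum_subtractf uu_def)
  moreover have "(\<Sum>s\<in>UNIV. \<Sum>x\<in>UNIV. \<Sum>y\<in>UNIV. f x y s) = (\<Sum>x\<in>UNIV. \<Sum>y\<in>UNIV. \<Sum>s\<in>UNIV. f x y s)"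
    using sum3_312[of "\<lambda>s x y. f x y s"] by simp
  ultimately show ?thesis using 1 by simp
qed

text \<open>In order, the six terms of the doubly contracted second Bianchi identity are uu times
  -2/3, 1/3, 1/3, 0, 1/3, 0. The two zeros pair the skew T with the symmetric Ricci tensor.\<close>

lemma uu_zero: "uu u = 0"
proof -
  define r where "r w v = (\<Sum>z\<in>UNIV. R z w z v)" for w v
  have rs: "r w v = r v w" for w v unfolding r_def by (rule ricci_sym)
  \<comment> \<open>Setting z = y and v = x makes the derivative terms a trace of the differentiated
    Ricci tensor and two divergences of it.\<close>
  have "(\<Sum>x\<in>UNIV. \<Sum>y\<in>UNIV. DR u x y y x + DR x y u y x + DR y u x y x
      + (\<Sum>s\<in>UNIV. T u x s * R s y y x + T x y s * R s u y x + T y u s * R s x y x)) = 0"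
    by (simp add: bianchi2)
  then have e: "(\<Sum>x\<in>UNIV. \<Sum>y\<in>UNIV. DR u x y y x) + (\<Sum>x\<in>UNIV. \<Sum>y\<in>UNIV. DR x y u y x) + (\<Sum>x\<in>UNIV. \<Sum>y\<in>UNIV. DR y u x y x)
     + (\<Sum>x\<in>UNIV. \<Sum>y\<in>UNIV. \<Sum>s\<in>UNIV. T u x s * R s y y x) + (\<Sum>x\<in>UNIV. \<Sum>y\<in>UNIV. \<Sum>s\<in>UNIV. T x y s * R s u y x)
     + (\<Sum>x\<in>UNIV. \<Sum>y\<in>UNIV. \<Sum>s\<in>UNIV. T y u s * R s x y x) = 0"
    by (simp add: sum.distrib)
  note d12 = spin7_bianchi.R12[OF deriv] and d34 = spin7_bianchi.R34[OF deriv]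
  have 1: "(\<Sum>x\<in>UNIV. \<Sum>y\<in>UNIV. DR u x y y x) = - (\<Sum>y\<in>UNIV. Dric u y y)"
  proof -
    have "DR u x y y x = - DR u x y x y" for x y by (rule d34)
    then show ?thesis unfolding Dric_def by (subst sum.swap) (simp add: sum_negf)
  qed
  have 2: "(\<Sum>x\<in>UNIV. \<Sum>y\<in>UNIV. DR x y u y x) = (\<Sum>x\<in>UNIV. Dric x u x)"
    by (simp add: Dric_def)
  have 3: "(\<Sum>x\<in>UNIV. \<Sum>y\<in>UNIV. DR y u x y x) = (\<Sum>x\<in>UNIV. Dric x u x)"
  proof -
    have "DR y u x y x = DR y x u x y" for x y using d12[of y x u y x] d34[of y x u y x] by simp
    then show ?thesis unfolding Dric_def by (subst sum.swap) simp
  qed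
  have skew0: "(\<Sum>x\<in>UNIV. \<Sum>s\<in>UNIV. T u x s * r s x) = 0"
  proof -
    have "(\<Sum>x\<in>UNIV. \<Sum>s\<in>UNIV. T u x s * r s x) = (\<Sum>s\<in>UNIV. \<Sum>x\<in>UNIV. T u x s * r s x)"
      by (rule sum.swap)
    also have "\<dots> = - (\<Sum>x\<in>UNIV. \<Sum>s\<in>UNIV. T u x s * r s x)"
      unfolding sum_negf[symmetric] 
    proof (intro sum.cong refl)
      fix s x
      show "T u x s * r s x = - (T u s x * r x s)" using td(2)[of u x s] rs[of s x] by simp
    qed
    finally show ?thesis by simp
  qed
  have 4: "(\<Sum>x\<in>UNIV. \<Sum>y\<in>UNIV. \<Sum>s\<in>UNIV. T u x s * R s y y x) = 0"
  proof -
    have "R s y y x = - R y s y x" for s y x by (rule R12)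
    then have "(\<Sum>x\<in>UNIV. \<Sum>y\<in>UNIV. \<Sum>s\<in>UNIV. T u x s * R s y y x) = - (\<Sum>x\<in>UNIV. \<Sum>y\<in>UNIV. \<Sum>s\<in>UNIV. T u x s * R y s y x)"
      by (simp add: sum_negf)
    also have "(\<Sum>x\<in>UNIV. \<Sum>y\<in>UNIV. \<Sum>s\<in>UNIV. T u x s * R y s y x) = (\<Sum>x\<in>UNIV. \<Sum>s\<in>UNIV. \<Sum>y\<in>UNIV. T u x s * R y s y x)"
      by (rule sum3_132)
    finally show ?thesis using skew0 by (simp add: r_def sum_distrib_left)
  qed
  have 6: "(\<Sum>x\<in>UNIV. \<Sum>y\<in>UNIV. \<Sum>s\<in>UNIV. T y u s * R s x y x) = 0"
  proof -
    have e: "R s x y x = R x s x y" for s y x using R12[of x s y x] R34[of x s x y] by simp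
    have "(\<Sum>x\<in>UNIV. \<Sum>y\<in>UNIV. \<Sum>s\<in>UNIV. T y u s * R s x y x) = (\<Sum>x\<in>UNIV. \<Sum>y\<in>UNIV. \<Sum>s\<in>UNIV. T x u y * R s y s x)"
      unfolding e by (rule sum3_312)
    also have "\<dots> = - (\<Sum>x\<in>UNIV. \<Sum>y\<in>UNIV. T u x y * r y x)"
      unfolding r_def sum_distrib_left sum_negf[symmetric]
      by (intro sum.cong refl) (simp add: td(1)[of _ u])
    finally show ?thesis using skew0 by simp
  qed
  have 5: "(\<Sum>x\<in>UNIV. \<Sum>y\<in>UNIV. \<Sum>s\<in>UNIV. T x y s * R s u y x) = 1/3 * uu u"
  proof -
    have "T x y s * R s u y x = - (T s x y * R s u x y)" for x y s
      using R34[of s u x y] td(5)[of s x y] by simp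
    then have "(\<Sum>x\<in>UNIV. \<Sum>y\<in>UNIV. \<Sum>s\<in>UNIV. T x y s * R s u y x) = - (\<Sum>x\<in>UNIV. \<Sum>y\<in>UNIV. \<Sum>s\<in>UNIV. T s x y * R s u x y)"
      by (simp add: sum_negf)
    also have "(\<Sum>x\<in>UNIV. \<Sum>y\<in>UNIV. \<Sum>s\<in>UNIV. T s x y * R s u x y) = (\<Sum>s\<in>UNIV. \<Sum>x\<in>UNIV. \<Sum>y\<in>UNIV. T s x y * R s u x y)"
      by (rule sum3_231)
    finally show ?thesis using T_R[of u] by simp
  qed
  show ?thesis using e 1 2 3 4 5 6 trace_Dric[of u] div_Dric[of u] by simp
qed

text \<open>The array \<open>B\<close>, quadratic in T, is skew in each of its pairs and symmetric
  under their exchange. With these symmetries \<open>N_closed\<close> makes the sum equal to -3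
  times itself.\<close>

lemma N_T_T: "(\<Sum>v\<in>UNIV. \<Sum>x\<in>UNIV. \<Sum>y\<in>UNIV. \<Sum>z\<in>UNIV. K v x y z v * T x y z) = 0"
proof -
  define B where "B v s x y = (\<Sum>z\<in>UNIV. T z v s * T x y z)" for v s x y
  define f where "f v s x y = N v x y s * B v s x y" for v s x y
  define S4 where "S4 F = (\<Sum>a\<in>UNIV. \<Sum>b\<in>UNIV. \<Sum>c\<in>UNIV. \<Sum>d\<in>UNIV. F a b c d :: real)" for F :: "'i \<Rightarrow> 'i \<Rightarrow> 'i \<Rightarrow> 'i \<Rightarrow> real"
  have B1: "B s v x y = - B v s x y" for v s x y
  proof -
    have "T z s v = - T z v s" for z by (rule td(2))
    then show ?thesis by (simp add: B_def sum_negf)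
  qed
  have B2: "B x y v s = B v s x y" for v s x y
  proof -
    have "T z x y * T v s z = T z v s * T x y z" for z using td(5)[of z x y] td(5)[of z v s] by simp
    then show ?thesis by (simp add: B_def)
  qed
  have "f v s x y = - f s v x y - f x y v s - f y x s v" for v s x y
  proof -
    have "N x v s y = - N x y s v" "N y s v x = - N y s x v" by (rule nd)+
    moreover have "B y x s v = B v s x y" using B1[of x y s v] B1[of s v x y] B1[of v s x y] B2[of v s x y] B2[of s v x y] by simp
    moreover have "N v x y s = N x y s v + N y s x v + N s x y v" using N_closed[of x y s v] by simp
    ultimately show ?thesis using B1[of s v x y] B2[of v s x y] by (simp add: f_def algebra_simps)
  qed
  then have "S4 f = - S4 (\<lambda>v s x y. f s v x y) - S4 (\<lambda>v s x y. f x y v s) - S4 (\<lambda>v s x y. f y x s v)"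
    unfolding S4_def sum_negf[symmetric] sum_subtractf[symmetric] by (intro sum.cong refl)
  also have "\<dots> = - 3 * S4 f"
    using sum4_2134[of f] sum4_3412[of f] sum4_4321[of f] by (simp add: S4_def)
  finally have "S4 f = 0" by simp
  moreover have "(\<Sum>v\<in>UNIV. \<Sum>x\<in>UNIV. \<Sum>y\<in>UNIV. \<Sum>z\<in>UNIV. K v x y z v * T x y z) = S4 f"
  proof -
    have "(\<Sum>z\<in>UNIV. K v x y z v * T x y z) = (\<Sum>s\<in>UNIV. f v s x y)" for v x y
    proof -
      have "(\<Sum>z\<in>UNIV. K v x y z v * T x y z) = (\<Sum>z\<in>UNIV. \<Sum>s\<in>UNIV. N v x y s * (T z v s * T x y z))"
        by (simp add: K_def sum_distrib_right mult.assoc)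
      also have "\<dots> = (\<Sum>s\<in>UNIV. \<Sum>z\<in>UNIV. N v x y s * (T z v s * T x y z))"
        by (rule sum.swap)
      finally show ?thesis by (simp add: f_def B_def sum_distrib_left)
    qed
    then have "(\<Sum>v\<in>UNIV. \<Sum>x\<in>UNIV. \<Sum>y\<in>UNIV. \<Sum>z\<in>UNIV. K v x y z v * T x y z)
      = (\<Sum>v\<in>UNIV. \<Sum>x\<in>UNIV. \<Sum>y\<in>UNIV. \<Sum>s\<in>UNIV. f v s x y)" by simp
    also have "\<dots> = S4 f" unfolding S4_def by (intro sum.cong refl sum3_312[symmetric])
    finally show ?thesis .
  qed
  ultimately show ?thesis by simp
qed

text \<open>The second Bianchi identity contracted with Psi in u, x, y: the instanton condition
  reduces the derivative terms to a divergence, and \<open>spin7_lee\<close> reduces the torsion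
  terms to the Lee form.\<close>

lemma div_R: "2 * (\<Sum>u\<in>UNIV. DR u u w z v) = 1/3 * (\<Sum>a\<in>UNIV. lee T a * R a w z v)"
proof -
  define f where "f u x y = DR u x y z v * psi u x y w" for u x y
  define h where "h u x y = (\<Sum>s\<in>UNIV. T u x s * R s y z v) * psi u x y w" for u x y
  have "(f u x y + h u x y) + (f x y u + h x y u) + (f y u x + h y u x) = 0" for u x y
  proof -
    have "(DR u x y z v + DR x y u z v + DR y u x z v
      + ((\<Sum>s\<in>UNIV. T u x s * R s y z v) + (\<Sum>s\<in>UNIV. T x y s * R s u z v) + (\<Sum>s\<in>UNIV. T y u s * R s x z v))) * psi u x y w = 0"
      using bianchi2[of u x y z v] by (simp add: sum.distrib)
    then show ?thesis using pd(4)[of x y u w] pd(5)[of y u x w] by (simp add: f_def h_def distrib_right)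
  qed
  then have "(\<Sum>u\<in>UNIV. \<Sum>x\<in>UNIV. \<Sum>y\<in>UNIV. (f u x y + h u x y) + (f x y u + h x y u) + (f y u x + h y u x)) = 0" by simp
  then have "(\<Sum>u\<in>UNIV. \<Sum>x\<in>UNIV. \<Sum>y\<in>UNIV. f u x y) + (\<Sum>u\<in>UNIV. \<Sum>x\<in>UNIV. \<Sum>y\<in>UNIV. h u x y) = 0"
    using sum3_231[of "\<lambda>u x y. f u x y + h u x y"] sum3_312[of "\<lambda>u x y. f u x y + h u x y"] by (simp add: sum.distrib)
  moreover have "(\<Sum>u\<in>UNIV. \<Sum>x\<in>UNIV. \<Sum>y\<in>UNIV. f u x y) = 2 * (\<Sum>u\<in>UNIV. DR u u w z v)"
  proof -
    have "f u x y = DR u x y z v * psi x y u w" for u x y using pd(4)[of x y u w] by (simp add: f_def)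
    then show ?thesis by (simp add: spin7D[OF spin7_bianchi.R_first[OF deriv]] sum_distrib_left)
  qed
  moreover have "(\<Sum>u\<in>UNIV. \<Sum>x\<in>UNIV. \<Sum>y\<in>UNIV. h u x y) = - 1/3 * (\<Sum>a\<in>UNIV. lee T a * R a w z v)"
  proof -
    have "(\<Sum>u\<in>UNIV. \<Sum>x\<in>UNIV. \<Sum>y\<in>UNIV. h u x y) = (\<Sum>u\<in>UNIV. \<Sum>x\<in>UNIV. \<Sum>y\<in>UNIV. \<Sum>s\<in>UNIV. R s y z v * (T u x s * psi u x y w))"
      by (simp add: h_def sum_distrib_right sum_distrib_left mult_ac)
    also have "\<dots> = (\<Sum>s\<in>UNIV. \<Sum>y\<in>UNIV. \<Sum>u\<in>UNIV. \<Sum>x\<in>UNIV. R s y z v * (T u x s * psi u x y w))"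
      by (rule sum4_3421)
    also have "\<dots> = (\<Sum>s\<in>UNIV. \<Sum>y\<in>UNIV. R s y z v * (\<Sum>u\<in>UNIV. \<Sum>x\<in>UNIV. T u x s * psi u x y w))"
      by (simp add: sum_distrib_left)
    also have "\<dots> = - 1/3 * (\<Sum>a\<in>UNIV. lee T a * R a w z v)"
      by (rule spin7_lee[OF T_skew R_first R12])
    finally show ?thesis .
  qed
  ultimately show ?thesis by simp
qed

text \<open>Pairing the Lee contraction of \<open>div_R\<close> with T gives, by \<open>T_R\<close>,
  a linear combination of the numbers uu, which are zero.\<close>

lemma div_R_T: "(\<Sum>v\<in>UNIV. \<Sum>x\<in>UNIV. \<Sum>y\<in>UNIV. \<Sum>z\<in>UNIV. DR v z v x y * T x y z) = 0"
proof -
  have d12: "DR v z v x y = - DR v v z x y" for v z x y by (rule spin7_bianchi.R12[OF deriv])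
  have "2 * (\<Sum>v\<in>UNIV. DR v z v x y * T x y z) = - 1/3 * (\<Sum>a\<in>UNIV. lee T a * (R a z x y * T x y z))" for x y z
  proof -
    have "2 * (\<Sum>v\<in>UNIV. DR v z v x y * T x y z) = - (2 * (\<Sum>v\<in>UNIV. DR v v z x y)) * T x y z"
      by (simp add: d12 sum_negf sum_distrib_right)
    also have "\<dots> = - (1/3 * (\<Sum>a\<in>UNIV. lee T a * R a z x y)) * T x y z" by (simp only: div_R)
    also have "\<dots> = - 1/3 * (\<Sum>a\<in>UNIV. lee T a * (R a z x y * T x y z))"
      by (simp add: sum_distrib_right mult.assoc)
    finally show ?thesis .
  qed
  note e = this
  have "2 * (\<Sum>v\<in>UNIV. \<Sum>x\<in>UNIV. \<Sum>y\<in>UNIV. \<Sum>z\<in>UNIV. DR v z v x y * T x y z)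
    = 2 * (\<Sum>x\<in>UNIV. \<Sum>y\<in>UNIV. \<Sum>z\<in>UNIV. \<Sum>v\<in>UNIV. DR v z v x y * T x y z)"
    by (rule arg_cong[OF sum4_4123])
  also have "\<dots> = - 1/3 * (\<Sum>x\<in>UNIV. \<Sum>y\<in>UNIV. \<Sum>z\<in>UNIV. \<Sum>a\<in>UNIV. lee T a * (R a z x y * T x y z))"
    unfolding sum_distrib_left[of 2] sum_distrib_left[of "- 1/3" ] e[unfolded sum_distrib_left[of 2] sum_distrib_left[of "- 1/3"]] ..
  also have "(\<Sum>x\<in>UNIV. \<Sum>y\<in>UNIV. \<Sum>z\<in>UNIV. \<Sum>a\<in>UNIV. lee T a * (R a z x y * T x y z))
     = (\<Sum>a\<in>UNIV. \<Sum>x\<in>UNIV. \<Sum>y\<in>UNIV. \<Sum>z\<in>UNIV. lee T a * (R a z x y * T x y z))"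
    by (rule sum4_2341)
  also have "\<dots> = (\<Sum>a\<in>UNIV. lee T a * (\<Sum>x\<in>UNIV. \<Sum>y\<in>UNIV. \<Sum>z\<in>UNIV. R a z x y * T x y z))"
    by (simp add: sum_distrib_left)
  also have "\<dots> = 0"
  proof -
    have "(\<Sum>x\<in>UNIV. \<Sum>y\<in>UNIV. \<Sum>z\<in>UNIV. R a z x y * T x y z) = - (\<Sum>z\<in>UNIV. \<Sum>x\<in>UNIV. \<Sum>y\<in>UNIV. T z x y * R z a x y)" for a
    proof -
      have "R a z x y * T x y z = - (T z x y * R z a x y)" for x y z
        using R12[of a z x y] td(5)[of z x y] by simp
      then have "(\<Sum>x\<in>UNIV. \<Sum>y\<in>UNIV. \<Sum>z\<in>UNIV. R a z x y * T x y z) = - (\<Sum>x\<in>UNIV. \<Sum>y\<in>UNIV. \<Sum>z\<in>UNIV. T z x y * R z a x y)"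
        by (simp add: sum_negf)
      also have "(\<Sum>x\<in>UNIV. \<Sum>y\<in>UNIV. \<Sum>z\<in>UNIV. T z x y * R z a x y) = (\<Sum>z\<in>UNIV. \<Sum>x\<in>UNIV. \<Sum>y\<in>UNIV. T z x y * R z a x y)"
        by (rule sum3_231)
      finally show ?thesis .
    qed
    then show ?thesis by (simp add: T_R uu_zero)
  qed
  finally show ?thesis by simp
qed

text \<open>The trace of the differentiated identity \<open>\<langle>\<nabla>T, T\<rangle> = 0\<close> is \<open>\<langle>\<nabla>\<^sup>2T, T\<rangle> = - |\<nabla>T|\<^sup>2\<close>, and its
  left hand side vanishes because the curvature is divergence free against \<open>T\<close>.\<close>

lemma N_zero:
  assumes "\<And>u w. (\<Sum>x\<in>UNIV. \<Sum>y\<in>UNIV. \<Sum>z\<in>UNIV. DN u w x y z * T x y z) + (\<Sum>x\<in>UNIV. \<Sum>y\<in>UNIV. \<Sum>z\<in>UNIV. N w x y z * N u x y z) = 0"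
  shows "N a b c d = 0"
proof -
  note D = deriv
  define S3 where "S3 F = (\<Sum>x\<in>UNIV. \<Sum>y\<in>UNIV. \<Sum>z\<in>UNIV. F x y z :: real)" for F :: "'i \<Rightarrow> 'i \<Rightarrow> 'i \<Rightarrow> real"
  have S3_add: "S3 (\<lambda>x y z. F x y z + G x y z) = S3 F + S3 G" for F G by (simp add: S3_def sum.distrib)
  have S3_231: "S3 (\<lambda>x y z. F y z x) = S3 F" "S3 (\<lambda>x y z. F z x y) = S3 F" "S3 (\<lambda>x y z. F y x z) = S3 F" for F
    using sum3_231[of F] sum3_312[of F] sum3_213[of F] by (simp_all add: S3_def)
  \<comment> \<open>After summation over v, the Bianchi identity gives p = b, exchange of pairs
    gives p = q + 2 b, and \<open>div_R_T\<close> gives q = 0; together they force b = 0.\<close>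
  define b where "b v = S3 (\<lambda>x y z. DN v x y z v * T x y z)" for v
  define p where "p v = S3 (\<lambda>x y z. DR v x y z v * T x y z)" for v
  define q where "q v = S3 (\<lambda>x y z. DR v z v x y * T x y z)" for v
  have 1: "S3 (\<lambda>x y z. DN v v x y z * T x y z) = 3 * b v" for v
    using spin7_bianchi.N_contract[OF D T_skew, of v v] by (simp add: S3_def b_def)
  define k where "k v x y z = K v x y z v * T x y z" for v x y z
  define l where "l v x y z = K v z v x y * T x y z" for v x y z
  have 2: "3 * p v = 3 * b v + 3 * S3 (k v) + 3 * S3 (l v)" for v
  proof -
    define f where "f x y z = DR v x y z v * T x y z" for x y z
    have "f x y z + f y z x + f z x y = DN v v x y z * T x y z + (k v x y z + k v y z x + k v z x y) + (l v x y z + l v y z x + l v z x y)" for x y z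
    proof -
      have "(DR v x y z v + DR v y z x v + DR v z x y v) * T x y z = (DN v v x y z + skewmix (N v) T x y z v) * T x y z"
        using spin7_bianchi.bianchi[OF D, of v x y z v] by simp
      then show ?thesis
        using td(4)[of y z x] td(5)[of z x y] by (simp add: f_def k_def l_def skewmix_K algebra_simps)
    qed
    then have "S3 (\<lambda>x y z. f x y z + f y z x + f z x y) = S3 (\<lambda>x y z. DN v v x y z * T x y z + (k v x y z + k v y z x + k v z x y) + (l v x y z + l v y z x + l v z x y))" by simp
    moreover have "p v = S3 f" by (simp add: p_def f_def[abs_def])
    ultimately show ?thesis
      using S3_231(1,2)[of f] S3_231(1,2)[of "k v"] S3_231(1,2)[of "l v"] 1[of v] by (simp add: S3_add)
  qed
  have k0: "(\<Sum>v\<in>UNIV. S3 (k v)) = 0" using N_T_T by (simp add: S3_def k_def)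
  have l0: "(\<Sum>v\<in>UNIV. S3 (l v)) = 0"
  proof -
    have K0: "(\<Sum>v\<in>UNIV. K v z v x y) = 0" for x y z
    proof -
      have "(\<Sum>v\<in>UNIV. K v z v x y) = (\<Sum>s\<in>UNIV. \<Sum>v\<in>UNIV. N v z v s * T x y s)"
        unfolding K_def by (rule sum.swap)
      then show ?thesis by (simp add: N_trace2 flip: sum_distrib_right)
    qed
    have "(\<Sum>v\<in>UNIV. S3 (l v)) = S3 (\<lambda>x y z. \<Sum>v\<in>UNIV. l v x y z)"
      unfolding S3_def by (rule sum4_4123)
    also have "\<dots> = 0" by (simp add: l_def S3_def K0 flip: sum_distrib_right)
    finally show ?thesis .
  qed
  have "3 * (\<Sum>v\<in>UNIV. p v) = 3 * (\<Sum>v\<in>UNIV. b v)"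
  proof -
    have "(\<Sum>v\<in>UNIV. 3 * p v) = (\<Sum>v\<in>UNIV. 3 * b v + 3 * S3 (k v) + 3 * S3 (l v))" by (simp only: 2)
    then show ?thesis using k0 l0 by (simp add: sum.distrib flip: sum_distrib_left)
  qed
  moreover have "p v = q v + 2 * b v" for v
  proof -
    have "DR v x y z v * T x y z = DR v z v x y * T x y z + DN v x y z v * T x y z + DN v y x z v * T y x z" for x y z
    proof -
      have "DR v x y z v = DR v z v x y + DN v x y z v - DN v y x z v"
        using spin7_bianchi.pair_exchange[OF D, of v x y z v] by simp
      then have "DR v x y z v * T x y z = (DR v z v x y + DN v x y z v - DN v y x z v) * T x y z" by (simp only:)
      then show ?thesis using td(1)[of y x z] by (simp only: left_diff_distrib distrib_right mult_minus_right diff_minus_eq_add)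
    qed
    then have "p v = S3 (\<lambda>x y z. DR v z v x y * T x y z + DN v x y z v * T x y z + DN v y x z v * T y x z)" by (simp add: p_def)
    also have "\<dots> = q v + b v + b v"
      using S3_231(3)[of "\<lambda>x y z. DN v x y z v * T x y z"] by (simp add: S3_add q_def b_def)
    finally show ?thesis by simp
  qed
  moreover have "(\<Sum>v\<in>UNIV. q v) = 0" using div_R_T by (simp add: q_def S3_def)
  ultimately have "(\<Sum>v\<in>UNIV. b v) = 0" by (simp add: sum.distrib flip: sum_distrib_left)
  \<comment> \<open>The diagonal u = w of the hypothesis, traced; the factor 3 is that of
    \<open>N_contract\<close>.\<close>
  moreover have "(\<Sum>v\<in>UNIV. 3 * b v) + (\<Sum>v\<in>UNIV. S3 (\<lambda>x y z. N v x y z * N v x y z)) = 0"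
    using assms[of v v for v] unfolding 1[symmetric] S3_def by (simp flip: sum.distrib)
  ultimately have "(\<Sum>v\<in>UNIV. \<Sum>x\<in>UNIV. \<Sum>y\<in>UNIV. \<Sum>z\<in>UNIV. N v x y z * N v x y z) = 0"
    by (simp add: S3_def flip: sum_distrib_left)
  then show ?thesis by (simp add: sum_nonneg_eq_0_iff sum_nonneg)
qed

end

section \<open>The fundamental 4-form\<close>

definition dl :: "nat \<Rightarrow> nat \<Rightarrow> real" where "dl i a = (if i = a then 1 else 0)"

definition det2 :: "(nat \<Rightarrow> 'v \<Rightarrow> real) \<Rightarrow> nat \<Rightarrow> nat \<Rightarrow> 'v \<Rightarrow> 'v \<Rightarrow> real" where
  "det2 u k l c d = u k c * u l d - u k d * u l c"
definition det3 :: "(nat \<Rightarrow> 'v \<Rightarrow> real) \<Rightarrow> nat \<Rightarrow> nat \<Rightarrow> nat \<Rightarrow> 'v \<Rightarrow> 'v \<Rightarrow> 'v \<Rightarrow> real" where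
  "det3 u j k l b c d = u j b * det2 u k l c d - u j c * det2 u k l b d + u j d * det2 u k l b c"
definition det4 :: "(nat \<Rightarrow> 'v \<Rightarrow> real) \<Rightarrow> nat \<Rightarrow> nat \<Rightarrow> nat \<Rightarrow> nat \<Rightarrow> 'v \<Rightarrow> 'v \<Rightarrow> 'v \<Rightarrow> 'v \<Rightarrow> real" where
  "det4 u i j k l a b c d = u i a * det3 u j k l b c d - u i b * det3 u j k l a c d
     + u i c * det3 u j k l a b d - u i d * det3 u j k l a b c"

text \<open>The constant components of Psi in an adapted frame.\<close>

definition psi_nat :: "nat \<Rightarrow> nat \<Rightarrow> nat \<Rightarrow> nat \<Rightarrow> real" where
  "psi_nat a b c d = (let E = (\<lambda>i j k l. det4 dl i j k l a b c d) in
     - E 0 1 2 7 + E 0 2 3 6 - E 0 3 4 7 - E 0 5 6 7 + E 0 1 4 6 + E 0 2 4 5 - E 0 1 3 5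
     - E 3 4 5 6 - E 1 4 5 7 - E 1 2 5 6 - E 1 2 3 4 - E 2 3 5 7 - E 1 3 6 7 + E 2 4 6 7)"

section \<open>Wedge products of 1-forms as determinants\<close>

lemma sum_permutes2:
  "(\<Sum>\<pi> | \<pi> permutes {..<2::nat}. of_int (sign \<pi>) * F (\<pi> 0) (\<pi> 1)) = F 0 1 - (F 1 0 :: real)"
proof -
  have "{..<2::nat} = insert 0 (insert 1 {})" by auto
  then show ?thesis
    by (simp add: sum_over_permutations_insert sign_compose sign_swap_id sign_id permutation_swap_id transpose_def)
qed

lemma sum_permutes3:
  "(\<Sum>\<pi> | \<pi> permutes {..<3::nat}. of_int (sign \<pi>) * F (\<pi> 0) (\<pi> 1) (\<pi> 2))
    = F 0 1 2 - F 0 2 1 - F 1 0 2 + F 1 2 0 + F 2 0 1 - (F 2 1 0 :: real)"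
proof -
  have "{..<3::nat} = insert 0 (insert 1 (insert 2 {}))" by auto
  then show ?thesis
    by (simp add: sum_over_permutations_insert sign_compose sign_swap_id sign_id permutation_swap_id permutation_compose transpose_def)
qed

lemma sum_permutes4:
  "(\<Sum>\<pi> | \<pi> permutes {..<4::nat}. of_int (sign \<pi>) * F (\<pi> 0) (\<pi> 1) (\<pi> 2) (\<pi> 3))
    = F 0 1 2 3 - F 0 1 3 2 - F 0 2 1 3 + F 0 2 3 1 + F 0 3 1 2 - F 0 3 2 1
    - F 1 0 2 3 + F 1 0 3 2 + F 1 2 0 3 - F 1 2 3 0 - F 1 3 0 2 + F 1 3 2 0
    + F 2 0 1 3 - F 2 0 3 1 - F 2 1 0 3 + F 2 1 3 0 + F 2 3 0 1 - F 2 3 1 0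
    - F 3 0 1 2 + F 3 0 2 1 + F 3 1 0 2 - F 3 1 2 0 - F 3 2 0 1 + (F 3 2 1 0 :: real)"
proof -
  have "{..<4::nat} = insert 0 (insert 1 (insert 2 (insert 3 {})))" by auto
  then show ?thesis
    by (simp add: sum_over_permutations_insert sign_compose sign_swap_id sign_id permutation_swap_id permutation_compose transpose_def)
qed

lemma wedge11: "wedge 1 1 \<alpha> \<beta> [X, Y] p = \<alpha> [X] p * \<beta> [Y] p - \<alpha> [Y] p * \<beta> [X] p"
  using sum_permutes2[of "\<lambda>a b. \<alpha> [[X, Y] ! a] p * \<beta> [[X, Y] ! b] p"]
  by (simp add: wedge_def upt_rec numeral_2_eq_2 mult.assoc)

lemma wedge12: "wedge 1 2 \<alpha> \<beta> [X, Y, Z] p = 1/2 * (\<alpha> [X] p * (\<beta> [Y, Z] p - \<beta> [Z, Y] p)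
   - \<alpha> [Y] p * (\<beta> [X, Z] p - \<beta> [Z, X] p) + \<alpha> [Z] p * (\<beta> [X, Y] p - \<beta> [Y, X] p))"
  using sum_permutes3[of "\<lambda>a b c. \<alpha> [[X, Y, Z] ! a] p * \<beta> [[X, Y, Z] ! b, [X, Y, Z] ! c] p"]
  by (simp add: wedge_def upt_rec numeral_2_eq_2 numeral_3_eq_3 mult.assoc algebra_simps)

lemma wedge13: "wedge 1 3 \<alpha> \<beta> [X, Y, Z, U] p = 1/6 * (
     \<alpha> [X] p * (\<beta> [Y, Z, U] p - \<beta> [Y, U, Z] p - \<beta> [Z, Y, U] p + \<beta> [Z, U, Y] p + \<beta> [U, Y, Z] p - \<beta> [U, Z, Y] p)
   - \<alpha> [Y] p * (\<beta> [X, Z, U] p - \<beta> [X, U, Z] p - \<beta> [Z, X, U] p + \<beta> [Z, U, X] p + \<beta> [U, X, Z] p - \<beta> [U, Z, X] p)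
   + \<alpha> [Z] p * (\<beta> [X, Y, U] p - \<beta> [X, U, Y] p - \<beta> [Y, X, U] p + \<beta> [Y, U, X] p + \<beta> [U, X, Y] p - \<beta> [U, Y, X] p)
   - \<alpha> [U] p * (\<beta> [X, Y, Z] p - \<beta> [X, Z, Y] p - \<beta> [Y, X, Z] p + \<beta> [Y, Z, X] p + \<beta> [Z, X, Y] p - \<beta> [Z, Y, X] p))"
  using sum_permutes4[of "\<lambda>a b c d. \<alpha> [[X, Y, Z, U] ! a] p * \<beta> [[X, Y, Z, U] ! b, [X, Y, Z, U] ! c, [X, Y, Z, U] ! d] p"]
  by (simp add: wedge_def upt_rec numeral_eq_Suc fact_numeral mult.assoc algebra_simps)

lemma wedge22: "wedge 2 2 \<alpha> \<alpha> [X, Y, Z, U] p = 1/4 * (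
     2 * (\<alpha> [X, Y] p - \<alpha> [Y, X] p) * (\<alpha> [Z, U] p - \<alpha> [U, Z] p)
   - 2 * (\<alpha> [X, Z] p - \<alpha> [Z, X] p) * (\<alpha> [Y, U] p - \<alpha> [U, Y] p)
   + 2 * (\<alpha> [X, U] p - \<alpha> [U, X] p) * (\<alpha> [Y, Z] p - \<alpha> [Z, Y] p))"
  using sum_permutes4[of "\<lambda>a b c d. \<alpha> [[X, Y, Z, U] ! a, [X, Y, Z, U] ! b] p * \<alpha> [[X, Y, Z, U] ! c, [X, Y, Z, U] ! d] p"]
  by (simp add: wedge_def upt_rec numeral_eq_Suc fact_numeral mult.assoc algebra_simps)

text \<open>Nested wedges reproduce the Laplace expansion of a determinant: the factorials in
  \<open>wedge\<close> cancel the multiplicity with which an already alternating factor is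
  alternated again.\<close>

lemma wedge4_det: "wedge4 \<theta> i j k l [X, Y, Z, U] p = det4 (\<lambda>m V. \<theta> m [V] p) i j k l X Y Z U"
proof -
  have 2: "wedge 1 1 (\<theta> k) (\<theta> l) [X, Y] p = det2 (\<lambda>m V. \<theta> m [V] p) k l X Y" for X Y
    unfolding wedge11 det2_def ..
  have 3: "wedge 1 2 (\<theta> j) (wedge 1 1 (\<theta> k) (\<theta> l)) [X, Y, Z] p = det3 (\<lambda>m V. \<theta> m [V] p) j k l X Y Z" for X Y Z
    unfolding wedge12 2 det3_def by (simp add: det2_def algebra_simps)
  \<comment> \<open>The six signed rearrangements of an alternating function coincide, which absorbs
    the factor 1/6 of \<open>wedge13\<close>.\<close>
  have s: "det3 u j k l Y Z U - det3 u j k l Y U Z - det3 u j k l Z Y U + det3 u j k l Z U Y + det3 u j k l U Y Z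
      - det3 u j k l U Z Y = 6 * det3 u j k l Y Z U" for u :: "nat \<Rightarrow> 'a vfield \<Rightarrow> real" and Y Z U
    by (simp add: det3_def det2_def algebra_simps)
  show ?thesis
    unfolding wedge4_def wedge13 3 s det4_def by simp
qed

lemma psi_nat_skew: "skew4 psi_nat"
  unfolding skew4_def
proof (intro conjI allI)
  fix a b c d
  have d: "det4 u i j k l b a c d = - det4 u i j k l a b c d" "det4 u i j k l a c b d = - det4 u i j k l a b c d"
    "det4 u i j k l a b d c = - det4 u i j k l a b c d" for u :: "nat \<Rightarrow> nat \<Rightarrow> real" and i j k l
    by (simp_all add: det4_def det3_def det2_def algebra_simps)
  show "psi_nat b a c d = - psi_nat a b c d" unfolding psi_nat_def Let_def d(1) by simp
  show "psi_nat a c b d = - psi_nat a b c d" unfolding psi_nat_def Let_def d(2) by simp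
  show "psi_nat a b d c = - psi_nat a b c d" unfolding psi_nat_def Let_def d(3) by simp
qed

lemma Psi_of_coframe_frame:
  assumes "\<And>i j. i < 8 \<Longrightarrow> j < 8 \<Longrightarrow> \<theta> i [e j] p = (if i = j then 1 else 0)" "a < 8" "b < 8" "c < 8" "d < 8"
  shows "Psi_of_coframe \<theta> [e a, e b, e c, e d] p = psi_nat a b c d"
proof -
  have "det4 (\<lambda>m V. \<theta> m [V] p) i j k l (e a) (e b) (e c) (e d) = det4 dl i j k l a b c d"
    if "i < 8" "j < 8" "k < 8" "l < 8" for i j k l
    using that assms by (simp add: det4_def det3_def det2_def dl_def)
  then show ?thesis by (simp add: Psi_of_coframe_def psi_nat_def wedge4_det)
qed

lemma sum8: "(\<Sum>s<8. f s) = f 0 + f 1 + f 2 + f 3 + f 4 + f 5 + f 6 + (f (7::nat) :: real)"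
  by (simp add: eval_nat_numeral)

text \<open>Each of the 28 index pairs lies in exactly three of the 14 terms of Psi, so three
  entries of F remain; the two orders of u and v give the factor 2.\<close>

lemma psi_contract:
  assumes s: "\<And>u v. F v u = - (F u v :: real)"
  shows
    "(\<Sum>u<8. \<Sum>v<8. F u v * psi_nat u v 0 1) = 2 * (- F 2 7 - F 3 5 + F 4 6)"
    "(\<Sum>u<8. \<Sum>v<8. F u v * psi_nat u v 0 2) = 2 * (F 1 7 + F 3 6 + F 4 5)"
    "(\<Sum>u<8. \<Sum>v<8. F u v * psi_nat u v 0 3) = 2 * (F 1 5 - F 2 6 - F 4 7)"
    "(\<Sum>u<8. \<Sum>v<8. F u v * psi_nat u v 0 4) = 2 * (- F 1 6 - F 2 5 + F 3 7)"
    "(\<Sum>u<8. \<Sum>v<8. F u v * psi_nat u v 0 5) = 2 * (- F 1 3 + F 2 4 - F 6 7)"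
    "(\<Sum>u<8. \<Sum>v<8. F u v * psi_nat u v 0 6) = 2 * (F 1 4 + F 2 3 + F 5 7)"
    "(\<Sum>u<8. \<Sum>v<8. F u v * psi_nat u v 0 7) = 2 * (- F 1 2 - F 3 4 - F 5 6)"
    "(\<Sum>u<8. \<Sum>v<8. F u v * psi_nat u v 1 2) = 2 * (- F 0 7 - F 3 4 - F 5 6)"
    "(\<Sum>u<8. \<Sum>v<8. F u v * psi_nat u v 1 3) = 2 * (- F 0 5 + F 2 4 - F 6 7)"
    "(\<Sum>u<8. \<Sum>v<8. F u v * psi_nat u v 1 4) = 2 * (F 0 6 - F 2 3 - F 5 7)"
    "(\<Sum>u<8. \<Sum>v<8. F u v * psi_nat u v 1 5) = 2 * (F 0 3 + F 2 6 + F 4 7)"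
    "(\<Sum>u<8. \<Sum>v<8. F u v * psi_nat u v 1 6) = 2 * (- F 0 4 - F 2 5 + F 3 7)"
    "(\<Sum>u<8. \<Sum>v<8. F u v * psi_nat u v 1 7) = 2 * (F 0 2 - F 3 6 - F 4 5)"
    "(\<Sum>u<8. \<Sum>v<8. F u v * psi_nat u v 2 3) = 2 * (F 0 6 - F 1 4 - F 5 7)"
    "(\<Sum>u<8. \<Sum>v<8. F u v * psi_nat u v 2 4) = 2 * (F 0 5 + F 1 3 + F 6 7)"
    "(\<Sum>u<8. \<Sum>v<8. F u v * psi_nat u v 2 5) = 2 * (- F 0 4 - F 1 6 + F 3 7)"
    "(\<Sum>u<8. \<Sum>v<8. F u v * psi_nat u v 2 6) = 2 * (- F 0 3 + F 1 5 - F 4 7)"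
    "(\<Sum>u<8. \<Sum>v<8. F u v * psi_nat u v 2 7) = 2 * (- F 0 1 - F 3 5 + F 4 6)"
    "(\<Sum>u<8. \<Sum>v<8. F u v * psi_nat u v 3 4) = 2 * (- F 0 7 - F 1 2 - F 5 6)"
    "(\<Sum>u<8. \<Sum>v<8. F u v * psi_nat u v 3 5) = 2 * (- F 0 1 - F 2 7 + F 4 6)"
    "(\<Sum>u<8. \<Sum>v<8. F u v * psi_nat u v 3 6) = 2 * (F 0 2 - F 1 7 - F 4 5)"
    "(\<Sum>u<8. \<Sum>v<8. F u v * psi_nat u v 3 7) = 2 * (F 0 4 + F 1 6 + F 2 5)"
    "(\<Sum>u<8. \<Sum>v<8. F u v * psi_nat u v 4 5) = 2 * (F 0 2 - F 1 7 - F 3 6)"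
    "(\<Sum>u<8. \<Sum>v<8. F u v * psi_nat u v 4 6) = 2 * (F 0 1 + F 2 7 + F 3 5)"
    "(\<Sum>u<8. \<Sum>v<8. F u v * psi_nat u v 4 7) = 2 * (- F 0 3 + F 1 5 - F 2 6)"
    "(\<Sum>u<8. \<Sum>v<8. F u v * psi_nat u v 5 6) = 2 * (- F 0 7 - F 1 2 - F 3 4)"
    "(\<Sum>u<8. \<Sum>v<8. F u v * psi_nat u v 5 7) = 2 * (F 0 6 - F 1 4 - F 2 3)"
    "(\<Sum>u<8. \<Sum>v<8. F u v * psi_nat u v 6 7) = 2 * (- F 0 5 - F 1 3 + F 2 4)"
proof -
  have f: "F u u = 0" for u using s[of u u] by simp
  have o: "v < u \<Longrightarrow> F u v = - F v u" for u v by (rule s)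
  note d = sum8 psi_nat_def det4_def det3_def det2_def dl_def f o
  show "(\<Sum>u<8. \<Sum>v<8. F u v * psi_nat u v 0 1) = 2 * (- F 2 7 - F 3 5 + F 4 6)" by (simp add: d)
  show "(\<Sum>u<8. \<Sum>v<8. F u v * psi_nat u v 0 2) = 2 * (F 1 7 + F 3 6 + F 4 5)" by (simp add: d)
  show "(\<Sum>u<8. \<Sum>v<8. F u v * psi_nat u v 0 3) = 2 * (F 1 5 - F 2 6 - F 4 7)" by (simp add: d)
  show "(\<Sum>u<8. \<Sum>v<8. F u v * psi_nat u v 0 4) = 2 * (- F 1 6 - F 2 5 + F 3 7)" by (simp add: d)
  show "(\<Sum>u<8. \<Sum>v<8. F u v * psi_nat u v 0 5) = 2 * (- F 1 3 + F 2 4 - F 6 7)" by (simp add: d)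
  show "(\<Sum>u<8. \<Sum>v<8. F u v * psi_nat u v 0 6) = 2 * (F 1 4 + F 2 3 + F 5 7)" by (simp add: d)
  show "(\<Sum>u<8. \<Sum>v<8. F u v * psi_nat u v 0 7) = 2 * (- F 1 2 - F 3 4 - F 5 6)" by (simp add: d)
  show "(\<Sum>u<8. \<Sum>v<8. F u v * psi_nat u v 1 2) = 2 * (- F 0 7 - F 3 4 - F 5 6)" by (simp add: d)
  show "(\<Sum>u<8. \<Sum>v<8. F u v * psi_nat u v 1 3) = 2 * (- F 0 5 + F 2 4 - F 6 7)" by (simp add: d)
  show "(\<Sum>u<8. \<Sum>v<8. F u v * psi_nat u v 1 4) = 2 * (F 0 6 - F 2 3 - F 5 7)" by (simp add: d)
  show "(\<Sum>u<8. \<Sum>v<8. F u v * psi_nat u v 1 5) = 2 * (F 0 3 + F 2 6 + F 4 7)" by (simp add: d)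
  show "(\<Sum>u<8. \<Sum>v<8. F u v * psi_nat u v 1 6) = 2 * (- F 0 4 - F 2 5 + F 3 7)" by (simp add: d)
  show "(\<Sum>u<8. \<Sum>v<8. F u v * psi_nat u v 1 7) = 2 * (F 0 2 - F 3 6 - F 4 5)" by (simp add: d)
  show "(\<Sum>u<8. \<Sum>v<8. F u v * psi_nat u v 2 3) = 2 * (F 0 6 - F 1 4 - F 5 7)" by (simp add: d)
  show "(\<Sum>u<8. \<Sum>v<8. F u v * psi_nat u v 2 4) = 2 * (F 0 5 + F 1 3 + F 6 7)" by (simp add: d)
  show "(\<Sum>u<8. \<Sum>v<8. F u v * psi_nat u v 2 5) = 2 * (- F 0 4 - F 1 6 + F 3 7)" by (simp add: d)
  show "(\<Sum>u<8. \<Sum>v<8. F u v * psi_nat u v 2 6) = 2 * (- F 0 3 + F 1 5 - F 4 7)" by (simp add: d)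
  show "(\<Sum>u<8. \<Sum>v<8. F u v * psi_nat u v 2 7) = 2 * (- F 0 1 - F 3 5 + F 4 6)" by (simp add: d)
  show "(\<Sum>u<8. \<Sum>v<8. F u v * psi_nat u v 3 4) = 2 * (- F 0 7 - F 1 2 - F 5 6)" by (simp add: d)
  show "(\<Sum>u<8. \<Sum>v<8. F u v * psi_nat u v 3 5) = 2 * (- F 0 1 - F 2 7 + F 4 6)" by (simp add: d)
  show "(\<Sum>u<8. \<Sum>v<8. F u v * psi_nat u v 3 6) = 2 * (F 0 2 - F 1 7 - F 4 5)" by (simp add: d)
  show "(\<Sum>u<8. \<Sum>v<8. F u v * psi_nat u v 3 7) = 2 * (F 0 4 + F 1 6 + F 2 5)" by (simp add: d)
  show "(\<Sum>u<8. \<Sum>v<8. F u v * psi_nat u v 4 5) = 2 * (F 0 2 - F 1 7 - F 3 6)" by (simp add: d)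
  show "(\<Sum>u<8. \<Sum>v<8. F u v * psi_nat u v 4 6) = 2 * (F 0 1 + F 2 7 + F 3 5)" by (simp add: d)
  show "(\<Sum>u<8. \<Sum>v<8. F u v * psi_nat u v 4 7) = 2 * (- F 0 3 + F 1 5 - F 2 6)" by (simp add: d)
  show "(\<Sum>u<8. \<Sum>v<8. F u v * psi_nat u v 5 6) = 2 * (- F 0 7 - F 1 2 - F 3 4)" by (simp add: d)
  show "(\<Sum>u<8. \<Sum>v<8. F u v * psi_nat u v 5 7) = 2 * (F 0 6 - F 1 4 - F 2 3)" by (simp add: d)
  show "(\<Sum>u<8. \<Sum>v<8. F u v * psi_nat u v 6 7) = 2 * (- F 0 5 - F 1 3 + F 2 4)" by (simp add: d)
qed

section \<open>Orthonormal frames\<close>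

context metric_connection8 begin

lemma frame_props:
  assumes "orthonormal_frame M A g W e"
  shows "openin M W" "\<And>i. i < 8 \<Longrightarrow> vf W (e i)"
    "\<And>i j p. i < 8 \<Longrightarrow> j < 8 \<Longrightarrow> p \<in> W \<Longrightarrow> g [e i, e j] p = (if i = j then 1 else 0)"
  using assms unfolding orthonormal_frame_def local_frame_def coframe_def by auto

lemma vf_empty: "vf {} X"
proof -
  have "sm {} f" for f using sm_cong[of "{}" f "\<lambda>_. 0"] sm_const[of "{}"] by simp
  then show ?thesis by (simp add: vector_field_def)
qed

text \<open>The coefficients supplied by the dual coframe are inner products with the frame. Hence g
  replaces the coframe in all later expansions.\<close>

lemma frame_expand:
  assumes "orthonormal_frame M A g W e" "vf V X" "V \<subseteq> W"
  shows "vf_eq M A V X (vf_sum {..<8} (\<lambda>s. g [X, e s]) e)" "vf V (vf_sum {..<8} (\<lambda>s. g [X, e s]) e)"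
proof -
  obtain \<theta> where \<theta>: "coframe M A W \<theta> e"
    using assms(1) by (auto simp: orthonormal_frame_def local_frame_def)
  have V: "openin M V" using assms vf_openin by blast
  define u where "u = (\<lambda>s. \<theta> s [X])"
  have eV: "vf V (e s)" if "s < 8" for s
    using frame_props(2)[OF assms(1) that] vf_restrict V assms(3) by blast
  have X1: "[X] \<in> vfs V 1" using assms(2) by (simp add: vfields_def)
  have us: "sm V (u s)" if "s < 8" for s
  proof -
    have "tensor_field M A W 1 (\<theta> s)" using \<theta> that by (simp add: coframe_def k_form_def)
    then show ?thesis using X1 V assms(3) unfolding tensor_field_def u_def by blast
  qed
  have eq: "vf_eq M A V X (vf_sum {..<8} u e)"
    using \<theta> assms(2,3) unfolding coframe_def vf_sum_def u_def by blast
  have u: "vf V (vf_sum {..<8} u e)" "g [X, e j] p = u j p" if "j < 8" "p \<in> V" for j p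
  proof -
    have l: "[X, e j] \<in> vfs V 2" using assms(2) eV that vfs2 by blast
    note s = tens_vf_sum[OF tens_g l, of 0 p "{..<8}" u e]
    show v: "vf V (vf_sum {..<8} u e)" using s us eV that by simp
    have "g [X, e j] p = g [vf_sum {..<8} u e, e j] p"
      by (rule g_cong[OF assms(2) v eV eq]) (use that in auto)
    also have "\<dots> = (\<Sum>s<8. u s p * g [e s, e j] p)" using s us eV that by simp
    also have "\<dots> = (\<Sum>s<8. if s = j then u s p else 0)"
      using frame_props(3)[OF assms(1)] that assms(3) by (intro sum.cong refl) auto
    finally show "g [X, e j] p = u j p" using that by simp
  qed
  show 1: "vf_eq M A V X (vf_sum {..<8} (\<lambda>s. g [X, e s]) e)"
  proof (rule vf_eqI)
    fix U f p assume U: "U \<subseteq> V" "sm U f" "p \<in> U"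
    have "X f p = vf_sum {..<8} u e f p" using eq U unfolding vf_eq_def by blast
    also have "\<dots> = vf_sum {..<8} (\<lambda>s. g [X, e s]) e f p"
      unfolding vf_sum_def using u(2) U by (intro sum.cong refl) auto
    finally show "X f p = vf_sum {..<8} (\<lambda>s. g [X, e s]) e f p" .
  qed
  show "vf V (vf_sum {..<8} (\<lambda>s. g [X, e s]) e)"
  \<comment> \<open>\<open>tens_vf_sum\<close> is stated at a point, so the empty open set is
    treated apart.\<close>
  proof (cases "V = {}")
    case True
    then show ?thesis by (simp add: vf_empty)
  next
    case False
    then obtain p where p: "p \<in> V" by blast
    show ?thesis
      using tens_vf_sum[OF tens_g, of "[X, X]" V 0 p "{..<8}" "\<lambda>s. g [X, e s]" e] p assms(2) eV g_sm
      by (simp add: vfs2)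
  qed
qed

lemma tens_expand:
  assumes "orthonormal_frame M A g W e" "tens k \<omega>" "Xs \<in> vfs V k" "i < k" "V \<subseteq> W" "p \<in> V"
  shows "\<omega> Xs p = (\<Sum>s<8. g [Xs ! i, e s] p * \<omega> (Xs[i := e s]) p)"
proof -
  have X: "vf V (Xs ! i)" using assms vfsD by blast
  have V: "openin M V" using X vf_openin by blast
  have eV: "vf V (e s)" if "s < 8" for s
    using frame_props(2)[OF assms(1) that] vf_restrict V assms(5) by blast
  note fe = frame_expand[OF assms(1) X assms(5)]
  have "\<omega> (Xs[i := Xs ! i]) p = \<omega> (Xs[i := vf_sum {..<8} (\<lambda>s. g [Xs ! i, e s]) e]) p"
    by (rule tens_cong1[OF assms(2,3) X fe(2,1) assms(6)])
  also have "\<dots> = (\<Sum>s<8. g [Xs ! i, e s] p * \<omega> (Xs[i := e s]) p)"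
    using tens_vf_sum[OF assms(2,3,4,6), of "{..<8}" "\<lambda>s. g [Xs ! i, e s]" e] eV g_sm X by simp
  finally show ?thesis by simp
qed

text \<open>The arguments are replaced by frame fields one at a time from the left. \<open>V\<close>
  and \<open>W\<close> are unrelated neighbourhoods of p, so the induction runs on their
  intersection.\<close>

lemma tens_vanish:
  assumes "orthonormal_frame M A g W e" "tens k \<omega>" "p \<in> W" "openin M V" "p \<in> V"
    and z: "\<And>I. length I = k \<Longrightarrow> set I \<subseteq> {..<8} \<Longrightarrow> \<omega> (map e I) p = 0"
  shows "Xs \<in> vfs V k \<Longrightarrow> \<omega> Xs p = 0"
proof -
  let ?U = "V \<inter> W"
  have U: "openin M ?U" using assms frame_props(1) by blast
  have eU: "vf ?U (e s)" if "s < 8" for s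
    using frame_props(2)[OF assms(1) that] vf_restrict U by blast
  have *: "\<omega> (map e I @ Ys) p = 0" if "length I + length Ys = k" "set I \<subseteq> {..<8}" "\<forall>Y\<in>set Ys. vf ?U Y" for I Ys
    using that
  proof (induction Ys arbitrary: I)
    case Nil then show ?case using z by simp
  next
    case (Cons Y Ys)
    have mem: "map e I @ Y # Ys \<in> vfs ?U k" using Cons.prems eU by (auto simp: vfields_def)
    have "\<omega> ((map e I @ Y # Ys)[length I := e s]) p = 0" if "s < 8" for s
      using Cons.IH[of "I @ [s]"] Cons.prems that by (simp add: list_update_append)
    then show ?case
      using tens_expand[OF assms(1,2) mem, of "length I" p] Cons.prems assms(3,5) by simp
  qed
  assume "Xs \<in> vfs V k"
  then have "Xs \<in> vfs ?U k" using vfs_restrict[OF _ U] by blast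
  then show ?thesis using *[of "[]" Xs] by (auto simp: vfields_def)
qed

end

section \<open>Components in an orthonormal frame\<close>

text \<open>Frames are numbered 0 to 7, whereas the algebra sums over a finite type.
  \<open>ix\<close> is any bijection from the type \<open>8\<close> onto these numbers; it plays the
  role of a relabelling only.\<close>

locale frame8 = metric_connection8 M A D g
  for M :: "'m topology" and A :: "'m chart set" and D :: "'m vfield \<Rightarrow> 'm vfield \<Rightarrow> 'm vfield" and g :: "'m tensor" +
  fixes W :: "'m set" and e :: "nat \<Rightarrow> 'm vfield" and ix :: "8 \<Rightarrow> nat"
  assumes frame: "orthonormal_frame M A g W e" and ix: "bij_betw ix UNIV {..<8}"
begin

definition "E a = e (ix a)"

lemma ix_less [simp]: "ix a < 8"
  using bij_betwE[OF ix] by auto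

lemma ix_eq [simp]: "ix a = ix b \<longleftrightarrow> a = b"
  using ix by (auto simp: bij_betw_def inj_on_def)

lemma sum_ix: "(\<Sum>s<8. f s) = (\<Sum>a\<in>UNIV. f (ix a))"
  using sum.reindex_bij_betw[OF ix, of f] by simp

lemma W_open: "openin M W"
  using frame_props(1)[OF frame] .

lemma E_vf [simp]: "vf W (E a)"
  by (simp add: E_def frame_props(2)[OF frame])

lemma g_E: "p \<in> W \<Longrightarrow> g [E a, E b] p = (if a = b then 1 else 0)"
  by (simp add: E_def frame_props(3)[OF frame])

lemma expandE:
  assumes "tens k \<omega>" "Xs \<in> vfs V k" "i < k" "V \<subseteq> W" "p \<in> V"
  shows "\<omega> Xs p = (\<Sum>s\<in>UNIV. g [Xs ! i, E s] p * \<omega> (Xs[i := E s]) p)"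
  using tens_expand[OF frame assms] by (simp add: sum_ix E_def)

definition "\<Gamma> p u a s = g [D (E u) (E a), E s] p"
definition "Tc p a b c = T [E a, E b, E c] p"
definition "Rc p a b c d = R [E a, E b, E c, E d] p"
definition "Nc p a b c d = nab T [E a, E b, E c, E d] p"
definition "DRc p u a b c d = nab R [E u, E a, E b, E c, E d] p"
definition "DNc p u a b c d = nab (nab T) [E u, E a, E b, E c, E d] p"

text \<open>The components of g are constant in the frame, so g being parallel leaves only the two
  connection terms, with sum 0.\<close>

lemma \<Gamma>_skew: "p \<in> W \<Longrightarrow> \<Gamma> p u b a = - \<Gamma> p u a b"
proof -
  assume p: "p \<in> W"
  have "E u (g [E a, E b]) p = E u (\<lambda>_. if a = b then 1 else 0) p"
    by (intro vf_local[OF E_vf] g_sm E_vf g_E p)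
  then have "E u (g [E a, E b]) p = 0" using vf_const[OF E_vf p] by simp
  then show ?thesis
    using g_deriv[OF E_vf E_vf E_vf p, of u a b] g_sym[OF E_vf D_vf[OF E_vf E_vf] p, of a u b]
    by (simp add: \<Gamma>_def)
qed

lemma nabE:
  assumes "tens k \<omega>" "length I = k" "p \<in> W"
  shows "nab \<omega> (E u # map E I) p = E u (\<omega> (map E I)) p
    - (\<Sum>j<k. \<Sum>s\<in>UNIV. \<Gamma> p u (I ! j) s * \<omega> (map E (I[j := s])) p)"
proof -
  have m: "map E I \<in> vfs W k" using assms(2) by (auto simp: vfields_def)
  have "\<omega> ((map E I)[j := D (E u) (map E I ! j)]) p = (\<Sum>s\<in>UNIV. \<Gamma> p u (I ! j) s * \<omega> (map E (I[j := s])) p)"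
    if "j < k" for j
    using expandE[OF assms(1) vfs_update[OF m D_vf[OF E_vf E_vf]] that order_refl assms(3), of j u "I ! j"] that assms(2)
    by (simp add: \<Gamma>_def map_update)
  then show ?thesis using assms(2) by (simp add: nab_Cons)
qed

lemma tor_E:
  assumes "tens (Suc k) \<omega>" "Xs \<in> vfs W k" "p \<in> W"
  shows "\<omega> (tor (E a) (E b) # Xs) p = (\<Sum>s\<in>UNIV. Tc p a b s * \<omega> (E s # Xs) p)"
  using expandE[OF assms(1), of "tor (E a) (E b) # Xs" W 0 p] assms(2,3)
  by (simp add: vfs_simps vf_tor Tc_def T_eq)

lemma first_bianchiE:
  assumes "p \<in> W"
  shows "Rc p a b c d + Rc p b c a d + Rc p c a b d = Nc p a b c d + Nc p b c a d + Nc p c a b d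
    + (\<Sum>s\<in>UNIV. Tc p a b s * Tc p s c d + Tc p b c s * Tc p s a d + Tc p c a s * Tc p s b d)"
proof -
  have t: "T [tor (E a) (E b), E c, E d] p = (\<Sum>s\<in>UNIV. Tc p a b s * Tc p s c d)" for a b c d
    using tor_E[of 2 T "[E c, E d]" p a b] tens_T assms by (simp add: Tc_def vfs_simps numeral_eq_Suc)
  show ?thesis
    using first_bianchi[of W "E a" "E b" "E c" "E d" p] assms
    by (simp add: t Rc_def Nc_def sum.distrib)
qed

lemma second_bianchiE:
  assumes "p \<in> W"
  shows "DRc p u x y z v + DRc p x y u z v + DRc p y u x z v
    + (\<Sum>s\<in>UNIV. Tc p u x s * Rc p s y z v + Tc p x y s * Rc p s u z v + Tc p y u s * Rc p s x z v) = 0"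
proof -
  have t: "R [tor (E a) (E b), E c, E d, E f] p = (\<Sum>s\<in>UNIV. Tc p a b s * Rc p s c d f)" for a b c d f
    using tor_E[of 3 R "[E c, E d, E f]" p a b] tens_R assms by (simp add: Rc_def vfs_simps numeral_eq_Suc)
  show ?thesis
    using second_bianchi[of W "E u" "E x" "E y" "E z" "E v" p] assms
    by (simp add: t DRc_def sum.distrib)
qed

lemma Tc_skew: "p \<in> W \<Longrightarrow> skew3 (Tc p)"
  unfolding skew3_def Tc_def by (intro conjI allI T_skew12[OF E_vf E_vf E_vf] T_skew23[OF E_vf E_vf E_vf])

lemma Rc_skew: "p \<in> W \<Longrightarrow> Rc p b a c d = - Rc p a b c d" "p \<in> W \<Longrightarrow> Rc p a b d c = - Rc p a b c d"
  unfolding Rc_def by (rule R_skew12[OF E_vf E_vf E_vf E_vf] R_skew34[OF E_vf E_vf E_vf E_vf], assumption)+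

lemma sm_comp:
  "sm W (\<lambda>q. Tc q a b c)" "sm W (\<lambda>q. Rc q a b c d)" "sm W (\<lambda>q. Nc q a b c d)"
proof -
  show "sm W (\<lambda>q. Tc q a b c)"
    using tens_sm[OF tens_T W_open, of "[E a, E b, E c]"] by (simp add: Tc_def vfs3)
  show "sm W (\<lambda>q. Rc q a b c d)"
    using tens_sm[OF tens_R W_open, of "[E a, E b, E c, E d]"] by (simp add: Rc_def vfs4)
  show "sm W (\<lambda>q. Nc q a b c d)"
    using tens_sm[OF tens_nab[OF tens_T] W_open, of "[E a, E b, E c, E d]"] by (simp add: Nc_def vfs4 numeral_eq_Suc vfs_simps)
qed

lemma Nc_eq: "p \<in> W \<Longrightarrow> Nc p u a b c = E u (\<lambda>q. Tc q a b c) p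
    - (\<Sum>s\<in>UNIV. \<Gamma> p u a s * Tc p s b c + \<Gamma> p u b s * Tc p a s c + \<Gamma> p u c s * Tc p a b s)"
  using nabE[OF tens_T, of "[a, b, c]" p u] by (simp add: Nc_def Tc_def numeral_eq_Suc sum.distrib)

lemma DRc_eq: "p \<in> W \<Longrightarrow> DRc p u a b c d = E u (\<lambda>q. Rc q a b c d) p
    - (\<Sum>s\<in>UNIV. \<Gamma> p u a s * Rc p s b c d + \<Gamma> p u b s * Rc p a s c d + \<Gamma> p u c s * Rc p a b s d + \<Gamma> p u d s * Rc p a b c s)"
  using nabE[OF tens_R, of "[a, b, c, d]" p u] by (simp add: DRc_def Rc_def numeral_eq_Suc sum.distrib)

lemma DNc_eq: "p \<in> W \<Longrightarrow> DNc p u a b c d = E u (\<lambda>q. Nc q a b c d) p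
    - (\<Sum>s\<in>UNIV. \<Gamma> p u a s * Nc p s b c d + \<Gamma> p u b s * Nc p a s c d + \<Gamma> p u c s * Nc p a b s d + \<Gamma> p u d s * Nc p a b c s)"
  using nabE[OF tens_nab[OF tens_T], of "[a, b, c, d]" p u] by (simp add: DNc_def Nc_def numeral_eq_Suc sum.distrib)

end

section \<open>Invariance of the curvature conditions under covariant differentiation\<close>

text \<open>The infinitesimal action of a matrix on arrays. For H the connection matrix, the
  covariant derivative is the directional derivative minus this action.\<close>

definition act3 :: "('i::finite \<Rightarrow> 'i \<Rightarrow> real) \<Rightarrow> ('i \<Rightarrow> 'i \<Rightarrow> 'i \<Rightarrow> real) \<Rightarrow> 'i \<Rightarrow> 'i \<Rightarrow> 'i \<Rightarrow> real" where
  "act3 H t a b c = (\<Sum>s\<in>UNIV. H a s * t s b c + H b s * t a s c + H c s * t a b s)"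

definition act4 :: "('i::finite \<Rightarrow> 'i \<Rightarrow> real) \<Rightarrow> ('i \<Rightarrow> 'i \<Rightarrow> 'i \<Rightarrow> 'i \<Rightarrow> real) \<Rightarrow> 'i \<Rightarrow> 'i \<Rightarrow> 'i \<Rightarrow> 'i \<Rightarrow> real" where
  "act4 H t a b c d = (\<Sum>s\<in>UNIV. H a s * t s b c d + H b s * t a s c d + H c s * t a b s d + H d s * t a b c s)"

lemma act3_skew:
  assumes "skew3 t" shows "skew3 (act3 H t)"
  unfolding skew3_def
proof (intro conjI allI)
  fix a b c
  note t = skew3D(1,2)[OF assms]
  have "H b s * t s a c + H a s * t b s c + H c s * t b a s = - (H a s * t s b c + H b s * t a s c + H c s * t a b s)" for s
    using t(1)[of s a c] t(1)[of b s c] t(1)[of b a s] by simp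
  then show "act3 H t b a c = - act3 H t a b c"
    unfolding act3_def sum_negf[symmetric] by (intro sum.cong refl)
  have "H a s * t s c b + H c s * t a s b + H b s * t a c s = - (H a s * t s b c + H b s * t a s c + H c s * t a b s)" for s
    using t(2)[of s c b] t(2)[of a s b] t(2)[of a c s] by simp
  then show "act3 H t a c b = - act3 H t a b c"
    unfolding act3_def sum_negf[symmetric] by (intro sum.cong refl)
qed

lemma act4_skew:
  "(\<And>a b c d. t b a c d = - t a b c d) \<Longrightarrow> act4 H t b a c d = - act4 H t a b c d"
  "(\<And>a b c d. t a c b d = - t a b c d) \<Longrightarrow> act4 H t a c b d = - act4 H t a b c d"
  "(\<And>a b c d. t a b d c = - t a b c d) \<Longrightarrow> act4 H t a b d c = - act4 H t a b c d"
proof -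
  assume t: "\<And>a b c d. t b a c d = - t a b c d"
  have "H b s * t s a c d + H a s * t b s c d + H c s * t b a s d + H d s * t b a c s
     = - (H a s * t s b c d + H b s * t a s c d + H c s * t a b s d + H d s * t a b c s)" for s
    using t[of s a] t[of b s] t[of b a] by simp
  then show "act4 H t b a c d = - act4 H t a b c d" unfolding act4_def sum_negf[symmetric] by (intro sum.cong refl)
next
  assume t: "\<And>a b c d. t a c b d = - t a b c d"
  have "H a s * t s c b d + H c s * t a s b d + H b s * t a c s d + H d s * t a c b s
     = - (H a s * t s b c d + H b s * t a s c d + H c s * t a b s d + H d s * t a b c s)" for s
    using t[of s c b d] t[of a s b d] t[of a c s d] t[of a c b s] by simp
  then show "act4 H t a c b d = - act4 H t a b c d" unfolding act4_def sum_negf[symmetric] by (intro sum.cong refl)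
next
  assume t: "\<And>a b c d. t a b d c = - t a b c d"
  have "H a s * t s b d c + H b s * t a s d c + H d s * t a b s c + H c s * t a b d s
     = - (H a s * t s b c d + H b s * t a s c d + H c s * t a b s d + H d s * t a b c s)" for s
    using t[of s b d c] t[of a s d c] t[of a b s c] t[of a b d s] by simp
  then show "act4 H t a b d c = - act4 H t a b c d" unfolding act4_def sum_negf[symmetric] by (intro sum.cong refl)
qed

lemma act4_cyclic:
  "act4 H t a b c d + act4 H t b c a d + act4 H t c a b d = act4 H (\<lambda>a b c d. t a b c d + t b c a d + t c a b d) a b c d"
  by (simp add: act4_def algebra_simps flip: sum.distrib)

lemma act4_rotate: "act4 H (\<lambda>a b c d. t d a b c) a b c d = act4 H t d a b c"
  by (simp add: act4_def algebra_simps)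

lemma act4_add: "act4 H (\<lambda>a b c d. t a b c d + t' a b c d) a b c d = act4 H t a b c d + act4 H t' a b c d"
  by (simp add: act4_def algebra_simps flip: sum.distrib)

locale rotation =
  fixes H :: "'i::finite \<Rightarrow> 'i \<Rightarrow> real"
  assumes H_skew: "H b a = - H a b"
begin

text \<open>The reason why contractions are invariant: a skew \<open>H\<close> sums to 0 against a
  symmetrised array.\<close>

lemma skew_contract: "(\<Sum>x\<in>UNIV. \<Sum>s\<in>UNIV. H x s * F s x + H x s * F x s) = (0::real)"
proof -
  have "(\<Sum>x\<in>UNIV. \<Sum>s\<in>UNIV. H x s * F s x) = (\<Sum>x\<in>UNIV. \<Sum>s\<in>UNIV. H s x * F x s)"
    by (rule sum.swap)
  also have "\<dots> = - (\<Sum>x\<in>UNIV. \<Sum>s\<in>UNIV. H x s * F x s)"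
    unfolding sum_negf[symmetric]
  proof (intro sum.cong refl)
    fix x s show "H s x * F x s = - (H x s * F x s)" using H_skew[of s x] by simp
  qed
  finally show ?thesis by (simp add: sum.distrib)
qed

lemma act4_trace:
  assumes "\<And>a b. (\<Sum>x\<in>UNIV. t x x a b) = 0"
  shows "(\<Sum>x\<in>UNIV. act4 H t x x a b) = 0"
proof -
  have "(\<Sum>x\<in>UNIV. act4 H t x x a b) = (\<Sum>x\<in>UNIV. \<Sum>s\<in>UNIV. H x s * t s x a b + H x s * t x s a b)
     + (\<Sum>x\<in>UNIV. \<Sum>s\<in>UNIV. H a s * t x x s b) + (\<Sum>x\<in>UNIV. \<Sum>s\<in>UNIV. H b s * t x x a s)"
    by (simp add: act4_def sum.distrib)
  moreover have "(\<Sum>x\<in>UNIV. \<Sum>s\<in>UNIV. H a s * t x x s b) = 0"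
    by (subst sum.swap) (simp add: assms flip: sum_distrib_left)
  moreover have "(\<Sum>x\<in>UNIV. \<Sum>s\<in>UNIV. H b s * t x x a s) = 0"
    by (subst sum.swap) (simp add: assms flip: sum_distrib_left)
  ultimately show ?thesis using skew_contract[of "\<lambda>s x. t s x a b"] by simp
qed

text \<open>A Leibniz rule. On the right the action also hits the contracted index s in both
  factors, and these two contributions cancel by \<open>skew_contract\<close>.\<close>

lemma act4_product:
  "act4 H (\<lambda>a b c d. \<Sum>s\<in>UNIV. P a b s * Q c d s) a b c d
    = (\<Sum>s\<in>UNIV. act3 H P a b s * Q c d s + P a b s * act3 H Q c d s)"
proof -
  have "(\<Sum>s\<in>UNIV. act3 H P a b s * Q c d s + P a b s * act3 H Q c d s)
    = (\<Sum>s\<in>UNIV. \<Sum>r\<in>UNIV. H a r * (P r b s * Q c d s) + H b r * (P a r s * Q c d s)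
        + H c r * (P a b s * Q r d s) + H d r * (P a b s * Q c r s))
      + (\<Sum>s\<in>UNIV. \<Sum>r\<in>UNIV. H s r * (P a b r * Q c d s) + H s r * (P a b s * Q c d r))"
    unfolding act3_def sum_distrib_left sum_distrib_right sum.distrib[symmetric]
    by (intro sum.cong refl) (simp add: algebra_simps)
  also have "(\<Sum>s\<in>UNIV. \<Sum>r\<in>UNIV. H s r * (P a b r * Q c d s) + H s r * (P a b s * Q c d r)) = 0"
    using skew_contract[of "\<lambda>r s. P a b r * Q c d s"] by simp
  also have "(\<Sum>s\<in>UNIV. \<Sum>r\<in>UNIV. H a r * (P r b s * Q c d s) + H b r * (P a r s * Q c d s)
        + H c r * (P a b s * Q r d s) + H d r * (P a b s * Q c r s))
     = (\<Sum>r\<in>UNIV. \<Sum>s\<in>UNIV. H a r * (P r b s * Q c d s) + H b r * (P a r s * Q c d s)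
        + H c r * (P a b s * Q r d s) + H d r * (P a b s * Q c r s))"
    by (rule sum.swap)
  finally show ?thesis by (simp add: act4_def sum_distrib_left sum.distrib)
qed

text \<open>A derivation applied to a quadratic expression: both factors contribute equally by
  symmetry, whence the 2.\<close>

lemma act4_skewmix:
  "act4 H (skewmix P P) a b c d = 2 * skewmix (act3 H P) P a b c d"
proof -
  define t where "t P Q = (\<lambda>a b c d. \<Sum>s\<in>UNIV. P a b s * Q c d s)" for P Q :: "'i \<Rightarrow> 'i \<Rightarrow> 'i \<Rightarrow> real"
  have k: "skewmix P Q = (\<lambda>a b c d. t P Q a b c d + t P Q b c a d + t P Q c a b d + t P Q c d a b + t P Q a d b c + t P Q b d c a)"
    for P Q by (simp add: t_def skewmix_def fun_eq_iff sum.distrib)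
  have t: "act4 H (t P P) a b c d = t (act3 H P) P a b c d + t (act3 H P) P c d a b" for a b c d
    using act4_product[of P P a b c d] by (simp add: t_def sum.distrib mult.commute)
  have "act4 H (skewmix P P) a b c d = act4 H (t P P) a b c d + act4 H (t P P) b c a d + act4 H (t P P) c a b d
     + act4 H (t P P) c d a b + act4 H (t P P) a d b c + act4 H (t P P) b d c a"
    unfolding k act4_def sum.distrib[symmetric] by (intro sum.cong refl) (simp add: algebra_simps)
  then show ?thesis unfolding t k by simp
qed

lemma act_inner:
  "(\<Sum>x\<in>UNIV. \<Sum>y\<in>UNIV. \<Sum>z\<in>UNIV. act3 H P x y z * Q x y z + P x y z * act3 H Q x y z) = 0"
proof -
  have "(\<Sum>x\<in>UNIV. \<Sum>y\<in>UNIV. \<Sum>z\<in>UNIV. act3 H P x y z * Q x y z + P x y z * act3 H Q x y z)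
    = (\<Sum>x\<in>UNIV. \<Sum>y\<in>UNIV. \<Sum>z\<in>UNIV. \<Sum>s\<in>UNIV. H x s * (P s y z * Q x y z) + H x s * (P x y z * Q s y z))
    + (\<Sum>x\<in>UNIV. \<Sum>y\<in>UNIV. \<Sum>z\<in>UNIV. \<Sum>s\<in>UNIV. H y s * (P x s z * Q x y z) + H y s * (P x y z * Q x s z))
    + (\<Sum>x\<in>UNIV. \<Sum>y\<in>UNIV. \<Sum>z\<in>UNIV. \<Sum>s\<in>UNIV. H z s * (P x y s * Q x y z) + H z s * (P x y z * Q x y s))"
    unfolding act3_def sum_distrib_left sum_distrib_right sum.distrib[symmetric]
    by (intro sum.cong refl) (simp add: algebra_simps)
  also have "(\<Sum>x\<in>UNIV. \<Sum>y\<in>UNIV. \<Sum>z\<in>UNIV. \<Sum>s\<in>UNIV. H z s * (P x y s * Q x y z) + H z s * (P x y z * Q x y s)) = 0"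
    using skew_contract[of "\<lambda>s z. P x y s * Q x y z" for x y] by simp
  also have "(\<Sum>x\<in>UNIV. \<Sum>y\<in>UNIV. \<Sum>z\<in>UNIV. \<Sum>s\<in>UNIV. H y s * (P x s z * Q x y z) + H y s * (P x y z * Q x s z))
     = (\<Sum>x\<in>UNIV. \<Sum>z\<in>UNIV. \<Sum>y\<in>UNIV. \<Sum>s\<in>UNIV. H y s * (P x s z * Q x y z) + H y s * (P x y z * Q x s z))"
    by (rule sum3_132)
  also have "\<dots> = 0" using skew_contract[of "\<lambda>s y. P x s z * Q x y z" for x z] by simp
  also have "(\<Sum>x\<in>UNIV. \<Sum>y\<in>UNIV. \<Sum>z\<in>UNIV. \<Sum>s\<in>UNIV. H x s * (P s y z * Q x y z) + H x s * (P x y z * Q s y z))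
     = (\<Sum>y\<in>UNIV. \<Sum>z\<in>UNIV. \<Sum>x\<in>UNIV. \<Sum>s\<in>UNIV. H x s * (P s y z * Q x y z) + H x s * (P x y z * Q s y z))"
    by (rule sum3_312)
  also have "\<dots> = 0" using skew_contract[of "\<lambda>s x. P s y z * Q x y z" for y z] by simp
  finally show ?thesis by simp
qed

end

section \<open>Infinitesimal rotations that fix Psi\<close>

locale spin7_rotation = spin7_form psi + rotation H for psi :: "'i::finite \<Rightarrow> 'i \<Rightarrow> 'i \<Rightarrow> 'i \<Rightarrow> real" and H +
  assumes H_psi: "act4 H psi a b c d = 0"
begin

text \<open>Skewness moves \<open>H\<close> from t onto the first two indices of Psi, invariance of
  Psi moves it on to k and l, and there the spin(7) equation for t applies.\<close>

lemma act_spin7: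
  assumes "\<And>c d. spin7 (\<lambda>a b. t a b c d)"
  shows "spin7 (\<lambda>a b. act4 H t a b c d)"
  unfolding spin7_def
proof (intro allI)
  fix k l
  have sw: "(\<Sum>a\<in>UNIV. \<Sum>b\<in>UNIV. \<Sum>s\<in>UNIV. H a s * (t s b c d * psi a b k l)) = - (\<Sum>a\<in>UNIV. \<Sum>b\<in>UNIV. \<Sum>s\<in>UNIV. t a b c d * (H a s * psi s b k l))"
    "(\<Sum>a\<in>UNIV. \<Sum>b\<in>UNIV. \<Sum>s\<in>UNIV. H b s * (t a s c d * psi a b k l)) = - (\<Sum>a\<in>UNIV. \<Sum>b\<in>UNIV. \<Sum>s\<in>UNIV. t a b c d * (H b s * psi a s k l))"
  proof -
    have "(\<Sum>a\<in>UNIV. \<Sum>b\<in>UNIV. \<Sum>s\<in>UNIV. H a s * (t s b c d * psi a b k l)) = (\<Sum>a\<in>UNIV. \<Sum>b\<in>UNIV. \<Sum>s\<in>UNIV. H s a * (t a b c d * psi s b k l))"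
      by (rule sum3_321)
    also have "\<dots> = - (\<Sum>a\<in>UNIV. \<Sum>b\<in>UNIV. \<Sum>s\<in>UNIV. t a b c d * (H a s * psi s b k l))"
      unfolding sum_negf[symmetric]
    proof (intro sum.cong refl)
      fix a b s show "H s a * (t a b c d * psi s b k l) = - (t a b c d * (H a s * psi s b k l))"
        using H_skew[of s a] by simp
    qed
    finally show "(\<Sum>a\<in>UNIV. \<Sum>b\<in>UNIV. \<Sum>s\<in>UNIV. H a s * (t s b c d * psi a b k l)) = - (\<Sum>a\<in>UNIV. \<Sum>b\<in>UNIV. \<Sum>s\<in>UNIV. t a b c d * (H a s * psi s b k l))" .
    have "(\<Sum>a\<in>UNIV. \<Sum>b\<in>UNIV. \<Sum>s\<in>UNIV. H b s * (t a s c d * psi a b k l)) = (\<Sum>a\<in>UNIV. \<Sum>b\<in>UNIV. \<Sum>s\<in>UNIV. H s b * (t a b c d * psi a s k l))"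
      by (rule sum3_132)
    also have "\<dots> = - (\<Sum>a\<in>UNIV. \<Sum>b\<in>UNIV. \<Sum>s\<in>UNIV. t a b c d * (H b s * psi a s k l))"
      unfolding sum_negf[symmetric]
    proof (intro sum.cong refl)
      fix a b s show "H s b * (t a b c d * psi a s k l) = - (t a b c d * (H b s * psi a s k l))"
        using H_skew[of s b] by simp
    qed
    finally show "(\<Sum>a\<in>UNIV. \<Sum>b\<in>UNIV. \<Sum>s\<in>UNIV. H b s * (t a s c d * psi a b k l)) = - (\<Sum>a\<in>UNIV. \<Sum>b\<in>UNIV. \<Sum>s\<in>UNIV. t a b c d * (H b s * psi a s k l))" .
  qed
  have ps: "(\<Sum>s\<in>UNIV. t a b c d * (H a s * psi s b k l)) + (\<Sum>s\<in>UNIV. t a b c d * (H b s * psi a s k l))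
     = - (\<Sum>s\<in>UNIV. H k s * (t a b c d * psi a b s l)) - (\<Sum>s\<in>UNIV. H l s * (t a b c d * psi a b k s))" for a b
  proof -
    have "t a b c d * act4 H psi a b k l = 0" by (simp add: H_psi)
    then show ?thesis by (simp add: act4_def sum_distrib_left sum.distrib algebra_simps)
  qed
  have rest: "(\<Sum>a\<in>UNIV. \<Sum>b\<in>UNIV. \<Sum>s\<in>UNIV. h s * (f a b s)) = (\<Sum>s\<in>UNIV. h s * (\<Sum>a\<in>UNIV. \<Sum>b\<in>UNIV. f a b s))" for h and f :: "'i \<Rightarrow> 'i \<Rightarrow> 'i \<Rightarrow> real"
    unfolding sum_distrib_left by (rule sum3_231)
  have 1: "(\<Sum>a\<in>UNIV. \<Sum>b\<in>UNIV. act4 H t a b c d * psi a b k l) = X1 + X2 + X3 + X4"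
    if "X1 = (\<Sum>a\<in>UNIV. \<Sum>b\<in>UNIV. \<Sum>s\<in>UNIV. H a s * (t s b c d * psi a b k l))" "X2 = (\<Sum>a\<in>UNIV. \<Sum>b\<in>UNIV. \<Sum>s\<in>UNIV. H b s * (t a s c d * psi a b k l))"
      "X3 = (\<Sum>a\<in>UNIV. \<Sum>b\<in>UNIV. \<Sum>s\<in>UNIV. H c s * (t a b s d * psi a b k l))" "X4 = (\<Sum>a\<in>UNIV. \<Sum>b\<in>UNIV. \<Sum>s\<in>UNIV. H d s * (t a b c s * psi a b k l))" for X1 X2 X3 X4
    unfolding that by (simp add: act4_def sum_distrib_right distrib_right sum.distrib mult.assoc)
  have 2: "(\<Sum>a\<in>UNIV. \<Sum>b\<in>UNIV. \<Sum>s\<in>UNIV. t a b c d * (H a s * psi s b k l)) + (\<Sum>a\<in>UNIV. \<Sum>b\<in>UNIV. \<Sum>s\<in>UNIV. t a b c d * (H b s * psi a s k l))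
     = - (\<Sum>a\<in>UNIV. \<Sum>b\<in>UNIV. \<Sum>s\<in>UNIV. H k s * (t a b c d * psi a b s l)) - (\<Sum>a\<in>UNIV. \<Sum>b\<in>UNIV. \<Sum>s\<in>UNIV. H l s * (t a b c d * psi a b k s))"
    unfolding sum.distrib[symmetric] sum_negf[symmetric] sum_subtractf[symmetric]
    by (rule sum.cong[OF refl], rule sum.cong[OF refl],
      rule ps[unfolded sum.distrib[symmetric] sum_negf[symmetric] sum_subtractf[symmetric]])
  have "(\<Sum>a\<in>UNIV. \<Sum>b\<in>UNIV. act4 H t a b c d * psi a b k l)
     = (\<Sum>a\<in>UNIV. \<Sum>b\<in>UNIV. \<Sum>s\<in>UNIV. H k s * (t a b c d * psi a b s l)) + (\<Sum>a\<in>UNIV. \<Sum>b\<in>UNIV. \<Sum>s\<in>UNIV. H l s * (t a b c d * psi a b k s))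
     + (\<Sum>a\<in>UNIV. \<Sum>b\<in>UNIV. \<Sum>s\<in>UNIV. H c s * (t a b s d * psi a b k l)) + (\<Sum>a\<in>UNIV. \<Sum>b\<in>UNIV. \<Sum>s\<in>UNIV. H d s * (t a b c s * psi a b k l))"
    using 1[OF refl refl refl refl] sw 2 by linarith
  also have "\<dots> = (\<Sum>s\<in>UNIV. H k s * (2 * t s l c d)) + (\<Sum>s\<in>UNIV. H l s * (2 * t k s c d))
     + (\<Sum>s\<in>UNIV. H c s * (2 * t k l s d)) + (\<Sum>s\<in>UNIV. H d s * (2 * t k l c s))"
    unfolding rest[of "H k" "\<lambda>a b s. t a b c d * psi a b s l"] rest[of "H l" "\<lambda>a b s. t a b c d * psi a b k s"]
      rest[of "H c" "\<lambda>a b s. t a b s d * psi a b k l"] rest[of "H d" "\<lambda>a b s. t a b c s * psi a b k l"]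
      spin7D[OF assms] ..
  finally show "(\<Sum>a\<in>UNIV. \<Sum>b\<in>UNIV. act4 H t a b c d * psi a b k l) = 2 * act4 H t k l c d"
    by (simp add: act4_def sum.distrib sum_distrib_left mult.left_commute)
qed

lemma act_spin7_last:
  assumes "\<And>a b. spin7 (t a b)"
  shows "spin7 (act4 H t a b)"
proof -
  have "act4 H t a b = (\<lambda>c d. act4 H (\<lambda>c d a b. t a b c d) c d a b)"
    by (simp add: act4_def fun_eq_iff algebra_simps)
  then show ?thesis using act_spin7[of "\<lambda>c d a b. t a b c d" a b] assms by simp
qed

end

section \<open>Verification in coordinates of the identities for Psi\<close>

lemma less8: "x < 8 \<Longrightarrow> x \<in> {0, 1, 2, 3, 4, 5, 6, 7 :: nat}"
  by auto

text \<open>The stabiliser of Psi in so(8) is spin(7). Seven invariance equations determine the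
  entries \<open>F 0 j\<close> from the others, cutting dimension 28 down to 21, and with them all
  entries of the contraction table become 2 F.\<close>

lemma psi_spin7_nat:
  assumes s: "\<And>u v. F v u = - (F u v :: real)"
    and inv: "\<And>a b c d. a < 8 \<Longrightarrow> b < 8 \<Longrightarrow> c < 8 \<Longrightarrow> d < 8 \<Longrightarrow>
      (\<Sum>s<8. F a s * psi_nat s b c d + F b s * psi_nat a s c d + F c s * psi_nat a b s d + F d s * psi_nat a b c s) = 0"
    and xy: "x < 8" "y < 8"
  shows "(\<Sum>u<8. \<Sum>v<8. F u v * psi_nat u v x y) = 2 * F x y"
proof -
  have f: "F u u = 0" for u using s[of u u] by simp
  have o: "v < u \<Longrightarrow> F u v = - F v u" for u v by (rule s)
  note d = sum8 psi_nat_def det4_def det3_def det2_def dl_def f o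
  note E = psi_contract[OF s]
  \<comment> \<open>The quadruples are not terms of Psi; for a term of Psi the equation is trivial,
    since only diagonal entries of F would occur.\<close>
  have r1: "F 0 1 = - F 2 7 - F 3 5 + F 4 6" using inv[of 0 2 3 4] by (simp add: d del: One_nat_def)
  have r2: "F 0 2 = F 1 7 + F 3 6 + F 4 5" using inv[of 0 1 3 4] by (simp add: d del: One_nat_def)
  have r3: "F 0 3 = F 1 5 - F 2 6 - F 4 7" using inv[of 0 1 2 4] by (simp add: d del: One_nat_def)
  have r4: "F 0 4 = - F 1 6 - F 2 5 + F 3 7" using inv[of 0 1 2 3] by (simp add: d del: One_nat_def)
  have r5: "F 0 5 = - F 1 3 + F 2 4 - F 6 7" using inv[of 0 1 2 6] by (simp add: d del: One_nat_def)
  have r6: "F 0 6 = F 1 4 + F 2 3 + F 5 7" using inv[of 0 1 2 5] by (simp add: d del: One_nat_def)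
  have r7: "F 0 7 = - F 1 2 - F 3 4 - F 5 6" using inv[of 0 1 3 6] by (simp add: d del: One_nat_def)
  note r = r1 r2 r3 r4 r5 r6 r7
  have lt: "(\<Sum>u<8. \<Sum>v<8. F u v * psi_nat u v x y) = 2 * F x y" if "x < y" "y < 8" for x y
  proof -
    have "x \<in> {0, 1, 2, 3, 4, 5, 6, 7}" "y \<in> {0, 1, 2, 3, 4, 5, 6, 7}" using less8[of x] less8[of y] that by simp_all
    then show ?thesis using that(1)
      by (elim insertE emptyE; simp add: E r del: insert_iff One_nat_def)
  qed
  show ?thesis
  proof (cases x y rule: linorder_cases)
    case less then show ?thesis using lt xy by blast
  next
    case equal
    have "psi_nat u v x x = 0" for u v using skew4D(3)[OF psi_nat_skew, of u v x x] by simp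
    then show ?thesis using equal f by simp
  next
    case greater
    then have "(\<Sum>u<8. \<Sum>v<8. F u v * psi_nat u v y x) = 2 * F y x" using lt xy by blast
    moreover have "psi_nat u v x y = - psi_nat u v y x" for u v using skew4D(3)[OF psi_nat_skew, of u v y x] by simp
    ultimately show ?thesis using s[of y x] by (simp add: sum_negf)
  qed
qed

lemma skew3_sorted:
  fixes H :: "nat \<Rightarrow> nat \<Rightarrow> nat \<Rightarrow> real"
  assumes "skew3 H" "\<And>x y z. x < y \<Longrightarrow> y < z \<Longrightarrow> z < n \<Longrightarrow> H x y z = 0" "x < n" "y < n" "z < n"
  shows "H x y z = 0"
proof -
  note s = skew3D[OF assms(1)]
  consider "x = y" | "y = z" | "x = z" | "x < y \<and> y < z" | "x < z \<and> z < y" | "y < x \<and> x < z" | "y < z \<and> z < x"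
    | "z < x \<and> x < y" | "z < y \<and> y < x" by linarith
  then show ?thesis
  proof cases
    case 1 then show ?thesis using s(1)[of x x z] by simp
  next
    case 2 then show ?thesis using s(2)[of x y y] by simp
  next
    case 3 then show ?thesis using s(3)[of x y x] by simp
  next
    case 4 then show ?thesis using assms by blast
  next
    case 5 then show ?thesis using assms(2)[of x z y] assms(4) s(2)[of x y z] by simp
  next
    case 6 then show ?thesis using assms(2)[of y x z] assms(5) s(1)[of x y z] by simp
  next
    case 7 then show ?thesis using assms(2)[of y z x] assms(3) s(4)[of y z x] by simp
  next
    case 8 then show ?thesis using assms(2)[of z x y] assms(4) s(5)[of z x y] by simp
  next
    case 9 then show ?thesis using assms(2)[of z y x] assms(3) s(3)[of x y z] by simp
  qed
qed

text \<open>The 14 terms of Psi form a Steiner system S(3,4,8): three distinct indices lie in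
  exactly one term, so a single summand survives.\<close>

lemma psi_single:
  fixes G :: "nat \<Rightarrow> real"
  shows
    "(\<Sum>a<8. G a * psi_nat a 0 1 2) = G 7"
    "(\<Sum>a<8. G a * psi_nat a 0 1 3) = G 5"
    "(\<Sum>a<8. G a * psi_nat a 0 1 4) = - G 6"
    "(\<Sum>a<8. G a * psi_nat a 0 1 5) = - G 3"
    "(\<Sum>a<8. G a * psi_nat a 0 1 6) = G 4"
    "(\<Sum>a<8. G a * psi_nat a 0 1 7) = - G 2"
    "(\<Sum>a<8. G a * psi_nat a 0 2 3) = - G 6"
    "(\<Sum>a<8. G a * psi_nat a 0 2 4) = - G 5"
    "(\<Sum>a<8. G a * psi_nat a 0 2 5) = G 4"
    "(\<Sum>a<8. G a * psi_nat a 0 2 6) = G 3"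
    "(\<Sum>a<8. G a * psi_nat a 0 2 7) = G 1"
    "(\<Sum>a<8. G a * psi_nat a 0 3 4) = G 7"
    "(\<Sum>a<8. G a * psi_nat a 0 3 5) = G 1"
    "(\<Sum>a<8. G a * psi_nat a 0 3 6) = - G 2"
    "(\<Sum>a<8. G a * psi_nat a 0 3 7) = - G 4"
    "(\<Sum>a<8. G a * psi_nat a 0 4 5) = - G 2"
    "(\<Sum>a<8. G a * psi_nat a 0 4 6) = - G 1"
    "(\<Sum>a<8. G a * psi_nat a 0 4 7) = G 3"
    "(\<Sum>a<8. G a * psi_nat a 0 5 6) = G 7"
    "(\<Sum>a<8. G a * psi_nat a 0 5 7) = - G 6"
    "(\<Sum>a<8. G a * psi_nat a 0 6 7) = G 5"
    "(\<Sum>a<8. G a * psi_nat a 1 2 3) = G 4"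
    "(\<Sum>a<8. G a * psi_nat a 1 2 4) = - G 3"
    "(\<Sum>a<8. G a * psi_nat a 1 2 5) = G 6"
    "(\<Sum>a<8. G a * psi_nat a 1 2 6) = - G 5"
    "(\<Sum>a<8. G a * psi_nat a 1 2 7) = - G 0"
    "(\<Sum>a<8. G a * psi_nat a 1 3 4) = G 2"
    "(\<Sum>a<8. G a * psi_nat a 1 3 5) = - G 0"
    "(\<Sum>a<8. G a * psi_nat a 1 3 6) = G 7"
    "(\<Sum>a<8. G a * psi_nat a 1 3 7) = - G 6"
    "(\<Sum>a<8. G a * psi_nat a 1 4 5) = G 7"
    "(\<Sum>a<8. G a * psi_nat a 1 4 6) = G 0"
    "(\<Sum>a<8. G a * psi_nat a 1 4 7) = - G 5"
    "(\<Sum>a<8. G a * psi_nat a 1 5 6) = G 2"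
    "(\<Sum>a<8. G a * psi_nat a 1 5 7) = G 4"
    "(\<Sum>a<8. G a * psi_nat a 1 6 7) = G 3"
    "(\<Sum>a<8. G a * psi_nat a 2 3 4) = - G 1"
    "(\<Sum>a<8. G a * psi_nat a 2 3 5) = G 7"
    "(\<Sum>a<8. G a * psi_nat a 2 3 6) = G 0"
    "(\<Sum>a<8. G a * psi_nat a 2 3 7) = - G 5"
    "(\<Sum>a<8. G a * psi_nat a 2 4 5) = G 0"
    "(\<Sum>a<8. G a * psi_nat a 2 4 6) = - G 7"
    "(\<Sum>a<8. G a * psi_nat a 2 4 7) = G 6"
    "(\<Sum>a<8. G a * psi_nat a 2 5 6) = - G 1"
    "(\<Sum>a<8. G a * psi_nat a 2 5 7) = G 3"
    "(\<Sum>a<8. G a * psi_nat a 2 6 7) = - G 4"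
    "(\<Sum>a<8. G a * psi_nat a 3 4 5) = G 6"
    "(\<Sum>a<8. G a * psi_nat a 3 4 6) = - G 5"
    "(\<Sum>a<8. G a * psi_nat a 3 4 7) = - G 0"
    "(\<Sum>a<8. G a * psi_nat a 3 5 6) = G 4"
    "(\<Sum>a<8. G a * psi_nat a 3 5 7) = - G 2"
    "(\<Sum>a<8. G a * psi_nat a 3 6 7) = - G 1"
    "(\<Sum>a<8. G a * psi_nat a 4 5 6) = - G 3"
    "(\<Sum>a<8. G a * psi_nat a 4 5 7) = - G 1"
    "(\<Sum>a<8. G a * psi_nat a 4 6 7) = G 2"
    "(\<Sum>a<8. G a * psi_nat a 5 6 7) = - G 0"
  by (simp_all add: sum8 psi_nat_def det4_def det3_def det2_def dl_def del: One_nat_def)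

text \<open>Both sides are skew in x, y, z, so 56 sorted triples suffice. For each of them the
  contraction tables leave a linear identity between sorted entries of P.\<close>

lemma psi_cubic_nat:
  fixes P :: "nat \<Rightarrow> nat \<Rightarrow> nat \<Rightarrow> real"
  assumes P: "skew3 P" and xyz: "x < 8" "y < 8" "z < 8"
  shows "(\<Sum>u<8. \<Sum>v<8. P u v z * psi_nat u v x y) + (\<Sum>u<8. \<Sum>v<8. P u v x * psi_nat u v y z)
      + (\<Sum>u<8. \<Sum>v<8. P u v y * psi_nat u v z x)
      = 2 * P x y z - 1/3 * (\<Sum>a<8. (\<Sum>u<8. \<Sum>v<8. \<Sum>w<8. P u v w * psi_nat a u v w) * psi_nat a x y z)"
proof -
  note pd = skew4D[OF psi_nat_skew] and s = skew3D[OF P]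
  have P0: "P a a c = 0" "P a b b = 0" "P a b a = 0" for a b c
    using s(1)[of a a c] s(2)[of a b b] s(3)[of a b a] by simp_all
  have Po: "b < a \<Longrightarrow> P a b c = - P b a c" "c < b \<Longrightarrow> P a b c = - P a c b" for a b c
    by (rule s)+
  have ps: "P v u w = - P u v w" for u v w by (rule s)
  note E = psi_contract[where F = "\<lambda>u v. P u v w" for w, OF ps]
  have E': "(\<Sum>u<8. \<Sum>v<8. P u v w * psi_nat u v y x) = - (\<Sum>u<8. \<Sum>v<8. P u v w * psi_nat u v x y)" for w x y
    by (simp add: pd(3)[of _ _ x y] sum_negf)
  have E0: "(\<Sum>u<8. \<Sum>v<8. P u v w * psi_nat u v x x) = 0" for w x
    using E'[of w x x] by simp
  define l where "l a = (\<Sum>u<8. \<Sum>v<8. \<Sum>w<8. P u v w * psi_nat a u v w)" for a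
  define Q where "Q w x y = (\<Sum>u<8. \<Sum>v<8. P u v w * psi_nat u v x y)" for w x y
  have Qs: "Q w y x = - Q w x y" for w x y unfolding Q_def by (rule E')
  have "l a = (\<Sum>w<8. Q w a w)" for a
  proof -
    have "l a = (\<Sum>u<8. \<Sum>w<8. \<Sum>v<8. P u v w * psi_nat a u v w)"
      unfolding l_def by (intro sum.cong refl sum.swap)
    also have "\<dots> = (\<Sum>w<8. \<Sum>u<8. \<Sum>v<8. P u v w * psi_nat a u v w)"
      by (rule sum.swap)
    also have "\<dots> = (\<Sum>w<8. Q w a w)"
    proof -
      have "psi_nat a u v w = psi_nat u v a w" for u v w
        using pd(4)[of u v a w] by simp
      then show ?thesis by (simp add: Q_def)
    qed
    finally show ?thesis .
  qed
  note l = this[unfolded sum8]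
  have Qo: "b < a \<Longrightarrow> Q w a b = - Q w b a" "Q w a a = 0" for w a b
    using Qs[of w b a] Qs[of w a a] by simp_all
  note E = E[folded Q_def]
  \<comment> \<open>Every index lies in 7 terms of Psi, and the 3! orders of the other three indices
    give the factor 6.\<close>
  have lt: "l 0 = 6 * (- P 1 2 7 + P 2 3 6 - P 3 4 7 - P 5 6 7 + P 1 4 6 + P 2 4 5 - P 1 3 5)"
    "l 1 = 6 * (P 0 2 7 - P 0 4 6 + P 0 3 5 - P 4 5 7 - P 2 5 6 - P 2 3 4 - P 3 6 7)"
    "l 2 = 6 * (- P 0 1 7 - P 0 3 6 - P 0 4 5 + P 1 5 6 + P 1 3 4 - P 3 5 7 + P 4 6 7)"
    "l 3 = 6 * (P 0 2 6 + P 0 4 7 - P 0 1 5 - P 4 5 6 - P 1 2 4 + P 2 5 7 + P 1 6 7)"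
    "l 4 = 6 * (- P 0 3 7 + P 0 1 6 + P 0 2 5 + P 3 5 6 + P 1 5 7 + P 1 2 3 - P 2 6 7)"
    "l 5 = 6 * (P 0 6 7 - P 0 2 4 + P 0 1 3 - P 3 4 6 - P 1 4 7 - P 1 2 6 - P 2 3 7)"
    "l 6 = 6 * (- P 0 2 3 - P 0 5 7 - P 0 1 4 + P 3 4 5 + P 1 2 5 - P 1 3 7 + P 2 4 7)"
    "l 7 = 6 * (P 0 1 2 + P 0 3 4 + P 0 5 6 + P 1 4 5 + P 2 3 5 + P 1 3 6 - P 2 4 6)"
    by (simp_all add: l E Qo P0 Po del: One_nat_def)
  \<comment> \<open>Three times the difference of the two sides, which removes the fraction.\<close>
  define H where "H x y z = 3 * (Q z x y + Q x y z + Q y z x) - 6 * P x y z + (\<Sum>a<8. l a * psi_nat a x y z)" for x y z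
  have "skew3 H"
    unfolding skew3_def H_def
  proof (intro conjI allI)
    fix a b c
    have "(\<Sum>e<8. l e * psi_nat e b a c) = - (\<Sum>e<8. l e * psi_nat e a b c)"
      by (simp add: pd(2)[of _ a b c] sum_negf)
    then show "3 * (Q c b a + Q b a c + Q a c b) - 6 * P b a c + (\<Sum>e<8. l e * psi_nat e b a c)
      = - (3 * (Q c a b + Q a b c + Q b c a) - 6 * P a b c + (\<Sum>e<8. l e * psi_nat e a b c))"
      using Qs[of c a b] Qs[of a b c] Qs[of b c a] s(1)[of a b c] by simp
    have "(\<Sum>e<8. l e * psi_nat e a c b) = - (\<Sum>e<8. l e * psi_nat e a b c)"
      by (simp add: pd(3)[of _ a b c] sum_negf)
    then show "3 * (Q b a c + Q a c b + Q c b a) - 6 * P a c b + (\<Sum>e<8. l e * psi_nat e a c b)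
      = - (3 * (Q c a b + Q a b c + Q b c a) - 6 * P a b c + (\<Sum>e<8. l e * psi_nat e a b c))"
      using Qs[of c a b] Qs[of a b c] Qs[of b c a] s(2)[of a b c] by simp
  qed
  have H_sorted: "H x y z = 3 * (Q z x y + Q x y z - Q y x z) - 6 * P x y z + (\<Sum>a<8. l a * psi_nat a x y z)" for x y z
    unfolding H_def Qs[of y z x] by simp
  note h = H_sorted psi_single lt E
  note sorted =
    s(4)[of 1 2 0] s(2)[of 0 2 1] s(4)[of 1 3 0] s(2)[of 0 3 1] s(4)[of 1 4 0] s(2)[of 0 4 1] s(4)[of 1 5 0] s(2)[of 0 5 1]
    s(4)[of 1 6 0] s(2)[of 0 6 1] s(4)[of 1 7 0] s(2)[of 0 7 1] s(4)[of 2 3 0] s(2)[of 0 3 2] s(4)[of 2 4 0] s(2)[of 0 4 2]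
    s(4)[of 2 5 0] s(2)[of 0 5 2] s(4)[of 2 6 0] s(2)[of 0 6 2] s(4)[of 2 7 0] s(2)[of 0 7 2] s(4)[of 3 4 0] s(2)[of 0 4 3]
    s(4)[of 3 5 0] s(2)[of 0 5 3] s(4)[of 3 6 0] s(2)[of 0 6 3] s(4)[of 3 7 0] s(2)[of 0 7 3] s(4)[of 4 5 0] s(2)[of 0 5 4]
    s(4)[of 4 6 0] s(2)[of 0 6 4] s(4)[of 4 7 0] s(2)[of 0 7 4] s(4)[of 5 6 0] s(2)[of 0 6 5] s(4)[of 5 7 0] s(2)[of 0 7 5]
    s(4)[of 6 7 0] s(2)[of 0 7 6] s(4)[of 2 3 1] s(2)[of 1 3 2] s(4)[of 2 4 1] s(2)[of 1 4 2] s(4)[of 2 5 1] s(2)[of 1 5 2]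
    s(4)[of 2 6 1] s(2)[of 1 6 2] s(4)[of 2 7 1] s(2)[of 1 7 2] s(4)[of 3 4 1] s(2)[of 1 4 3] s(4)[of 3 5 1] s(2)[of 1 5 3]
    s(4)[of 3 6 1] s(2)[of 1 6 3] s(4)[of 3 7 1] s(2)[of 1 7 3] s(4)[of 4 5 1] s(2)[of 1 5 4] s(4)[of 4 6 1] s(2)[of 1 6 4]
    s(4)[of 4 7 1] s(2)[of 1 7 4] s(4)[of 5 6 1] s(2)[of 1 6 5] s(4)[of 5 7 1] s(2)[of 1 7 5] s(4)[of 6 7 1] s(2)[of 1 7 6]
    s(4)[of 3 4 2] s(2)[of 2 4 3] s(4)[of 3 5 2] s(2)[of 2 5 3] s(4)[of 3 6 2] s(2)[of 2 6 3] s(4)[of 3 7 2] s(2)[of 2 7 3]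
    s(4)[of 4 5 2] s(2)[of 2 5 4] s(4)[of 4 6 2] s(2)[of 2 6 4] s(4)[of 4 7 2] s(2)[of 2 7 4] s(4)[of 5 6 2] s(2)[of 2 6 5]
    s(4)[of 5 7 2] s(2)[of 2 7 5] s(4)[of 6 7 2] s(2)[of 2 7 6] s(4)[of 4 5 3] s(2)[of 3 5 4] s(4)[of 4 6 3] s(2)[of 3 6 4]
    s(4)[of 4 7 3] s(2)[of 3 7 4] s(4)[of 5 6 3] s(2)[of 3 6 5] s(4)[of 5 7 3] s(2)[of 3 7 5] s(4)[of 6 7 3] s(2)[of 3 7 6]
    s(4)[of 5 6 4] s(2)[of 4 6 5] s(4)[of 5 7 4] s(2)[of 4 7 5] s(4)[of 6 7 4] s(2)[of 4 7 6] s(4)[of 6 7 5] s(2)[of 5 7 6]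
  have h012: "H 0 1 2 = 0" unfolding h sorted P0 by algebra
  have h013: "H 0 1 3 = 0" unfolding h sorted P0 by algebra
  have h014: "H 0 1 4 = 0" unfolding h sorted P0 by algebra
  have h015: "H 0 1 5 = 0" unfolding h sorted P0 by algebra
  have h016: "H 0 1 6 = 0" unfolding h sorted P0 by algebra
  have h017: "H 0 1 7 = 0" unfolding h sorted P0 by algebra
  have h023: "H 0 2 3 = 0" unfolding h sorted P0 by algebra
  have h024: "H 0 2 4 = 0" unfolding h sorted P0 by algebra
  have h025: "H 0 2 5 = 0" unfolding h sorted P0 by algebra
  have h026: "H 0 2 6 = 0" unfolding h sorted P0 by algebra
  have h027: "H 0 2 7 = 0" unfolding h sorted P0 by algebra
  have h034: "H 0 3 4 = 0" unfolding h sorted P0 by algebra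
  have h035: "H 0 3 5 = 0" unfolding h sorted P0 by algebra
  have h036: "H 0 3 6 = 0" unfolding h sorted P0 by algebra
  have h037: "H 0 3 7 = 0" unfolding h sorted P0 by algebra
  have h045: "H 0 4 5 = 0" unfolding h sorted P0 by algebra
  have h046: "H 0 4 6 = 0" unfolding h sorted P0 by algebra
  have h047: "H 0 4 7 = 0" unfolding h sorted P0 by algebra
  have h056: "H 0 5 6 = 0" unfolding h sorted P0 by algebra
  have h057: "H 0 5 7 = 0" unfolding h sorted P0 by algebra
  have h067: "H 0 6 7 = 0" unfolding h sorted P0 by algebra
  have h123: "H 1 2 3 = 0" unfolding h sorted P0 by algebra
  have h124: "H 1 2 4 = 0" unfolding h sorted P0 by algebra
  have h125: "H 1 2 5 = 0" unfolding h sorted P0 by algebra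
  have h126: "H 1 2 6 = 0" unfolding h sorted P0 by algebra
  have h127: "H 1 2 7 = 0" unfolding h sorted P0 by algebra
  have h134: "H 1 3 4 = 0" unfolding h sorted P0 by algebra
  have h135: "H 1 3 5 = 0" unfolding h sorted P0 by algebra
  have h136: "H 1 3 6 = 0" unfolding h sorted P0 by algebra
  have h137: "H 1 3 7 = 0" unfolding h sorted P0 by algebra
  have h145: "H 1 4 5 = 0" unfolding h sorted P0 by algebra
  have h146: "H 1 4 6 = 0" unfolding h sorted P0 by algebra
  have h147: "H 1 4 7 = 0" unfolding h sorted P0 by algebra
  have h156: "H 1 5 6 = 0" unfolding h sorted P0 by algebra
  have h157: "H 1 5 7 = 0" unfolding h sorted P0 by algebra
  have h167: "H 1 6 7 = 0" unfolding h sorted P0 by algebra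
  have h234: "H 2 3 4 = 0" unfolding h sorted P0 by algebra
  have h235: "H 2 3 5 = 0" unfolding h sorted P0 by algebra
  have h236: "H 2 3 6 = 0" unfolding h sorted P0 by algebra
  have h237: "H 2 3 7 = 0" unfolding h sorted P0 by algebra
  have h245: "H 2 4 5 = 0" unfolding h sorted P0 by algebra
  have h246: "H 2 4 6 = 0" unfolding h sorted P0 by algebra
  have h247: "H 2 4 7 = 0" unfolding h sorted P0 by algebra
  have h256: "H 2 5 6 = 0" unfolding h sorted P0 by algebra
  have h257: "H 2 5 7 = 0" unfolding h sorted P0 by algebra
  have h267: "H 2 6 7 = 0" unfolding h sorted P0 by algebra
  have h345: "H 3 4 5 = 0" unfolding h sorted P0 by algebra
  have h346: "H 3 4 6 = 0" unfolding h sorted P0 by algebra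
  have h347: "H 3 4 7 = 0" unfolding h sorted P0 by algebra
  have h356: "H 3 5 6 = 0" unfolding h sorted P0 by algebra
  have h357: "H 3 5 7 = 0" unfolding h sorted P0 by algebra
  have h367: "H 3 6 7 = 0" unfolding h sorted P0 by algebra
  have h456: "H 4 5 6 = 0" unfolding h sorted P0 by algebra
  have h457: "H 4 5 7 = 0" unfolding h sorted P0 by algebra
  have h467: "H 4 6 7 = 0" unfolding h sorted P0 by algebra
  have h567: "H 5 6 7 = 0" unfolding h sorted P0 by algebra
  note H0 = h012 h013 h014 h015 h016 h017 h023 h024 h025 h026 h027 h034 h035 h036 h037 h045 h046 h047 h056 h057 h067 h123 h124 h125 h126 h127 h134 h135 h136 h137 h145 h146 h147 h156 h157 h167 h234 h235 h236 h237 h245 h246 h247 h256 h257 h267 h345 h346 h347 h356 h357 h367 h456 h457 h467 h567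
  have "H x y z = 0" if "x < y" "y < z" "z < 8" for x y z
  proof -
    have z: "z \<in> {0, 1, 2, 3, 4, 5, 6, 7}" using less8[OF that(3)] .
    have y: "y = 1 \<or> y = 2 \<or> y = 3 \<or> y = 4 \<or> y = 5 \<or> y = 6" using that by linarith
    from y that(1) have "x = 0 \<or> x = 1 \<or> x = 2 \<or> x = 3 \<or> x = 4 \<or> x = 5" by linarith
    then show ?thesis using y z that(1,2)
      by (elim disjE insertE emptyE; hypsubst; simp add: H0 del: One_nat_def)
  qed
  with \<open>skew3 H\<close> have "H x y z = 0" using skew3_sorted[of H 8] xyz by blast
  then show ?thesis by (simp add: H_def Q_def l_def)
qed

section \<open>Transport of the identities to the index type \<open>8\<close>\<close>

definition psi8 :: "(8 \<Rightarrow> nat) \<Rightarrow> 8 \<Rightarrow> 8 \<Rightarrow> 8 \<Rightarrow> 8 \<Rightarrow> real" where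
  "psi8 ix a b c d = psi_nat (ix a) (ix b) (ix c) (ix d)"

locale index8 =
  fixes ix :: "8 \<Rightarrow> nat"
  assumes ix: "bij_betw ix UNIV {..<8}"
begin

lemma ix_less: "ix a < 8"
  using bij_betwE[OF ix] by auto

lemma sum_ix: "(\<Sum>s<8. f s) = (\<Sum>a\<in>UNIV. f (ix a))"
  using sum.reindex_bij_betw[OF ix, of f] by simp

lemma inv_ix: "inv ix (ix a) = a"
  using ix by (simp add: bij_betw_def)

lemma psi8_skew: "skew4 (psi8 ix)"
  using psi_nat_skew unfolding skew4_def psi8_def by blast

lemma psi8_cubic: "spin7_form (psi8 ix)"
proof
  show "skew4 (psi8 ix)" by (rule psi8_skew)
  fix P :: "8 \<Rightarrow> 8 \<Rightarrow> 8 \<Rightarrow> real" and x y z assume P: "skew3 P"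
  let ?P = "\<lambda>a b c. P (inv ix a) (inv ix b) (inv ix c)"
  have "skew3 ?P" using P unfolding skew3_def by blast
  from psi_cubic_nat[OF this ix_less[of x] ix_less[of y] ix_less[of z]]
  show "(\<Sum>u\<in>UNIV. \<Sum>v\<in>UNIV. P u v z * psi8 ix u v x y) + (\<Sum>u\<in>UNIV. \<Sum>v\<in>UNIV. P u v x * psi8 ix u v y z)
      + (\<Sum>u\<in>UNIV. \<Sum>v\<in>UNIV. P u v y * psi8 ix u v z x)
      = 2 * P x y z - 1/3 * (\<Sum>a\<in>UNIV. (\<Sum>u\<in>UNIV. \<Sum>v\<in>UNIV. \<Sum>w\<in>UNIV. P u v w * psi8 ix a u v w) * psi8 ix a x y z)"
    by (simp add: sum_ix inv_ix psi8_def)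
qed

lemma psi8_spin7:
  assumes F: "\<And>a b. F b a = - F a b" and inv: "\<And>a b c d. act4 F (psi8 ix) a b c d = 0"
  shows "(\<Sum>a\<in>UNIV. \<Sum>b\<in>UNIV. F a b * psi8 ix a b k l) = 2 * F k l"
proof -
  let ?F = "\<lambda>a b. F (inv ix a) (inv ix b)"
  have "(\<Sum>s<8. ?F a s * psi_nat s b c d + ?F b s * psi_nat a s c d + ?F c s * psi_nat a b s d + ?F d s * psi_nat a b c s) = 0"
    if "a < 8" "b < 8" "c < 8" "d < 8" for a b c d
  proof -
    have r: "ix (inv ix n) = n" if "n < 8" for n
      using ix that by (metis bij_betw_inv_into_right lessThan_iff)
    show ?thesis using inv[of "inv ix a" "inv ix b" "inv ix c" "inv ix d"] that
      by (simp add: sum_ix inv_ix r act4_def psi8_def)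
  qed
  from psi_spin7_nat[OF F this ix_less[of k] ix_less[of l]]
  show ?thesis by (simp add: sum_ix inv_ix psi8_def)
qed

end

section \<open>The form sigma^T and the exterior derivative of the torsion\<close>

context metric_connection8 begin

lemma T_cyclic: "vf V X \<Longrightarrow> vf V Y \<Longrightarrow> vf V Z \<Longrightarrow> p \<in> V \<Longrightarrow> T [Z, X, Y] p = T [X, Y, Z] p"
  using T_skew12[of V X Z Y p] T_skew23[of V X Y Z p] by simp

lemma T_tor_expand:
  assumes "orthonormal_frame M A g W e" "vf V X" "vf V Y" "vf V Z" "vf V U" "V \<subseteq> W" "p \<in> V"
  shows "T [tor X Y, Z, U] p = (\<Sum>s<8. T [e s, X, Y] p * T [e s, Z, U] p)"
proof -
  have *: "T [e s, X, Y] p = g [tor X Y, e s] p" if "s < 8" for s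
    using T_cyclic[of V X Y "e s" p] frame_props(2)[OF assms(1) that] vf_restrict[of W "e s" V] vf_openin[OF assms(2)] assms
    by (simp add: T_eq)
  then show ?thesis
  proof -
    have "[tor X Y, Z, U] \<in> vfs V 3" using vf_tor[OF assms(2,3)] assms(4,5) by (simp add: vfs3)
    from tens_expand[OF assms(1) tens_T this _ assms(6,7), of 0]
    have "T [tor X Y, Z, U] p = (\<Sum>s<8. g [tor X Y, e s] p * T [e s, Z, U] p)" by simp
    then show ?thesis using * by simp
  qed
qed

text \<open>Expanding \<open>tor\<close> in whatever orthonormal frame \<open>sigma_form\<close>
  selects at p expresses its value without a frame; the sum over the frame also exhibits the
  symmetry between the two pairs.\<close>

lemma sigma_tor:
  assumes "\<exists>W e. p \<in> W \<and> orthonormal_frame M A g W e" "vf V X" "vf V Y" "vf V Z" "vf V U" "p \<in> V"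
  shows "sigma_form M A g T [X, Y, Z, U] p = T [tor X Y, Z, U] p - T [tor X Z, Y, U] p + T [tor X U, Y, Z] p"
    and "T [tor Z U, X, Y] p = T [tor X Y, Z, U] p"
proof -
  define e where "e = (SOME e. \<exists>W. p \<in> W \<and> orthonormal_frame M A g W e)"
  have "\<exists>W. p \<in> W \<and> orthonormal_frame M A g W e"
  proof -
    obtain W' e' where "p \<in> W' \<and> orthonormal_frame M A g W' e'" using assms(1) by blast
    then have "\<exists>W. p \<in> W \<and> orthonormal_frame M A g W e'" by blast
    then show ?thesis unfolding e_def by (rule someI[where P = "\<lambda>e. \<exists>W. p \<in> W \<and> orthonormal_frame M A g W e"])
  qed
  then obtain W where W: "p \<in> W" "orthonormal_frame M A g W e" by blast
  have o: "openin M (V \<inter> W)" using vf_openin[OF assms(2)] frame_props(1)[OF W(2)] by blast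
  note v = assms(2-5)[THEN vf_restrict[OF _ o Int_lower1]]
  have p: "p \<in> V \<inter> W" using assms W by blast
  note ex = T_tor_expand[OF W(2) _ _ _ _ Int_lower2 p]
  have ev: "vf (V \<inter> W) (e s)" if "s < 8" for s
    using frame_props(2)[OF W(2) that] vf_restrict o by blast
  \<comment> \<open>The square of a 2-form counts each product twice; this 2 cancels the 1/2 in the
    definition of sigma^T.\<close>
  have "wedge 2 2 (interior (e s) T) (interior (e s) T) [X, Y, Z, U] p
     = 2 * (T [e s, X, Y] p * T [e s, Z, U] p - T [e s, X, Z] p * T [e s, Y, U] p + T [e s, X, U] p * T [e s, Y, Z] p)"
    if "s < 8" for s
    using T_skew23[OF ev[OF that] v(1) v(2) p] T_skew23[OF ev[OF that] v(1) v(3) p] T_skew23[OF ev[OF that] v(1) v(4) p]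
      T_skew23[OF ev[OF that] v(2) v(3) p] T_skew23[OF ev[OF that] v(2) v(4) p] T_skew23[OF ev[OF that] v(3) v(4) p]
    unfolding wedge22 interior_def by simp
  then have "sigma_form M A g T [X, Y, Z, U] p
     = 1/2 * (\<Sum>s<8. 2 * (T [e s, X, Y] p * T [e s, Z, U] p - T [e s, X, Z] p * T [e s, Y, U] p + T [e s, X, U] p * T [e s, Y, Z] p))"
    unfolding sigma_form_def e_def[symmetric] Let_def by simp
  then show "sigma_form M A g T [X, Y, Z, U] p = T [tor X Y, Z, U] p - T [tor X Z, Y, U] p + T [tor X U, Y, Z] p"
    unfolding ex[OF v(1,2,3,4)] ex[OF v(1,3,2,4)] ex[OF v(1,4,2,3)]
    by (simp add: sum.distrib sum_subtractf flip: sum_distrib_left)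
  show "T [tor Z U, X, Y] p = T [tor X Y, Z, U] p"
    unfolding ex[OF v(1,2,3,4)] ex[OF v(3,4,1,2)] by (simp add: mult.commute)
qed

text \<open>Brackets are replaced by D and torsion. The terms in D assemble to
  \<open>d_nabla\<close>; the six torsion terms coincide in pairs by the exchange symmetry of
  \<open>sigma_tor\<close> and give 2 sigma^T.\<close>

lemma ext_d_T:
  assumes "\<exists>W e. p \<in> W \<and> orthonormal_frame M A g W e" "vf V X" "vf V Y" "vf V Z" "vf V U" "p \<in> V"
  shows "ext_d T [X, Y, Z, U] p = d_nabla D T [X, Y, Z, U] p + 2 * sigma_form M A g T [X, Y, Z, U] p"
proof -
  note v = assms(2-5) and p = assms(6)
  note sw = sigma_tor(2)[OF assms(1) _ _ _ _ p]
  have b: "T [bracket B C, F, G] p = T [D B C, F, G] p - T [D C B, F, G] p - T [tor B C, F, G] p"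
    if "vf V B" "vf V C" "vf V F" "vf V G" for B C F G
    using that p by (simp add: tor_def T_diff1 vf_closed)
  have ov: "openin M V" using v vf_openin by blast
  have d: "B (T [G, F, C]) p = - B (T [F, G, C]) p" if "vf V B" "vf V C" "vf V F" "vf V G" for B C F G
  proof -
    have s: "sm V (T [F, G, C])" by (rule tens_sm[OF tens_T ov]) (simp add: vfs3 that)
    have s': "sm V (T [G, F, C])" by (rule tens_sm[OF tens_T ov]) (simp add: vfs3 that)
    have "B (T [G, F, C]) p = B (\<lambda>q. - T [F, G, C] q) p"
      by (rule vf_local[OF that(1) s' T_skew12[OF that(3,4,2)] p])
    then show ?thesis using vf_minus[OF that(1) s p] by simp
  qed
  note DD = D_vf[OF v(1) v(2)] D_vf[OF v(1) v(3)] D_vf[OF v(1) v(4)] D_vf[OF v(2) v(1)] D_vf[OF v(2) v(3)] D_vf[OF v(2) v(4)]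
    D_vf[OF v(3) v(1)] D_vf[OF v(3) v(2)] D_vf[OF v(3) v(4)] D_vf[OF v(4) v(1)] D_vf[OF v(4) v(2)] D_vf[OF v(4) v(3)]
  have l: "ext_d T [X, Y, Z, U] p = X (T [Y, Z, U]) p - Y (T [X, Z, U]) p + Z (T [X, Y, U]) p - U (T [X, Y, Z]) p
     - T [bracket X Y, Z, U] p + T [bracket X Z, Y, U] p - T [bracket Y Z, X, U] p
     - T [bracket X U, Y, Z] p + T [bracket Y U, X, Z] p - T [bracket Z U, X, Y] p"
    by (simp add: ext_d_def omit_def eval_nat_numeral)
  have r: "d_nabla D T [X, Y, Z, U] p = X (T [Y, Z, U]) p - T [D X Y, Z, U] p - T [Y, D X Z, U] p - T [Y, Z, D X U] p
    + (Y (T [Z, X, U]) p - T [D Y Z, X, U] p - T [Z, D Y X, U] p - T [Z, X, D Y U] p)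
    + (Z (T [X, Y, U]) p - T [D Z X, Y, U] p - T [X, D Z Y, U] p - T [X, Y, D Z U] p)
    - (U (T [X, Y, Z]) p - T [D U X, Y, Z] p - T [X, D U Y, Z] p - T [X, Y, D U Z] p)"
    by (simp add: d_nabla_def cov_deriv_def eval_nat_numeral)
  show ?thesis
    unfolding l r sigma_tor(1)[OF assms] b[OF v(1,2,3,4)] b[OF v(1,3,2,4)] b[OF v(2,3,1,4)] b[OF v(1,4,2,3)] b[OF v(2,4,1,3)] b[OF v(3,4,1,2)]
    using sw[OF v(1,2,3,4)] sw[OF v(1,3,2,4)] sw[OF v(1,4,2,3)] d[OF v(2,4,1,3)]
      T_skew12[OF DD(2) v(2,4) p] T_cyclic[OF v(2,3) DD(3) p] T_skew12[OF DD(4) v(3,4) p]  T_cyclic[OF v(3,1) DD(6) p] T_skew23[OF DD(6) v(3,1) p]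
      T_skew12[OF v(1,3) DD(6) p] T_skew12[OF DD(8) v(1,4) p] T_cyclic[OF v(1,2) DD(9) p] T_skew12[OF DD(11) v(1,3) p] T_cyclic[OF v(1,2) DD(12) p]
    by simp
qed

lemma d_nabla_eq_iff:
  assumes "\<And>p. p \<in> topspace M \<Longrightarrow> \<exists>W e. p \<in> W \<and> orthonormal_frame M A g W e"
  shows "tensor_eq M A (topspace M) 4 (d_nabla D T) (\<lambda>_ _. 0) \<longleftrightarrow>
    tensor_eq M A (topspace M) 4 (ext_d T) (\<lambda>Xs p. 2 * sigma_form M A g T Xs p)"
proof -
  have "d_nabla D T Xs p = 0 \<longleftrightarrow> ext_d T Xs p = 2 * sigma_form M A g T Xs p"
    if h: "openin M V" "Xs \<in> vfs V 4" "p \<in> V" for V Xs p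
  proof -
    obtain X Y Z U where X: "Xs = [X, Y, Z, U]" using list4 vfsD(1)[OF h(2)] by blast
    have "p \<in> topspace M" using openin_subset[OF h(1)] h(3) by blast
    from ext_d_T[OF assms[OF this], of V X Y Z U] show ?thesis using h by (simp add: X vfs4)
  qed
  then show ?thesis unfolding tensor_eq_def by blast
qed

end

section \<open>Contractions of the Levi-Civita symbol\<close>

definition tuples :: "nat \<Rightarrow> nat list set" where
  "tuples k = {I. length I = k \<and> set I \<subseteq> {..<8}}"

lemma take_drop_append: "take i L @ drop i L @ Z = L @ Z"
  by (simp flip: append_assoc)

lemma finite_tuples: "finite (tuples k)"
  using finite_lists_length_eq[of "{..<8::nat}" k] by (simp add: tuples_def conj_commute)

text \<open>Isolates the i-th entry of an index list, the one that \<open>ext_d\<close> omits, at an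
  arbitrary position.\<close>

lemma sum_tuples_insert:
  assumes "i \<le> k"
  shows "(\<Sum>I\<in>tuples (Suc k). F I) = (\<Sum>x<8. \<Sum>J\<in>tuples k. F (take i J @ x # drop i J))"
proof -
  have "(\<Sum>I\<in>tuples (Suc k). F I) = (\<Sum>(x, J)\<in>{..<8} \<times> tuples k. F (take i J @ x # drop i J))"
  proof (rule sum.reindex_bij_witness[of _ "\<lambda>(x, J). take i J @ x # drop i J" "\<lambda>I. (I ! i, omit i I)"])
    fix I assume I: "I \<in> tuples (Suc k)"
    then have i: "i < length I" using assms by (simp add: tuples_def)
    then have "I ! i \<in> set I" by simp
    then have n: "I ! i < 8" using I by (auto simp: tuples_def)
    have "take i (omit i I) = take i I" "drop i (omit i I) = drop (Suc i) I"
      using i by (simp_all add: omit_def)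
    then show "(case (I ! i, omit i I) of (x, J) \<Rightarrow> take i J @ x # drop i J) = I"
      "(case (I ! i, omit i I) of (x, J) \<Rightarrow> F (take i J @ x # drop i J)) = F I"
      using i by (simp_all add: id_take_nth_drop[symmetric])
    show "(I ! i, omit i I) \<in> {..<8} \<times> tuples k"
      using I i n by (auto simp: tuples_def omit_def dest: in_set_takeD in_set_dropD)
  next
    fix z :: "nat \<times> nat list" assume "z \<in> {..<8} \<times> tuples k"
    then obtain x J where z: "z = (x, J)" "x < 8" "J \<in> tuples k" by auto
    then have l: "length J = k" by (simp add: tuples_def)
    show "(case z of (x, J) \<Rightarrow> take i J @ x # drop i J) \<in> tuples (Suc k)"
      using z l by (auto simp: tuples_def dest: in_set_takeD in_set_dropD)
    show "((case z of (x, J) \<Rightarrow> take i J @ x # drop i J) ! i, omit i (case z of (x, J) \<Rightarrow> take i J @ x # drop i J)) = z"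
      using z l assms by (simp add: nth_append omit_def)
  qed
  then show ?thesis by (simp add: sum.cartesian_product)
qed

lemma sum_tuples_Suc: "(\<Sum>I\<in>tuples (Suc k). F I) = (\<Sum>x<8. \<Sum>J\<in>tuples k. F (x # J))"
  using sum_tuples_insert[of 0 k F] by simp

lemma tuples_0: "tuples 0 = {[]}"
  by (auto simp: tuples_def)

section \<open>Alternating functions of index lists\<close>

definition alternating :: "nat \<Rightarrow> (nat list \<Rightarrow> real) \<Rightarrow> bool" where
  "alternating k f \<longleftrightarrow> (\<forall>B x y C. length (B @ x # y # C) = k \<longrightarrow> f (B @ y # x # C) = - f (B @ x # y # C))"

lemma alternatingD: "alternating k f \<Longrightarrow> length (B @ x # y # C) = k \<Longrightarrow> f (B @ y # x # C) = - f (B @ x # y # C)"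
  unfolding alternating_def by blast

text \<open>Moving an entry to the front of a block is a chain of adjacent swaps, one for each entry
  passed.\<close>

lemma alternating_move:
  assumes "alternating k f" "length (B @ C @ x # E) = k"
  shows "f (B @ C @ x # E) = (-1) ^ length C * f (B @ x # C @ E)"
  using assms(2)
proof (induction C arbitrary: B)
  case (Cons c C)
  then show ?case
    using Cons.IH[of "B @ [c]"] alternatingD[OF assms(1), of B x c "C @ E"] by simp
qed simp

lemma alternating_repeat:
  assumes "alternating k f" "length L = k" "\<not> distinct L"
  shows "f L = 0"
proof -
  obtain B x C E where L: "L = B @ [x] @ C @ [x] @ E"
    using not_distinct_decomp[OF assms(3)] by blast
  have "f L = (-1) ^ length C * f ((B @ [x]) @ x # C @ E)"
    using alternating_move[OF assms(1), of "B @ [x]" C x E] L assms(2) by simp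
  moreover have "f (B @ x # x # C @ E) = 0"
    using alternatingD[OF assms(1), of B x x "C @ E"] L assms(2) by simp
  ultimately show ?thesis by simp
qed

lemma symmetric_insort:
  assumes "\<And>B x y C. length (B @ x # y # C) = k \<Longrightarrow> f (B @ y # x # C) = f (B @ x # y # C)"
    "length (B @ x # ys) = k"
  shows "f (B @ x # ys) = f (B @ insort x ys)"
  using assms(2)
proof (induction ys arbitrary: B)
  case (Cons y ys)
  then show ?case using Cons.IH[of "B @ [y]"] assms(1)[of B x y ys] by auto
qed simp

lemma symmetric_sort:
  assumes "\<And>B x y C. length (B @ x # y # C) = k \<Longrightarrow> f (B @ y # x # C) = f (B @ x # y # C)"
    "length (B @ xs) = k"
  shows "f (B @ xs) = f (B @ sort xs)"
  using assms(2)
proof (induction xs arbitrary: B)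
  case (Cons x xs)
  have "f (B @ x # xs) = f (B @ x # sort xs)"
    using Cons.IH[of "B @ [x]"] Cons.prems by simp
  also have "\<dots> = f (B @ insort x (sort xs))"
    by (rule symmetric_insort[where k = k and f = f, OF assms(1)]) (use Cons.prems in auto)
  finally show ?case by simp
qed simp

text \<open>Invariance under adjacent swaps gives invariance under sorting. It is applied to
  products of two alternating functions, where the signs cancel, and so replaces any computation
  with signs of permutations.\<close>

lemma symmetric_mset:
  assumes "\<And>B x y C. length (B @ x # y # C) = k \<Longrightarrow> f (B @ y # x # C) = f (B @ x # y # C)"
    "length xs = k" "mset xs = mset (ys :: nat list)"
  shows "f xs = f ys"
proof -
  have "length ys = k" using assms(2,3) mset_eq_length by metis
  moreover have "sort xs = sort ys" by (rule properties_for_sort) (simp_all add: assms(3))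
  ultimately show ?thesis
    using symmetric_sort[where k = k and f = f and B = "[]" and xs = xs, OF assms(1)]
      symmetric_sort[where k = k and f = f and B = "[]" and xs = ys, OF assms(1)] assms(2) by simp
qed

section \<open>The Levi-Civita symbol in dimension 8\<close>

locale levi_civita =
  fixes eps :: "nat list \<Rightarrow> real"
  assumes eps_alt: "alternating 8 eps" and eps_one: "eps [0..<8] = 1"
begin

lemma eps_square:
  assumes "L \<in> tuples 8" "distinct L"
  shows "eps L * eps L = 1"
proof -
  have l: "length L = 8" "set L \<subseteq> {..<8}" using assms by (simp_all add: tuples_def)
  have "set L = {..<8}"
    using l assms(2) by (intro card_subset_eq) (simp_all add: distinct_card)
  then have "mset L = mset [0..<8]"
    using assms(2) set_eq_iff_mset_eq_distinct[of L "[0..<8]"] by (simp add: atLeast0LessThan)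
  moreover have "eps (E @ y # x # F) * eps (E @ y # x # F) = eps (E @ x # y # F) * eps (E @ x # y # F)"
    if "length (E @ x # y # F) = 8" for E x y F
    using alternatingD[OF eps_alt that] by simp
  ultimately have "eps L * eps L = eps [0..<8] * eps [0..<8]"
    using symmetric_mset[of 8 "\<lambda>L. eps L * eps L" L "[0..<8]"] l(1) by blast
  then show ?thesis using eps_one by simp
qed

text \<open>Only arrangements \<open>v\<close> of the entries of \<open>u\<close> and arrangements
  \<open>J\<close> of the complement contribute. \<open>B v * eps (v @ J)\<close> is unchanged by
  swaps in v, so each of these k! (8-k)! terms equals \<open>B u\<close>.\<close>

lemma contraction:
  assumes B: "alternating k B" and k: "k \<le> 8" and u: "u \<in> tuples k"
  shows "(\<Sum>v\<in>tuples k. \<Sum>J\<in>tuples (8 - k). B v * eps (v @ J) * eps (u @ J)) = fact k * fact (8 - k) * B u"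
proof (cases "distinct u")
  case False
  have "eps (u @ J) = 0" if "J \<in> tuples (8 - k)" for J
    using that u k False by (intro alternating_repeat[OF eps_alt]) (auto simp: tuples_def)
  moreover have "B u = 0" using alternating_repeat[OF B _ False] u by (simp add: tuples_def)
  ultimately show ?thesis by simp
next
  case True
  have lu: "length u = k" "set u \<subseteq> {..<8}" using u by (simp_all add: tuples_def)
  define C where "C = {..<8} - set u"
  have cC: "card C = 8 - k" "finite C"
    using lu True by (simp_all add: C_def card_Diff_subset distinct_card)
  have inner: "(\<Sum>v\<in>tuples k. B v * eps (v @ J) * eps (u @ J)) = (if J \<in> permutations_of_set C then fact k * B u else 0)"
    if J: "J \<in> tuples (8 - k)" for J
  proof (cases "J \<in> permutations_of_set C")
    case False
    have "\<not> distinct (u @ J)"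
    proof
      assume d: "distinct (u @ J)"
      then have "set J \<subseteq> C" using J by (auto simp: C_def tuples_def)
      moreover have "card (set J) = card C" using d J cC by (simp add: distinct_card tuples_def)
      ultimately have "set J = C" using cC(2) by (simp add: card_subset_eq)
      then show False using d False by (simp add: permutations_of_set_def)
    qed
    then have "eps (u @ J) = 0" using J lu k by (intro alternating_repeat[OF eps_alt]) (auto simp: tuples_def)
    then show ?thesis using False by simp
  next
    case True': True
    then have J': "set J = C" "distinct J" by (simp_all add: permutations_of_set_def)
    have z: "B v * eps (v @ J) * eps (u @ J) = 0" if "v \<in> tuples k - permutations_of_set (set u)" for v
    proof -
      have "\<not> distinct (v @ J)"
      proof
        assume d: "distinct (v @ J)"
        have "set v \<subseteq> set u" using d that J' by (auto simp: C_def tuples_def)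
        moreover have "card (set v) = card (set u)" using d that lu True by (simp add: distinct_card tuples_def)
        ultimately have "set v = set u" by (simp add: card_subset_eq)
        then show False using d that by (simp add: permutations_of_set_def)
      qed
      then have "eps (v @ J) = 0" using J that k by (intro alternating_repeat[OF eps_alt]) (auto simp: tuples_def)
      then show ?thesis by simp
    qed
    have o: "B v * eps (v @ J) * eps (u @ J) = B u" if v: "v \<in> permutations_of_set (set u)" for v
    proof -
      have "mset v = mset u" using v True set_eq_iff_mset_eq_distinct[of v u] by (simp add: permutations_of_set_def)
      moreover have "length v = k" using calculation lu by (metis mset_eq_length)
      moreover have "B (E @ y # x # F) * eps ((E @ y # x # F) @ J) = B (E @ x # y # F) * eps ((E @ x # y # F) @ J)"
        if "length (E @ x # y # F) = k" for E x y F
        using alternatingD[OF B that] alternatingD[OF eps_alt, of E x y "F @ J"] that J k by (simp add: tuples_def)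
      ultimately have "B v * eps (v @ J) = B u * eps (u @ J)"
        using symmetric_mset[of k "\<lambda>v. B v * eps (v @ J)" v u] by blast
      moreover have "eps (u @ J) * eps (u @ J) = 1"
        using J lu k True J' by (intro eps_square) (auto simp: tuples_def C_def)
      ultimately show ?thesis by (simp add: mult.assoc)
    qed
    have sub: "permutations_of_set (set u) \<subseteq> tuples k"
      using lu True by (auto simp: permutations_of_set_def tuples_def) (metis distinct_card)
    have "(\<Sum>v\<in>tuples k. B v * eps (v @ J) * eps (u @ J)) = (\<Sum>v\<in>permutations_of_set (set u). B v * eps (v @ J) * eps (u @ J))"
      using z by (intro sum.mono_neutral_right finite_tuples sub) auto
    also have "\<dots> = fact k * B u" using o True lu by (simp add: distinct_card)
    finally show ?thesis using True' by simp
  qed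
  have subC: "permutations_of_set C \<subseteq> tuples (8 - k)"
  proof
    fix J assume "J \<in> permutations_of_set C"
    then have J: "set J = C" "distinct J" by (simp_all add: permutations_of_set_def)
    then have "length J = 8 - k" using cC(1) distinct_card[of J] by simp
    then show "J \<in> tuples (8 - k)" using J(1) by (auto simp: tuples_def C_def)
  qed
  have "(\<Sum>v\<in>tuples k. \<Sum>J\<in>tuples (8 - k). B v * eps (v @ J) * eps (u @ J))
    = (\<Sum>J\<in>tuples (8 - k). if J \<in> permutations_of_set C then fact k * B u else 0)"
    by (subst sum.swap) (simp add: inner)
  also have "\<dots> = (\<Sum>J\<in>permutations_of_set C. fact k * B u)"
    using subC by (simp add: sum.If_cases finite_tuples Int_absorb1)
  also have "\<dots> = fact k * fact (8 - k) * B u" using cC by simp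
  finally show ?thesis .
qed

text \<open>The derivative part of d of the star of T, contracted as the outer star demands. Each of
  the six positions i gives 3! 5! = 720, the sign of d cancelling the one from moving x to the
  front.\<close>

lemma divergence_first:
  assumes \<tau>: "\<And>x. alternating 3 (\<tau> x)" and ab: "a < 8" "b < 8"
  shows "(\<Sum>I\<in>tuples 6. (\<Sum>i<6. (-1) ^ i * (\<Sum>K\<in>tuples 3. \<tau> (I ! i) K * eps (K @ omit i I))) * eps (I @ [a, b]))
    = 4320 * (\<Sum>x<8. \<tau> x [x, a, b])"
proof -
  have one: "(\<Sum>I\<in>tuples 6. (-1) ^ i * (\<Sum>K\<in>tuples 3. \<tau> (I ! i) K * eps (K @ omit i I)) * eps (I @ [a, b]))
     = 720 * (\<Sum>x<8. \<tau> x [x, a, b])" if i: "i < 6" for i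
  proof -
    let ?F = "\<lambda>I. (-1) ^ i * (\<Sum>K\<in>tuples 3. \<tau> (I ! i) K * eps (K @ omit i I)) * eps (I @ [a, b])"
    have f: "?F (take i J @ x # drop i J) = (\<Sum>K\<in>tuples 3. \<tau> x K * eps (K @ J) * eps ([x, a, b] @ J))"
      if J: "J \<in> tuples 5" for x J
    proof -
      have l: "length J = 5" using J by (simp add: tuples_def)
      have "eps ((take i J @ x # drop i J) @ [a, b]) = (-1) ^ i * eps (x # J @ [a, b])"
        using alternating_move[OF eps_alt, of "[]" "take i J" x "drop i J @ [a, b]"] l i
        by (simp add: take_drop_append)
      \<comment> \<open>Both a and b pass the five entries of J, and the two signs cancel.\<close>
      also have "eps (x # J @ [a, b]) = eps ([x, a, b] @ J)"
        using alternating_move[OF eps_alt, of "[x]" J a "[b]"] alternating_move[OF eps_alt, of "[x, a]" J b "[]"] l by simp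
      finally have "eps ((take i J @ x # drop i J) @ [a, b]) = (-1) ^ i * eps ([x, a, b] @ J)" .
      moreover have "(take i J @ x # drop i J) ! i = x" "omit i (take i J @ x # drop i J) = J"
        using l i by (simp_all add: nth_append omit_def)
      moreover have "(-1) ^ i * (-1) ^ i = (1::real)" by (simp flip: power_add)
      ultimately show ?thesis by (simp add: sum_distrib_right sum_distrib_left mult.assoc mult.left_commute[of "(-1) ^ i"])
    qed
    have "(\<Sum>I\<in>tuples 6. ?F I) = (\<Sum>x<8. \<Sum>J\<in>tuples 5. ?F (take i J @ x # drop i J))"
      using sum_tuples_insert[of i 5 ?F] i by simp
    also have "\<dots> = (\<Sum>x<8. \<Sum>J\<in>tuples 5. \<Sum>K\<in>tuples 3. \<tau> x K * eps (K @ J) * eps ([x, a, b] @ J))"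
      by (intro sum.cong refl f)
    also have "\<dots> = (\<Sum>x<8. \<Sum>K\<in>tuples 3. \<Sum>J\<in>tuples (8 - 3). \<tau> x K * eps (K @ J) * eps ([x, a, b] @ J))"
      by (rule sum.cong[OF refl]) (subst sum.swap, simp)
    also have "\<dots> = (\<Sum>x<8. fact 3 * fact (8 - 3) * \<tau> x [x, a, b])"
      by (intro sum.cong refl contraction \<tau>) (use ab in \<open>simp_all add: tuples_def\<close>)
    finally show ?thesis by (simp add: fact_numeral sum_distrib_left)
  qed
  have "(\<Sum>I\<in>tuples 6. (\<Sum>i<6. (-1) ^ i * (\<Sum>K\<in>tuples 3. \<tau> (I ! i) K * eps (K @ omit i I))) * eps (I @ [a, b]))
    = (\<Sum>i<6. \<Sum>I\<in>tuples 6. (-1) ^ i * (\<Sum>K\<in>tuples 3. \<tau> (I ! i) K * eps (K @ omit i I)) * eps (I @ [a, b]))"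
    unfolding sum_distrib_right by (rule sum.swap)
  then show ?thesis using one by simp
qed

text \<open>The bracket part of d of the star of T, with structure functions \<open>c\<close>. Each
  of the 15 pairs i < j gives -(1/4) 4! 4! = -144, and 15 * 144 = 2160.\<close>

lemma divergence_second:
  assumes t: "alternating 3 t" and ab: "a < 8" "b < 8"
  shows "(\<Sum>I\<in>tuples 6. (\<Sum>j<6. \<Sum>i<j. (-1) ^ (i + j) *
      (\<Sum>K\<in>tuples 3. \<Sum>s<8. t K * c (I ! i) (I ! j) s * eps (K @ s # omit i (omit j I)))) * eps (I @ [a, b]))
    = - 2160 * (\<Sum>x<8. \<Sum>y<8. t [x, y, a] * c x y b - t [x, y, b] * c x y a + t [x, a, b] * c x y y - t [y, a, b] * c x y x)"
proof -
  \<comment> \<open>The wedge product of the 3-form t with the 1-form \<open>c x y\<close>, so that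
    \<open>contraction\<close> applies with k = 4.\<close>
  define B where "B x y v = t [v ! 0, v ! 1, v ! 2] * c x y (v ! 3) - t [v ! 0, v ! 1, v ! 3] * c x y (v ! 2)
    + t [v ! 0, v ! 2, v ! 3] * c x y (v ! 1) - t [v ! 1, v ! 2, v ! 3] * c x y (v ! 0)" for x y :: nat and v
  have t1: "t [q, p, r] = - t [p, q, r]" "t [p, r, q] = - t [p, q, r]" for p q r
    using alternatingD[OF t, of "[]" p q "[r]"] alternatingD[OF t, of "[p]" q r "[]"] by simp_all
  have B: "alternating 4 (B x y)" for x y
    unfolding alternating_def
  proof (intro allI impI)
    fix E F :: "nat list" and p q assume l: "length (E @ p # q # F) = 4"
    then consider "E = []" "\<exists>r s. F = [r, s]" | "\<exists>r s. E = [r] \<and> F = [s]" | "\<exists>r s. E = [r, s]" "F = []"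
      by (cases E; cases F; cases "tl E"; cases "tl F") (auto simp: length_Suc_conv numeral_eq_Suc)
    then show "B x y (E @ q # p # F) = - B x y (E @ p # q # F)"
    proof cases
      case 1 then obtain r s where "E = []" "F = [r, s]" by blast
      then show ?thesis using t1(1)[of p q r] t1(1)[of p q s] by (simp add: B_def numeral_eq_Suc)
    next
      case 2 then obtain r s where "E = [r]" "F = [s]" by blast
      then show ?thesis using t1(2)[of r p q] t1(1)[of p q s] by (simp add: B_def numeral_eq_Suc)
    next
      case 3 then obtain r s where "E = [r, s]" "F = []" by blast
      then show ?thesis using t1(2)[of r p q] t1(2)[of s p q] by (simp add: B_def numeral_eq_Suc)
    qed
  qed
  \<comment> \<open>The four terms of the wedge product contribute equally against the alternating
    \<open>eps\<close>, whence 1/4.\<close>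
  have B4: "(\<Sum>K\<in>tuples 3. \<Sum>s<8. t K * c x y s * eps (K @ s # L)) = 1/4 * (\<Sum>v\<in>tuples 4. B x y v * eps (v @ L))"
    if L: "L \<in> tuples 4" for x y L
  proof -
    have lL: "length L = 4" using L by (simp add: tuples_def)
    define h where "h p q r s = t [p, q, r] * c x y s * eps ([p, q, r, s] @ L)" for p q r s
    have e: "eps ([p, q, s, r] @ L) = - eps ([p, q, r, s] @ L)" "eps ([p, s, q, r] @ L) = eps ([p, q, r, s] @ L)"
      "eps ([s, p, q, r] @ L) = - eps ([p, q, r, s] @ L)" for p q r s
      using alternatingD[OF eps_alt, of "[p, q]" r s L] alternatingD[OF eps_alt, of "[p]" q s "r # L"]
        alternatingD[OF eps_alt, of "[]" p s "q # r # L"] lL by simp_all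
    have b: "B x y [p, q, r, s] * eps ([p, q, r, s] @ L) = h p q r s + h p q s r + h p r s q + h q r s p" for p q r s
    proof -
      have "h p q s r = - (t [p, q, s] * c x y r * eps ([p, q, r, s] @ L))"
        unfolding h_def e(1)[of p q r s] by simp
      moreover have "h p r s q = t [p, r, s] * c x y q * eps ([p, q, r, s] @ L)"
        unfolding h_def using e(2)[of p q r s] e(2)[of p s q r] by simp
      moreover have "h q r s p = - (t [q, r, s] * c x y p * eps ([p, q, r, s] @ L))"
        unfolding h_def using e(3)[of p q r s] by simp
      moreover have "h p q r s = t [p, q, r] * c x y s * eps ([p, q, r, s] @ L)" by (simp only: h_def)
      moreover have "B x y [p, q, r, s] = t [p, q, r] * c x y s - t [p, q, s] * c x y r + t [p, r, s] * c x y q - t [q, r, s] * c x y p"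
        by (simp add: B_def numeral_eq_Suc)
      ultimately show ?thesis by (simp only: left_diff_distrib distrib_right)
    qed
    have T34: "tuples 4 = tuples (Suc (Suc (Suc (Suc 0))))" "tuples 3 = tuples (Suc (Suc (Suc 0)))"
      by (simp_all add: numeral_eq_Suc)
    have s4: "(\<Sum>v\<in>tuples 4. F v) = (\<Sum>p<8. \<Sum>q<8. \<Sum>r<8. \<Sum>s<8. F [p, q, r, s])" for F :: "nat list \<Rightarrow> real"
      by (simp add: T34 sum_tuples_Suc tuples_0)
    have s3: "(\<Sum>v\<in>tuples 3. F v) = (\<Sum>p<8. \<Sum>q<8. \<Sum>r<8. F [p, q, r])" for F :: "nat list \<Rightarrow> real"
      by (simp add: T34 sum_tuples_Suc tuples_0)
    have p1: "(\<Sum>p<8. \<Sum>q<8. \<Sum>r<8. \<Sum>s<8. h p q s r) = (\<Sum>p<8. \<Sum>q<8. \<Sum>r<8. \<Sum>s<(8::nat). h p q r s)"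
      by (rule sum.cong[OF refl], rule sum.cong[OF refl]) (rule sum.swap)
    have p2: "(\<Sum>p<8. \<Sum>q<8. \<Sum>r<8. \<Sum>s<8. h p r s q) = (\<Sum>p<8. \<Sum>q<8. \<Sum>r<8. \<Sum>s<(8::nat). h p q r s)"
    proof (rule sum.cong[OF refl])
      fix p
      have "(\<Sum>q<8. \<Sum>r<8. \<Sum>s<8. h p r s q) = (\<Sum>r<8. \<Sum>q<8. \<Sum>s<8. h p r s q)" by (rule sum.swap)
      also have "\<dots> = (\<Sum>r<8. \<Sum>s<8. \<Sum>q<8. h p r s q)" by (rule sum.cong[OF refl]) (rule sum.swap)
      finally show "(\<Sum>q<8. \<Sum>r<8. \<Sum>s<8. h p r s q) = (\<Sum>q<8. \<Sum>r<8. \<Sum>s<8. h p q r s)" .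
    qed
    have p3: "(\<Sum>p<8. \<Sum>q<8. \<Sum>r<8. \<Sum>s<8. h q r s p) = (\<Sum>p<8. \<Sum>q<8. \<Sum>r<8. \<Sum>s<(8::nat). h p q r s)"
    proof -
      have "(\<Sum>p<8. \<Sum>q<8. \<Sum>r<8. \<Sum>s<8. h q r s p) = (\<Sum>q<8. \<Sum>p<8. \<Sum>r<8. \<Sum>s<8. h q r s p)" by (rule sum.swap)
      also have "\<dots> = (\<Sum>q<8. \<Sum>r<8. \<Sum>p<8. \<Sum>s<8. h q r s p)" by (rule sum.cong[OF refl]) (rule sum.swap)
      also have "\<dots> = (\<Sum>q<8. \<Sum>r<8. \<Sum>s<8. \<Sum>p<8. h q r s p)"
        by (rule sum.cong[OF refl], rule sum.cong[OF refl]) (rule sum.swap)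
      finally show ?thesis .
    qed
    have "(\<Sum>v\<in>tuples 4. B x y v * eps (v @ L)) = 4 * (\<Sum>p<8. \<Sum>q<8. \<Sum>r<8. \<Sum>s<8. h p q r s)"
      unfolding s4 b sum.distrib p1 p2 p3 by simp
    then show ?thesis unfolding s3 by (simp add: h_def)
  qed
  have one: "(\<Sum>I\<in>tuples 6. (-1) ^ (i + j) *
      (\<Sum>K\<in>tuples 3. \<Sum>s<8. t K * c (I ! i) (I ! j) s * eps (K @ s # omit i (omit j I))) * eps (I @ [a, b]))
    = - 144 * (\<Sum>x<8. \<Sum>y<8. B x y [x, y, a, b])" if ij: "i < j" "j < 6" for i j
  proof -
    let ?F = "\<lambda>I. (-1) ^ (i + j) * (\<Sum>K\<in>tuples 3. \<Sum>s<8. t K * c (I ! i) (I ! j) s * eps (K @ s # omit i (omit j I))) * eps (I @ [a, b])"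
    let ?N = "\<lambda>x L. take i L @ x # drop i L"
    have key: "eps ((take j N @ y # drop j N) @ [a, b]) = (-1) ^ j * eps (y # N @ [a, b])" if "length N = 5" for N y
      using alternating_move[OF eps_alt, of "[]" "take j N" y "drop j N @ [a, b]"] that ij by (simp add: take_drop_append)
    have f: "?F (take j (?N x L) @ y # drop j (?N x L)) = - 1/4 * (\<Sum>v\<in>tuples 4. B x y v * eps (v @ L) * eps ([x, y, a, b] @ L))"
      if L: "L \<in> tuples 4" for x y L
    proof -
      have l: "length L = 4" using L by (simp add: tuples_def)
      have lN: "length (?N x L) = 5" using l ij by simp
      have o: "omit j (take j (?N x L) @ y # drop j (?N x L)) = ?N x L" "omit i (?N x L) = L"
        "(take j (?N x L) @ y # drop j (?N x L)) ! j = y" "(take j (?N x L) @ y # drop j (?N x L)) ! i = x"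
        using l lN ij by (simp_all add: omit_def nth_append)
      have "eps ((take j (?N x L) @ y # drop j (?N x L)) @ [a, b]) = (-1) ^ j * eps (y # ?N x L @ [a, b])"
        by (rule key[OF lN])
      also have "eps (y # ?N x L @ [a, b]) = (-1) ^ i * eps (y # x # L @ [a, b])"
        using alternating_move[OF eps_alt, of "[y]" "take i L" x "drop i L @ [a, b]"] l ij
        by (simp add: take_drop_append)
      \<comment> \<open>Extracting j before i leaves y ahead of x; this swap is the origin of the
        overall minus sign.\<close>
      also have "eps (y # x # L @ [a, b]) = - eps (x # y # L @ [a, b])"
        using alternatingD[OF eps_alt, of "[]" x y "L @ [a, b]"] l by simp
      also have "eps (x # y # L @ [a, b]) = eps ([x, y, a, b] @ L)"
        using alternating_move[OF eps_alt, of "[x, y]" L a "[b]"] alternating_move[OF eps_alt, of "[x, y, a]" L b "[]"] l by simp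
      finally have e: "eps ((take j (?N x L) @ y # drop j (?N x L)) @ [a, b]) = - ((-1) ^ (i + j) * eps ([x, y, a, b] @ L))"
        by (simp add: power_add)
      have m: "(-1) ^ (i + j) * z * - ((-1) ^ (i + j) * w) = - (z * w)" for z w :: real
      proof -
        have "(-1) ^ (i + j) * (-1) ^ (i + j) = (1::real)" by (simp flip: power_add)
        then show ?thesis by (simp add: mult.assoc mult.left_commute[of z])
      qed
      show ?thesis unfolding o e m B4[OF L] by (simp add: sum_distrib_right sum_divide_distrib)
    qed
    have "(\<Sum>I\<in>tuples 6. ?F I) = (\<Sum>y<8. \<Sum>J\<in>tuples 5. ?F (take j J @ y # drop j J))"
      using sum_tuples_insert[of j 5 ?F] ij by simp
    also have "\<dots> = (\<Sum>y<8. \<Sum>x<8. \<Sum>L\<in>tuples 4. ?F (take j (?N x L) @ y # drop j (?N x L)))"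
      using sum_tuples_insert[of i 4 "\<lambda>J. ?F (take j J @ y # drop j J)" for y] ij by simp
    also have "\<dots> = (\<Sum>y<8. \<Sum>x<8. \<Sum>L\<in>tuples 4. - 1/4 * (\<Sum>v\<in>tuples 4. B x y v * eps (v @ L) * eps ([x, y, a, b] @ L)))"
      by (intro sum.cong refl f)
    also have "\<dots> = (\<Sum>y<8. \<Sum>x<8. - 1/4 * (\<Sum>L\<in>tuples 4. \<Sum>v\<in>tuples 4. B x y v * eps (v @ L) * eps ([x, y, a, b] @ L)))"
      by (simp only: sum_distrib_left)
    also have "\<dots> = (\<Sum>y<8. \<Sum>x<8. - 1/4 * (\<Sum>v\<in>tuples 4. \<Sum>L\<in>tuples (8 - 4). B x y v * eps (v @ L) * eps ([x, y, a, b] @ L)))"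
      by (rule sum.cong[OF refl], rule sum.cong[OF refl], rule arg_cong[of _ _ "times (- 1/4)"]) (subst sum.swap, simp)
    also have "\<dots> = (\<Sum>y<8. \<Sum>x<8. - 1/4 * (fact 4 * fact (8 - 4) * B x y [x, y, a, b]))"
      by (intro sum.cong refl arg_cong[of _ _ "times (- 1/4)"] contraction B) (use ab in \<open>simp_all add: tuples_def\<close>)
    also have "\<dots> = (\<Sum>x<8. \<Sum>y<8. - 144 * B x y [x, y, a, b])"
      by (subst sum.swap) (simp add: fact_numeral)
    finally show ?thesis by (simp only: sum_distrib_left)
  qed
  have "(\<Sum>I\<in>tuples 6. (\<Sum>j<6. \<Sum>i<j. (-1) ^ (i + j) *
      (\<Sum>K\<in>tuples 3. \<Sum>s<8. t K * c (I ! i) (I ! j) s * eps (K @ s # omit i (omit j I)))) * eps (I @ [a, b]))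
    = (\<Sum>j<6. \<Sum>I\<in>tuples 6. \<Sum>i<j. (-1) ^ (i + j) *
      (\<Sum>K\<in>tuples 3. \<Sum>s<8. t K * c (I ! i) (I ! j) s * eps (K @ s # omit i (omit j I))) * eps (I @ [a, b]))"
    unfolding sum_distrib_right by (rule sum.swap)
  also have "\<dots> = (\<Sum>j<6. \<Sum>i<j. \<Sum>I\<in>tuples 6. (-1) ^ (i + j) *
      (\<Sum>K\<in>tuples 3. \<Sum>s<8. t K * c (I ! i) (I ! j) s * eps (K @ s # omit i (omit j I))) * eps (I @ [a, b]))"
    by (rule sum.cong[OF refl]) (rule sum.swap)
  also have "\<dots> = (\<Sum>j<(6::nat). \<Sum>i<j. - 144 * (\<Sum>x<8. \<Sum>y<8. B x y [x, y, a, b]))"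
    using one by (intro sum.cong refl) simp
  also have "\<dots> = - 2160 * (\<Sum>x<8. \<Sum>y<8. B x y [x, y, a, b])"
  proof -
    have "(\<Sum>j<(6::nat). \<Sum>i<j. z) = 15 * z" for z :: real by (simp add: eval_nat_numeral)
    then show ?thesis by (simp only:)
  qed
  finally show ?thesis by (simp add: B_def numeral_eq_Suc)
qed

end

section \<open>The codifferential of the torsion\<close>

locale oriented_connection8 = metric_connection8 M A D g
  for M :: "'m topology" and A :: "'m chart set" and D :: "'m vfield \<Rightarrow> 'm vfield \<Rightarrow> 'm vfield" and g :: "'m tensor" +
  fixes vol :: "'m tensor"
  assumes vol_form: "k_form M A (topspace M) 8 vol"
    and oriented_frames: "\<And>p. p \<in> topspace M \<Longrightarrow> \<exists>W e. p \<in> W \<and> oriented_orthonormal_frame M A g vol W e"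
begin

lemma tens_vol: "tens 8 vol"
  using vol_form by (simp add: k_form_def)

lemma form_swap:
  assumes "k_form M A (topspace M) k \<omega>" "B @ X # Y # C \<in> vfs V k" "p \<in> V"
  shows "\<omega> (B @ Y # X # C) p = - \<omega> (B @ X # Y # C) p"
proof -
  have l: "length B + 2 + length C = k" "vf V X" "vf V Y" using assms(2) by (auto simp: vfields_def)
  have "(B @ X # Y # C)[length B := Y, Suc (length B) := X] = B @ Y # X # C"
    "(B @ X # Y # C)[length B := X, Suc (length B) := Y] = B @ X # Y # C"
    by (simp_all add: list_update_append)
  then show ?thesis
    using alternating_swap[OF assms(1,2), of "length B" "Suc (length B)" Y X p] l assms(3) by simp
qed

text \<open>The matrix of inner products between two orthonormal frames is orthogonal, so a
  contraction does not see which of them is used.\<close>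

lemma contract_frame:
  assumes f: "orthonormal_frame M A g W f" and e: "orthonormal_frame M A g W' e" and V: "openin M V" "V \<subseteq> W" "V \<subseteq> W'" "p \<in> V"
    and \<alpha>: "tens k \<alpha>" "i < k" "Xs \<in> vfs V k" and \<beta>: "tens l \<beta>" "j < l" "Ys \<in> vfs V l"
  shows "(\<Sum>s<8. \<alpha> (Xs[i := f s]) p * \<beta> (Ys[j := f s]) p) = (\<Sum>s<8. \<alpha> (Xs[i := e s]) p * \<beta> (Ys[j := e s]) p)"
proof -
  have fV: "vf V (f s)" and eV: "vf V (e s)" if "s < 8" for s
    using frame_props(2)[OF f that] frame_props(2)[OF e that] vf_restrict V by blast+
  have li: "length Xs = k" "length Ys = l" using \<alpha> \<beta> vfsD by blast+
  have ex: "\<alpha> (Xs[i := f s]) p = (\<Sum>a<8. g [f s, e a] p * \<alpha> (Xs[i := e a]) p)"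
    "\<beta> (Ys[j := f s]) p = (\<Sum>a<8. g [f s, e a] p * \<beta> (Ys[j := e a]) p)" if "s < 8" for s
    using tens_expand[OF e \<alpha>(1) vfs_update[OF \<alpha>(3) fV[OF that]] \<alpha>(2) V(3,4), of i]
      tens_expand[OF e \<beta>(1) vfs_update[OF \<beta>(3) fV[OF that]] \<beta>(2) V(3,4), of j] \<alpha>(2) \<beta>(2) li by simp_all
  have orth: "(\<Sum>s<8. g [f s, e a] p * g [f s, e b] p) = (if a = b then 1 else 0)" if ab: "a < 8" "b < 8" for a b
  proof -
    have "g [e a, e b] p = (\<Sum>s<8. g [e a, f s] p * g [f s, e b] p)"
      using tens_expand[OF f tens_g, of "[e a, e b]" V 0 p] V eV ab by (simp add: vfs2)
    moreover have "g [e a, f s] p = g [f s, e a] p" if "s < 8" for s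
      using g_sym[OF eV[OF ab(1)] fV[OF that] V(4)] .
    moreover have "g [e a, e b] p = (if a = b then 1 else 0)" using frame_props(3)[OF e ab] V by blast
    ultimately show ?thesis by simp
  qed
  let ?a = "\<lambda>a. \<alpha> (Xs[i := e a]) p" and ?b = "\<lambda>b. \<beta> (Ys[j := e b]) p"
  have "(\<Sum>s<8. \<alpha> (Xs[i := f s]) p * \<beta> (Ys[j := f s]) p) = (\<Sum>s<8. \<Sum>a<8. \<Sum>b<8. (g [f s, e a] p * g [f s, e b] p) * (?a a * ?b b))"
    by (intro sum.cong refl) (simp add: ex sum_product mult_ac)
  also have "\<dots> = (\<Sum>a<8. \<Sum>s<8. \<Sum>b<8. (g [f s, e a] p * g [f s, e b] p) * (?a a * ?b b))"
    by (rule sum.swap)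
  also have "\<dots> = (\<Sum>a<8. \<Sum>b<8. \<Sum>s<8. (g [f s, e a] p * g [f s, e b] p) * (?a a * ?b b))"
    by (rule sum.cong[OF refl]) (rule sum.swap)
  also have "\<dots> = (\<Sum>a<8. \<Sum>b<8. (if a = b then ?a a * ?b b else 0))"
    by (intro sum.cong refl) (simp add: orth flip: sum_distrib_right)
  finally show ?thesis by simp
qed

text \<open>Indices are exchanged one by one. The prefixes \<open>P\<close> and \<open>Q\<close>
  hold the indices already split off, which is why the induction leaves them arbitrary.\<close>

lemma contract_frames:
  assumes f: "orthonormal_frame M A g W f" and e: "orthonormal_frame M A g W' e" and V: "openin M V" "V \<subseteq> W" "V \<subseteq> W'" "p \<in> V"
    and "tens k \<alpha>" "tens l \<beta>"
  shows "length P + m + length Xs = k \<Longrightarrow> length Q + m + length Ys = l \<Longrightarrow>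
    \<forall>X\<in>set P \<union> set Q \<union> set Xs \<union> set Ys. vf V X \<Longrightarrow>
    (\<Sum>I\<in>tuples m. \<alpha> (P @ map f I @ Xs) p * \<beta> (Q @ map f I @ Ys) p)
    = (\<Sum>I\<in>tuples m. \<alpha> (P @ map e I @ Xs) p * \<beta> (Q @ map e I @ Ys) p)"
proof (induction m arbitrary: P Q)
  case 0 then show ?case by (simp add: tuples_0)
next
  case (Suc m)
  have fV: "vf V (f s)" and eV: "vf V (e s)" if "s < 8" for s
    using frame_props(2)[OF f that] frame_props(2)[OF e that] vf_restrict V by blast+
  have "(\<Sum>I\<in>tuples (Suc m). \<alpha> (P @ map f I @ Xs) p * \<beta> (Q @ map f I @ Ys) p)
    = (\<Sum>s<8. \<Sum>I\<in>tuples m. \<alpha> ((P @ [f s]) @ map f I @ Xs) p * \<beta> ((Q @ [f s]) @ map f I @ Ys) p)"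
    by (simp add: sum_tuples_Suc)
  also have "\<dots> = (\<Sum>s<8. \<Sum>I\<in>tuples m. \<alpha> ((P @ [f s]) @ map e I @ Xs) p * \<beta> ((Q @ [f s]) @ map e I @ Ys) p)"
    by (rule sum.cong[OF refl], rule Suc.IH) (use Suc.prems fV in auto)
  also have "\<dots> = (\<Sum>I\<in>tuples m. \<Sum>s<8. \<alpha> ((P @ [f s]) @ map e I @ Xs) p * \<beta> ((Q @ [f s]) @ map e I @ Ys) p)"
    by (rule sum.swap)
  also have "\<dots> = (\<Sum>I\<in>tuples m. \<Sum>s<8. \<alpha> ((P @ [e s]) @ map e I @ Xs) p * \<beta> ((Q @ [e s]) @ map e I @ Ys) p)"
  proof (rule sum.cong[OF refl])
    fix I assume I: "I \<in> tuples m"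
    have IV: "\<forall>X\<in>set (map e I). vf V X" "length I = m" using I eV by (auto simp: tuples_def)
    have "P @ e 0 # map e I @ Xs \<in> vfs V k" "Q @ e 0 # map e I @ Ys \<in> vfs V l"
      using Suc.prems IV eV[of 0] by (auto simp: vfields_def)
    from contract_frame[OF f e V assms(7) _ this(1) assms(8) _ this(2), of "length P" "length Q"]
    show "(\<Sum>s<8. \<alpha> ((P @ [f s]) @ map e I @ Xs) p * \<beta> ((Q @ [f s]) @ map e I @ Ys) p)
      = (\<Sum>s<8. \<alpha> ((P @ [e s]) @ map e I @ Xs) p * \<beta> ((Q @ [e s]) @ map e I @ Ys) p)"
      using Suc.prems by (simp add: list_update_append)
  qed
  also have "\<dots> = (\<Sum>s<8. \<Sum>I\<in>tuples m. \<alpha> ((P @ [e s]) @ map e I @ Xs) p * \<beta> ((Q @ [e s]) @ map e I @ Ys) p)"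
    by (rule sum.swap)
  finally show ?case by (simp add: sum_tuples_Suc)
qed

lemma chosen_frame:
  assumes "p \<in> topspace M"
  shows "\<exists>W. p \<in> W \<and> oriented_orthonormal_frame M A g vol W (SOME e. \<exists>W. p \<in> W \<and> oriented_orthonormal_frame M A g vol W e)"
proof -
  obtain W' e' where "p \<in> W' \<and> oriented_orthonormal_frame M A g vol W' e'" using oriented_frames[OF assms] by blast
  then have "\<exists>W. p \<in> W \<and> oriented_orthonormal_frame M A g vol W e'" by blast
  then show ?thesis by (rule someI[where P = "\<lambda>e. \<exists>W. p \<in> W \<and> oriented_orthonormal_frame M A g vol W e"])
qed

text \<open>\<open>hodge_star\<close> selects a frame anew at each point, so as defined it gives no
  control over derivatives. The same frame \<open>e\<close> may be used here for all points of its
  domain.\<close>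

lemma hodge_T:
  assumes e: "orthonormal_frame M A g W e" and V: "p \<in> W" "p \<in> V" "Ys \<in> vfs V 5" "openin M V"
  shows "hodge_star M A g vol 3 T Ys p = 1/6 * (\<Sum>I\<in>tuples 3. T (map e I) p * vol (map e I @ Ys) p)"
proof -
  define f where "f = (SOME e. \<exists>W. p \<in> W \<and> oriented_orthonormal_frame M A g vol W e)"
  have "p \<in> topspace M" using V openin_subset by blast
  from chosen_frame[OF this] obtain W' where o: "p \<in> W'" "oriented_orthonormal_frame M A g vol W' f"
    unfolding f_def[symmetric] by blast
  then have f: "p \<in> W'" "orthonormal_frame M A g W' f" by (simp_all add: oriented_orthonormal_frame_def)
  have U: "openin M (V \<inter> W \<inter> W')"
    by (rule openin_Int[OF openin_Int[OF V(4) frame_props(1)[OF e]] frame_props(1)[OF f(2)]])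
  have "Ys \<in> vfs (V \<inter> W \<inter> W') 5" using vfs_restrict[OF V(3) U] by blast
  then have Y: "length Ys = 5" "\<forall>Y\<in>set Ys. vf (V \<inter> W \<inter> W') Y" by (simp_all add: vfields_def)
  have "(\<Sum>I\<in>tuples 3. T ([] @ map f I @ []) p * vol ([] @ map f I @ Ys) p)
      = (\<Sum>I\<in>tuples 3. T ([] @ map e I @ []) p * vol ([] @ map e I @ Ys) p)"
    by (rule contract_frames[OF f(2) e U _ _ _ tens_T tens_vol]) (use V f Y in auto)
  then show ?thesis
    unfolding hodge_star_def f_def[symmetric] Let_def tuples_def[symmetric] by (simp add: fact_numeral)
qed

end

section \<open>The codifferential computed in a fixed oriented frame\<close>

locale oriented_frame8 = oriented_connection8 M A D g vol
  for M :: "'m topology" and A :: "'m chart set" and D :: "'m vfield \<Rightarrow> 'm vfield \<Rightarrow> 'm vfield" and g vol :: "'m tensor" +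
  fixes W :: "'m set" and e :: "nat \<Rightarrow> 'm vfield"
  assumes oframe: "oriented_orthonormal_frame M A g vol W e"
begin

lemma fr: "orthonormal_frame M A g W e"
  using oframe by (simp add: oriented_orthonormal_frame_def)

lemma e_vf: "i < 8 \<Longrightarrow> vf W (e i)" and W_open: "openin M W"
  using frame_props[OF fr] by auto

lemma map_vfs: "I \<in> tuples k \<Longrightarrow> map e I \<in> vfs W k"
  using e_vf by (auto simp: vfields_def tuples_def)

text \<open>\<open>alternating\<close> ranges over all lists of naturals, so the components are set
  to 0 outside the index range.\<close>

lemma form_alternating:
  assumes "k_form M A (topspace M) k \<omega>" "p \<in> W"
  shows "alternating k (\<lambda>I. if I \<in> tuples k then \<omega> (map e I) p else 0)"
  unfolding alternating_def
proof (intro allI impI)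
  fix B C :: "nat list" and x y assume l: "length (B @ x # y # C) = k"
  have "B @ y # x # C \<in> tuples k \<longleftrightarrow> B @ x # y # C \<in> tuples k" by (auto simp: tuples_def)
  moreover have "\<omega> (map e (B @ y # x # C)) p = - \<omega> (map e (B @ x # y # C)) p" if "B @ x # y # C \<in> tuples k"
    using form_swap[OF assms(1) _ assms(2), of "map e B" "e x" "e y" "map e C"] map_vfs[OF that] by simp
  ultimately show "(if B @ y # x # C \<in> tuples k then \<omega> (map e (B @ y # x # C)) p else 0)
    = - (if B @ x # y # C \<in> tuples k then \<omega> (map e (B @ x # y # C)) p else 0)" by simp
qed

definition "eps q I = (if I \<in> tuples 8 then vol (map e I) q else 0)"

lemma levi_civita: "q \<in> W \<Longrightarrow> levi_civita (eps q)"
proof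
  assume q: "q \<in> W"
  show "alternating 8 (eps q)" using form_alternating[OF vol_form q] unfolding eps_def .
  have "[0..<8] \<in> tuples 8" by (auto simp: tuples_def)
  then show "eps q [0..<8] = 1" using oframe q by (simp add: eps_def oriented_orthonormal_frame_def)
qed

text \<open>The components of the volume form at q and p transform alike and are both 1 on the
  standard list; being signs, they agree. Hence they can be pulled out of derivatives.\<close>

lemma eps_const:
  assumes q: "q \<in> W" "p \<in> W"
  shows "eps q I = eps p I"
proof (cases "I \<in> tuples 8 \<and> distinct I")
  case True
  interpret q: levi_civita "eps q" by (rule levi_civita[OF q(1)])
  interpret p: levi_civita "eps p" by (rule levi_civita[OF q(2)])
  have l: "length I = 8" "set I \<subseteq> {..<8}" using True by (simp_all add: tuples_def)
  have "set I = {..<8}" using l True by (intro card_subset_eq) (simp_all add: distinct_card)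
  then have "mset I = mset [0..<8]"
    using True set_eq_iff_mset_eq_distinct[of I "[0..<8]"] by (simp add: atLeast0LessThan)
  moreover have "eps q (E @ y # x # F) * eps p (E @ y # x # F) = eps q (E @ x # y # F) * eps p (E @ x # y # F)"
    if "length (E @ x # y # F) = 8" for E x y F
    using alternatingD[OF q.eps_alt that] alternatingD[OF p.eps_alt that] by simp
  ultimately have "eps q I * eps p I = eps q [0..<8] * eps p [0..<8]"
    using symmetric_mset[of 8 "\<lambda>I. eps q I * eps p I" I "[0..<8]"] l(1) by blast
  then have "eps q I * eps p I = 1" by (simp add: q.eps_one p.eps_one)
  then have "eps q I * (eps p I * eps p I) = eps p I" by (simp flip: mult.assoc)
  then show ?thesis using p.eps_square True by simp
next
  case False
  then show ?thesis
    using alternating_repeat[OF levi_civita.eps_alt[OF levi_civita[OF q(1)]], of I]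
      alternating_repeat[OF levi_civita.eps_alt[OF levi_civita[OF q(2)]], of I] by (cases "I \<in> tuples 8") (auto simp: eps_def tuples_def)
qed

lemma hodge_frame:
  assumes q: "q \<in> W" and p: "p \<in> W" and J: "J \<in> tuples 5"
  shows "hodge_star M A g vol 3 T (map e J) q = 1/6 * (\<Sum>K\<in>tuples 3. eps p (K @ J) * T (map e K) q)"
proof -
  have "vol (map e K @ map e J) q = eps p (K @ J)" if "K \<in> tuples 3" for K
    using eps_const[OF q p, of "K @ J"] that J by (auto simp: eps_def tuples_def)
  then show ?thesis using hodge_T[OF fr q q map_vfs[OF J] W_open] by (simp add: mult.commute)
qed

text \<open>The bracket of two frame fields is a difference of D-derivatives minus the torsion. The
  terms quadratic in T cancel and the D-terms are those of the trace of \<open>nab T\<close>, so the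
  divergence by D needs no torsion correction.\<close>

lemma codiff_frame:
  assumes p: "p \<in> W" and ab: "a < 8" "b < 8"
  shows "(\<Sum>I\<in>tuples 6. ext_d (hodge_star M A g vol 3 T) (map e I) p * eps p (I @ [a, b]))
    = 720 * (\<Sum>x<8. nab T [e x, e x, e a, e b] p)"
proof -
  interpret lc: levi_civita "eps p" by (rule levi_civita[OF p])
  define G where "G x y s = g [D (e x) (e y), e s] p" for x y s
  define t where "t K = (if K \<in> tuples 3 then T (map e K) p else 0)" for K
  define \<tau> where "\<tau> x K = (if x < 8 \<and> K \<in> tuples 3 then e x (T (map e K)) p else 0)" for x K
  define c where "c x y s = g [bracket (e x) (e y), e s] p" for x y s
  have t_alt: "alternating 3 t" using form_alternating[OF torsion_form p] unfolding t_def .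
  have smT: "sm W (T (map e K))" if "K \<in> tuples 3" for K
    using tens_sm[OF tens_T W_open map_vfs[OF that]] .
  have \<tau>_alt: "alternating 3 (\<tau> x)" for x
    unfolding alternating_def
  proof (intro allI impI)
    fix B C :: "nat list" and y z assume l: "length (B @ y # z # C) = 3"
    have i: "B @ z # y # C \<in> tuples 3 \<longleftrightarrow> B @ y # z # C \<in> tuples 3" by (auto simp: tuples_def)
    have "e x (T (map e (B @ z # y # C))) p = - e x (T (map e (B @ y # z # C))) p" if "x < 8" "B @ y # z # C \<in> tuples 3"
    proof -
      have "e x (T (map e (B @ z # y # C))) p = e x (\<lambda>q. - T (map e (B @ y # z # C)) q) p"
        using form_swap[OF torsion_form, of "map e B" "e y" "e z" "map e C" W] map_vfs[OF that(2)] i that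
        by (intro vf_local[OF e_vf[OF that(1)] smT _ p]) simp_all
      then show ?thesis using vf_minus[OF e_vf[OF that(1)] smT[OF that(2)] p] by simp
    qed
    then show "\<tau> x (B @ z # y # C) = - \<tau> x (B @ y # z # C)" using i by (simp add: \<tau>_def)
  qed
  have D1: "e x (hodge_star M A g vol 3 T (map e J)) p = 1/6 * (\<Sum>K\<in>tuples 3. \<tau> x K * eps p (K @ J))"
    if "x < 8" "J \<in> tuples 5" for x J
  proof -
    have s: "sm W (\<lambda>q. eps p (K @ J) * T (map e K) q)" if "K \<in> tuples 3" for K by (rule sm_cmult[OF smT[OF that]])
    have s1: "sm W (\<lambda>q. \<Sum>K\<in>tuples 3. eps p (K @ J) * T (map e K) q)" by (rule sm_sum[OF W_open s])
    have s': "sm W (\<lambda>q. 1/6 * (\<Sum>K\<in>tuples 3. eps p (K @ J) * T (map e K) q))" by (rule sm_cmult[OF s1])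
    have "e x (\<lambda>q. 1/6 * (\<Sum>K\<in>tuples 3. eps p (K @ J) * T (map e K) q)) p = e x (hodge_star M A g vol 3 T (map e J)) p"
      by (rule vf_local[OF e_vf[OF that(1)] s' _ p]) (simp only: hodge_frame[OF _ p that(2)])
    moreover have "e x (\<lambda>q. 1/6 * (\<Sum>K\<in>tuples 3. eps p (K @ J) * T (map e K) q)) p = 1/6 * (\<Sum>K\<in>tuples 3. e x (\<lambda>q. eps p (K @ J) * T (map e K) q) p)"
      unfolding vf_cmult[OF e_vf[OF that(1)] s1 p]
      by (rule arg_cong[of _ _ "times (1/6)"]) (rule vf_sum[OF e_vf[OF that(1)] p s])
    moreover have "e x (\<lambda>q. eps p (K @ J) * T (map e K) q) p = \<tau> x K * eps p (K @ J)" if "K \<in> tuples 3" for K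
      using vf_cmult[OF e_vf[OF \<open>x < 8\<close>] smT[OF that] p] \<open>x < 8\<close> that by (simp add: \<tau>_def)
    ultimately show ?thesis by simp
  qed
  have D2: "hodge_star M A g vol 3 T (bracket (e x) (e y) # map e L) p = 1/6 * (\<Sum>K\<in>tuples 3. \<Sum>s<8. t K * c x y s * eps p (K @ s # L))"
    if "x < 8" "y < 8" "L \<in> tuples 4" for x y L
  proof -
    have bv: "vf W (bracket (e x) (e y))" using that e_vf vf_bracket by blast
    have m: "bracket (e x) (e y) # map e L \<in> vfs W 5" using map_vfs[OF that(3)] bv by (simp add: vfields_def)
    have "vol (map e K @ bracket (e x) (e y) # map e L) p = (\<Sum>s<8. c x y s * eps p (K @ s # L))" if K: "K \<in> tuples 3" for K
    proof -
      have m8: "map e K @ bracket (e x) (e y) # map e L \<in> vfs W 8"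
        using map_vfs[OF \<open>L \<in> tuples 4\<close>] map_vfs[OF K] bv by (auto simp: vfields_def)
      have lK: "length K = 3" using K by (simp add: tuples_def)
      have "vol (map e K @ e s # map e L) p = eps p (K @ s # L)" if "s < 8" for s
        using that K \<open>L \<in> tuples 4\<close> by (auto simp: eps_def tuples_def)
      then show ?thesis
        using tens_expand[OF fr tens_vol m8, of 3 p] p lK by (simp add: list_update_append nth_append c_def)
    qed
    then show ?thesis
      using hodge_T[OF fr p p m W_open] by (simp add: t_def sum_distrib_left mult.assoc)
  qed
  have ext: "ext_d (hodge_star M A g vol 3 T) (map e I) p
     = 1/6 * (\<Sum>i<6. (-1) ^ i * (\<Sum>K\<in>tuples 3. \<tau> (I ! i) K * eps p (K @ omit i I)))
     + 1/6 * (\<Sum>j<6. \<Sum>i<j. (-1) ^ (i + j) * (\<Sum>K\<in>tuples 3. \<Sum>s<8. t K * c (I ! i) (I ! j) s * eps p (K @ s # omit i (omit j I))))"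
    if I: "I \<in> tuples 6" for I
  proof -
    have l: "length I = 6" using I by (simp add: tuples_def)
    have n: "I ! i < 8" if "i < 6" for i using I that subsetD[of "set I" "{..<8}" "I ! i"] by (simp add: tuples_def)
    have o: "omit i I \<in> tuples 5" if "i < 6" for i
      using I that by (auto simp: tuples_def omit_def dest: in_set_takeD in_set_dropD)
    have oo: "omit i (omit j I) \<in> tuples 4" if "i < j" "j < 6" for i j
      using o[OF that(2)] that by (auto simp: tuples_def omit_def[of i] dest: in_set_takeD in_set_dropD)
    have mo: "omit i (map e J) = map e (omit i J)" for i J by (simp add: omit_def take_map drop_map)
    have 1: "(\<Sum>i<6. (-1) ^ i * (map e I ! i) (hodge_star M A g vol 3 T (omit i (map e I))) p)
      = 1/6 * (\<Sum>i<6. (-1) ^ i * (\<Sum>K\<in>tuples 3. \<tau> (I ! i) K * eps p (K @ omit i I)))"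
      unfolding sum_distrib_left[of "1/6"]
      by (intro sum.cong refl) (use l n o in \<open>simp add: mo D1\<close>)
    have 2: "(\<Sum>j<6. \<Sum>i<j. (-1) ^ (i + j) * hodge_star M A g vol 3 T (bracket (map e I ! i) (map e I ! j) # omit i (omit j (map e I))) p)
      = 1/6 * (\<Sum>j<6. \<Sum>i<j. (-1) ^ (i + j) * (\<Sum>K\<in>tuples 3. \<Sum>s<8. t K * c (I ! i) (I ! j) s * eps p (K @ s # omit i (omit j I))))"
      unfolding sum_distrib_left[of "1/6"]
      by (intro sum.cong refl) (use l n oo in \<open>simp add: mo D2\<close>)
    show ?thesis using 1 2 l by (simp add: ext_d_def)
  qed
  have "(\<Sum>I\<in>tuples 6. ext_d (hodge_star M A g vol 3 T) (map e I) p * eps p (I @ [a, b]))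
    = 1/6 * (\<Sum>I\<in>tuples 6. (\<Sum>i<6. (-1) ^ i * (\<Sum>K\<in>tuples 3. \<tau> (I ! i) K * eps p (K @ omit i I))) * eps p (I @ [a, b]))
    + 1/6 * (\<Sum>I\<in>tuples 6. (\<Sum>j<6. \<Sum>i<j. (-1) ^ (i + j) *
        (\<Sum>K\<in>tuples 3. \<Sum>s<8. t K * c (I ! i) (I ! j) s * eps p (K @ s # omit i (omit j I)))) * eps p (I @ [a, b]))"
    unfolding sum_distrib_left[of "1/6"] sum.distrib[symmetric] by (intro sum.cong refl) (simp add: ext distrib_right)
  \<comment> \<open>The factor 1/3! of the inner star turns 4320 and 2160 into 720 and 360.\<close>
  also have "\<dots> = 720 * (\<Sum>x<8. \<tau> x [x, a, b])
    - 360 * (\<Sum>x<8. \<Sum>y<8. t [x, y, a] * c x y b - t [x, y, b] * c x y a + t [x, a, b] * c x y y - t [y, a, b] * c x y x)"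
    unfolding lc.divergence_first[of \<tau>, OF \<tau>_alt ab] lc.divergence_second[OF t_alt ab] by simp
  also have "\<dots> = 720 * (\<Sum>x<8. nab T [e x, e x, e a, e b] p)"
  proof -
    have tt: "t [y, x, z] = - t [x, y, z]" "t [x, z, y] = - t [x, y, z]" for x y z
      using alternatingD[OF t_alt, of "[]" x y "[z]"] alternatingD[OF t_alt, of "[x]" y z "[]"] by simp_all
    have gd: "g [D (e x) (e y), e s] p = - g [D (e x) (e s), e y] p" if "x < 8" "y < 8" "s < 8" for x y s
    proof -
      have "e x (g [e y, e s]) p = e x (\<lambda>_. if y = s then 1 else 0) p"
        by (rule vf_local[OF e_vf[OF that(1)] g_sm[OF e_vf[OF that(2)] e_vf[OF that(3)]] _ p])
          (rule frame_props(3)[OF fr that(2,3)])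
      then have "e x (g [e y, e s]) p = 0" using vf_const[OF e_vf[OF that(1)] p] by simp
      then show ?thesis
        using g_deriv[OF e_vf[OF that(1)] e_vf[OF that(2)] e_vf[OF that(3)] p]
          g_sym[OF e_vf[OF that(2)] D_vf[OF e_vf[OF that(1)] e_vf[OF that(3)]] p] by simp
    qed
    have Gs: "G x s y = - G x y s" if "x < 8" "y < 8" "s < 8" for x y s
      using gd[of x s y] that by (simp add: G_def)
    have cG: "c x y s = G x y s - G y x s - t [x, y, s]" if "x < 8" "y < 8" "s < 8" for x y s
    proof -
      have "T [e x, e y, e s] p = G x y s - G y x s - c x y s"
        using that p e_vf by (simp add: T_eq tor_def G_def c_def g_diff[of p W] vf_closed)
      then show ?thesis using that by (simp add: t_def tuples_def)
    qed
    have N: "nab T [e x, e x, e a, e b] p = \<tau> x [x, a, b] - (\<Sum>y<8. G x x y * t [y, a, b] + G x a y * t [x, y, b] + G x b y * t [x, a, y])"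
      if x: "x < 8" for x
    proof -
      have m: "[e x, e a, e b] \<in> vfs W 3" using x ab e_vf by (simp add: vfs3)
      have q: "T ([e x, e a, e b][i := D (e x) (e z)]) p = (\<Sum>y<8. G x z y * T ([e x, e a, e b][i := e y]) p)" if "i < 3" "z < 8" for i z
      proof -
        have "i = 0 \<or> i = 1 \<or> i = 2" using that(1) by auto
        then show ?thesis
          using tens_expand[OF fr tens_T vfs_update[OF m D_vf[OF e_vf[OF x] e_vf[OF that(2)]]] that(1) order_refl p, of i]
          by (elim disjE) (simp_all add: G_def numeral_2_eq_2)
      qed
      have "nab T [e x, e x, e a, e b] p = e x (T [e x, e a, e b]) p
        - (T ([e x, e a, e b][0 := D (e x) (e x)]) p + T ([e x, e a, e b][1 := D (e x) (e a)]) p + T ([e x, e a, e b][2 := D (e x) (e b)]) p)"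
        by (simp add: nab_Cons numeral_eq_Suc)
      also have "T ([e x, e a, e b][0 := D (e x) (e x)]) p = (\<Sum>y<8. G x x y * t [y, a, b])"
        using q[of 0 x] x ab by (simp add: t_def tuples_def)
      also have "T ([e x, e a, e b][1 := D (e x) (e a)]) p = (\<Sum>y<8. G x a y * t [x, y, b])"
        using q[of 1 a] x ab by (simp add: t_def tuples_def)
      also have "T ([e x, e a, e b][2 := D (e x) (e b)]) p = (\<Sum>y<8. G x b y * t [x, a, y])"
        using q[of 2 b] x ab by (simp add: t_def tuples_def)
      finally show ?thesis using x ab by (simp add: \<tau>_def tuples_def sum.distrib)
    qed
    \<comment> \<open>The bracket expression is \<open>Z x y + Z y x\<close>, so its double sum is
      twice that of \<open>Z\<close>; this raises 360 to 720.\<close>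
    define Z where "Z x y = t [x, y, a] * G x y b - t [x, y, b] * G x y a + t [y, a, b] * G x x y" for x y
    have z: "t [x, y, a] * c x y b - t [x, y, b] * c x y a + t [x, a, b] * c x y y - t [y, a, b] * c x y x = Z x y + Z y x"
      if xy: "x < 8" "y < 8" for x y
    proof -
      have 0: "t [x, y, y] = 0" "t [x, y, x] = 0" "G x y y = 0" "G y x x = 0"
        using tt(2)[of x y y] tt(1)[of x y x] tt(2)[of y x x] Gs[of x y y] Gs[of y x x] xy by simp_all
      show ?thesis
        unfolding Z_def cG[OF xy ab(1)] cG[OF xy ab(2)] cG[OF xy xy(2)] cG[OF xy xy(1)] tt(1)[of y x a] tt(1)[of y x b]
          Gs[of y x y, OF xy(2) xy] Gs[of x x y, OF xy(1) xy(1) xy(2)]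
        using 0 by (simp add: algebra_simps)
    qed
    have "(\<Sum>x<8. \<Sum>y<8. Z x y + Z y x) = 2 * (\<Sum>x<8. \<Sum>y<8. Z x y)"
      using sum.swap[of "\<lambda>x y. Z y x" "{..<8}" "{..<8}"] by (simp add: sum.distrib)
    moreover have "nab T [e x, e x, e a, e b] p = \<tau> x [x, a, b] - (\<Sum>y<8. Z x y)" if "x < 8" for x
    proof -
      have "G x x y * t [y, a, b] + G x a y * t [x, y, b] + G x b y * t [x, a, y] = Z x y" if "y < 8" for y
        using Gs[of x y a] Gs[of x y b] tt(2)[of x y a] \<open>x < 8\<close> that ab by (simp add: Z_def algebra_simps)
      then show ?thesis using N[OF that] by simp
    qed
    ultimately show ?thesis using z by (simp add: sum_subtractf)
  qed
  finally show ?thesis .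
qed

end

context oriented_connection8 begin

text \<open>The frame in the conclusion is the one that the outer star selects at p;
  \<open>codiff_trace\<close> later frees the formula from it.\<close>

lemma codiff_T:
  assumes p: "p \<in> V" and Y: "vf V Y" "vf V Z"
  shows "\<exists>W e. p \<in> W \<and> oriented_orthonormal_frame M A g vol W e \<and>
    codiff M A g vol 3 T [Y, Z] p = - (\<Sum>x<8. nab T [e x, e x, Y, Z] p)"
proof -
  define e where "e = (SOME e. \<exists>W. p \<in> W \<and> oriented_orthonormal_frame M A g vol W e)"
  have V: "openin M V" using Y vf_openin by blast
  then obtain W where W: "p \<in> W" "oriented_orthonormal_frame M A g vol W e"
    using chosen_frame[OF subsetD[OF openin_subset[OF V] p]] unfolding e_def[symmetric] by blast
  interpret oriented_frame8 M A D g vol W e by unfold_locales (rule W(2))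
  have U: "openin M (V \<inter> W)" using V W_open by blast
  have eU: "vf (V \<inter> W) (e s)" if "s < 8" for s using vf_restrict[OF e_vf[OF that] U] by blast
  note YU = Y[THEN vf_restrict[OF _ U Int_lower1]]
  have pU: "p \<in> V \<inter> W" using p W by blast
  have vv: "vol (map e I @ [Y, Z]) p = (\<Sum>a<8. \<Sum>b<8. g [Y, e a] p * g [Z, e b] p * eps p (I @ [a, b]))" if I: "I \<in> tuples 6" for I
  proof -
    have l: "length I = 6" using I by (simp add: tuples_def)
    have m: "map e I @ [X, X'] \<in> vfs (V \<inter> W) 8" if "vf (V \<inter> W) X" "vf (V \<inter> W) X'" for X X'
      using I that eU by (auto simp: vfields_def tuples_def)
    have "vol (map e I @ [Y, Z]) p = (\<Sum>a<8. g [Y, e a] p * vol (map e I @ [e a, Z]) p)"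
      using tens_expand[OF fr tens_vol m[OF YU], of 6 p] pU l by (simp add: list_update_append nth_append)
    also have "\<dots> = (\<Sum>a<8. g [Y, e a] p * (\<Sum>b<8. g [Z, e b] p * eps p (I @ [a, b])))"
    proof (intro sum.cong refl)
      fix a :: nat assume a: "a \<in> {..<8}"
      have "vol (map e I @ [e a, e b]) p = eps p (I @ [a, b])" if "b < 8" for b
        using I a that by (auto simp: eps_def tuples_def)
      then have "vol (map e I @ [e a, Z]) p = (\<Sum>b<8. g [Z, e b] p * eps p (I @ [a, b]))"
        using tens_expand[OF fr tens_vol m[OF eU YU(2)], of a 7 p] pU l a by (simp add: list_update_append nth_append)
      then show "g [Y, e a] p * vol (map e I @ [e a, Z]) p = g [Y, e a] p * (\<Sum>b<8. g [Z, e b] p * eps p (I @ [a, b]))" by simp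
    qed
    finally show ?thesis by (simp add: sum_distrib_left mult.assoc)
  qed
  have nn: "nab T [e x, e x, Y, Z] p = (\<Sum>a<8. \<Sum>b<8. g [Y, e a] p * g [Z, e b] p * nab T [e x, e x, e a, e b] p)" if x: "x < 8" for x
  proof -
    have tn: "tens 4 (nab T)" using tens_nab[OF tens_T] by simp
    have "nab T [e x, e x, Y, Z] p = (\<Sum>a<8. g [Y, e a] p * nab T [e x, e x, e a, Z] p)"
      using tens_expand[OF fr tn, of "[e x, e x, Y, Z]" "V \<inter> W" 2 p] pU YU eU[OF x] by (simp add: vfs4)
    also have "\<dots> = (\<Sum>a<8. g [Y, e a] p * (\<Sum>b<8. g [Z, e b] p * nab T [e x, e x, e a, e b] p))"
    proof (intro sum.cong refl)
      fix a :: nat assume a: "a \<in> {..<8}"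
      show "g [Y, e a] p * nab T [e x, e x, e a, Z] p = g [Y, e a] p * (\<Sum>b<8. g [Z, e b] p * nab T [e x, e x, e a, e b] p)"
        using tens_expand[OF fr tn, of "[e x, e x, e a, Z]" "V \<inter> W" 3 p] pU YU eU[OF x] eU[of a] a by (simp add: vfs4)
    qed
    finally show ?thesis by (simp add: sum_distrib_left mult.assoc)
  qed
  \<comment> \<open>The outer star acts in degree 9 - 3 = 6, and its factor 1/6! will cancel the 720
    of \<open>codiff_frame\<close>.\<close>
  have "codiff M A g vol 3 T [Y, Z] p = - (1/720 * (\<Sum>I\<in>tuples 6. ext_d (hodge_star M A g vol 3 T) (map e I) p * vol (map e I @ [Y, Z]) p))"
    unfolding codiff_def hodge_star_def[of M A g vol "9 - 3"] e_def[symmetric] Let_def by (simp add: tuples_def fact_numeral)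
  also have "(\<Sum>I\<in>tuples 6. ext_d (hodge_star M A g vol 3 T) (map e I) p * vol (map e I @ [Y, Z]) p)
    = (\<Sum>I\<in>tuples 6. \<Sum>a<8. \<Sum>b<8. g [Y, e a] p * g [Z, e b] p * (ext_d (hodge_star M A g vol 3 T) (map e I) p * eps p (I @ [a, b])))"
    by (intro sum.cong refl) (simp add: vv sum_distrib_left mult_ac)
  also have "\<dots> = (\<Sum>a<8. \<Sum>b<8. \<Sum>I\<in>tuples 6. g [Y, e a] p * g [Z, e b] p * (ext_d (hodge_star M A g vol 3 T) (map e I) p * eps p (I @ [a, b])))"
    by (subst sum.swap, rule sum.cong[OF refl], rule sum.swap)
  also have "\<dots> = (\<Sum>a<8. \<Sum>b<8. g [Y, e a] p * g [Z, e b] p * (720 * (\<Sum>x<8. nab T [e x, e x, e a, e b] p)))"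
    by (intro sum.cong refl) (simp add: codiff_frame[OF W(1)] flip: sum_distrib_left)
  also have "\<dots> = (\<Sum>a<8. \<Sum>b<8. \<Sum>x<8. 720 * (g [Y, e a] p * g [Z, e b] p * nab T [e x, e x, e a, e b] p))"
    by (simp add: sum_distrib_left mult_ac)
  also have "\<dots> = (\<Sum>a<8. \<Sum>x<8. \<Sum>b<8. 720 * (g [Y, e a] p * g [Z, e b] p * nab T [e x, e x, e a, e b] p))"
    by (rule sum.cong[OF refl]) (rule sum.swap)
  also have "\<dots> = (\<Sum>x<8. \<Sum>a<8. \<Sum>b<8. 720 * (g [Y, e a] p * g [Z, e b] p * nab T [e x, e x, e a, e b] p))"
    by (rule sum.swap)
  also have "\<dots> = 720 * (\<Sum>x<8. nab T [e x, e x, Y, Z] p)"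
    by (simp add: nn sum_distrib_left)
  finally have "codiff M A g vol 3 T [Y, Z] p = - (\<Sum>x<8. nab T [e x, e x, Y, Z] p)" by simp
  then show ?thesis using W by blast
qed

end

section \<open>Adapted frames\<close>

lemma skew4_scale: "skew4 S \<Longrightarrow> skew4 (\<lambda>a b c d. k * S a b c d)"
  unfolding skew4_def by (metis mult_minus_right)

lemma act4_scale: "act4 H (\<lambda>a b c d. k * t a b c d) a b c d = k * act4 H t a b c d"
  unfolding act4_def sum_distrib_left[of k] by (rule sum.cong[OF refl]) (simp add: algebra_simps)

text \<open>Psi has the same constant components at all points of \<open>W\<close>, so directional
  derivatives do not see it.\<close>

locale adapted8 = frame8 M A D g W e ix
  for M :: "'m topology" and A :: "'m chart set" and D :: "'m vfield \<Rightarrow> 'm vfield \<Rightarrow> 'm vfield" and g :: "'m tensor"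
    and W :: "'m set" and e :: "nat \<Rightarrow> 'm vfield" and ix :: "8 \<Rightarrow> nat" +
  fixes \<Psi> :: "'m tensor"
  assumes tens_Psi: "tens 4 \<Psi>" and parallel_Psi: "parallel M A D 4 \<Psi>"
    and Psi_frame: "\<And>a b c d p. p \<in> W \<Longrightarrow> \<Psi> [E a, E b, E c, E d] p = psi8 ix a b c d"
begin

sublocale index8 ix
  by unfold_locales (rule ix)

abbreviation "\<psi> \<equiv> psi8 ix"

sublocale spin7_form \<psi>
  by (rule psi8_cubic)

lemma E_deriv: "p \<in> W \<Longrightarrow> sm W f \<Longrightarrow> (\<And>q. q \<in> W \<Longrightarrow> f q = h q) \<Longrightarrow> E u f p = E u h p"
  by (rule vf_local[OF E_vf])

lemma E_const: "p \<in> W \<Longrightarrow> E u (\<lambda>_. c) p = 0"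
  by (rule vf_const[OF E_vf])

text \<open>For a parallel tensor with constant components only the action of the connection matrix
  remains in the covariant derivative.\<close>

lemma \<Gamma>_psi: "p \<in> W \<Longrightarrow> act4 (\<Gamma> p u) \<psi> a b c d = 0"
proof -
  assume p: "p \<in> W"
  have v: "[E a, E b, E c, E d] \<in> vfs W 4" by (simp add: vfs4)
  have "E u (\<Psi> [E a, E b, E c, E d]) p = E u (\<lambda>_. \<psi> a b c d) p"
    by (rule E_deriv[OF p tens_sm[OF tens_Psi W_open v] Psi_frame])
  moreover have "cov_deriv D (E u) \<Psi> [E a, E b, E c, E d] p = 0"
    using parallel_Psi v p W_open unfolding parallel_def tensor_eq_def by (meson E_vf order_refl)
  ultimately have "nab \<Psi> (E u # map E [a, b, c, d]) p = 0" "E u (\<Psi> (map E [a, b, c, d])) p = 0"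
    using E_const[OF p] by (simp_all add: nab_def)
  then show ?thesis
    using nabE[OF tens_Psi, of "[a, b, c, d]" p u] p
    by (simp add: act4_def Psi_frame numeral_eq_Suc sum.distrib)
qed

lemma rotation: "p \<in> W \<Longrightarrow> spin7_rotation \<psi> (\<Gamma> p u)"
  by unfold_locales (rule \<Gamma>_skew \<Gamma>_psi, assumption)+

text \<open>The curvature endomorphism annihilates the parallel tensor Psi, and the stabiliser of
  Psi is spin(7). This concerns the last pair of R; the instanton condition concerns the
  first.\<close>

lemma R_spin7: "p \<in> W \<Longrightarrow> spin7 (Rc p a b)"
proof -
  assume p: "p \<in> W"
  have "act4 (Rc p a b) \<psi> c d k l = 0" for c d k l
  proof -
    have v: "[E c, E d, E k, E l] \<in> vfs W 4" by (simp add: vfs4)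
    have cv: "vf W (curvature D (E a) (E b) X)" if "vf W X" for X using that by (simp add: vf_curvature)
    have ex: "\<Psi> ([E c, E d, E k, E l][i := curvature D (E a) (E b) X]) p
        = (\<Sum>s\<in>UNIV. R [E a, E b, X, E s] p * \<Psi> ([E c, E d, E k, E l][i := E s]) p)" if "i < 4" "vf W X" for i X
    proof -
      have "i = 0 \<or> i = 1 \<or> i = 2 \<or> i = 3" using that(1) by auto
      moreover have "R [E a, E b, X, E s] p = g [curvature D (E a) (E b) X, E s] p" for s by (simp add: R_eq)
      ultimately show ?thesis
        using expandE[OF tens_Psi vfs_update[OF v cv[OF that(2)]] that(1) order_refl p, of i]
        by (elim disjE) (simp_all add: numeral_2_eq_2 numeral_3_eq_3)
    qed
    have "(\<Sum>i<4. \<Psi> ([E c, E d, E k, E l][i := curvature D (E a) (E b) ([E c, E d, E k, E l] ! i)]) p) = 0"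
      by (rule parallel_curvature[OF tens_Psi parallel_Psi v E_vf E_vf p])
    then have "\<Psi> ([E c, E d, E k, E l][0 := curvature D (E a) (E b) (E c)]) p
       + \<Psi> ([E c, E d, E k, E l][1 := curvature D (E a) (E b) (E d)]) p
       + \<Psi> ([E c, E d, E k, E l][2 := curvature D (E a) (E b) (E k)]) p
       + \<Psi> ([E c, E d, E k, E l][3 := curvature D (E a) (E b) (E l)]) p = 0"
      by (simp add: eval_nat_numeral)
    then show ?thesis using p by (simp only: ex E_vf) (simp add: Psi_frame act4_def Rc_def sum.distrib)
  qed
  then show ?thesis unfolding spin7_def using psi8_spin7[of "Rc p a b"] Rc_skew(2)[OF p] by blast
qed

lemma Nc_skew: "p \<in> W \<Longrightarrow> skew3 (Nc p u)"
proof -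
  assume p: "p \<in> W"
  have e: "Nc p u = (\<lambda>a b c. E u (\<lambda>q. Tc q a b c) p - act3 (\<Gamma> p u) (Tc p) a b c)"
    using p by (simp add: Nc_eq act3_def fun_eq_iff)
  have "E u (\<lambda>q. Tc q b a c) p = - E u (\<lambda>q. Tc q a b c) p" "E u (\<lambda>q. Tc q a c b) p = - E u (\<lambda>q. Tc q a b c) p" for a b c
  proof -
    have "E u (\<lambda>q. Tc q b a c) p = E u (\<lambda>q. - Tc q a b c) p" "E u (\<lambda>q. Tc q a c b) p = E u (\<lambda>q. - Tc q a b c) p"
      by (rule E_deriv[OF p sm_comp(1)], rule skew3D[OF Tc_skew], assumption)+
    then show "E u (\<lambda>q. Tc q b a c) p = - E u (\<lambda>q. Tc q a b c) p" "E u (\<lambda>q. Tc q a c b) p = - E u (\<lambda>q. Tc q a b c) p"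
      using vf_minus[OF E_vf sm_comp(1) p] by simp_all
  qed
  note h = this
  have k: "act3 (\<Gamma> p u) (Tc p) b a c = - act3 (\<Gamma> p u) (Tc p) a b c"
    "act3 (\<Gamma> p u) (Tc p) a c b = - act3 (\<Gamma> p u) (Tc p) a b c" for a b c
    by (rule skew3D[OF act3_skew[OF Tc_skew[OF p]]])+
  show ?thesis unfolding skew3_def e
  proof (intro conjI allI)
    fix a b c
    show "E u (\<lambda>q. Tc q b a c) p - act3 (\<Gamma> p u) (Tc p) b a c = - (E u (\<lambda>q. Tc q a b c) p - act3 (\<Gamma> p u) (Tc p) a b c)"
      unfolding h(1)[of b a c] k(1)[of b a c] by simp
    show "E u (\<lambda>q. Tc q a c b) p - act3 (\<Gamma> p u) (Tc p) a c b = - (E u (\<lambda>q. Tc q a b c) p - act3 (\<Gamma> p u) (Tc p) a b c)"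
      unfolding h(2)[of a c b] k(2)[of a c b] by simp
  qed
qed

lemma S_skew: "p \<in> W \<Longrightarrow> skew4 (\<lambda>a b c d. 1/2 * skewmix (Tc p) (Tc p) a b c d)"
  by (rule skew4_scale[OF skewmix_skew4[OF Tc_skew Tc_skew]])

lemma torsion_square:
  assumes "p \<in> W"
  shows "(\<Sum>s\<in>UNIV. Tc p a b s * Tc p s c d + Tc p b c s * Tc p s a d + Tc p c a s * Tc p s b d)
    = 1/2 * skewmix (Tc p) (Tc p) a b c d"
  unfolding skewmix_def sum_distrib_left
proof (intro sum.cong refl)
  fix s
  note t = skew3D(4)[OF Tc_skew[OF assms]]
  show "Tc p a b s * Tc p s c d + Tc p b c s * Tc p s a d + Tc p c a s * Tc p s b d
    = 1/2 * (Tc p a b s * Tc p c d s + Tc p b c s * Tc p a d s + Tc p c a s * Tc p b d s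
      + Tc p c d s * Tc p a b s + Tc p a d s * Tc p b c s + Tc p b d s * Tc p c a s)"
    using t[of c d s] t[of a d s] t[of b d s] by simp
qed

text \<open>The second hypothesis is \<open>d_nabla D T\<close> = 0 in components; it collapses the
  cyclic sum of derivatives of T to the single one in direction d.\<close>

lemma bianchi_parallel:
  assumes "p \<in> W" "\<And>a b c d. Nc p a b c d + Nc p b c a d + Nc p c a b d = Nc p d a b c"
  shows "Rc p a b c d + Rc p b c a d + Rc p c a b d = Nc p d a b c + 1/2 * skewmix (Tc p) (Tc p) a b c d"
  using first_bianchiE[OF assms(1), of a b c d] assms(2)[of a b c d] torsion_square[OF assms(1)] by simp

end

section \<open>The three conditions on T and R in an adapted frame\<close>

text \<open>The conditions are imposed on all of \<open>W\<close>, since they must be differentiated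
  before being evaluated at a point.\<close>

locale adapted8_instanton = adapted8 +
  assumes instanton: "\<And>p c d. p \<in> W \<Longrightarrow> spin7 (\<lambda>a b. Rc p a b c d)"
    and closed: "\<And>p a b c d. p \<in> W \<Longrightarrow> Nc p a b c d + Nc p b c a d + Nc p c a b d = Nc p d a b c"
    and trace: "\<And>p a b. p \<in> W \<Longrightarrow> (\<Sum>x\<in>UNIV. Nc p x x a b) = 0"
begin

lemma base: "p \<in> W \<Longrightarrow> spin7_bianchi \<psi> (Rc p) (Nc p) (\<lambda>a b c d. 1/2 * skewmix (Tc p) (Tc p) a b c d)"
  by unfold_locales
    (assumption | rule Rc_skew instanton R_spin7 Nc_skew S_skew closed trace bianchi_parallel)+

lemma DRc_act: "p \<in> W \<Longrightarrow> DRc p u a b c d = E u (\<lambda>q. Rc q a b c d) p - act4 (\<Gamma> p u) (Rc p) a b c d"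
  by (simp add: DRc_eq act4_def)

lemma DNc_act: "p \<in> W \<Longrightarrow> DNc p u a b c d = E u (\<lambda>q. Nc q a b c d) p - act4 (\<Gamma> p u) (Nc p) a b c d"
  by (simp add: DNc_eq act4_def)

lemma Nc_act: "p \<in> W \<Longrightarrow> Nc p u a b c = E u (\<lambda>q. Tc q a b c) p - act3 (\<Gamma> p u) (Tc p) a b c"
  by (simp add: Nc_eq act3_def)

lemma E_plus: "p \<in> W \<Longrightarrow> sm W f \<Longrightarrow> sm W h \<Longrightarrow> E u (\<lambda>q. f q + h q) p = E u f p + E u h p"
  by (rule vf_plus[OF E_vf])

lemma E_cmult: "p \<in> W \<Longrightarrow> sm W f \<Longrightarrow> E u (\<lambda>q. c * f q) p = c * E u f p"
  by (rule vf_cmult[OF E_vf])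

lemma E_times: "p \<in> W \<Longrightarrow> sm W f \<Longrightarrow> sm W h \<Longrightarrow> E u (\<lambda>q. f q * h q) p = f p * E u h p + E u f p * h p"
  by (rule vf_times[OF E_vf])

lemma E_minus: "p \<in> W \<Longrightarrow> sm W f \<Longrightarrow> E u (\<lambda>q. - f q) p = - E u f p"
  by (rule vf_minus[OF E_vf])

lemma E_sum: "p \<in> W \<Longrightarrow> (\<And>i. i \<in> I \<Longrightarrow> sm W (f i)) \<Longrightarrow> E u (\<lambda>q. \<Sum>i\<in>I. f i q) p = (\<Sum>i\<in>I. E u (f i) p)"
  by (rule vf_sum[OF E_vf])

text \<open>In an adapted frame the spin(7) equation has constant coefficients and can be
  differentiated term by term.\<close>

lemma E_spin7:
  assumes p: "p \<in> W" and sm: "\<And>a b. sm W (\<lambda>q. F q a b)" and F: "\<And>q. q \<in> W \<Longrightarrow> spin7 (F q)"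
  shows "spin7 (\<lambda>a b. E u (\<lambda>q. F q a b) p)"
  unfolding spin7_def
proof (intro allI)
  fix k l
  have s1: "sm W (\<lambda>q. \<psi> a b k l * F q a b)" for a b by (rule sm_cmult[OF sm])
  have s2: "sm W (\<lambda>q. \<Sum>b\<in>UNIV. \<psi> a b k l * F q a b)" for a by (rule sm_sum[OF W_open s1])
  have s3: "sm W (\<lambda>q. \<Sum>a\<in>UNIV. \<Sum>b\<in>UNIV. \<psi> a b k l * F q a b)" by (rule sm_sum[OF W_open s2])
  have "E u (\<lambda>q. \<Sum>a\<in>UNIV. \<Sum>b\<in>UNIV. \<psi> a b k l * F q a b) p = E u (\<lambda>q. 2 * F q k l) p"
    by (rule E_deriv[OF p s3]) (use spin7D[OF F] in \<open>simp add: mult.commute\<close>)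
  then show "(\<Sum>a\<in>UNIV. \<Sum>b\<in>UNIV. E u (\<lambda>q. F q a b) p * \<psi> a b k l) = 2 * E u (\<lambda>q. F q k l) p"
    unfolding E_sum[OF p s2] E_sum[OF p s1] E_cmult[OF p sm] by (simp add: mult.commute)
qed

text \<open>The Leibniz rule on a symmetric quadratic expression yields two equal halves, which
  absorb the factor 1/2.\<close>

lemma E_skewmix:
  assumes p: "p \<in> W"
  shows "E u (\<lambda>q. 1/2 * skewmix (Tc q) (Tc q) a b c d) p = skewmix (\<lambda>a b c. E u (\<lambda>q. Tc q a b c) p) (Tc p) a b c d"
proof -
  have s1: "sm W (\<lambda>q. Tc q a b s * Tc q c d s)" for a b c d s by (rule sm_mult[OF sm_comp(1) sm_comp(1)])
  have s2: "sm W (\<lambda>q. Tc q a b s * Tc q c d s + Tc q b c s * Tc q a d s + Tc q c a s * Tc q b d s)" for s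
    by (rule sm_add[OF sm_add[OF s1 s1] s1])
  have "1/2 * skewmix (Tc q) (Tc q) a b c d = (\<Sum>s\<in>UNIV. Tc q a b s * Tc q c d s + Tc q b c s * Tc q a d s + Tc q c a s * Tc q b d s)" for q
    unfolding skewmix_def sum_distrib_left by (intro sum.cong refl) (simp add: mult.commute)
  then have "E u (\<lambda>q. 1/2 * skewmix (Tc q) (Tc q) a b c d) p
    = (\<Sum>s\<in>UNIV. E u (\<lambda>q. Tc q a b s * Tc q c d s + Tc q b c s * Tc q a d s + Tc q c a s * Tc q b d s) p)"
    using E_sum[OF p s2] by simp
  also have "\<dots> = skewmix (\<lambda>a b c. E u (\<lambda>q. Tc q a b c) p) (Tc p) a b c d"
    unfolding skewmix_def E_plus[OF p sm_add[OF s1 s1] s1] E_plus[OF p s1 s1] E_times[OF p sm_comp(1) sm_comp(1)]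
    by (intro sum.cong refl) (simp add: algebra_simps)
  finally show ?thesis .
qed

text \<open>The directional derivative preserves identities with constant coefficients, and the
  action of the connection matrix preserves those invariant under spin(7); their difference is the
  covariant derivative.\<close>

lemma deriv: "p \<in> W \<Longrightarrow> spin7_bianchi \<psi> (DRc p u) (DNc p u) (skewmix (Nc p u) (Tc p))"
proof -
  assume p: "p \<in> W"
  interpret rot: spin7_rotation \<psi> "\<Gamma> p u" by (rule rotation[OF p])
  note DR = DRc_act[OF p] and DN = DNc_act[OF p]
  have dR: "E u (\<lambda>q. Rc q b a c d) p = - E u (\<lambda>q. Rc q a b c d) p" "E u (\<lambda>q. Rc q a b d c) p = - E u (\<lambda>q. Rc q a b c d) p" for a b c d
  proof -
    have "E u (\<lambda>q. Rc q b a c d) p = E u (\<lambda>q. - Rc q a b c d) p" "E u (\<lambda>q. Rc q a b d c) p = E u (\<lambda>q. - Rc q a b c d) p"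
      by (rule E_deriv[OF p sm_comp(2)], rule Rc_skew, assumption)+
    then show "E u (\<lambda>q. Rc q b a c d) p = - E u (\<lambda>q. Rc q a b c d) p" "E u (\<lambda>q. Rc q a b d c) p = - E u (\<lambda>q. Rc q a b c d) p"
      using E_minus[OF p sm_comp(2)] by simp_all
  qed
  have dN: "E u (\<lambda>q. Nc q v b a c) p = - E u (\<lambda>q. Nc q v a b c) p" "E u (\<lambda>q. Nc q v a c b) p = - E u (\<lambda>q. Nc q v a b c) p" for v a b c
  proof -
    have "E u (\<lambda>q. Nc q v b a c) p = E u (\<lambda>q. - Nc q v a b c) p" "E u (\<lambda>q. Nc q v a c b) p = E u (\<lambda>q. - Nc q v a b c) p"
      by (rule E_deriv[OF p sm_comp(3)], rule skew3D[OF Nc_skew], assumption)+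
    then show "E u (\<lambda>q. Nc q v b a c) p = - E u (\<lambda>q. Nc q v a b c) p" "E u (\<lambda>q. Nc q v a c b) p = - E u (\<lambda>q. Nc q v a b c) p"
      using E_minus[OF p sm_comp(3)] by simp_all
  qed
  show ?thesis
  proof unfold_locales
    fix a b c d
    show "DRc p u b a c d = - DRc p u a b c d"
      unfolding DR using dR(1)[of b a c d] act4_skew(1)[of "Rc p" "\<Gamma> p u" b a c d, OF Rc_skew(1)[OF p]] by simp
    show "DRc p u a b d c = - DRc p u a b c d"
      unfolding DR using dR(2)[of a b d c] act4_skew(3)[of "Rc p" "\<Gamma> p u" a b d c, OF Rc_skew(2)[OF p]] by simp
    show "spin7 (\<lambda>a b. DRc p u a b c d)"
      unfolding DR by (intro spin7_diff E_spin7[OF p sm_comp(2) instanton] rot.act_spin7 instanton p)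
    show "spin7 (DRc p u a b)"
      using spin7_diff[OF E_spin7[OF p sm_comp(2) R_spin7] rot.act_spin7_last[of "Rc p" a b]] R_spin7[OF p]
      by (simp add: DR[abs_def])
    show "skew3 (DNc p u d)"
      unfolding skew3_def DN
    proof (intro conjI allI)
      fix a b c
      show "E u (\<lambda>q. Nc q d b a c) p - act4 (\<Gamma> p u) (Nc p) d b a c = - (E u (\<lambda>q. Nc q d a b c) p - act4 (\<Gamma> p u) (Nc p) d a b c)"
        using dN(1)[of d b a c] act4_skew(2)[of "Nc p" "\<Gamma> p u" d b a c, OF skew3D(1)[OF Nc_skew[OF p]]] by simp
      show "E u (\<lambda>q. Nc q d a c b) p - act4 (\<Gamma> p u) (Nc p) d a c b = - (E u (\<lambda>q. Nc q d a b c) p - act4 (\<Gamma> p u) (Nc p) d a b c)"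
        using dN(2)[of d a c b] act4_skew(3)[of "Nc p" "\<Gamma> p u" d a c b, OF skew3D(2)[OF Nc_skew[OF p]]] by simp
    qed
    show "skew4 (skewmix (Nc p u) (Tc p))"
      by (rule skewmix_skew4[OF Nc_skew[OF p] Tc_skew[OF p]])
    have cl: "E u (\<lambda>q. Nc q a b c d) p + E u (\<lambda>q. Nc q b c a d) p + E u (\<lambda>q. Nc q c a b d) p = E u (\<lambda>q. Nc q d a b c) p" for a b c d
      unfolding E_plus[OF p sm_comp(3) sm_comp(3), symmetric] E_plus[OF p sm_add[OF sm_comp(3) sm_comp(3)] sm_comp(3), symmetric]
      by (rule E_deriv[OF p sm_add[OF sm_add[OF sm_comp(3) sm_comp(3)] sm_comp(3)] closed])
    \<comment> \<open>The action is applied to the closedness identity as a whole;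
      \<open>act4_cyclic\<close> separates it into the three terms.\<close>
    have acl: "act4 (\<Gamma> p u) (\<lambda>a b c d. Nc p a b c d + Nc p b c a d + Nc p c a b d) a b c d = act4 (\<Gamma> p u) (Nc p) d a b c" for a b c d
      unfolding closed[OF p] by (rule act4_rotate)
    show "DNc p u a b c d + DNc p u b c a d + DNc p u c a b d = DNc p u d a b c"
      unfolding DN using cl[of a b c d] acl[of a b c d] act4_cyclic[of "\<Gamma> p u" "Nc p" a b c d] by simp
    show "(\<Sum>x\<in>UNIV. DNc p u x x a b) = 0"
    proof -
      have "E u (\<lambda>q. \<Sum>x\<in>UNIV. Nc q x x a b) p = E u (\<lambda>_. 0) p"
        by (rule E_deriv[OF p sm_sum[OF W_open sm_comp(3)] trace])
      moreover have "E u (\<lambda>q. \<Sum>x\<in>UNIV. Nc q x x a b) p = (\<Sum>x\<in>UNIV. E u (\<lambda>q. Nc q x x a b) p)"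
        by (rule E_sum[OF p sm_comp(3)])
      ultimately have "(\<Sum>x\<in>UNIV. E u (\<lambda>q. Nc q x x a b) p) = 0"
        using E_const[OF p, of u 0] by simp
      then show ?thesis using rot.act4_trace[of "Nc p"] trace[OF p] by (simp add: DN sum_subtractf)
    qed
    show "DRc p u a b c d + DRc p u b c a d + DRc p u c a b d = DNc p u d a b c + skewmix (Nc p u) (Tc p) a b c d"
    proof -
      let ?S = "\<lambda>q a b c d. 1/2 * skewmix (Tc q) (Tc q) a b c d"
      have s: "sm W (\<lambda>q. ?S q a b c d)"
      proof -
        have "sm W (\<lambda>q. Tc q a b s * Tc q c d s)" for a b c d s by (rule sm_mult[OF sm_comp(1) sm_comp(1)])
        then show ?thesis unfolding skewmix_def by (intro sm_cmult sm_sum W_open sm_add)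
      qed
      have "E u (\<lambda>q. Rc q a b c d) p + E u (\<lambda>q. Rc q b c a d) p + E u (\<lambda>q. Rc q c a b d) p
        = E u (\<lambda>q. Nc q d a b c + ?S q a b c d) p"
        unfolding E_plus[OF p sm_comp(2) sm_comp(2), symmetric] E_plus[OF p sm_add[OF sm_comp(2) sm_comp(2)] sm_comp(2), symmetric]
        by (rule E_deriv[OF p sm_add[OF sm_add[OF sm_comp(2) sm_comp(2)] sm_comp(2)] bianchi_parallel[OF _ closed]])
      then have 1: "E u (\<lambda>q. Rc q a b c d) p + E u (\<lambda>q. Rc q b c a d) p + E u (\<lambda>q. Rc q c a b d) p
        = E u (\<lambda>q. Nc q d a b c) p + skewmix (\<lambda>a b c. E u (\<lambda>q. Tc q a b c) p) (Tc p) a b c d"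
        using E_plus[OF p sm_comp(3) s] E_skewmix[OF p] by simp
      have "act4 (\<Gamma> p u) (Rc p) a b c d + act4 (\<Gamma> p u) (Rc p) b c a d + act4 (\<Gamma> p u) (Rc p) c a b d
        = act4 (\<Gamma> p u) (\<lambda>a b c d. Nc p d a b c + ?S p a b c d) a b c d"
        unfolding act4_cyclic bianchi_parallel[OF p closed[OF p]] ..
      also have "\<dots> = act4 (\<Gamma> p u) (Nc p) d a b c + act4 (\<Gamma> p u) (?S p) a b c d"
        using act4_add[of "\<Gamma> p u" "\<lambda>a b c d. Nc p d a b c" "?S p" a b c d] act4_rotate[of "\<Gamma> p u" "Nc p" a b c d]
        by (simp only:)
      finally have A: "act4 (\<Gamma> p u) (Rc p) a b c d + act4 (\<Gamma> p u) (Rc p) b c a d + act4 (\<Gamma> p u) (Rc p) c a b d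
        = act4 (\<Gamma> p u) (Nc p) d a b c + act4 (\<Gamma> p u) (?S p) a b c d" .
      have B: "act4 (\<Gamma> p u) (?S p) a b c d = 1/2 * act4 (\<Gamma> p u) (skewmix (Tc p) (Tc p)) a b c d"
        by (rule act4_scale)
      have C: "1/2 * act4 (\<Gamma> p u) (skewmix (Tc p) (Tc p)) a b c d = skewmix (act3 (\<Gamma> p u) (Tc p)) (Tc p) a b c d"
        using rot.act4_skewmix[of "Tc p" a b c d] by simp
      have 2: "act4 (\<Gamma> p u) (Rc p) a b c d + act4 (\<Gamma> p u) (Rc p) b c a d + act4 (\<Gamma> p u) (Rc p) c a b d
        = act4 (\<Gamma> p u) (Nc p) d a b c + skewmix (act3 (\<Gamma> p u) (Tc p)) (Tc p) a b c d"
        unfolding A B C ..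
      have 3: "skewmix (Nc p u) (Tc p) a b c d = skewmix (\<lambda>a b c. E u (\<lambda>q. Tc q a b c) p) (Tc p) a b c d
        - skewmix (act3 (\<Gamma> p u) (Tc p)) (Tc p) a b c d"
        unfolding skewmix_def sum_subtractf[symmetric] Nc_act[OF p] by (intro sum.cong refl) (simp add: algebra_simps)
      show ?thesis unfolding DR DN 3 using 1 2 by simp
    qed
  qed
qed

lemma Nc_zero: "p \<in> W \<Longrightarrow> Nc p a b c d = 0"
proof -
  have jet: "spin7_jet \<psi> (Tc p) (Nc p) (Rc p) (DNc p) (DRc p)" if "p \<in> W" for p
    by (rule spin7_jet.intro[OF spin7_form_axioms spin7_jet_axioms.intro])
      (rule Tc_skew[OF that] base[OF that] deriv[OF that] second_bianchiE[OF that])+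
  assume p: "p \<in> W"
  interpret j: spin7_jet \<psi> "Tc p" "Nc p" "Rc p" "DNc p" "DRc p" by (rule jet[OF p])
  show ?thesis
  proof (rule j.N_zero)
    fix u w
    interpret rot: spin7_rotation \<psi> "\<Gamma> p u" by (rule rotation[OF p])
    let ?I = "\<lambda>f. \<Sum>x\<in>UNIV. \<Sum>y\<in>UNIV. \<Sum>z\<in>UNIV. (f x y z :: real)"
    have s1: "sm W (\<lambda>q. Nc q w x y z * Tc q x y z)" for x y z by (rule sm_mult[OF sm_comp(3,1)])
    note s2 = sm_sum[OF W_open s1] note s3 = sm_sum[OF W_open s2] note s4 = sm_sum[OF W_open s3]
    \<comment> \<open><N_w, T> vanishes at every point of \<open>W\<close>, so its derivative
      vanishes too; this provides the hypothesis of \<open>N_zero\<close>.\<close>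
    have "E u (\<lambda>q. ?I (\<lambda>x y z. Nc q w x y z * Tc q x y z)) p = E u (\<lambda>_. 0) p"
    proof (rule E_deriv[OF p s4])
      fix q assume q: "q \<in> W"
      show "?I (\<lambda>x y z. Nc q w x y z * Tc q x y z) = 0"
        using spin7_jet.uu_zero[OF jet[OF q], of w] unfolding spin7_jet.uu_def[OF jet[OF q]] .
    qed
    then have "?I (\<lambda>x y z. Nc p w x y z * E u (\<lambda>q. Tc q x y z) p + E u (\<lambda>q. Nc q w x y z) p * Tc p x y z) = 0"
      unfolding E_sum[OF p s3] E_sum[OF p s2] E_sum[OF p s1] E_times[OF p sm_comp(3,1)] E_const[OF p] .
    moreover have "?I (\<lambda>x y z. act4 (\<Gamma> p u) (Nc p) w x y z * Tc p x y z + Nc p w x y z * act3 (\<Gamma> p u) (Tc p) x y z) = 0"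
    proof -
      have a: "act4 (\<Gamma> p u) (Nc p) w x y z = (\<Sum>s\<in>UNIV. \<Gamma> p u w s * Nc p s x y z) + act3 (\<Gamma> p u) (Nc p w) x y z" for x y z
        by (simp add: act4_def act3_def sum.distrib)
      \<comment> \<open>The action on the free index w yields a linear combination of the numbers
        <N_s, T>, which are zero as well.\<close>
      have "?I (\<lambda>x y z. (\<Sum>s\<in>UNIV. \<Gamma> p u w s * Nc p s x y z) * Tc p x y z) = (\<Sum>s\<in>UNIV. ?I (\<lambda>x y z. \<Gamma> p u w s * (Nc p s x y z * Tc p x y z)))"
        unfolding sum_distrib_right mult.assoc by (rule sum4_2341)
      also have "\<dots> = 0"
        using j.uu_zero unfolding j.uu_def by (simp flip: sum_distrib_left)
      finally show ?thesis
        unfolding a distrib_right using rot.act_inner[of "Nc p w" "Tc p"] by (simp add: sum.distrib)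
    qed
    ultimately have "?I (\<lambda>x y z. Nc p w x y z * E u (\<lambda>q. Tc q x y z) p + E u (\<lambda>q. Nc q w x y z) p * Tc p x y z)
      - ?I (\<lambda>x y z. act4 (\<Gamma> p u) (Nc p) w x y z * Tc p x y z + Nc p w x y z * act3 (\<Gamma> p u) (Tc p) x y z) = 0" by simp
    then show "?I (\<lambda>x y z. DNc p u w x y z * Tc p x y z) + ?I (\<lambda>x y z. Nc p w x y z * Nc p u x y z) = 0"
      unfolding DNc_act[OF p] Nc_act[OF p, of u] sum_subtractf[symmetric] sum.distrib[symmetric]
      by (simp add: algebra_simps)
  qed
qed

end

section \<open>Parallel torsion\<close>

context metric_connection8 begin

lemma tens_nab_T: "tens 4 (nab T)"
  using tens_nab[OF tens_T] by simp

lemma parallel_nab: "parallel M A D 3 T \<longleftrightarrow> (\<forall>V Xs p. Xs \<in> vfs V 4 \<longrightarrow> p \<in> V \<longrightarrow> nab T Xs p = 0)"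
proof (intro iffI allI impI)
  fix V Xs p assume h: "parallel M A D 3 T" "Xs \<in> vfs V 4" "p \<in> V"
  obtain a b c d where Xs: "Xs = [a, b, c, d]" using list4 vfsD(1)[OF h(2)] by blast
  then have v: "vf V a" "[b, c, d] \<in> vfs V 3" using h(2) by (auto simp: vfs4 vfs3)
  then show "nab T Xs p = 0"
    using h(1,3) vf_openin[OF v(1)] unfolding parallel_def tensor_eq_def by (simp add: Xs nab_def)
next
  assume h: "\<forall>V Xs p. Xs \<in> vfs V 4 \<longrightarrow> p \<in> V \<longrightarrow> nab T Xs p = 0"
  show "parallel M A D 3 T"
    unfolding parallel_def tensor_eq_def
  proof (intro allI impI ballI)
    fix V X U Xs p assume k: "vf V X" "openin M U" "U \<subseteq> V" "Xs \<in> vfs U 3" "p \<in> U"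
    have "X # Xs \<in> vfs U 4" using k vf_restrict[OF k(1-3)] by (simp add: vfields_def)
    then have "nab T (X # Xs) p = 0" using h k(5) by blast
    then show "cov_deriv D X T Xs p = 0" by (simp add: nab_def)
  qed
qed

lemma d_nabla_nab: "d_nabla D T [X, Y, Z, U] p = nab T [X, Y, Z, U] p + nab T [Y, Z, X, U] p + nab T [Z, X, Y, U] p - nab T [U, X, Y, Z] p"
  by (simp add: d_nabla_def nab_def numeral_3_eq_3)

end

section \<open>Independence of traces from the frame\<close>

context oriented_connection8 begin

text \<open>\<open>contract_frame\<close> pairs slots of two tensors, whereas here two slots of one
  tensor are contracted. Expanding the first slot makes g the second tensor.\<close>

lemma trace_frame:
  assumes f: "orthonormal_frame M A g W f" and e: "orthonormal_frame M A g W' e"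
    and V: "openin M V" "V \<subseteq> W" "V \<subseteq> W'" "p \<in> V" and YZ: "vf V Y" "vf V Z"
  shows "(\<Sum>x<8. nab T [f x, f x, Y, Z] p) = (\<Sum>x<8. nab T [e x, e x, Y, Z] p)"
proof -
  have fV: "vf V (f s)" and eV: "vf V (e s)" if "s < 8" for s
    using frame_props(2)[OF f that] frame_props(2)[OF e that] vf_restrict V by blast+
  have "(\<Sum>x<8. nab T [f x, f x, Y, Z] p) = (\<Sum>x<8. \<Sum>a<8. g [f x, e a] p * nab T [e a, f x, Y, Z] p)"
  proof (rule sum.cong[OF refl])
    fix x :: nat assume "x \<in> {..<8}"
    then show "nab T [f x, f x, Y, Z] p = (\<Sum>a<8. g [f x, e a] p * nab T [e a, f x, Y, Z] p)"
      using tens_expand[OF e tens_nab_T, of "[f x, f x, Y, Z]" V 0 p] fV YZ V by (simp add: vfs4)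
  qed
  also have "\<dots> = (\<Sum>a<8. \<Sum>x<8. g [f x, e a] p * nab T [e a, f x, Y, Z] p)" by (rule sum.swap)
  also have "\<dots> = (\<Sum>a<8. nab T [e a, e a, Y, Z] p)"
  proof (rule sum.cong[OF refl])
    fix a :: nat assume "a \<in> {..<8}"
    then have a: "a < 8" by simp
    have "[e a, e a] \<in> vfs V 2" "[e a, e a, Y, Z] \<in> vfs V 4" using eV[OF a] YZ by (simp_all add: vfs2 vfs4)
    from contract_frame[OF f e V tens_g _ this(1) tens_nab_T _ this(2), of 0 1]
    have "(\<Sum>x<8. g [f x, e a] p * nab T [e a, f x, Y, Z] p) = (\<Sum>x<8. g [e x, e a] p * nab T [e a, e x, Y, Z] p)"
      by simp
    also have "\<dots> = (\<Sum>x<8. if x = a then nab T [e a, e a, Y, Z] p else 0)"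
      by (rule sum.cong[OF refl]) (use frame_props(3)[OF e _ a] V in auto)
    finally show "(\<Sum>x<8. g [f x, e a] p * nab T [e a, f x, Y, Z] p) = nab T [e a, e a, Y, Z] p" using a by simp
  qed
  finally show ?thesis .
qed

lemma codiff_trace:
  assumes e: "orthonormal_frame M A g W e" and p: "p \<in> W" "p \<in> V" and Y: "vf V Y" "vf V Z"
  shows "codiff M A g vol 3 T [Y, Z] p = - (\<Sum>x<8. nab T [e x, e x, Y, Z] p)"
proof -
  obtain W' f where f: "p \<in> W'" "orthonormal_frame M A g W' f"
    "codiff M A g vol 3 T [Y, Z] p = - (\<Sum>x<8. nab T [f x, f x, Y, Z] p)"
    using codiff_T[OF p(2) Y] unfolding oriented_orthonormal_frame_def by blast
  have U: "openin M (V \<inter> W \<inter> W')"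
    by (rule openin_Int[OF openin_Int[OF vf_openin[OF Y(1)] frame_props(1)[OF e]] frame_props(1)[OF f(2)]])
  have "vf (V \<inter> W \<inter> W') Y" "vf (V \<inter> W \<inter> W') Z" using Y vf_restrict[OF _ U] by blast+
  from trace_frame[OF f(2) e U _ _ _ this, of p] show ?thesis using f p by auto
qed

end

context adapted8 begin

lemma spin7_sum: "(\<And>i. spin7 (F i)) \<Longrightarrow> spin7 (\<lambda>a b. \<Sum>i\<in>UNIV. c i * F i a b)"
proof -
  assume F: "\<And>i. spin7 (F i)"
  have "(\<Sum>a\<in>UNIV. \<Sum>b\<in>UNIV. (\<Sum>i\<in>UNIV. c i * F i a b) * \<psi> a b k l) = 2 * (\<Sum>i\<in>UNIV. c i * F i k l)" for k l
  proof -
    have "(\<Sum>a\<in>UNIV. \<Sum>b\<in>UNIV. (\<Sum>i\<in>UNIV. c i * F i a b) * \<psi> a b k l)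
      = (\<Sum>a\<in>UNIV. \<Sum>i\<in>UNIV. \<Sum>b\<in>UNIV. c i * (F i a b * \<psi> a b k l))"
      unfolding sum_distrib_right mult.assoc by (rule sum.cong[OF refl]) (rule sum.swap)
    also have "\<dots> = (\<Sum>i\<in>UNIV. \<Sum>a\<in>UNIV. \<Sum>b\<in>UNIV. c i * (F i a b * \<psi> a b k l))"
      by (rule sum.swap)
    also have "\<dots> = (\<Sum>i\<in>UNIV. c i * (2 * F i k l))"
      by (simp only: spin7D[OF F] flip: sum_distrib_left)
    finally show ?thesis by (simp add: sum_distrib_left mult_ac)
  qed
  then show ?thesis by (simp add: spin7_def)
qed

lemma expand_last:
  assumes \<omega>: "tens 4 \<omega>" and V: "openin M V" "V \<subseteq> W" "p \<in> V" and vf: "vf V P" "vf V Q" "vf V X" "vf V Y"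
  shows "\<omega> [P, Q, X, Y] p = (\<Sum>c\<in>UNIV. g [X, E c] p * (\<Sum>d\<in>UNIV. g [Y, E d] p * \<omega> [P, Q, E c, E d] p))"
proof -
  have EV: "vf V (E c)" for c using vf_restrict[OF E_vf V(1,2)] .
  have "\<omega> [P, Q, E c, Y] p = (\<Sum>d\<in>UNIV. g [Y, E d] p * \<omega> [P, Q, E c, E d] p)" for c
    using expandE[OF \<omega>, of "[P, Q, E c, Y]" V 3 p] vf EV V by (simp add: vfs4)
  then show ?thesis
    using expandE[OF \<omega>, of "[P, Q, X, Y]" V 2 p] vf V by (simp add: vfs4)
qed

lemma expand_first:
  assumes \<omega>: "tens 4 \<omega>" and V: "openin M V" "V \<subseteq> W" "p \<in> V" and vf: "vf V P" "vf V Q" "vf V X" "vf V Y"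
  shows "\<omega> [P, Q, X, Y] p = (\<Sum>c\<in>UNIV. g [P, E c] p * (\<Sum>d\<in>UNIV. g [Q, E d] p * \<omega> [E c, E d, X, Y] p))"
proof -
  have EV: "vf V (E c)" for c using vf_restrict[OF E_vf V(1,2)] .
  have "\<omega> [E c, Q, X, Y] p = (\<Sum>d\<in>UNIV. g [Q, E d] p * \<omega> [E c, E d, X, Y] p)" for c
    using expandE[OF \<omega>, of "[E c, Q, X, Y]" V 1 p] vf EV V by (simp add: vfs4)
  then show ?thesis
    using expandE[OF \<omega>, of "[P, Q, X, Y]" V 0 p] vf V by (simp add: vfs4)
qed

text \<open>\<open>Spin7_instanton\<close> speaks of all orthonormal frames, the components only of
  an adapted one. Multilinearity frees X, Y, Z, U, while a and b are still summed over the adapted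
  frame.\<close>

lemma instanton_invariant:
  assumes inst: "\<And>c d. spin7 (\<lambda>a b. Rc p a b c d)"
    and V: "openin M V" "V \<subseteq> W" "p \<in> V" and vf: "vf V X" "vf V Y" "vf V Z" "vf V U"
  shows "(\<Sum>a\<in>UNIV. \<Sum>b\<in>UNIV. R [E a, E b, X, Y] p * \<Psi> [E a, E b, Z, U] p) = 2 * R [Z, U, X, Y] p"
proof -
  have EV: "vf V (E c)" for c using vf_restrict[OF E_vf V(1,2)] .
  let ?F = "\<lambda>a b. R [E a, E b, X, Y] p"
  have "?F = (\<lambda>a b. \<Sum>c\<in>UNIV. g [X, E c] p * (\<Sum>d\<in>UNIV. g [Y, E d] p * Rc p a b c d))"
    using expand_last[OF tens_R V EV EV vf(1,2)] by (simp add: Rc_def fun_eq_iff)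
  then have F: "spin7 ?F" using inst by (simp only: spin7_sum)
  have Psi: "\<Psi> [E a, E b, Z, U] p = (\<Sum>k\<in>UNIV. \<Sum>l\<in>UNIV. g [Z, E k] p * g [U, E l] p * \<psi> a b k l)" for a b
    using expand_last[OF tens_Psi V EV EV vf(3,4), of a b] Psi_frame[OF subsetD[OF V(2,3)]]
    by (simp add: sum_distrib_left mult.assoc)
  have "(\<Sum>a\<in>UNIV. \<Sum>b\<in>UNIV. ?F a b * \<Psi> [E a, E b, Z, U] p)
    = (\<Sum>a\<in>UNIV. \<Sum>b\<in>UNIV. \<Sum>k\<in>UNIV. \<Sum>l\<in>UNIV. (g [Z, E k] p * g [U, E l] p) * (?F a b * \<psi> a b k l))"
    unfolding Psi by (simp add: sum_distrib_left mult_ac)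
  also have "\<dots> = (\<Sum>k\<in>UNIV. \<Sum>l\<in>UNIV. \<Sum>a\<in>UNIV. \<Sum>b\<in>UNIV. (g [Z, E k] p * g [U, E l] p) * (?F a b * \<psi> a b k l))"
    by (rule sum4_3412)
  also have "\<dots> = (\<Sum>k\<in>UNIV. \<Sum>l\<in>UNIV. (g [Z, E k] p * g [U, E l] p) * (2 * ?F k l))"
    by (simp only: spin7D[OF F] flip: sum_distrib_left)
  also have "\<dots> = 2 * (\<Sum>k\<in>UNIV. g [Z, E k] p * (\<Sum>l\<in>UNIV. g [U, E l] p * ?F k l))"
    by (simp add: sum_distrib_left mult_ac)
  also have "\<dots> = 2 * R [Z, U, X, Y] p"
    using expand_first[OF tens_R V vf(3,4,1,2)] by simp
  finally show ?thesis .
qed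

lemma parallel_instanton:
  assumes p: "p \<in> W" and N: "\<And>a b c d. Nc p a b c d = 0"
  shows "spin7 (\<lambda>a b. Rc p a b c d)"
proof -
  have "Rc p a b c d - Rc p c d a b = Nc p a b c d - Nc p b a c d" for a b
    by (rule pair_exchange_skew[OF Rc_skew[OF p] Nc_skew[OF p] S_skew[OF p] _ bianchi_parallel[OF p]])
      (simp_all add: N)
  then have "(\<lambda>a b. Rc p a b c d) = Rc p c d" by (simp add: N fun_eq_iff)
  then show ?thesis using R_spin7[OF p] by simp
qed

end

section \<open>From components to the global conditions\<close>

locale spin7_connection8 = oriented_connection8 M A D g vol
  for M :: "'m topology" and A :: "'m chart set" and D :: "'m vfield \<Rightarrow> 'm vfield \<Rightarrow> 'm vfield" and g vol :: "'m tensor" +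
  fixes \<Psi> :: "'m tensor"
  assumes tens_Psi: "tens 4 \<Psi>" and parallel_Psi: "parallel M A D 4 \<Psi>"
    and Psi_frames: "\<And>p. p \<in> topspace M \<Longrightarrow> \<exists>W e. p \<in> W \<and> orthonormal_frame M A g W e \<and>
      (\<forall>q\<in>W. \<forall>a<8. \<forall>b<8. \<forall>c<8. \<forall>d<8. \<Psi> [e a, e b, e c, e d] q = psi_nat a b c d)"
begin

lemma adapted:
  assumes "p \<in> topspace M"
  shows "\<exists>W e ix. p \<in> W \<and> adapted8 M A D g W e ix \<Psi>"
proof -
  obtain W e where e: "p \<in> W" "orthonormal_frame M A g W e"
    and psi: "\<forall>q\<in>W. \<forall>a<8. \<forall>b<8. \<forall>c<8. \<forall>d<8. \<Psi> [e a, e b, e c, e d] q = psi_nat a b c d"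
    using Psi_frames[OF assms] by blast
  obtain ix :: "8 \<Rightarrow> nat" where "bij_betw ix UNIV {..<8}"
    using finite_same_card_bij[of "UNIV :: 8 set" "{..<8::nat}"] by auto
  then interpret frame8 M A D g W e ix by unfold_locales (rule e(2))
  have "adapted8 M A D g W e ix \<Psi>"
    by unfold_locales (use tens_Psi parallel_Psi psi in \<open>simp_all add: E_def psi8_def\<close>)
  then show ?thesis using e(1) by blast
qed

lemma topspaceI: "Xs \<in> vfs V (Suc k) \<Longrightarrow> p \<in> V \<Longrightarrow> p \<in> topspace M"
  by (cases Xs) (auto simp: vfs_simps vfields_def dest: vf_openin openin_subset)

text \<open>The conclusion is tested at one point, but the three global conditions are read off on a
  whole adapted frame domain around it, as \<open>adapted8_instanton\<close> requires.\<close>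

lemma parallel_if_instanton:
  assumes inst: "Spin7_instanton M A \<Psi> g R" and closed: "tensor_eq M A (topspace M) 4 (d_nabla D T) (\<lambda>_ _. 0)"
    and coclosed: "tensor_eq M A (topspace M) 2 (codiff M A g vol 3 T) (\<lambda>_ _. 0)"
  shows "parallel M A D 3 T"
  unfolding parallel_nab
proof (intro allI impI)
  fix V Xs p assume Xs: "Xs \<in> vfs V 4" and p: "p \<in> V"
  have "p \<in> topspace M" using topspaceI[of Xs V 3 p] Xs p by simp
  then obtain W e ix where pW: "p \<in> W" and ad: "adapted8 M A D g W e ix \<Psi>" using adapted by blast
  interpret adapted8 M A D g W e ix \<Psi> by (rule ad)
  note sub = openin_subset[OF W_open]
  have "adapted8_instanton M A D g W e ix \<Psi>"
  proof unfold_locales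
    fix q a b c d assume q: "q \<in> W"
    have "(\<Sum>a<8. \<Sum>b<8. R [e a, e b, e (ix c), e (ix d)] q * \<Psi> [e a, e b, e (ix k), e (ix l)] q)
      = 2 * R [e (ix k), e (ix l), e (ix c), e (ix d)] q" for k l
      using inst frame q unfolding Spin7_instanton_def by auto
    then show "spin7 (\<lambda>a b. Rc q a b c d)"
      by (simp add: spin7_def Rc_def sum_ix Psi_frame[OF q, symmetric] flip: E_def)
    have "d_nabla D T [E a, E b, E c, E d] q = 0"
      using closed q W_open sub unfolding tensor_eq_def by (simp add: vfs4)
    then show "Nc q a b c d + Nc q b c a d + Nc q c a b d = Nc q d a b c"
      by (simp add: d_nabla_nab Nc_def)
    have "codiff M A g vol 3 T [E a, E b] q = 0"
      using coclosed q W_open sub unfolding tensor_eq_def by (simp add: vfs2)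
    then show "(\<Sum>x\<in>UNIV. Nc q x x a b) = 0"
      using codiff_trace[OF frame q q E_vf E_vf, of a b] by (simp add: sum_ix Nc_def flip: E_def)
  qed
  then interpret adapted8_instanton M A D g W e ix \<Psi> .
  have V: "openin M V" using Xs vf_openin vfsD(2)[of Xs V 4 0] by simp
  show "nab T Xs p = 0"
  proof (rule tens_vanish[OF frame tens_nab_T pW V p _ Xs])
    fix I :: "nat list" assume I: "length I = 4" "set I \<subseteq> {..<8}"
    then obtain i j k l where ijkl: "I = [i, j, k, l]" using list4 by blast
    have "range ix = {..<8}" using ix by (simp add: bij_betw_def)
    then have "\<exists>a. m = ix a" if "m < 8" for m using that by blast
    then obtain a b c d where "i = ix a" "j = ix b" "k = ix c" "l = ix d" using I ijkl by (metis insert_subset lessThan_iff list.simps(15))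
    then show "nab T (map e I) p = 0"
      using Nc_zero[OF pW, of a b c d] by (simp add: ijkl Nc_def E_def)
  qed
qed

lemma parallel_imp:
  assumes "parallel M A D 3 T"
  shows "Spin7_instanton M A \<Psi> g R" "tensor_eq M A (topspace M) 4 (d_nabla D T) (\<lambda>_ _. 0)"
    "tensor_eq M A (topspace M) 2 (codiff M A g vol 3 T) (\<lambda>_ _. 0)"
proof -
  have N: "nab T Xs p = 0" if "Xs \<in> vfs V 4" "p \<in> V" for V Xs p
    using assms that unfolding parallel_nab by blast
  show "tensor_eq M A (topspace M) 4 (d_nabla D T) (\<lambda>_ _. 0)"
    unfolding tensor_eq_def
  proof (intro allI impI ballI)
    fix V Xs p assume h: "Xs \<in> vfs V 4" "p \<in> V"
    obtain X Y Z U where "Xs = [X, Y, Z, U]" using list4 vfsD(1)[OF h(1)] by blast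
    then show "d_nabla D T Xs p = 0" using N[OF _ h(2)] h(1) by (simp add: d_nabla_nab vfs4)
  qed
  show "tensor_eq M A (topspace M) 2 (codiff M A g vol 3 T) (\<lambda>_ _. 0)"
    unfolding tensor_eq_def
  proof (intro allI impI ballI)
    fix V Xs p assume h: "Xs \<in> vfs V 2" "p \<in> V"
    then obtain Y Z where Xs: "Xs = [Y, Z]" by (auto simp: vfields_def length_Suc_conv numeral_2_eq_2)
    then have Y: "vf V Y" "vf V Z" using h(1) by (simp_all add: vfs2)
    obtain W e where e: "p \<in> W" "orthonormal_frame M A g W e"
      using Psi_frames[of p] openin_subset[OF vf_openin[OF Y(1)]] h(2) by blast
    have U: "openin M (V \<inter> W)" by (rule openin_Int[OF vf_openin[OF Y(1)] frame_props(1)[OF e(2)]])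
    have YU: "vf (V \<inter> W) Y" "vf (V \<inter> W) Z" using Y vf_restrict[OF _ U] by blast+
    have "nab T [e x, e x, Y, Z] p = 0" if "x < 8" for x
    proof -
      have "vf (V \<inter> W) (e x)" using vf_restrict[OF frame_props(2)[OF e(2) that] U] by blast
      then show ?thesis using N[of "[e x, e x, Y, Z]" "V \<inter> W" p] YU h(2) e(1) by (simp add: vfs4)
    qed
    then show "codiff M A g vol 3 T Xs p = 0" unfolding Xs codiff_trace[OF e(2,1) h(2) Y] by simp
  qed
  show "Spin7_instanton M A \<Psi> g R"
    unfolding Spin7_instanton_def
  proof (intro allI impI ballI)
    fix W' f p and i j k l :: nat
    assume f: "orthonormal_frame M A g W' f" and ijkl: "i < 8" "j < 8" "k < 8" "l < 8" and p: "p \<in> W'"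
    have "p \<in> topspace M" using frame_props(1)[OF f] openin_subset p by blast
    then obtain W e ix where pW: "p \<in> W" and ad: "adapted8 M A D g W e ix \<Psi>" using adapted by blast
    interpret adapted8 M A D g W e ix \<Psi> by (rule ad)
    have U: "openin M (W \<inter> W')" by (rule openin_Int[OF W_open frame_props(1)[OF f]])
    have fU: "vf (W \<inter> W') (f s)" if "s < 8" for s using vf_restrict[OF frame_props(2)[OF f that] U] by blast
    have "Nc p a b c d = 0" for a b c d
      unfolding Nc_def by (rule N[OF _ pW]) (simp add: vfs4)
    from instanton_invariant[OF parallel_instanton[OF pW this] U _ _ fU[OF ijkl(1)] fU[OF ijkl(2)] fU[OF ijkl(3)] fU[OF ijkl(4)]]
    have "(\<Sum>a\<in>UNIV. \<Sum>b\<in>UNIV. R [E a, E b, f i, f j] p * \<Psi> [E a, E b, f k, f l] p) = 2 * R [f k, f l, f i, f j] p"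
      using p pW by simp
    then have "(\<Sum>a<8. \<Sum>b<8. R [e a, e b, f i, f j] p * \<Psi> [e a, e b, f k, f l] p) = 2 * R [f k, f l, f i, f j] p"
      by (simp add: sum_ix flip: E_def)
    \<comment> \<open>The summed indices pass from the adapted frame to the given one as a double
      contraction of two tensors.\<close>
    moreover have "(\<Sum>I\<in>tuples 2. R ([] @ map f I @ [f i, f j]) p * \<Psi> ([] @ map f I @ [f k, f l]) p)
      = (\<Sum>I\<in>tuples 2. R ([] @ map e I @ [f i, f j]) p * \<Psi> ([] @ map e I @ [f k, f l]) p)"
      by (rule contract_frames[OF f frame U _ _ _ tens_R tens_Psi]) (use p pW fU ijkl in auto)
    ultimately show "(\<Sum>a<8. \<Sum>b<8. R [f a, f b, f i, f j] p * \<Psi> [f a, f b, f k, f l] p) = 2 * R [f k, f l, f i, f j] p"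
      by (simp add: numeral_2_eq_2 sum_tuples_Suc tuples_0)
  qed
qed

end

theorem theorem1p8:
  fixes M :: "'m topology" and A :: "'m chart set"
    and \<Psi> g vol T R :: "'m tensor"
    and D :: "'m vfield \<Rightarrow> 'm vfield \<Rightarrow> 'm vfield"
  assumes "Spin7_manifold M A \<Psi>"
    and "induced_metric_orientation M A \<Psi> g vol"
    and "torsion_connection M A \<Psi> g D"
    and "T = torsion g D"
    and "R = curvature_tensor g D"
  shows "(tensor_eq M A (topspace M) 4 (d_nabla D T) (\<lambda>_ _. 0) \<longleftrightarrow>
          tensor_eq M A (topspace M) 4 (ext_d T) (\<lambda>Xs p. 2 * sigma_form M A g T Xs p))
       \<and> (Spin7_instanton M A \<Psi> g R
          \<and> tensor_eq M A (topspace M) 4 (d_nabla D T) (\<lambda>_ _. 0)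
          \<and> tensor_eq M A (topspace M) 2 (codiff M A g vol 3 T) (\<lambda>_ _. 0)
          \<longleftrightarrow> parallel M A D 3 T)"
proof -
  \<comment> \<open>An adapted coframe gives at once an oriented orthonormal frame and constant
    components of Psi; the construction works with such frames.\<close>
  have frames: "\<exists>W e. p \<in> W \<and> oriented_orthonormal_frame M A g vol W e \<and>
      (\<forall>q\<in>W. \<forall>a<8. \<forall>b<8. \<forall>c<8. \<forall>d<8. \<Psi> [e a, e b, e c, e d] q = psi_nat a b c d)" if "p \<in> topspace M" for p
  proof -
    have "\<forall>p\<in>topspace M. \<exists>W \<theta> e. p \<in> W \<and> adapted_coframe M A \<Psi> W \<theta> e"
      using assms(1) by (simp add: Spin7_manifold_def)
    from bspec[OF this that] obtain W \<theta> e where W: "p \<in> W" "adapted_coframe M A \<Psi> W \<theta> e" by (elim exE conjE)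
    then have c: "coframe M A W \<theta> e" "tensor_eq M A W 4 \<Psi> (Psi_of_coframe \<theta>)"
      by (simp_all add: adapted_coframe_def)
    have "\<Psi> [e a, e b, e c, e d] q = psi_nat a b c d" if q: "q \<in> W" and abcd: "a < 8" "b < 8" "c < 8" "d < 8" for q a b c d
    proof -
      have "[e a, e b, e c, e d] \<in> vfields M A W 4" "openin M W"
        using c(1) abcd unfolding coframe_def vfields_def by auto
      then have "\<Psi> [e a, e b, e c, e d] q = Psi_of_coframe \<theta> [e a, e b, e c, e d] q"
        using c(2) q unfolding tensor_eq_def by blast
      also have "\<dots> = psi_nat a b c d"
      proof (rule Psi_of_coframe_frame[OF _ abcd])
        show "\<theta> i [e j] q = (if i = j then 1 else 0)" if "i < 8" "j < 8" for i j
          using c(1) q that unfolding coframe_def by blast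
      qed
      finally show ?thesis .
    qed
    moreover have "oriented_orthonormal_frame M A g vol W e"
      using assms(2) W(2) by (simp add: induced_metric_orientation_def)
    ultimately show ?thesis using W(1) by blast
  qed
  interpret spin7_connection8 M A D g vol \<Psi>
  proof unfold_locales
    show "\<exists>W e. p \<in> W \<and> oriented_orthonormal_frame M A g vol W e" if "p \<in> topspace M" for p
      using frames[OF that] by blast
    show "\<exists>W e. p \<in> W \<and> orthonormal_frame M A g W e \<and>
      (\<forall>q\<in>W. \<forall>a<8. \<forall>b<8. \<forall>c<8. \<forall>d<8. \<Psi> [e a, e b, e c, e d] q = psi_nat a b c d)" if "p \<in> topspace M" for p
      using frames[OF that] unfolding oriented_orthonormal_frame_def by blast
  qed (use assms in \<open>simp_all add: Spin7_manifold_def k_form_def induced_metric_orientation_def torsion_connection_def\<close>)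
  have "\<exists>W e. p \<in> W \<and> orthonormal_frame M A g W e" if "p \<in> topspace M" for p
    using frames[OF that] unfolding oriented_orthonormal_frame_def by blast
  then show ?thesis
    unfolding assms(4,5) using d_nabla_eq_iff parallel_if_instanton parallel_imp by blast
qed

end
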